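(* Let $D_0\subset\mathbb C$ be a bounded simply connected domain such that $0\in D_0$, such that $\partial D_0$ is a real-analytic Jordan curve, and such that $D_0$ is not a disk centered at the origin. Then there exist $t_0>0$ and a real-analytic increasing family $(D_t)_{0\le t<t_0}$ of bounded simply connected domains (starting at the given $D_0$), with $\overline{D_s}\subset D_t$ for $0\le s<t<t_0$, such that for every $0<t<t_0$ the shell $$\Omega_t:=D_t\setminus\overline{D_0}$$ is a doubly connected domain with two real-analytic boundary components, is not radial about the origin (in particular, it is not a union of concentric annuli), and satisfies $$\mathcal L_{\Omega_t}h_0=2\pi t\,h_0,\qquad 2\pi t\in(0,1).$$
   Context: Identify $\mathbb C$ with $\mathbb R^2$ via $z=x+i\omega$. Let $h_0(t)=\varphi(t)=2^{1/4}e^{-\pi t^2}$ on $\mathbb R$ and, for $f\in L^2(\mathbb R)$, $V_\varphi f(x,\omega)=\int_{\mathbb R}f(t)\overline{\varphi(t-x)}e^{-2\pi i t\omega}\,dt$. For a measurable set $\Omega\subset\mathbb C$ of finite measure, the localization operator $\mathcal L_\Omega$ is the bounded operator on $L^2(\mathbb R)$ defined by $\langle\mathcal L_\Omega f,g\rangle=\int_\Omega V_\varphi f\,\overline{V_\varphi g}\,dx\,d\omega$ for $f,g\in L^2(\mathbb R)$. A set is radial about the origin if it is invariant under all rotations about $0$. "Real-analytic family" means that each $\partial D_t$ is a real-analytic Jordan curve and that these curves depend real-analytically on $t$. *)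

theory Defs
  imports "HOL-Probability.Probability"
begin

section \<open>Localization operators with Gaussian window\<close>

text \<open>
  Elements of \<open>L\<^sup>2(\<real>)\<close> are represented by Borel functions, and equality in \<open>L\<^sup>2(\<real>)\<close> is equality
  almost everywhere. (Every class of Lebesgue measurable functions has a Borel representative.)
\<close>

definition square_integrable :: "(real \<Rightarrow> complex) \<Rightarrow> bool" where
  "square_integrable f \<longleftrightarrow>
     f \<in> borel_measurable lborel \<and> integrable lborel (\<lambda>t. (cmod (f t))\<^sup>2)"

definition L2_inner :: "(real \<Rightarrow> complex) \<Rightarrow> (real \<Rightarrow> complex) \<Rightarrow> complex" where
  "L2_inner f g = (LINT t|lborel. f t * cnj (g t))"

definition h0 :: "real \<Rightarrow> complex" where
  "h0 t = of_real (2 powr (1/4) * exp (- pi * t\<^sup>2))"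

definition stft :: "(real \<Rightarrow> complex) \<Rightarrow> (real \<Rightarrow> complex) \<Rightarrow> real \<Rightarrow> real \<Rightarrow> complex" where
  "stft \<phi> f x \<omega> =
     (LINT t|lborel. f t * cnj (\<phi> (t - x)) * exp (- 2 * of_real pi * \<i> * of_real t * of_real \<omega>))"

definition localization_form ::
    "complex set \<Rightarrow> (real \<Rightarrow> complex) \<Rightarrow> (real \<Rightarrow> complex) \<Rightarrow> complex" where
  "localization_form \<Omega> f g =
     (LINT z:\<Omega>|lebesgue. stft h0 f (Re z) (Im z) * cnj (stft h0 g (Re z) (Im z)))"

text \<open>
  The operator picks a representative of the unique class given by the weak formula. Existence
  and uniqueness, for \<open>\<Omega>\<close> Lebesgue measurable of finite measure, are shown in
  \<open>localization_operator\<close> and \<open>localization_operator_unique\<close> below.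
\<close>

definition localization_operator ::
    "complex set \<Rightarrow> (real \<Rightarrow> complex) \<Rightarrow> (real \<Rightarrow> complex)" where
  "localization_operator \<Omega> f =
     (SOME u. square_integrable u \<and>
        (\<forall>g. square_integrable g \<longrightarrow> L2_inner u g = localization_form \<Omega> f g))"

lemma measurable_cnj [measurable]: "cnj \<in> borel_measurable borel"
  by (intro borel_measurable_continuous_onI continuous_intros)

lemma measurable_character [measurable]:
  assumes [measurable]: "p \<in> borel_measurable M" "q \<in> borel_measurable M"
  shows "(\<lambda>x. exp (2 * of_real pi * \<i> * of_real (p x) * of_real (q x)) :: complex) \<in> borel_measurable M"
    and "(\<lambda>x. exp (- 2 * of_real pi * \<i> * of_real (p x) * of_real (q x)) :: complex) \<in> borel_measurable M"
proof -
  have "(\<lambda>y. exp (c * y) :: complex) \<in> borel_measurable borel" for c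
    by (intro borel_measurable_continuous_onI continuous_intros)
  moreover have "(\<lambda>x. of_real (p x * q x) :: complex) \<in> borel_measurable M" by measurable
  ultimately have *: "(\<lambda>x. exp (c * of_real (p x * q x)) :: complex) \<in> borel_measurable M" for c
    by (rule measurable_compose[rotated])
  show "(\<lambda>x. exp (2 * of_real pi * \<i> * of_real (p x) * of_real (q x)) :: complex) \<in> borel_measurable M"
    using *[of "2 * of_real pi * \<i>"] by (simp add: mult.assoc)
  show "(\<lambda>x. exp (- 2 * of_real pi * \<i> * of_real (p x) * of_real (q x)) :: complex) \<in> borel_measurable M"
    using *[of "- 2 * of_real pi * \<i>"] by (simp add: mult.assoc)
qed

lemma h0_cmod: "cmod (h0 t) = 2 powr (1/4) * exp (- pi * t\<^sup>2)"
  unfolding h0_def norm_of_real by simp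

lemma h0_measurable [measurable]: "h0 \<in> borel_measurable borel"
  unfolding h0_def by measurable

lemma h0_cmod_le: "cmod (h0 t) \<le> 2 powr (1/4)"
  unfolding h0_cmod by simp

lemma h0_integrable: "integrable lborel h0"
proof -
  have "integrable lborel (\<lambda>t. of_real (2 powr (1/4) * normal_density 0 (1 / sqrt (2*pi)) t) :: complex)"
    by (intro integrable_of_real integrable_mult_right integrable_normal_density) auto
  also have "(\<lambda>t. of_real (2 powr (1/4) * normal_density 0 (1 / sqrt (2*pi)) t) :: complex) = h0"
    by (auto simp: fun_eq_iff h0_def normal_density_def power_divide real_sqrt_divide)
  finally show ?thesis .
qed

lemma square_integrable_h0: "square_integrable h0"
  unfolding square_integrable_def
proof
  show "h0 \<in> borel_measurable lborel" by simp
  show "integrable lborel (\<lambda>t. (cmod (h0 t))\<^sup>2)"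
  proof (rule Bochner_Integration.integrable_bound)
    show "integrable lborel (\<lambda>t. 2 powr (1/4) * cmod (h0 t))"
      using h0_integrable by simp
    show "AE t in lborel. norm ((cmod (h0 t))\<^sup>2) \<le> norm (2 powr (1/4) * cmod (h0 t))"
      using h0_cmod_le by (auto simp: power2_eq_square intro!: mult_right_mono)
  qed simp
qed

lemma square_integrable_translate:
  assumes "square_integrable f"
  shows "square_integrable (\<lambda>t. f (t - x))"
  using assms lborel_integrable_real_affine[of "\<lambda>t. (cmod (f t))\<^sup>2" 1 "-x"]
  unfolding square_integrable_def by (auto simp: algebra_simps)

lemma mult_le_squares: "a * b \<le> a\<^sup>2 + (b::real)\<^sup>2"
proof -
  have "0 \<le> (a - b)\<^sup>2" "0 \<le> a\<^sup>2" "0 \<le> b\<^sup>2" by auto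
  then show ?thesis unfolding power2_diff by linarith
qed

lemma L2_product:
  assumes f: "square_integrable f" and g: "square_integrable g"
  shows "integrable lborel (\<lambda>t. cmod (f t) * cmod (g t))"
    and "(LINT t|lborel. cmod (f t) * cmod (g t))
           \<le> (LINT t|lborel. (cmod (f t))\<^sup>2) + (LINT t|lborel. (cmod (g t))\<^sup>2)"
proof -
  have [measurable]: "f \<in> borel_measurable borel" "g \<in> borel_measurable borel"
    using f g by (auto simp: square_integrable_def)
  have i: "integrable lborel (\<lambda>t. (cmod (f t))\<^sup>2)" "integrable lborel (\<lambda>t. (cmod (g t))\<^sup>2)"
    using f g by (auto simp: square_integrable_def)
  show 1: "integrable lborel (\<lambda>t. cmod (f t) * cmod (g t))"
    by (rule Bochner_Integration.integrable_bound[OF Bochner_Integration.integrable_add[OF i]])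
       (auto simp: mult_le_squares)
  show "(LINT t|lborel. cmod (f t) * cmod (g t))
           \<le> (LINT t|lborel. (cmod (f t))\<^sup>2) + (LINT t|lborel. (cmod (g t))\<^sup>2)"
    unfolding Bochner_Integration.integral_add[OF i, symmetric]
    using 1 i by (intro integral_mono) (auto simp: mult_le_squares)
qed

lemma L2_inner_integrable:
  assumes "square_integrable f" "square_integrable g"
  shows "integrable lborel (\<lambda>t. f t * cnj (g t))"
proof -
  have [measurable]: "f \<in> borel_measurable borel" "g \<in> borel_measurable borel"
    using assms by (auto simp: square_integrable_def)
  show ?thesis
    by (rule Bochner_Integration.integrable_bound[OF L2_product(1)[OF assms]]) (auto simp: norm_mult)
qed

lemma square_integrable_diff:
  assumes f: "square_integrable f" and g: "square_integrable g"
  shows "square_integrable (\<lambda>t. f t - g t)"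
  unfolding square_integrable_def
proof
  have [measurable]: "f \<in> borel_measurable borel" "g \<in> borel_measurable borel"
    using f g by (auto simp: square_integrable_def)
  show "(\<lambda>t. f t - g t) \<in> borel_measurable lborel" by simp
  have "integrable lborel (\<lambda>t. 2 * ((cmod (f t))\<^sup>2 + (cmod (g t))\<^sup>2))"
    using f g by (auto simp: square_integrable_def)
  then show "integrable lborel (\<lambda>t. (cmod (f t - g t))\<^sup>2)"
  proof (rule Bochner_Integration.integrable_bound)
    show "AE t in lborel. norm ((cmod (f t - g t))\<^sup>2) \<le> norm (2 * ((cmod (f t))\<^sup>2 + (cmod (g t))\<^sup>2))"
    proof (rule AE_I2)
      fix t
      have "(cmod (f t - g t))\<^sup>2 \<le> (cmod (f t) + cmod (g t))\<^sup>2"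
        by (intro power_mono norm_triangle_ineq4) auto
      also have "\<dots> \<le> 2 * ((cmod (f t))\<^sup>2 + (cmod (g t))\<^sup>2)"
        using sum_squares_bound[of "cmod (f t)" "cmod (g t)"] by (simp add: power2_sum)
      finally show "norm ((cmod (f t - g t))\<^sup>2) \<le> norm (2 * ((cmod (f t))\<^sup>2 + (cmod (g t))\<^sup>2))"
        by simp
    qed
  qed simp
qed

lemma cmod_character:
  "cmod (exp (2 * of_real pi * \<i> * of_real t * of_real w)) = 1"
  "cmod (exp (- 2 * of_real pi * \<i> * of_real t * of_real w)) = 1"
  unfolding norm_exp_eq_Re by simp_all

lemma stft_measurable [measurable]:
  assumes [measurable]: "f \<in> borel_measurable borel"
  shows "(\<lambda>z. stft h0 f (Re z) (Im z)) \<in> borel_measurable borel"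
proof -
  have "(\<lambda>z. stft h0 f (Re z) (Im z)) \<in> borel_measurable (lborel :: complex measure)"
    unfolding stft_def by measurable
  then show ?thesis by simp
qed

lemma stft_bounded:
  assumes "square_integrable f"
  obtains M where "0 \<le> M" "\<And>x w. cmod (stft h0 f x w) \<le> M"
proof
  let ?M = "(LINT t|lborel. (cmod (f t))\<^sup>2) + (LINT t|lborel. (cmod (h0 t))\<^sup>2)"
  show "0 \<le> ?M" by simp
  fix x w
  have eq: "(LINT t|lborel. (cmod (h0 (t - x)))\<^sup>2) = (LINT t|lborel. (cmod (h0 t))\<^sup>2)"
    using lborel_integral_real_affine[of 1 "\<lambda>t. (cmod (h0 t))\<^sup>2" "-x"] by simp
  have "cmod (stft h0 f x w)
      \<le> (LINT t|lborel. cmod (f t * cnj (h0 (t - x)) * exp (- 2 * of_real pi * \<i> * of_real t * of_real w)))"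
    unfolding stft_def by (rule integral_norm_bound)
  also have "\<dots> = (LINT t|lborel. cmod (f t) * cmod (h0 (t - x)))"
    unfolding norm_mult cmod_character by simp
  also have "\<dots> \<le> ?M"
    using L2_product(2)[OF assms square_integrable_translate[OF square_integrable_h0, of x]]
    unfolding eq .
  finally show "cmod (stft h0 f x w) \<le> ?M" .
qed

lemma localization_exists:
  assumes \<Omega>: "\<Omega> \<in> lmeasurable" and f: "square_integrable f"
  shows "\<exists>u. square_integrable u \<and>
           (\<forall>g. square_integrable g \<longrightarrow> L2_inner u g = localization_form \<Omega> f g)"
proof -
  from \<Omega> have "\<Omega> \<in> sets (completion lborel)" by auto
  then obtain B N N' where B: "\<Omega> = B \<union> N" "N \<subseteq> N'" "N' \<in> null_sets lborel" "B \<in> sets lborel"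
    by (rule sets_completionE)
  have [measurable]: "B \<in> sets borel" using B(4) by simp
  have "emeasure lborel B = emeasure lebesgue B" using B(4) by simp
  also have "\<dots> \<le> emeasure lebesgue \<Omega>" using B(1) \<Omega> by (intro emeasure_mono) auto
  also have "\<dots> < \<infinity>" using \<Omega> by (auto simp: fmeasurable_def)
  finally have Bfin: "emeasure lborel B < \<infinity>" .
  have N'leb: "AE z in lebesgue. z \<notin> N'"
    using AE_not_in[OF B(3)] by (rule AE_completion)
  have [measurable]: "f \<in> borel_measurable borel" using f by (simp add: square_integrable_def)
  define V where "V z = stft h0 f (Re z) (Im z)" for z
  have [measurable]: "V \<in> borel_measurable borel" unfolding V_def by measurable
  obtain M where M: "0 \<le> M" "\<And>x w. cmod (stft h0 f x w) \<le> M"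
    using stft_bounded[OF f] by metis
  have VM: "cmod (V z) \<le> M" for z unfolding V_def by (rule M)
  define F where "F z t = indicator B z *\<^sub>R (V z * h0 (t - Re z)
      * exp (2 * of_real pi * \<i> * of_real t * of_real (Im z)))" for z :: complex and t :: real
  have [measurable]: "case_prod F \<in> borel_measurable (borel \<Otimes>\<^sub>M borel)"
    unfolding F_def by measurable
  have Fc: "cmod (F z t) \<le> indicator B z * (M * cmod (h0 (t - Re z)))" for z t
    unfolding F_def norm_scaleR norm_mult cmod_character using VM[of z]
    by (auto simp: indicator_def intro!: mult_right_mono)
  have hshift: "integrable lborel (\<lambda>t. cmod (h0 (t - x)))"
    "(LINT t|lborel. cmod (h0 (t - x))) = (LINT t|lborel. cmod (h0 t))" for x
    using lborel_integrable_real_affine[of "\<lambda>t. cmod (h0 t)" 1 "-x"] h0_integrable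
      lborel_integral_real_affine[of 1 "\<lambda>t. cmod (h0 t)" "-x"] by simp_all
  have indB: "integrable lborel (\<lambda>z. indicator B z * c :: real)" for c
    using Bfin by (intro integrable_mult_left integrable_real_indicator) auto

  have main: "integrable (lborel \<Otimes>\<^sub>M lborel) (\<lambda>(z, t). F z t * g t)"
    if [measurable]: "g \<in> borel_measurable borel"
      and gi: "\<And>x. integrable lborel (\<lambda>t. cmod (h0 (t - x)) * cmod (g t))"
      and gb: "\<And>x. (LINT t|lborel. cmod (h0 (t - x)) * cmod (g t)) \<le> K"
    for g :: "real \<Rightarrow> complex" and K
  proof (rule lborel_pair.Fubini_integrable)
    show "(\<lambda>(z, t). F z t * g t) \<in> borel_measurable (lborel \<Otimes>\<^sub>M lborel)" by measurable
    have bd: "cmod (F z t * g t) \<le> indicator B z * M * (cmod (h0 (t - Re z)) * cmod (g t))" for z t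
      using mult_right_mono[OF Fc[of z t], of "cmod (g t)"] by (simp add: norm_mult mult.assoc)
    have int: "integrable lborel (\<lambda>t. F z t * g t)" for z
      by (rule Bochner_Integration.integrable_bound[OF integrable_mult_right[OF gi[of "Re z"], of "indicator B z * M"]])
         (use bd M(1) in \<open>auto simp: abs_mult intro!: order_trans[OF bd]\<close>)
    then show "AE z in lborel. integrable lborel (\<lambda>t. case (z, t) of (z, t) \<Rightarrow> F z t * g t)" by simp
    show "integrable lborel (\<lambda>z. LINT t|lborel. norm (case (z, t) of (z, t) \<Rightarrow> F z t * g t))"
    proof (rule Bochner_Integration.integrable_bound[OF indB[of "M * K"]])
      show "AE z in lborel. norm (LINT t|lborel. norm (case (z, t) of (z, t) \<Rightarrow> F z t * g t))
              \<le> norm (indicator B z * (M * K))"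
      proof (rule AE_I2)
        fix z
        have "(LINT t|lborel. cmod (F z t * g t))
            \<le> (LINT t|lborel. indicator B z * M * (cmod (h0 (t - Re z)) * cmod (g t)))"
          using int[of z] gi by (intro integral_mono integrable_norm integrable_mult_right bd)
        also have "\<dots> = indicator B z * M * (LINT t|lborel. cmod (h0 (t - Re z)) * cmod (g t))"
          by (rule integral_mult_right_zero)
        also have "\<dots> \<le> indicator B z * M * K"
          using gb M(1) by (intro mult_left_mono) auto
        finally show "norm (LINT t|lborel. norm (case (z, t) of (z, t) \<Rightarrow> F z t * g t))
              \<le> norm (indicator B z * (M * K))"
          by (simp add: mult.assoc)
      qed
    qed measurable
  qed

  have F_int: "integrable (lborel \<Otimes>\<^sub>M lborel) (\<lambda>(z, t). F z t)"
    using main[of "\<lambda>_. 1" "LINT t|lborel. cmod (h0 t)"] hshift by simp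
  define u where "u t = (LINT z|lborel. F z t)" for t
  have [measurable]: "u \<in> borel_measurable borel"
  proof -
    have "u \<in> borel_measurable lborel" unfolding u_def by measurable
    then show ?thesis by simp
  qed
  have u_int: "integrable lborel u"
    unfolding u_def using lborel_pair.integrable_snd[OF F_int] .
  define C where "C = (LINT z|lborel. indicator B z * (M * 2 powr (1/4)))"
  have uC: "cmod (u t) \<le> C" for t
    unfolding u_def C_def
  proof (rule Bochner_Integration.integral_norm_bound_integral)
    have le: "cmod (F z t) \<le> indicator B z * (M * 2 powr (1/4))" for z
      using Fc[of z t] h0_cmod_le[of "t - Re z"] M(1)
      by (auto simp: indicator_def intro: order_trans mult_left_mono)
    show "integrable lborel (\<lambda>z. F z t)"
      by (rule Bochner_Integration.integrable_bound[OF indB[of "M * 2 powr (1/4)"]])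
         (auto intro!: order_trans[OF le])
    show "integrable lborel (\<lambda>z. indicator B z * (M * 2 powr (1/4)))" by (rule indB)
    show "cmod (F z t) \<le> indicator B z * (M * 2 powr (1/4))" for z by (rule le)
  qed
  have u_sq: "square_integrable u"
    unfolding square_integrable_def
  proof
    show "integrable lborel (\<lambda>t. (cmod (u t))\<^sup>2)"
    proof (rule Bochner_Integration.integrable_bound)
      show "integrable lborel (\<lambda>t. C * cmod (u t))" using u_int by simp
      show "AE t in lborel. norm ((cmod (u t))\<^sup>2) \<le> norm (C * cmod (u t))"
        using uC by (auto simp: power2_eq_square abs_mult intro!: mult_right_mono order_trans[OF uC])
    qed simp
  qed simp
  have "L2_inner u g = localization_form \<Omega> f g" if g: "square_integrable g" for g
  proof -
    have [measurable]: "g \<in> borel_measurable borel" using g by (simp add: square_integrable_def)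
    have eq: "(LINT t|lborel. (cmod (h0 (t - x)))\<^sup>2) = (LINT t|lborel. (cmod (h0 t))\<^sup>2)" for x
      using lborel_integral_real_affine[of 1 "\<lambda>t. (cmod (h0 t))\<^sup>2" "-x"] by simp
    have Fg: "integrable (lborel \<Otimes>\<^sub>M lborel) (\<lambda>(z, t). F z t * cnj (g t))"
      using L2_product[OF square_integrable_translate[OF square_integrable_h0] g]
      by (intro main) (simp_all add: eq)
    have "L2_inner u g = (LINT t|lborel. (LINT z|lborel. F z t * cnj (g t)))"
      unfolding L2_inner_def u_def by simp
    also have "\<dots> = (LINT z|lborel. (LINT t|lborel. F z t * cnj (g t)))"
      by (rule lborel_pair.Fubini_integral[OF Fg])
    also have "\<dots> = (LINT z|lborel. indicator B z *\<^sub>R (V z * cnj (stft h0 g (Re z) (Im z))))"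
    proof (rule Bochner_Integration.integral_cong[OF refl])
      fix z :: complex
      have "(LINT t|lborel. F z t * cnj (g t))
          = (LINT t|lborel. (indicator B z *\<^sub>R V z) * cnj (g t * cnj (h0 (t - Re z))
               * exp (- 2 * of_real pi * \<i> * of_real t * of_real (Im z))))"
        by (rule Bochner_Integration.integral_cong[OF refl])
           (simp add: F_def exp_cnj mult_ac)
      also have "\<dots> = (indicator B z *\<^sub>R V z) * cnj (stft h0 g (Re z) (Im z))"
        unfolding stft_def integral_mult_right_zero Bochner_Integration.integral_cnj ..
      finally show "(LINT t|lborel. F z t * cnj (g t))
          = indicator B z *\<^sub>R (V z * cnj (stft h0 g (Re z) (Im z)))" by simp
    qed
    also have "\<dots> = (LINT z|lebesgue. indicator B z *\<^sub>R (V z * cnj (stft h0 g (Re z) (Im z))))"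
      by (rule integral_completion[symmetric]) measurable
    also have "\<dots> = (LINT z|lebesgue. indicator \<Omega> z *\<^sub>R (V z * cnj (stft h0 g (Re z) (Im z))))"
    proof (rule integral_cong_AE)
      show m: "(\<lambda>z. indicator B z *\<^sub>R (V z * cnj (stft h0 g (Re z) (Im z)))) \<in> borel_measurable lebesgue"
        by (rule measurable_completion) measurable
      show e: "AE z in lebesgue. indicator B z *\<^sub>R (V z * cnj (stft h0 g (Re z) (Im z)))
              = indicator \<Omega> z *\<^sub>R (V z * cnj (stft h0 g (Re z) (Im z)))"
        using N'leb by eventually_elim (use B(1,2) in \<open>auto simp: indicator_def\<close>)
      have [measurable]: "\<Omega> \<in> sets lebesgue" using \<Omega> by auto
      have [measurable]: "(\<lambda>z. V z * cnj (stft h0 g (Re z) (Im z))) \<in> borel_measurable lebesgue"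
        by (rule measurable_completion) measurable
      show "(\<lambda>z. indicator \<Omega> z *\<^sub>R (V z * cnj (stft h0 g (Re z) (Im z)))) \<in> borel_measurable lebesgue"
        by measurable
    qed
    also have "\<dots> = localization_form \<Omega> f g"
      unfolding localization_form_def set_lebesgue_integral_def V_def ..
    finally show ?thesis .
  qed
  with u_sq show ?thesis by blast
qed

lemma localization_operator:
  assumes "\<Omega> \<in> lmeasurable" "square_integrable f"
  shows "square_integrable (localization_operator \<Omega> f)"
    and "square_integrable g \<Longrightarrow>
           L2_inner (localization_operator \<Omega> f) g = localization_form \<Omega> f g"
  using someI_ex[OF localization_exists[OF assms]] unfolding localization_operator_def by auto

lemma localization_operator_unique:
  assumes \<Omega>: "\<Omega> \<in> lmeasurable" and f: "square_integrable f" and u: "square_integrable u"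
    and eq: "\<And>g. square_integrable g \<Longrightarrow> L2_inner u g = localization_form \<Omega> f g"
  shows "AE t in lborel. localization_operator \<Omega> f t = u t"
proof -
  define L where "L = localization_operator \<Omega> f"
  have L: "square_integrable L" unfolding L_def by (rule localization_operator[OF \<Omega> f])
  define d where "d t = L t - u t" for t
  have d: "square_integrable d" unfolding d_def by (rule square_integrable_diff[OF L u])
  have "(LINT t|lborel. L t * cnj (d t)) = (LINT t|lborel. u t * cnj (d t))"
    using eq[OF d] localization_operator(2)[OF \<Omega> f d] by (simp add: L2_inner_def L_def)
  then have "(LINT t|lborel. d t * cnj (d t)) = 0"
    using L2_inner_integrable[OF L d] L2_inner_integrable[OF u d]
    by (simp add: d_def left_diff_distrib)
  moreover have "d t * cnj (d t) = of_real ((cmod (d t))\<^sup>2)" for t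
    by (rule complex_norm_square[symmetric])
  ultimately have "of_real (LINT t|lborel. (cmod (d t))\<^sup>2) = (0 :: complex)"
    by (simp only: integral_complex_of_real)
  then have "(LINT t|lborel. (cmod (d t))\<^sup>2) = 0" by simp
  then have "AE t in lborel. (cmod (d t))\<^sup>2 = 0"
    using d by (subst (asm) integral_nonneg_eq_0_iff_AE) (auto simp: square_integrable_def)
  then show ?thesis by (simp add: d_def L_def)
qed


section \<open>Real-analytic curves and families\<close>

definition real_analytic :: "(real \<Rightarrow> complex) \<Rightarrow> bool" where
  "real_analytic \<gamma> \<longleftrightarrow>
     (\<forall>s. \<exists>a. \<exists>r>0. \<forall>h. \<bar>h\<bar> < r \<longrightarrow> (\<lambda>n. a n * of_real (h ^ n)) sums \<gamma> (s + h))"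

text \<open>
  Joint real-analyticity in two variables, relative to \<open>S\<close>: near each point of \<open>S\<close> the function
  agrees on \<open>S\<close> with a convergent double power series. At boundary points of \<open>S\<close> this means
  real-analytic up to the boundary.
\<close>

definition real_analytic2_on :: "(real \<times> real) set \<Rightarrow> (real \<Rightarrow> real \<Rightarrow> complex) \<Rightarrow> bool" where
  "real_analytic2_on S \<Gamma> \<longleftrightarrow>
     (\<forall>(t, s)\<in>S. \<exists>c. \<exists>r>0. \<forall>h k. \<bar>h\<bar> < r \<longrightarrow> \<bar>k\<bar> < r \<longrightarrow> (t + h, s + k) \<in> S \<longrightarrow>
        ((\<lambda>(m, n). c m n * of_real (h ^ m * k ^ n)) has_sum \<Gamma> (t + h) (s + k)) UNIV)"

text \<open>Closed curves are parametrized by 1-periodic functions on the real line.\<close>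

definition analytic_Jordan_parametrization :: "(real \<Rightarrow> complex) \<Rightarrow> complex set \<Rightarrow> bool" where
  "analytic_Jordan_parametrization \<gamma> C \<longleftrightarrow>
     real_analytic \<gamma> \<and> (\<forall>s. \<gamma> (s + 1) = \<gamma> s) \<and> inj_on \<gamma> {0..<1} \<and>
     (\<forall>s. vector_derivative \<gamma> (at s) \<noteq> 0) \<and> range \<gamma> = C"

definition analytic_Jordan_curve :: "complex set \<Rightarrow> bool" where
  "analytic_Jordan_curve C \<longleftrightarrow> (\<exists>\<gamma>. analytic_Jordan_parametrization \<gamma> C)"

definition analytic_family :: "real \<Rightarrow> (real \<Rightarrow> complex set) \<Rightarrow> bool" where
  "analytic_family t\<^sub>0 D \<longleftrightarrow>
     (\<exists>\<Gamma>. real_analytic2_on ({0..<t\<^sub>0} \<times> UNIV) \<Gamma> \<and>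
          (\<forall>t\<in>{0..<t\<^sub>0}. analytic_Jordan_parametrization (\<Gamma> t) (frontier (D t))))"


section \<open>Plane domains\<close>

definition bounded_simply_connected_domain :: "complex set \<Rightarrow> bool" where
  "bounded_simply_connected_domain D \<longleftrightarrow>
     D \<noteq> {} \<and> open D \<and> connected D \<and> bounded D \<and> simply_connected D"

text \<open>Doubly connected: the complement in the Riemann sphere has exactly two components.\<close>

definition doubly_connected_domain :: "complex set \<Rightarrow> bool" where
  "doubly_connected_domain \<Omega> \<longleftrightarrow>
     \<Omega> \<noteq> {} \<and> open \<Omega> \<and> connected \<Omega> \<and>
     card (connected_components_of
       (subtopology (Alexandroff_compactification euclidean) (- Some ` \<Omega>))) = 2"

definition radial :: "complex set \<Rightarrow> bool" where
  "radial S \<longleftrightarrow> (\<forall>\<theta>::real. (\<lambda>z. cis \<theta> * z) ` S = S)"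

text \<open>Annuli centred at the origin; open, closed and degenerate ones are all included.\<close>

definition centred_annulus :: "complex set \<Rightarrow> bool" where
  "centred_annulus A \<longleftrightarrow> (\<exists>I::real set. is_interval I \<and> A = {z. cmod z \<in> I})"

lemma radial_Union_annuli:
  assumes "\<forall>A\<in>\<A>. centred_annulus A"
  shows "radial (\<Union>\<A>)"
proof -
  have sub: "(\<lambda>z. cis \<theta> * z) ` \<Union>\<A> \<subseteq> \<Union>\<A>" for \<theta>
  proof clarify
    fix z A assume A: "z \<in> A" "A \<in> \<A>"
    with assms have "cis \<theta> * z \<in> A" by (auto simp: centred_annulus_def norm_mult)
    with A(2) show "cis \<theta> * z \<in> \<Union>\<A>" by blast
  qed
  have "z \<in> (\<lambda>z. cis \<theta> * z) ` \<Union>\<A>" if "z \<in> \<Union>\<A>" for \<theta> z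
  proof (rule image_eqI)
    show "z = cis \<theta> * (cis (- \<theta>) * z)" by (simp add: mult.assoc[symmetric] cis_mult)
    show "cis (- \<theta>) * z \<in> \<Union>\<A>" using sub[of "- \<theta>"] that by blast
  qed
  then have "(\<lambda>z. cis \<theta> * z) ` \<Union>\<A> = \<Union>\<A>" for \<theta>
    using sub[of \<theta>] by (intro subset_antisym) (auto simp only: subset_iff)
  then show ?thesis unfolding radial_def by blast
qed

end

theory Submission
  imports Defs "HOL-Complex_Analysis.Complex_Analysis"
begin

text \<open>
  The transform of the Gaussian window is again a Gaussian, and up to this weight the transforms of all other functions are
  entire. So the window is an eigenfunction of the localization operator of \<open>\<Omega>\<close> with eigenvalue \<open>c\<close> as soon as
  \<open>\<Omega>\<close> satisfies the quadrature identity: the integral over \<open>\<Omega>\<close> of \<open>B z * exp (- pi * norm z^2)\<close> is \<open>c * B 0\<close>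
  for every entire \<open>B\<close> (\<open>localization_of_quadrature\<close>). Discs centred at 0 have this property by the mean value theorem,
  but they are not the only source of such sets. Let a domain grow with normal velocity proportional to the density of
  harmonic measure seen from 0, divided by the Gaussian weight (a weighted Hele-Shaw or Laplacian growth). With the factor \<open>2 * pi\<close>, the rate of change of the
  weighted integral of \<open>B\<close> is \<open>2 * pi\<close> times the mean of \<open>B\<close> against harmonic measure, which is \<open>2 * pi * B 0\<close>, so the region swept up to time
  \<open>t\<close> satisfies the identity with \<open>c = 2 * pi * t\<close>, whatever the initial domain was.

  In terms of conformal maps \<open>F z t\<close> of the unit disc with \<open>F 0 t = 0\<close> the growth law is the Polubarinova-Galin equation
  \<open>Re (Ft * cnj (z * Fz)) = exp (pi * norm F^2)\<close> for \<open>norm z = 1\<close>. It says that the Jacobian of the boundary curve as a function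
  of time and angle is \<open>2 * pi\<close> divided by the Gaussian weight, and a change of variables gives the quadrature identity
  (\<open>quadrature\<close>).

  The main work is the short-time solution of this equation with analytic data. The initial conformal map \<open>f\<close> extends
  injectively to a larger disc by reflection in the analytic boundary (\<open>Riemann_map_extension\<close>). One then looks for
  \<open>F = f \<circ> phi\<close> with \<open>phi = \<zeta> * exp \<kappa>\<close>. Differentiated equations lose derivatives, but there is an integrated form
  that does not: on the circle the weight \<open>exp (- pi * norm F^2)\<close> should be a fixed holomorphic function of \<open>phi\<close> plus a function
  holomorphic in the disc with prescribed real part at 0. This is a fixed point equation for \<open>\<kappa>\<close> whose linear
  part is multiplication by a positive function, and it is solved by contraction in the Banach algebra of absolutely convergent
  series in \<open>\<zeta>\<close>, \<open>cnj \<zeta>\<close> and \<open>t\<close> (\<open>fixed_point_in_algebra\<close>). Treating \<open>t\<close> as a formal variable gives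
  joint analyticity of the boundary curves at once (\<open>conformal_flow\<close>). Eliminating the fixed holomorphic function from the time
  and angle derivatives produces a holomorphic function that is real on the circle, hence constant: this is the
  growth law (\<open>polubarinova_galin\<close>).

  Positivity of the velocity makes the domains increase strictly and shows that each point of the shell is passed by the boundary
  exactly once (\<open>closure_D_subset\<close>, \<open>shell_swept\<close>, \<open>curve_inj\<close>). A radial shell would force the inner domain to be a
  disc centred at 0 (\<open>radial_shell_imp_disc\<close>).
\<close>

section \<open>The convolution algebra of absolutely summable families\<close>

lemma abs_summable_Times:
  fixes f :: "'a \<Rightarrow> complex" and g :: "'b \<Rightarrow> complex"
  assumes "(\<lambda>x. norm (f x)) summable_on UNIV" "(\<lambda>x. norm (g x)) summable_on UNIV"
  shows "(\<lambda>(x, y). norm (f x * g y)) summable_on UNIV"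
proof -
  have "(\<lambda>p. norm ((\<lambda>(x, y). f x * g y) p)) summable_on Sigma UNIV (\<lambda>_. UNIV)"
  proof (rule Infinite_Sum.abs_summable_on_Sigma_iff[THEN iffD2], intro conjI ballI)
    show "(\<lambda>y. norm (case (x, y) of (x, y) \<Rightarrow> f x * g y)) summable_on UNIV" for x
      using assms(2) by (simp add: norm_mult summable_on_cmult_right)
    show "(\<lambda>x. norm (\<Sum>\<^sub>\<infinity>y. norm (case (x, y) of (x, y) \<Rightarrow> f x * g y))) summable_on UNIV"
      using assms(1) by (simp add: norm_mult infsum_cmult_right' abs_mult summable_on_cmult_left)
  qed
  then show ?thesis by (simp add: case_prod_unfold)
qed

lemma summable_norm_add:
  fixes f g :: "'a \<Rightarrow> complex"
  assumes "(\<lambda>x. norm (f x)) summable_on A" "(\<lambda>x. norm (g x)) summable_on A"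
  shows "(\<lambda>x. norm (f x + g x)) summable_on A"
  by (rule summable_on_comparison_test[OF summable_on_add[OF assms]]) (auto intro: norm_triangle_ineq)

text \<open>For a commutative monoid of indices this is the convolution algebra of absolutely convergent
  formal series. Every bounded character of the monoid evaluates such a series, and the ring
  operations and the exponential commute with evaluation; identities between functions can therefore
  be solved for inside one commutative Banach algebra.\<close>

typedef 'i ell1 = "{f :: 'i \<Rightarrow> complex. (\<lambda>i. norm (f i)) summable_on UNIV}"
  morphisms coeff Ell1
  by (rule exI[of _ "\<lambda>_. 0"]) simp

setup_lifting type_definition_ell1

lemma coeff_summable_norm: "(\<lambda>i. norm (coeff f i)) summable_on A"
proof -
  have "(\<lambda>i. norm (coeff f i)) summable_on UNIV" using coeff[of f] by simp
  then show ?thesis by (rule summable_on_subset_banach) simp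
qed

lemma ell1_eqI: "(\<And>i. coeff f i = coeff g i) \<Longrightarrow> f = g"
  by (simp add: coeff_inject[symmetric] fun_eq_iff)

instantiation ell1 :: (type) real_normed_vector
begin

lift_definition zero_ell1 :: "'a ell1" is "\<lambda>_. 0" by simp
lift_definition plus_ell1 :: "'a ell1 \<Rightarrow> 'a ell1 \<Rightarrow> 'a ell1" is "\<lambda>f g i. f i + g i"
  by (rule summable_norm_add)
lift_definition uminus_ell1 :: "'a ell1 \<Rightarrow> 'a ell1" is "\<lambda>f i. - f i" by simp
lift_definition minus_ell1 :: "'a ell1 \<Rightarrow> 'a ell1 \<Rightarrow> 'a ell1" is "\<lambda>f g i. f i - g i"
  subgoal for f g using summable_norm_add[of f UNIV "\<lambda>i. - g i"] by simp
  done
lift_definition scaleR_ell1 :: "real \<Rightarrow> 'a ell1 \<Rightarrow> 'a ell1" is "\<lambda>r f i. r *\<^sub>R f i"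
  by (auto intro: summable_on_cmult_right)
lift_definition norm_ell1 :: "'a ell1 \<Rightarrow> real" is "\<lambda>f. \<Sum>\<^sub>\<infinity>i. norm (f i)" .
definition "dist f g = norm (f - g)" for f g :: "'a ell1"
definition "sgn f = inverse (norm f) *\<^sub>R f" for f :: "'a ell1"
definition [code del]: "(uniformity :: ('a ell1 \<times> 'a ell1) filter) = (INF e\<in>{0<..}. principal {(x, y). dist x y < e})"
definition [code del]: "open (U :: 'a ell1 set) = (\<forall>x\<in>U. \<forall>\<^sub>F (x', y) in uniformity. x' = x \<longrightarrow> y \<in> U)"

lemma coeff_simps [simp]:
  "coeff (0 :: 'a ell1) i = 0"
  "coeff (f + g) i = coeff f i + coeff g i"
  "coeff (f - g) i = coeff f i - coeff g i"
  "coeff (- f) i = - coeff f i"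
  "coeff (r *\<^sub>R f) i = r *\<^sub>R coeff f i" for f g :: "'a ell1"
  by (transfer, simp)+

lemma norm_ell1_eq: "norm (f :: 'a ell1) = (\<Sum>\<^sub>\<infinity>i. norm (coeff f i))"
  by transfer simp

lemma norm_coeff_le: "norm (coeff f i) \<le> norm (f :: 'a ell1)"
proof -
  have "(\<Sum>\<^sub>\<infinity>i\<in>{i}. norm (coeff f i)) \<le> (\<Sum>\<^sub>\<infinity>i. norm (coeff f i))"
    by (rule infsum_mono_neutral) (auto intro: coeff_summable_norm)
  then show ?thesis by (simp add: norm_ell1_eq)
qed

instance
proof
  fix a b c :: "'a ell1" and r s :: real
  show "a + b + c = a + (b + c)" "a + b = b + a" "0 + a = a" "- a + a = 0" "a - b = a + - b"
    "r *\<^sub>R (a + b) = r *\<^sub>R a + r *\<^sub>R b" "(r + s) *\<^sub>R a = r *\<^sub>R a + s *\<^sub>R a"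
    "r *\<^sub>R s *\<^sub>R a = (r * s) *\<^sub>R a" "1 *\<^sub>R a = a"
    by (auto intro!: ell1_eqI simp: algebra_simps)
  show "dist a b = norm (a - b)" by (rule dist_ell1_def)
  show "sgn a = inverse (norm a) *\<^sub>R a" by (rule sgn_ell1_def)
  show "norm a = 0 \<longleftrightarrow> a = 0"
  proof
    assume "norm a = 0"
    then have "norm (coeff a i) = 0" for i using norm_coeff_le[of a i] by simp
    then show "a = 0" by (auto intro!: ell1_eqI)
  qed (simp add: norm_ell1_eq)
  show "norm (a + b) \<le> norm a + norm b"
  proof -
    have "norm (a + b) \<le> (\<Sum>\<^sub>\<infinity>i. norm (coeff a i) + norm (coeff b i))"
      unfolding norm_ell1_eq
      by (intro infsum_mono coeff_summable_norm summable_on_add) (auto intro: norm_triangle_ineq)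
    also have "\<dots> = norm a + norm b"
      unfolding norm_ell1_eq by (intro infsum_add coeff_summable_norm)
    finally show ?thesis .
  qed
  show "norm (r *\<^sub>R a) = \<bar>r\<bar> * norm a"
    by (simp add: norm_ell1_eq infsum_cmult_right')
qed (rule uniformity_ell1_def open_ell1_def)+

end

lemma coeff_Ell1: "(\<lambda>i. norm (f i)) summable_on UNIV \<Longrightarrow> coeff (Ell1 f) = f"
  by (rule Ell1_inverse) simp

lemma bounded_linear_coeff: "bounded_linear (\<lambda>f. coeff f i)"
  by (rule bounded_linear_intro[where K = 1]) (auto simp: norm_coeff_le)

lemma sum_norm_coeff_le: "finite F \<Longrightarrow> (\<Sum>i\<in>F. norm (coeff f i)) \<le> norm f"
  unfolding norm_ell1_eq infsum_finite[symmetric]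
  by (rule infsum_mono_neutral) (auto intro: coeff_summable_norm)

lemma ell1_dominatedI:
  fixes f :: "'i \<Rightarrow> complex"
  assumes "\<And>F. finite F \<Longrightarrow> (\<Sum>i\<in>F. norm (f i)) \<le> e"
  shows "(\<lambda>i. norm (f i)) summable_on UNIV" "(\<Sum>\<^sub>\<infinity>i. norm (f i)) \<le> e"
proof -
  show *: "(\<lambda>i. norm (f i)) summable_on UNIV"
    by (rule nonneg_bdd_above_summable_on) (auto intro!: bdd_aboveI[of _ e] assms)
  show "(\<Sum>\<^sub>\<infinity>i. norm (f i)) \<le> e"
    by (rule infsum_le_finite_sums[OF *]) (use assms in auto)
qed

instance ell1 :: (type) banach
proof
  fix X :: "nat \<Rightarrow> 'a ell1" assume X: "Cauchy X"
  have "Cauchy (\<lambda>n. coeff (X n) i)" for i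
    using X by (rule bounded_linear.Cauchy[OF bounded_linear_coeff])
  then have L: "(\<lambda>n. coeff (X n) i) \<longlonglongrightarrow> lim (\<lambda>n. coeff (X n) i)" for i
    by (simp add: Cauchy_convergent convergent_LIMSEQ_iff[symmetric])
  define L where "L i = lim (\<lambda>n. coeff (X n) i)" for i
  note L = L[folded L_def]
  have fin: "(\<Sum>i\<in>F. norm (coeff (X m) i - L i)) \<le> e"
    if N: "\<And>n. n \<ge> m \<Longrightarrow> norm (X m - X n) \<le> e" and F: "finite F" for e m F
  proof (rule tendsto_upperbound)
    show "(\<lambda>n. \<Sum>i\<in>F. norm (coeff (X m) i - coeff (X n) i)) \<longlonglongrightarrow> (\<Sum>i\<in>F. norm (coeff (X m) i - L i))"
      by (intro tendsto_intros L)
    show "\<forall>\<^sub>F n in sequentially. (\<Sum>i\<in>F. norm (coeff (X m) i - coeff (X n) i)) \<le> e"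
      using eventually_ge_at_top[of m]
    proof eventually_elim
      case (elim n)
      show ?case using sum_norm_coeff_le[OF F, of "X m - X n"] N[OF elim] by simp
    qed
  qed simp
  have ex: "\<exists>N. \<forall>m\<ge>N. \<forall>n\<ge>m. norm (X m - X n) \<le> e" if e: "e > 0" for e
  proof -
    obtain N where "\<And>m n. m \<ge> N \<Longrightarrow> n \<ge> N \<Longrightarrow> norm (X m - X n) < e"
      using X e unfolding Cauchy_def dist_norm by blast
    then show ?thesis by (intro exI[of _ N]) (auto intro: less_imp_le)
  qed
  obtain m where m: "\<And>n. n \<ge> m \<Longrightarrow> norm (X m - X n) \<le> 1" using ex[OF zero_less_one] by blast
  have "(\<lambda>i. norm (L i)) summable_on UNIV"
  proof (rule ell1_dominatedI)
    fix F :: "'a set" assume F: "finite F"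
    have "(\<Sum>i\<in>F. norm (L i)) \<le> (\<Sum>i\<in>F. norm (coeff (X m) i - L i) + norm (coeff (X m) i))"
    proof (rule sum_mono)
      fix i show "norm (L i) \<le> norm (coeff (X m) i - L i) + norm (coeff (X m) i)"
        using norm_triangle_sub[of "L i" "coeff (X m) i"] by (simp add: norm_minus_commute)
    qed
    also have "\<dots> \<le> 1 + norm (X m)"
      unfolding sum.distrib by (intro add_mono fin[OF m F] sum_norm_coeff_le F)
    finally show "(\<Sum>i\<in>F. norm (L i)) \<le> 1 + norm (X m)" .
  qed
  then have cL: "coeff (Ell1 L) = L" by (rule coeff_Ell1)
  have "X \<longlonglongrightarrow> Ell1 L"
  proof (rule LIMSEQ_I)
    fix r :: real assume r: "0 < r"
    then obtain N where N: "\<And>m n. m \<ge> N \<Longrightarrow> n \<ge> m \<Longrightarrow> norm (X m - X n) \<le> r / 2"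
      using ex[OF half_gt_zero[OF r]] by blast
    have "norm (X m - Ell1 L) < r" if "m \<ge> N" for m
      using ell1_dominatedI(2)[OF fin[OF N[OF that]]] r by (simp add: norm_ell1_eq cL)
    then show "\<exists>no. \<forall>n\<ge>no. norm (X n - Ell1 L) < r" by blast
  qed
  then show "convergent X" by (auto simp: convergent_def)
qed

lemma summable_Times_coeff:
  "(\<lambda>(a, b). norm (coeff f a * coeff g b)) summable_on A"
  by (rule summable_on_subset_banach[OF abs_summable_Times[OF coeff_summable_norm coeff_summable_norm]]) simp

lemma has_sum_fibres:
  fixes h :: "'i::plus \<times> 'i \<Rightarrow> 'c::banach"
  assumes "h summable_on UNIV"
  shows "(\<lambda>c. \<Sum>\<^sub>\<infinity>p\<in>{p. fst p + snd p = c}. h p) summable_on UNIV"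
    "(\<Sum>\<^sub>\<infinity>c. \<Sum>\<^sub>\<infinity>p\<in>{p. fst p + snd p = c}. h p) = (\<Sum>\<^sub>\<infinity>p. h p)"
proof -
  have bij: "bij_betw snd (Sigma UNIV (\<lambda>c. {p. fst p + snd p = c})) (UNIV :: ('i \<times> 'i) set)"
    by (rule bij_betw_byWitness[where f' = "\<lambda>p. (fst p + snd p, p)"]) auto
  have *: "(\<lambda>(c, p). h p) summable_on (Sigma UNIV (\<lambda>c. {p. fst p + snd p = c}))"
    using assms summable_on_reindex_bij_betw[OF bij, of h] by (simp add: case_prod_unfold)
  show "(\<lambda>c. \<Sum>\<^sub>\<infinity>p\<in>{p. fst p + snd p = c}. h p) summable_on UNIV"
    by (rule summable_on_Sigma_banach[OF *])
  show "(\<Sum>\<^sub>\<infinity>c. \<Sum>\<^sub>\<infinity>p\<in>{p. fst p + snd p = c}. h p) = (\<Sum>\<^sub>\<infinity>p. h p)"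
    using infsum_Sigma'_banach[OF *] infsum_reindex_bij_betw[OF bij, of h] by (simp add: case_prod_unfold)
qed

instantiation ell1 :: (comm_monoid_add) "{times, one}"
begin

lift_definition times_ell1 :: "'a ell1 \<Rightarrow> 'a ell1 \<Rightarrow> 'a ell1"
  is "\<lambda>f g c. \<Sum>\<^sub>\<infinity>p\<in>{p. fst p + snd p = c}. f (fst p) * g (snd p)"
proof -
  fix f g :: "'a \<Rightarrow> complex"
  assume "(\<lambda>i. norm (f i)) summable_on UNIV" "(\<lambda>i. norm (g i)) summable_on UNIV"
  then have s: "(\<lambda>p. norm (f (fst p) * g (snd p))) summable_on UNIV"
    using abs_summable_Times by (simp add: case_prod_unfold)
  show "(\<lambda>c. norm (\<Sum>\<^sub>\<infinity>p\<in>{p. fst p + snd p = c}. f (fst p) * g (snd p))) summable_on UNIV"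
    by (rule summable_on_comparison_test[OF has_sum_fibres(1)[OF s]])
       (auto intro!: norm_infsum_bound summable_on_subset_banach[OF s])
qed

lift_definition one_ell1 :: "'a ell1" is "\<lambda>i. if i = 0 then 1 else 0"
  by (rule summable_on_cong_neutral[THEN iffD2, OF _ _ _ summable_on_finite[of "{0}"]]) auto

instance ..

end

lemma coeff_times:
  "coeff (f * g) c = (\<Sum>\<^sub>\<infinity>p\<in>{p. fst p + snd p = c}. coeff f (fst p) * coeff g (snd p))"
  by transfer simp

lemma coeff_one: "coeff 1 i = (if i = 0 then 1 else 0)"
  by transfer simp

text \<open>For a multiplicative weight \<open>\<xi>\<close> this is a character of the algebra; general bounded weights are needed to
  read off coefficients.\<close>

definition pairing :: "('i \<Rightarrow> complex) \<Rightarrow> 'i ell1 \<Rightarrow> complex" where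
  "pairing \<xi> f = (\<Sum>\<^sub>\<infinity>i. coeff f i * \<xi> i)"

lemma summable_pairing:
  assumes "\<And>i. norm (\<xi> i) \<le> 1"
  shows "(\<lambda>i. norm (coeff f i * \<xi> i)) summable_on A" "(\<lambda>i. coeff f i * \<xi> i) summable_on A"
proof -
  show *: "(\<lambda>i. norm (coeff f i * \<xi> i)) summable_on A"
    by (rule summable_on_comparison_test[OF coeff_summable_norm[of f]])
       (auto simp: norm_mult intro!: mult_left_le assms)
  then show "(\<lambda>i. coeff f i * \<xi> i) summable_on A" by (rule abs_summable_summable)
qed

lemma norm_pairing_le:
  assumes "\<And>i. norm (\<xi> i) \<le> 1"
  shows "norm (pairing \<xi> f) \<le> norm f"
proof -
  have "norm (pairing \<xi> f) \<le> (\<Sum>\<^sub>\<infinity>i. norm (coeff f i * \<xi> i))"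
    unfolding pairing_def by (rule norm_infsum_bound[OF summable_pairing(1)[OF assms]])
  also have "\<dots> \<le> norm f"
    unfolding norm_ell1_eq using assms
    by (intro infsum_mono summable_pairing coeff_summable_norm) (auto simp: norm_mult intro: mult_left_le)
  finally show ?thesis .
qed

lemma bounded_linear_pairing:
  fixes \<xi> :: "'a \<Rightarrow> complex"
  assumes "\<And>i. norm (\<xi> i) \<le> 1"
  shows "bounded_linear (pairing \<xi>)"
proof (rule bounded_linear_intro[where K = 1])
  fix f g :: "'a ell1" and r :: real
  show "pairing \<xi> (f + g) = pairing \<xi> f + pairing \<xi> g"
    by (simp add: pairing_def distrib_right infsum_add[OF summable_pairing(2) summable_pairing(2)] assms)
  show "pairing \<xi> (r *\<^sub>R f) = r *\<^sub>R pairing \<xi> f"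
    by (simp add: pairing_def scaleR_conv_of_real infsum_cmult_right' mult.assoc)
  show "norm (pairing \<xi> f) \<le> norm f * 1" using norm_pairing_le[OF assms] by simp
qed

lemma pairing_times:
  assumes "\<And>i. norm (\<xi> i) \<le> 1"
  shows "(\<lambda>p. norm (coeff f (fst p) * coeff g (snd p) * \<xi> (fst p + snd p))) summable_on UNIV"
    and "pairing \<xi> (f * g) = (\<Sum>\<^sub>\<infinity>p. coeff f (fst p) * coeff g (snd p) * \<xi> (fst p + snd p))"
proof -
  show s: "(\<lambda>p. norm (coeff f (fst p) * coeff g (snd p) * \<xi> (fst p + snd p))) summable_on UNIV"
    by (rule summable_on_comparison_test[OF summable_Times_coeff[of f g]])
       (auto simp: norm_mult intro!: mult_left_le assms)
  have "pairing \<xi> (f * g) = (\<Sum>\<^sub>\<infinity>c. \<Sum>\<^sub>\<infinity>p\<in>{p. fst p + snd p = c}. coeff f (fst p) * coeff g (snd p) * \<xi> (fst p + snd p))"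
    unfolding pairing_def coeff_times infsum_cmult_left'[symmetric]
    by (intro infsum_cong) auto
  also have "\<dots> = (\<Sum>\<^sub>\<infinity>p. coeff f (fst p) * coeff g (snd p) * \<xi> (fst p + snd p))"
    by (rule has_sum_fibres(2)[OF abs_summable_summable[OF s]])
  finally show "pairing \<xi> (f * g) = \<dots>" .
qed

lemma pairing_times_iterated:
  assumes "\<And>i. norm (\<xi> i) \<le> 1"
  shows "pairing \<xi> (f * g) = pairing (\<lambda>a. pairing (\<lambda>b. \<xi> (a + b)) g) f"
proof -
  have "pairing \<xi> (f * g) = (\<Sum>\<^sub>\<infinity>(a, b)\<in>UNIV \<times> UNIV. coeff f a * coeff g b * \<xi> (a + b))"
    unfolding pairing_times(2)[OF assms] by (simp add: case_prod_unfold)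
  also have "\<dots> = (\<Sum>\<^sub>\<infinity>a. \<Sum>\<^sub>\<infinity>b. coeff f a * coeff g b * \<xi> (a + b))"
    using abs_summable_summable[OF pairing_times(1)[OF assms, of f g]]
    by (intro infsum_Sigma'_banach[symmetric]) (simp add: case_prod_unfold)
  also have "\<dots> = pairing (\<lambda>a. pairing (\<lambda>b. \<xi> (a + b)) g) f"
    by (simp add: pairing_def infsum_cmult_right' mult.assoc)
  finally show ?thesis .
qed

lemma pairing_indicator: "pairing (\<lambda>i. if i = c then 1 else 0) f = coeff f c"
proof -
  have "(\<Sum>\<^sub>\<infinity>i. coeff f i * (if i = c then 1 else 0)) = (\<Sum>\<^sub>\<infinity>i\<in>{c}. coeff f i)"
    by (rule infsum_cong_neutral) auto
  then show ?thesis by (simp add: pairing_def)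
qed

text \<open>The ring axioms for the convolution product need no manipulation of nested sums: the functionals
  separate points, and each iterated product evaluates to an absolutely convergent multiple sum
  that does not depend on how it is bracketed.\<close>

lemma ell1_eqI_pairing:
  assumes "\<And>\<xi>. (\<And>i. norm (\<xi> i) \<le> 1) \<Longrightarrow> pairing \<xi> f = pairing \<xi> g"
  shows "f = g"
proof (rule ell1_eqI)
  fix c show "coeff f c = coeff g c"
    using assms[of "\<lambda>i. if i = c then 1 else 0"] by (simp add: pairing_indicator)
qed

lemma pairing_one: "pairing \<xi> 1 = \<xi> 0"
proof -
  have "(\<Sum>\<^sub>\<infinity>i. coeff 1 i * \<xi> i) = (\<Sum>\<^sub>\<infinity>i\<in>{0}. \<xi> i)"
    by (rule infsum_cong_neutral) (auto simp: coeff_one)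
  then show ?thesis by (simp add: pairing_def)
qed

instantiation ell1 :: (comm_monoid_add) comm_ring_1
begin

instance
proof
  fix f g h :: "'a ell1"
  show "f * g = g * f"
  proof (rule ell1_eqI)
    fix c
    show "coeff (f * g) c = coeff (g * f) c"
      unfolding coeff_times
      by (rule infsum_reindex_bij_witness[where i = prod.swap and j = prod.swap]) (auto simp: add.commute)
  qed
  show "1 * f = f"
  proof (rule ell1_eqI_pairing)
    fix \<xi> :: "'a \<Rightarrow> complex" assume b: "\<And>i. norm (\<xi> i) \<le> 1"
    show "pairing \<xi> (1 * f) = pairing \<xi> f"
      unfolding pairing_times_iterated[OF b] pairing_one by simp
  qed
  show "(f + g) * h = f * h + g * h"
  proof (rule ell1_eqI)
    fix c
    have s: "(\<lambda>p. coeff u (fst p) * coeff h (snd p)) summable_on A" for u A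
      using abs_summable_summable[of "\<lambda>p. coeff u (fst p) * coeff h (snd p)", OF summable_Times_coeff[of u h, unfolded case_prod_unfold]] .
    show "coeff ((f + g) * h) c = coeff (f * h + g * h) c"
      unfolding coeff_simps coeff_times by (simp add: distrib_right infsum_add[OF s s])
  qed
  show "f * g * h = f * (g * h)"
  proof (rule ell1_eqI_pairing)
    fix \<xi> :: "'a \<Rightarrow> complex" assume b: "\<And>i. norm (\<xi> i) \<le> 1"
    have b': "norm (pairing (\<lambda>c. \<xi> (i + c)) h / of_real (norm h + 1)) \<le> 1" for i
    proof -
      have "norm (of_real (norm h + 1) :: complex) = norm h + 1"
        unfolding norm_of_real using norm_ge_zero[of h] by linarith
      moreover have "norm (pairing (\<lambda>c. \<xi> (i + c)) h) \<le> norm h + 1"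
        using norm_pairing_le[of "\<lambda>c. \<xi> (i + c)" h, OF b] by linarith
      ultimately show ?thesis
        unfolding norm_divide using norm_ge_zero[of h]
        by (subst divide_le_eq_1_pos) linarith+
    qed
    have sc: "pairing (\<lambda>i. \<psi> i / c) u = pairing \<psi> u / c" for \<psi> c and u :: "'a ell1"
      unfolding pairing_def by (simp add: divide_inverse infsum_cmult_left' mult.assoc[symmetric])
    have nz: "(of_real (norm h + 1) :: complex) \<noteq> 0"
      unfolding of_real_eq_0_iff using norm_ge_zero[of h] by linarith
    have "pairing \<xi> (f * g * h) = pairing (\<lambda>a. pairing (\<lambda>c. \<xi> (a + c)) h) (f * g)"
      by (rule pairing_times_iterated[OF b])
    also have "\<dots> = pairing (\<lambda>a. pairing (\<lambda>b. pairing (\<lambda>c. \<xi> (a + b + c)) h) g) f"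
      using pairing_times_iterated[of "\<lambda>a. pairing (\<lambda>c. \<xi> (a + c)) h / of_real (norm h + 1)" f g, OF b'] nz
      by (simp add: sc)
    also have "\<dots> = pairing (\<lambda>a. pairing (\<lambda>b. \<xi> (a + b)) (g * h)) f"
    proof -
      have "pairing (\<lambda>b. \<xi> (a + b)) (g * h) = pairing (\<lambda>b. pairing (\<lambda>c. \<xi> (a + b + c)) h) g" for a
        using pairing_times_iterated[where \<xi> = "\<lambda>i. \<xi> (a + i)" and f = g and g = h] b by (simp add: add.assoc)
      then show ?thesis by simp
    qed
    also have "\<dots> = pairing \<xi> (f * (g * h))"
      by (rule pairing_times_iterated[OF b, symmetric])
    finally show "pairing \<xi> (f * g * h) = pairing \<xi> (f * (g * h))" .
  qed
  show "(0::'a ell1) \<noteq> 1"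
  proof
    assume "(0::'a ell1) = 1"
    then have "coeff (0::'a ell1) 0 = coeff (1::'a ell1) 0" by simp
    then show False by (simp add: coeff_one)
  qed
qed

end

instance ell1 :: (comm_monoid_add) real_normed_algebra_1
proof
  fix f g :: "'a ell1" and r :: real
  have scale: "r *\<^sub>R f * g = r *\<^sub>R (f * g)" for f g :: "'a ell1"
    by (rule ell1_eqI) (simp add: coeff_times scaleR_conv_of_real infsum_cmult_right' mult.assoc)
  show "r *\<^sub>R f * g = r *\<^sub>R (f * g)" by (rule scale)
  show "f * r *\<^sub>R g = r *\<^sub>R (f * g)"
    using scale[of g f] by (simp add: mult.commute)
  show "norm (1 :: 'a ell1) = 1"
  proof -
    have "(\<Sum>\<^sub>\<infinity>i. norm (coeff (1 :: 'a ell1) i)) = (\<Sum>\<^sub>\<infinity>i\<in>{0::'a}. 1)"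
      by (rule infsum_cong_neutral) (auto simp: coeff_one)
    then show ?thesis by (simp add: norm_ell1_eq)
  qed
  show "norm (f * g) \<le> norm f * norm g"
  proof -
    have s: "(\<lambda>p. norm (coeff f (fst p) * coeff g (snd p))) summable_on A" for A
      using summable_Times_coeff[of f g A] by (simp add: case_prod_unfold)
    have "norm (f * g) \<le> (\<Sum>\<^sub>\<infinity>c. \<Sum>\<^sub>\<infinity>p\<in>{p. fst p + snd p = c}. norm (coeff f (fst p) * coeff g (snd p)))"
      unfolding norm_ell1_eq
      by (intro infsum_mono coeff_summable_norm has_sum_fibres(1) s)
         (auto simp: coeff_times intro: norm_infsum_bound s)
    also have "\<dots> = (\<Sum>\<^sub>\<infinity>(a,b)\<in>UNIV\<times>UNIV. norm (coeff f a * coeff g b))"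
      using has_sum_fibres(2)[OF s] by (simp add: case_prod_unfold)
    also have "\<dots> = (\<Sum>\<^sub>\<infinity>a. \<Sum>\<^sub>\<infinity>b. norm (coeff f a * coeff g b))"
      using s by (intro infsum_Sigma'_banach[symmetric]) (simp add: case_prod_unfold)
    also have "\<dots> = norm f * norm g"
      by (simp add: norm_ell1_eq norm_mult infsum_cmult_right' infsum_cmult_left')
    finally show ?thesis .
  qed
qed

lift_definition single :: "'i \<Rightarrow> complex \<Rightarrow> 'i ell1" is "\<lambda>i c j. if j = i then c else 0"
  by (rule summable_on_cong_neutral[THEN iffD2, OF _ _ _ summable_on_finite[of "{_}"]]) auto

lemma coeff_single [simp]: "coeff (single i c) j = (if j = i then c else 0)"
  by transfer simp

lemma pairing_single: "pairing \<xi> (single i c) = c * \<xi> i"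
proof -
  have "(\<Sum>\<^sub>\<infinity>j. coeff (single i c) j * \<xi> j) = (\<Sum>\<^sub>\<infinity>j\<in>{i}. c * \<xi> i)"
    by (rule infsum_cong_neutral) auto
  then show ?thesis by (simp add: pairing_def)
qed

lemma norm_single: "norm (single i c) = norm c"
proof -
  have "(\<Sum>\<^sub>\<infinity>j. norm (coeff (single i c) j)) = (\<Sum>\<^sub>\<infinity>j\<in>{i}. norm c)"
    by (rule infsum_cong_neutral) auto
  then show ?thesis by (simp add: norm_ell1_eq)
qed

lemma pairing_mult:
  assumes b: "\<And>i. norm (\<xi> i) \<le> 1" and hom: "\<And>i j. \<xi> (i + j) = \<xi> i * \<xi> j"
  shows "pairing \<xi> (f * g) = pairing \<xi> f * pairing \<xi> g"
proof -
  have "pairing (\<lambda>b. \<xi> (a + b)) g = \<xi> a * pairing \<xi> g" for a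
    by (simp add: pairing_def hom infsum_cmult_right'[symmetric] mult_ac)
  then show ?thesis
    unfolding pairing_times_iterated[OF b]
    by (simp add: pairing_def infsum_cmult_left'[symmetric] mult_ac)
qed

lemma pairing_power:
  assumes b: "\<And>i. norm (\<xi> i) \<le> 1" and hom: "\<And>i j. \<xi> (i + j) = \<xi> i * \<xi> j" and "\<xi> 0 = 1"
  shows "pairing \<xi> (f ^ n) = pairing \<xi> f ^ n"
  by (induction n) (simp_all add: pairing_mult[OF b hom] pairing_one assms(3))

lemma pairing_exp:
  assumes b: "\<And>i. norm (\<xi> i) \<le> 1" and hom: "\<And>i j. \<xi> (i + j) = \<xi> i * \<xi> j" and "\<xi> 0 = 1"
  shows "pairing \<xi> (exp f) = exp (pairing \<xi> f)"
proof -
  interpret bounded_linear "pairing \<xi>" by (rule bounded_linear_pairing[OF b])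
  have "(\<lambda>n. pairing \<xi> (f ^ n /\<^sub>R fact n)) sums pairing \<xi> (exp f)"
    by (rule sums[OF exp_converges])
  moreover have "(\<lambda>n. pairing \<xi> (f ^ n /\<^sub>R fact n)) = (\<lambda>n. pairing \<xi> f ^ n /\<^sub>R fact n)"
    by (simp add: scaleR pairing_power[OF assms])
  ultimately show ?thesis using exp_converges[of "pairing \<xi> f"] sums_unique2 by metis
qed

section \<open>Series in a boundary point and a time\<close>

text \<open>Coefficientwise multipliers. Clipping the weights to \<open>[-1, 1]\<close> makes the map total and a
  contraction.\<close>

lift_definition mask :: "('i \<Rightarrow> real) \<Rightarrow> 'i ell1 \<Rightarrow> 'i ell1"
  is "\<lambda>w f i. max (-1) (min 1 (w i)) *\<^sub>R f i"
proof -
  fix w :: "'i \<Rightarrow> real" and f :: "'i \<Rightarrow> complex"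
  assume f: "(\<lambda>i. norm (f i)) summable_on UNIV"
  show "(\<lambda>i. norm (max (-1) (min 1 (w i)) *\<^sub>R f i)) summable_on UNIV"
    by (rule summable_on_comparison_test[OF f]) (auto intro!: mult_left_le_one_le)
qed

lemma coeff_mask: "\<bar>w i\<bar> \<le> 1 \<Longrightarrow> coeff (mask w f) i = w i *\<^sub>R coeff f i"
  by transfer (simp add: abs_le_iff max_def min_def)

lemma bounded_linear_mask: "bounded_linear (mask w)"
proof (rule bounded_linear_intro[where K = 1])
  show "mask w (f + g) = mask w f + mask w g" for f g
    by (rule ell1_eqI) (simp add: mask.rep_eq scaleR_add_right)
  show "mask w (r *\<^sub>R f) = r *\<^sub>R mask w f" for f r
    by (rule ell1_eqI) (simp add: mask.rep_eq)
  show "norm (mask w f) \<le> norm f * 1" for f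
    unfolding norm_ell1_eq mult_1_right
    by (intro infsum_mono coeff_summable_norm) (auto simp: mask.rep_eq intro!: mult_left_le_one_le)
qed

text \<open>The index \<open>(a, b, k)\<close> stands for the monomial of degree \<open>a\<close> in \<open>\<zeta>\<close>, \<open>b\<close> in \<open>cnj \<zeta>\<close> and
  \<open>k\<close> in the time \<open>t\<close>. On the unit circle \<open>cnj \<zeta> = 1 / \<zeta>\<close>, but the two are kept apart so that
  both may be given a radius of convergence larger than 1.\<close>

type_synonym index = "nat \<times> nat \<times> nat"

definition flip :: "index \<Rightarrow> index" where "flip = (\<lambda>(a, b, k). (b, a, k))"

lemma flip_simps [simp]: "flip (a, b, k) = (b, a, k)" "flip (flip i) = i" "flip (i + j) = flip i + flip j"
  by (auto simp: flip_def split: prod.splits)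

lemma bij_flip: "bij flip" by (rule o_bij[of flip]) auto

text \<open>Complex conjugation of the function on the circle that a series represents.\<close>

lift_definition star :: "index ell1 \<Rightarrow> index ell1" is "\<lambda>f i. cnj (f (flip i))"
  by (simp add: summable_on_reindex_bij_betw[OF bij_flip, of "\<lambda>i. norm (_ i)"])

lemma coeff_star: "coeff (star f) i = cnj (coeff f (flip i))" by transfer simp

lemma star_star [simp]: "star (star f) = f" by (rule ell1_eqI) (simp add: coeff_star)

lemma norm_star: "norm (star f) = norm f"
  unfolding norm_ell1_eq coeff_star complex_mod_cnj
  by (rule infsum_reindex_bij_betw[OF bij_flip, of "\<lambda>i. norm (coeff f i)"])

lemma star_add: "star (f + g) = star f + star g" by (rule ell1_eqI) (simp add: coeff_star)
lemma star_diff: "star (f - g) = star f - star g" by (rule ell1_eqI) (simp add: coeff_star)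
lemma star_scaleR: "star (r *\<^sub>R f) = r *\<^sub>R star f" by (rule ell1_eqI) (simp add: coeff_star)

lemma bounded_linear_star: "bounded_linear star"
  by (rule bounded_linear_intro[where K = 1]) (auto simp: star_add star_scaleR norm_star)

lemma star_mult: "star (f * g) = star f * star g"
proof (rule ell1_eqI)
  fix c
  show "coeff (star (f * g)) c = coeff (star f * star g) c"
    unfolding coeff_star coeff_times infsum_cnj[symmetric]
    by (rule infsum_reindex_bij_witness[where i = "map_prod flip flip" and j = "map_prod flip flip"])
       (auto simp: coeff_star flip_simps(3)[symmetric] simp del: flip_simps(3))
qed

section \<open>Nonlinear maps on Banach algebras and their fixed points\<close>

lemma norm_power_diff_le:
  fixes p q :: "'a::{real_normed_algebra_1,comm_ring_1}"
  assumes "norm p \<le> m" "norm q \<le> m"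
  shows "norm (p ^ Suc n - q ^ Suc n) \<le> (real n + 1) * m ^ n * norm (p - q)"
proof (induction n)
  case (Suc n)
  have m: "0 \<le> m" using assms norm_ge_zero order_trans by blast
  have "p ^ Suc (Suc n) - q ^ Suc (Suc n) = p * (p ^ Suc n - q ^ Suc n) + (p - q) * q ^ Suc n"
    by (simp add: algebra_simps)
  also have "norm \<dots> \<le> norm (p * (p ^ Suc n - q ^ Suc n)) + norm ((p - q) * q ^ Suc n)"
    by (rule norm_triangle_ineq)
  also have "\<dots> \<le> norm p * norm (p ^ Suc n - q ^ Suc n) + norm (p - q) * norm (q ^ Suc n)"
    by (intro add_mono norm_mult_ineq)
  also have "\<dots> \<le> m * ((real n + 1) * m ^ n * norm (p - q)) + norm (p - q) * m ^ Suc n"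
    by (intro add_mono mult_mono Suc.IH assms mult_left_mono order_trans[OF norm_power_ineq] power_mono)
       (use m in auto)
  also have "\<dots> = (real (Suc n) + 1) * m ^ Suc n * norm (p - q)" by (simp add: algebra_simps)
  finally show ?case .
qed simp

lemma suminf_norm_le_dominated:
  fixes f :: "nat \<Rightarrow> 'a::banach"
  assumes "\<And>n. norm (f n) \<le> g n" "summable g"
  shows "norm (suminf f) \<le> suminf g"
proof -
  have s: "summable (\<lambda>n. norm (f n))" by (rule summable_comparison_test'[OF assms(2)]) (simp add: assms(1))
  show ?thesis
    by (rule order_trans[OF summable_norm[OF s] suminf_le[OF assms(1) s assms(2)]])
qed

lemma exp_remainder_le:
  fixes p q :: "'a::{real_normed_algebra_1,comm_ring_1,banach}"
  shows "norm (exp p - exp q - (p - q)) \<le> (norm p + norm q) * norm (p - q) * exp (norm p + norm q)"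
proof -
  define m where "m = norm p + norm q"
  have m: "0 \<le> m" "norm p \<le> m" "norm q \<le> m" by (auto simp: m_def)
  have s: "(\<lambda>n. (p ^ n - q ^ n) /\<^sub>R fact n) sums (exp p - exp q)"
    using sums_diff[OF exp_converges[of p] exp_converges[of q]] by (simp add: scaleR_diff_right)
  have s2: "(\<lambda>n. (p ^ Suc (Suc n) - q ^ Suc (Suc n)) /\<^sub>R fact (Suc (Suc n))) sums (exp p - exp q - (p - q))"
    using sums_split_initial_segment[OF s, of 2] by (simp add: numeral_2_eq_2)
  have e: "(\<lambda>n. m ^ Suc n / fact (Suc n) * norm (p - q)) sums ((exp m - 1) * norm (p - q))"
    using sums_mult2[OF sums_split_initial_segment[OF exp_converges[of m], of 1], of "norm (p - q)"]
    by (simp add: divide_inverse mult_ac)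
  have "norm (exp p - exp q - (p - q)) \<le> (exp m - 1) * norm (p - q)"
    unfolding sums_unique[OF s2] sums_unique[OF e]
  proof (rule suminf_norm_le_dominated)
    fix n
    have "norm ((p ^ Suc (Suc n) - q ^ Suc (Suc n)) /\<^sub>R fact (Suc (Suc n)))
        \<le> ((real (Suc n) + 1) * m ^ Suc n * norm (p - q)) / fact (Suc (Suc n))"
      using norm_power_diff_le[OF m(2,3), of "Suc n"] by (simp add: divide_simps mult_ac)
    also have "\<dots> = m ^ Suc n / fact (Suc n) * norm (p - q)"
      by (simp add: divide_simps)
    finally show "norm ((p ^ Suc (Suc n) - q ^ Suc (Suc n)) /\<^sub>R fact (Suc (Suc n)))
        \<le> m ^ Suc n / fact (Suc n) * norm (p - q)" .
  qed (use e sums_summable in blast)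
  also have "exp m - 1 \<le> m * exp m"
    using exp_ge_add_one_self[of "- m"] mult_right_mono[of "1 - m" "exp (- m)" "exp m"]
    by (simp add: exp_minus algebra_simps)
  finally show ?thesis unfolding m_def[symmetric] by (simp add: mult_right_mono mult_ac)
qed

text \<open>Differentiability at the origin with a remainder that is Lipschitz with small constant. This is
  what a contraction argument needs, and unlike continuous differentiability it is inherited
  by sums, products, exponentials and power series without any differentiation at other points.\<close>

definition sdiff :: "('a::real_normed_vector \<Rightarrow> 'b::real_normed_vector) \<Rightarrow> ('a \<Rightarrow> 'b) \<Rightarrow> bool" where
  "sdiff \<Phi> L \<longleftrightarrow> bounded_linear L \<and> (\<exists>C r. 0 < r \<and> (\<forall>p q. norm p \<le> r \<longrightarrow> norm q \<le> r \<longrightarrow>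
     norm (\<Phi> p - \<Phi> q - L (p - q)) \<le> C * (norm p + norm q) * norm (p - q)))"

lemma sdiffI:
  assumes "bounded_linear L" "0 < r"
    "\<And>p q. norm p \<le> r \<Longrightarrow> norm q \<le> r \<Longrightarrow> norm (\<Phi> p - \<Phi> q - L (p - q)) \<le> C * (norm p + norm q) * norm (p - q)"
  shows "sdiff \<Phi> L"
  using assms unfolding sdiff_def by blast

lemma sdiffE:
  fixes \<Phi> :: "'a::real_normed_vector \<Rightarrow> 'b::real_normed_vector"
  assumes "sdiff \<Phi> L"
  obtains C r where "bounded_linear L" "0 \<le> C" "0 < r"
    "\<And>p q. norm p \<le> r \<Longrightarrow> norm q \<le> r \<Longrightarrow> norm (\<Phi> p - \<Phi> q - L (p - q)) \<le> C * (norm p + norm q) * norm (p - q)"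
proof -
  obtain C r where 1: "bounded_linear L" "0 < r"
    and 2: "\<And>p q. norm p \<le> r \<Longrightarrow> norm q \<le> r \<Longrightarrow> norm (\<Phi> p - \<Phi> q - L (p - q)) \<le> C * (norm p + norm q) * norm (p - q)"
    using assms unfolding sdiff_def by blast
  show thesis
  proof (rule that[of "\<bar>C\<bar>" r])
    fix p q :: 'a assume "norm p \<le> r" "norm q \<le> r"
    then have "norm (\<Phi> p - \<Phi> q - L (p - q)) \<le> C * ((norm p + norm q) * norm (p - q))"
      using 2[of p q] by (simp add: mult.assoc)
    also have "\<dots> \<le> \<bar>C\<bar> * ((norm p + norm q) * norm (p - q))"
      by (intro mult_right_mono) auto
    finally show "norm (\<Phi> p - \<Phi> q - L (p - q)) \<le> \<bar>C\<bar> * (norm p + norm q) * norm (p - q)"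
      by (simp add: mult.assoc)
  qed (use 1 in auto)
qed

lemma sdiff_linear: "bounded_linear L \<Longrightarrow> sdiff L L"
  by (rule sdiffI[where r = 1 and C = 0]) (auto simp: linear_simps)

lemma sdiff_lipschitz:
  fixes \<Phi> :: "'a::real_normed_vector \<Rightarrow> 'b::real_normed_vector"
  assumes "sdiff \<Phi> L"
  obtains K r where "0 \<le> K" "0 < r"
    "\<And>p q. norm p \<le> r \<Longrightarrow> norm q \<le> r \<Longrightarrow> norm (\<Phi> p - \<Phi> q) \<le> K * norm (p - q)"
proof -
  obtain C r where L: "bounded_linear L" and C: "0 \<le> C" "0 < r"
    and e: "\<And>p q. norm p \<le> r \<Longrightarrow> norm q \<le> r \<Longrightarrow> norm (\<Phi> p - \<Phi> q - L (p - q)) \<le> C * (norm p + norm q) * norm (p - q)"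
    using sdiffE[OF assms] by blast
  obtain M where M: "0 \<le> M" "\<And>x. norm (L x) \<le> norm x * M"
    using bounded_linear.nonneg_bounded[OF L] by blast
  show ?thesis
  proof (rule that[of "C * (r + r) + M" r])
    fix p q :: 'a assume pq: "norm p \<le> r" "norm q \<le> r"
    have "norm (\<Phi> p - \<Phi> q) \<le> norm (\<Phi> p - \<Phi> q - L (p - q)) + norm (L (p - q))"
      by (rule norm_triangle_sub[of "\<Phi> p - \<Phi> q" "L (p - q)", unfolded add.commute[of "norm (L _)"]])
    also have "\<dots> \<le> C * (r + r) * norm (p - q) + norm (p - q) * M"
      by (intro add_mono M order_trans[OF e[OF pq]] mult_right_mono mult_left_mono C pq) auto
    finally show "norm (\<Phi> p - \<Phi> q) \<le> (C * (r + r) + M) * norm (p - q)" by (simp add: algebra_simps)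
  qed (use C M in auto)
qed

lemma sdiff_post:
  fixes T :: "'b::real_normed_vector \<Rightarrow> 'c::real_normed_vector" and \<Phi> :: "'a::real_normed_vector \<Rightarrow> 'b"
  assumes T: "bounded_linear T" and \<Phi>: "sdiff \<Phi> L"
  shows "sdiff (\<lambda>p. T (\<Phi> p)) (\<lambda>p. T (L p))"
proof -
  obtain C r where L: "bounded_linear L" and C: "0 \<le> C" "0 < r"
    and e: "\<And>p q. norm p \<le> r \<Longrightarrow> norm q \<le> r \<Longrightarrow> norm (\<Phi> p - \<Phi> q - L (p - q)) \<le> C * (norm p + norm q) * norm (p - q)"
    using sdiffE[OF \<Phi>] by blast
  obtain M where M: "0 \<le> M" "\<And>x. norm (T x) \<le> norm x * M"
    using bounded_linear.nonneg_bounded[OF T] by blast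
  show ?thesis
  proof (rule sdiffI[where C = "C * M", OF bounded_linear_compose[OF T L] C(2)])
    fix p q :: 'a assume pq: "norm p \<le> r" "norm q \<le> r"
    have "norm (T (\<Phi> p) - T (\<Phi> q) - T (L (p - q))) = norm (T (\<Phi> p - \<Phi> q - L (p - q)))"
      by (simp add: linear_simps(2)[OF T])
    also have "\<dots> \<le> C * (norm p + norm q) * norm (p - q) * M"
      by (rule order_trans[OF M(2) mult_right_mono[OF e[OF pq] M(1)]])
    finally show "norm (T (\<Phi> p) - T (\<Phi> q) - T (L (p - q))) \<le> C * M * (norm p + norm q) * norm (p - q)"
      by (simp add: mult_ac)
  qed
qed

lemma sdiff_pre:
  fixes T :: "'a::real_normed_vector \<Rightarrow> 'b::real_normed_vector" and \<Phi> :: "'b \<Rightarrow> 'c::real_normed_vector"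
  assumes T: "bounded_linear T" and \<Phi>: "sdiff \<Phi> L"
  shows "sdiff (\<lambda>p. \<Phi> (T p)) (\<lambda>p. L (T p))"
proof -
  obtain C r where L: "bounded_linear L" and C: "0 \<le> C" "0 < r"
    and e: "\<And>p q. norm p \<le> r \<Longrightarrow> norm q \<le> r \<Longrightarrow> norm (\<Phi> p - \<Phi> q - L (p - q)) \<le> C * (norm p + norm q) * norm (p - q)"
    using sdiffE[OF \<Phi>] by blast
  obtain M where M: "0 < M" "\<And>x. norm (T x) \<le> norm x * M"
    using bounded_linear.pos_bounded[OF T] by blast
  show ?thesis
  proof (rule sdiffI[where C = "C * M * M" and r = "r / M", OF bounded_linear_compose[OF L T]])
    fix p q :: 'a assume pq: "norm p \<le> r / M" "norm q \<le> r / M"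
    have "norm (T p) \<le> r" "norm (T q) \<le> r"
      using order_trans[OF M(2)] pq M(1) by (auto simp: pos_le_divide_eq)
    then have "norm (\<Phi> (T p) - \<Phi> (T q) - L (T (p - q))) \<le> C * (norm (T p) + norm (T q)) * norm (T (p - q))"
      using e[of "T p" "T q"] by (simp add: linear_simps(2)[OF T])
    also have "\<dots> \<le> C * (norm p * M + norm q * M) * (norm (p - q) * M)"
      using C M(1) by (intro mult_mono mult_left_mono add_mono M(2)) auto
    finally show "norm (\<Phi> (T p) - \<Phi> (T q) - L (T (p - q))) \<le> C * M * M * (norm p + norm q) * norm (p - q)"
      by (simp add: algebra_simps)
  qed (use M C in auto)
qed

lemma sdiff_add:
  fixes \<Phi> \<Psi> :: "'a::real_normed_vector \<Rightarrow> 'b::real_normed_vector"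
  assumes "sdiff \<Phi> L" "sdiff \<Psi> M"
  shows "sdiff (\<lambda>p. \<Phi> p + \<Psi> p) (\<lambda>p. L p + M p)"
proof -
  obtain C r where L: "bounded_linear L" and C: "0 \<le> C" "0 < r"
    and e: "\<And>p q. norm p \<le> r \<Longrightarrow> norm q \<le> r \<Longrightarrow> norm (\<Phi> p - \<Phi> q - L (p - q)) \<le> C * (norm p + norm q) * norm (p - q)"
    using sdiffE[OF assms(1)] by blast
  obtain C' r' where M: "bounded_linear M" and C': "0 \<le> C'" "0 < r'"
    and e': "\<And>p q. norm p \<le> r' \<Longrightarrow> norm q \<le> r' \<Longrightarrow> norm (\<Psi> p - \<Psi> q - M (p - q)) \<le> C' * (norm p + norm q) * norm (p - q)"
    using sdiffE[OF assms(2)] by blast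
  show ?thesis
  proof (rule sdiffI[where C = "C + C'" and r = "min r r'", OF bounded_linear_add[OF L M]])
    fix p q :: 'a assume "norm p \<le> min r r'" "norm q \<le> min r r'"
    then have pq: "norm p \<le> r" "norm q \<le> r" "norm p \<le> r'" "norm q \<le> r'" by auto
    have "norm (\<Phi> p + \<Psi> p - (\<Phi> q + \<Psi> q) - (L (p - q) + M (p - q)))
        = norm ((\<Phi> p - \<Phi> q - L (p - q)) + (\<Psi> p - \<Psi> q - M (p - q)))" by (simp add: algebra_simps)
    also have "\<dots> \<le> C * (norm p + norm q) * norm (p - q) + C' * (norm p + norm q) * norm (p - q)"
      by (rule order_trans[OF norm_triangle_ineq add_mono[OF e[OF pq(1,2)] e'[OF pq(3,4)]]])
    finally show "norm (\<Phi> p + \<Psi> p - (\<Phi> q + \<Psi> q) - (L (p - q) + M (p - q))) \<le> (C + C') * (norm p + norm q) * norm (p - q)"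
      by (simp add: algebra_simps)
  qed (use C C' in auto)
qed

lemma sdiff_diff:
  assumes "sdiff \<Phi> L" "sdiff \<Psi> M"
  shows "sdiff (\<lambda>p. \<Phi> p - \<Psi> p) (\<lambda>p. L p - M p)"
  using sdiff_add[OF assms(1) sdiff_post[OF bounded_linear_minus[OF bounded_linear_ident] assms(2)]] by simp

lemma sdiff_mult:
  fixes \<Phi> \<Psi> :: "'a::real_normed_vector \<Rightarrow> 'b::{real_normed_algebra_1,comm_ring_1}"
  assumes "sdiff \<Phi> L" "sdiff \<Psi> M"
  shows "sdiff (\<lambda>p. \<Phi> p * \<Psi> p) (\<lambda>p. \<Phi> 0 * M p + \<Psi> 0 * L p)"
proof -
  obtain C r where L: "bounded_linear L" and C: "0 \<le> C" "0 < r"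
    and e: "\<And>p q. norm p \<le> r \<Longrightarrow> norm q \<le> r \<Longrightarrow> norm (\<Phi> p - \<Phi> q - L (p - q)) \<le> C * (norm p + norm q) * norm (p - q)"
    using sdiffE[OF assms(1)] by blast
  obtain C' r' where M: "bounded_linear M" and C': "0 \<le> C'" "0 < r'"
    and e': "\<And>p q. norm p \<le> r' \<Longrightarrow> norm q \<le> r' \<Longrightarrow> norm (\<Psi> p - \<Psi> q - M (p - q)) \<le> C' * (norm p + norm q) * norm (p - q)"
    using sdiffE[OF assms(2)] by blast
  obtain K s where K: "0 \<le> K" "0 < s" "\<And>p q. norm p \<le> s \<Longrightarrow> norm q \<le> s \<Longrightarrow> norm (\<Phi> p - \<Phi> q) \<le> K * norm (p - q)"
    using sdiff_lipschitz[OF assms(1)] by blast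
  obtain K' s' where K': "0 \<le> K'" "0 < s'" "\<And>p q. norm p \<le> s' \<Longrightarrow> norm q \<le> s' \<Longrightarrow> norm (\<Psi> p - \<Psi> q) \<le> K' * norm (p - q)"
    using sdiff_lipschitz[OF assms(2)] by blast
  obtain B where B: "0 \<le> B" "\<And>x. norm (L x) \<le> norm x * B" using bounded_linear.nonneg_bounded[OF L] by blast
  obtain B' where B': "0 \<le> B'" "\<And>x. norm (M x) \<le> norm x * B'" using bounded_linear.nonneg_bounded[OF M] by blast
  define R where "R = min (min r r') (min s s')"
  define D where "D = norm (\<Phi> 0) + K * R"
  define D' where "D' = norm (\<Psi> 0) + K' * R"
  have R: "0 < R" "R \<le> r" "R \<le> r'" "R \<le> s" "R \<le> s'" using C C' K K' by (auto simp: R_def)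
  show ?thesis
  proof (rule sdiffI[where C = "C * D' + D * C' + K' * B + K * B'", OF _ R(1)])
    show "bounded_linear (\<lambda>p. \<Phi> 0 * M p + \<Psi> 0 * L p)"
      by (intro bounded_linear_add bounded_linear_const_mult L M)
    fix p q :: 'a assume pq: "norm p \<le> R" "norm q \<le> R"
    then have 1: "norm p \<le> r" "norm q \<le> r" "norm p \<le> r'" "norm q \<le> r'" "norm p \<le> s" "norm q \<le> s" "norm p \<le> s'" "norm q \<le> s'"
      using R by auto
    have 2: "norm (\<Phi> q - \<Phi> 0) \<le> K * norm q" "norm (\<Psi> p - \<Psi> 0) \<le> K' * norm p"
      using K(3)[of q 0] K'(3)[of p 0] 1 K K' by auto
    have 3: "norm (\<Phi> q) \<le> D" "norm (\<Psi> p) \<le> D'"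
      using norm_triangle_sub[of "\<Phi> q" "\<Phi> 0"] norm_triangle_sub[of "\<Psi> p" "\<Psi> 0"] 2
        mult_left_mono[OF pq(2) K(1)] mult_left_mono[OF pq(1) K'(1)] by (auto simp: D_def D'_def)
    have "\<Phi> p * \<Psi> p - \<Phi> q * \<Psi> q - (\<Phi> 0 * M (p - q) + \<Psi> 0 * L (p - q))
        = (\<Phi> p - \<Phi> q - L (p - q)) * \<Psi> p + \<Phi> q * (\<Psi> p - \<Psi> q - M (p - q))
          + (\<Psi> p - \<Psi> 0) * L (p - q) + (\<Phi> q - \<Phi> 0) * M (p - q)" by (simp add: algebra_simps)
    also have "norm \<dots> \<le> norm (\<Phi> p - \<Phi> q - L (p - q)) * norm (\<Psi> p) + norm (\<Phi> q) * norm (\<Psi> p - \<Psi> q - M (p - q))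
          + norm (\<Psi> p - \<Psi> 0) * norm (L (p - q)) + norm (\<Phi> q - \<Phi> 0) * norm (M (p - q))"
      by (intro order_trans[OF norm_triangle_ineq] add_mono norm_mult_ineq)
    also have "\<dots> \<le> (C * (norm p + norm q) * norm (p - q)) * D' + D * (C' * (norm p + norm q) * norm (p - q))
          + (K' * (norm p + norm q)) * (norm (p - q) * B) + (K * (norm p + norm q)) * (norm (p - q) * B')"
    proof (intro add_mono mult_mono e e' 1 B B' 3)
      show "norm (\<Psi> p - \<Psi> 0) \<le> K' * (norm p + norm q)" "norm (\<Phi> q - \<Phi> 0) \<le> K * (norm p + norm q)"
        using 2 mult_nonneg_nonneg[OF K(1), of "norm p"] mult_nonneg_nonneg[OF K'(1), of "norm q"]
        by (simp_all add: distrib_left)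
      show "0 \<le> D" using K R by (simp add: D_def)
    qed (use C C' K K' in \<open>auto intro!: mult_nonneg_nonneg add_nonneg_nonneg\<close>)
    also have "\<dots> = (C * D' + D * C' + K' * B + K * B') * (norm p + norm q) * norm (p - q)"
      by (simp add: algebra_simps)
    finally show "norm (\<Phi> p * \<Psi> p - \<Phi> q * \<Psi> q - (\<Phi> 0 * M (p - q) + \<Psi> 0 * L (p - q)))
        \<le> (C * D' + D * C' + K' * B + K * B') * (norm p + norm q) * norm (p - q)" .
  qed
qed

lemma exp_add_comm:
  fixes p q :: "'a::{real_normed_algebra_1,comm_ring_1,banach}"
  shows "exp (p + q) = exp p * exp q"
  by (rule exp_add_commuting) (rule mult.commute)

lemma sdiff_exp:
  fixes \<Phi> :: "'a::real_normed_vector \<Rightarrow> 'b::{real_normed_algebra_1,comm_ring_1,banach}"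
  assumes "sdiff \<Phi> L"
  shows "sdiff (\<lambda>p. exp (\<Phi> p)) (\<lambda>p. exp (\<Phi> 0) * L p)"
proof -
  obtain C r where L: "bounded_linear L" and C: "0 \<le> C" "0 < r"
    and e: "\<And>p q. norm p \<le> r \<Longrightarrow> norm q \<le> r \<Longrightarrow> norm (\<Phi> p - \<Phi> q - L (p - q)) \<le> C * (norm p + norm q) * norm (p - q)"
    using sdiffE[OF assms] by blast
  obtain K s where K: "0 \<le> K" "0 < s" "\<And>p q. norm p \<le> s \<Longrightarrow> norm q \<le> s \<Longrightarrow> norm (\<Phi> p - \<Phi> q) \<le> K * norm (p - q)"
    using sdiff_lipschitz[OF assms] by blast
  define R where "R = min r s"
  have R: "0 < R" "R \<le> r" "R \<le> s" using C K by (auto simp: R_def)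
  have main: "sdiff (\<lambda>p. exp (\<Phi> p - \<Phi> 0)) L"
  proof (rule sdiffI[where C = "K * K * exp (K * (R + R)) + C", OF L R(1)])
    fix p q :: 'a assume pq: "norm p \<le> R" "norm q \<le> R"
    let ?P = "\<Phi> p - \<Phi> 0" and ?Q = "\<Phi> q - \<Phi> 0"
    have P: "norm ?P \<le> K * norm p" "norm ?Q \<le> K * norm q" "norm (\<Phi> p - \<Phi> q) \<le> K * norm (p - q)"
      using K(3)[of p 0] K(3)[of q 0] K(3)[of p q] pq R K by auto
    have PR: "norm ?P + norm ?Q \<le> K * (R + R)"
      using P(1,2) mult_left_mono[OF pq(1) K(1)] mult_left_mono[OF pq(2) K(1)] by (simp add: distrib_left)
    have "exp ?P - exp ?Q - L (p - q) = (exp ?P - exp ?Q - (?P - ?Q)) + (\<Phi> p - \<Phi> q - L (p - q))" by simp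
    also have "norm \<dots> \<le> norm (exp ?P - exp ?Q - (?P - ?Q)) + norm (\<Phi> p - \<Phi> q - L (p - q))"
      by (rule norm_triangle_ineq)
    also have "\<dots> \<le> (K * norm p + K * norm q) * (K * norm (p - q)) * exp (K * (R + R)) + C * (norm p + norm q) * norm (p - q)"
    proof (intro add_mono order_trans[OF exp_remainder_le] mult_mono e)
      show "norm (?P - ?Q) \<le> K * norm (p - q)" using P(3) by simp
      show "exp (norm ?P + norm ?Q) \<le> exp (K * (R + R))" using PR by simp
    qed (use P pq R K in auto)
    also have "\<dots> = (K * K * exp (K * (R + R)) + C) * (norm p + norm q) * norm (p - q)"
      by (simp add: algebra_simps)
    finally show "norm (exp ?P - exp ?Q - L (p - q)) \<le> (K * K * exp (K * (R + R)) + C) * (norm p + norm q) * norm (p - q)" .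
  qed
  have "(\<lambda>p. exp (\<Phi> 0) * exp (\<Phi> p - \<Phi> 0)) = (\<lambda>p. exp (\<Phi> p))"
    by (subst exp_add_comm[symmetric]) simp
  then show ?thesis
    using sdiff_post[OF bounded_linear_mult_right main, of "exp (\<Phi> 0)"] by (simp only:)
qed

lemma power2_le_exp:
  fixes x r :: real
  assumes "0 \<le> x" "0 < r"
  shows "x\<^sup>2 \<le> 2 / r\<^sup>2 * exp (x * r)"
proof -
  have "(x * r)\<^sup>2 / 2 \<le> exp (x * r)"
    using exp_lower_Taylor_quadratic[of "x * r"] mult_nonneg_nonneg[of x r] assms by linarith
  then show ?thesis using assms by (simp add: power_mult_distrib field_simps)
qed

text \<open>If \<open>u n\<close> are the homogeneous parts of a holomorphic function \<open>f\<close>, the series is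
  \<open>f (z * exp p)\<close>; its derivative at \<open>p = 0\<close> is multiplication by \<open>z * deriv f z\<close>.\<close>

lemma sdiff_exp_series:
  fixes u :: "nat \<Rightarrow> 'a::{real_normed_algebra_1,comm_ring_1,banach}"
  assumes r: "0 < r" and s: "summable (\<lambda>n. norm (u n) * exp (3 * r * real n))"
  shows "\<And>p. norm p \<le> r \<Longrightarrow> summable (\<lambda>n. u n * exp (real n *\<^sub>R p))"
    and "summable (\<lambda>n. real n *\<^sub>R u n)"
    and "sdiff (\<lambda>p. \<Sum>n. u n * exp (real n *\<^sub>R p)) (\<lambda>p. (\<Sum>n. real n *\<^sub>R u n) * p)"
proof -
  show sp: "summable (\<lambda>n. u n * exp (real n *\<^sub>R p))" if p: "norm p \<le> r" for p
  proof (rule summable_comparison_test'[OF s, where N = 0])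
    fix n :: nat
    have "norm (exp (real n *\<^sub>R p)) \<le> exp (norm (real n *\<^sub>R p))" by (rule norm_exp)
    also have "norm (real n *\<^sub>R p) = real n * norm p" by simp
    also have "real n * norm p \<le> real n * (3 * r)" using p r by (intro mult_left_mono) auto
    also have "\<dots> = 3 * r * real n" by simp
    finally have "norm (exp (real n *\<^sub>R p)) \<le> exp (3 * r * real n)" by simp
    then show "norm (u n * exp (real n *\<^sub>R p)) \<le> norm (u n) * exp (3 * r * real n)"
      by (intro order_trans[OF norm_mult_ineq] mult_left_mono) auto
  qed
  have le_exp: "real n \<le> 1 / r * exp (3 * r * real n)" for n
  proof -
    have "real n * r \<le> exp (real n * r)" using exp_ge_add_one_self[of "real n * r"] by linarith
    also have "\<dots> \<le> exp (3 * r * real n)" using r by (simp add: mult_ac)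
    finally show ?thesis using r by (simp add: field_simps)
  qed
  show s1: "summable (\<lambda>n. real n *\<^sub>R u n)"
  proof (rule summable_comparison_test'[OF summable_mult[OF s, of "1 / r"], where N = 0])
    fix n show "norm (real n *\<^sub>R u n) \<le> 1 / r * (norm (u n) * exp (3 * r * real n))"
      using mult_right_mono[OF le_exp, of "norm (u n)"] by (simp add: mult_ac)
  qed
  define W where "W = (\<Sum>n. 2 / r\<^sup>2 * (norm (u n) * exp (3 * r * real n)))"
  show "sdiff (\<lambda>p. \<Sum>n. u n * exp (real n *\<^sub>R p)) (\<lambda>p. (\<Sum>n. real n *\<^sub>R u n) * p)"
  proof (rule sdiffI[where C = W, OF bounded_linear_mult_right r])
    fix p q :: 'a assume pq: "norm p \<le> r" "norm q \<le> r"
    have s2: "summable (\<lambda>n. real n *\<^sub>R u n * (p - q))" by (rule summable_mult2[OF s1])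
    have eq: "(\<Sum>n. u n * exp (real n *\<^sub>R p)) - (\<Sum>n. u n * exp (real n *\<^sub>R q)) - (\<Sum>n. real n *\<^sub>R u n) * (p - q)
      = (\<Sum>n. u n * exp (real n *\<^sub>R p) - u n * exp (real n *\<^sub>R q) - real n *\<^sub>R u n * (p - q))"
      using sp pq s1 s2 by (simp add: suminf_diff summable_diff suminf_mult2)
    have "norm \<dots> \<le> (\<Sum>n. 2 / r\<^sup>2 * (norm (u n) * exp (3 * r * real n)) * ((norm p + norm q) * norm (p - q)))"
    proof (rule suminf_norm_le_dominated)
      fix n
      have "u n * exp (real n *\<^sub>R p) - u n * exp (real n *\<^sub>R q) - real n *\<^sub>R u n * (p - q)
        = u n * (exp (real n *\<^sub>R p) - exp (real n *\<^sub>R q) - (real n *\<^sub>R p - real n *\<^sub>R q))"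
        by (simp add: algebra_simps)
      also have "norm \<dots> \<le> norm (u n) * ((norm (real n *\<^sub>R p) + norm (real n *\<^sub>R q)) * norm (real n *\<^sub>R p - real n *\<^sub>R q)
            * exp (norm (real n *\<^sub>R p) + norm (real n *\<^sub>R q)))"
        by (rule order_trans[OF norm_mult_ineq mult_left_mono[OF exp_remainder_le norm_ge_zero]])
      also have "\<dots> = norm (u n) * ((real n)\<^sup>2 * exp (real n * (norm p + norm q)) * ((norm p + norm q) * norm (p - q)))"
        by (simp add: scaleR_diff_right[symmetric] power2_eq_square algebra_simps del: scaleR_diff_right)
      also have "\<dots> \<le> norm (u n) * (2 / r\<^sup>2 * exp (real n * r) * exp (real n * (r + r)) * ((norm p + norm q) * norm (p - q)))"
        using pq r by (intro mult_left_mono mult_right_mono mult_mono power2_le_exp) (auto intro!: mult_left_mono add_mono)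
      also have "\<dots> = 2 / r\<^sup>2 * (norm (u n) * exp (3 * r * real n)) * ((norm p + norm q) * norm (p - q))"
        by (simp add: exp_add[symmetric] algebra_simps)
      finally show "norm (u n * exp (real n *\<^sub>R p) - u n * exp (real n *\<^sub>R q) - real n *\<^sub>R u n * (p - q))
        \<le> 2 / r\<^sup>2 * (norm (u n) * exp (3 * r * real n)) * ((norm p + norm q) * norm (p - q))" .
    qed (intro summable_mult2 summable_mult s)
    also have "\<dots> = W * (norm p + norm q) * norm (p - q)"
      unfolding W_def using suminf_mult2[OF summable_mult[OF s, of "2 / r\<^sup>2"], of "(norm p + norm q) * norm (p - q)"]
      by (simp only: mult.assoc)
    finally show "norm ((\<Sum>n. u n * exp (real n *\<^sub>R p)) - (\<Sum>n. u n * exp (real n *\<^sub>R q)) - (\<Sum>n. real n *\<^sub>R u n) * (p - q))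
        \<le> W * (norm p + norm q) * norm (p - q)" unfolding eq .
  qed
qed

text \<open>A map with zero derivative at the origin is a contraction on a small ball, so \<open>\<rho> = g - Z \<rho>\<close> is
  solvable for small \<open>g\<close>. The closed subgroup \<open>V\<close> records a linear constraint that the iteration
  preserves.\<close>

lemma sdiff_fixed_point:
  fixes Z :: "'a::banach \<Rightarrow> 'a"
  assumes Z: "sdiff Z (\<lambda>_. 0)" "Z 0 = 0" and V: "closed V" "0 \<in> V" "\<And>p q. p \<in> V \<Longrightarrow> q \<in> V \<Longrightarrow> p - q \<in> V"
    and \<delta>: "0 < \<delta>" and ZV: "\<And>p. p \<in> V \<Longrightarrow> norm p \<le> \<delta> \<Longrightarrow> Z p \<in> V"
  obtains \<eta> where "0 < \<eta>" "\<And>g. g \<in> V \<Longrightarrow> norm g \<le> \<eta> \<Longrightarrow> \<exists>\<rho>\<in>V. norm \<rho> \<le> \<delta> \<and> \<rho> = g - Z \<rho>"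
proof -
  obtain C r where C: "0 \<le> C" "0 < r"
    and e: "\<And>p q. norm p \<le> r \<Longrightarrow> norm q \<le> r \<Longrightarrow> norm (Z p - Z q) \<le> C * (norm p + norm q) * norm (p - q)"
  proof (rule sdiffE[OF Z(1)])
    fix C r assume "0 \<le> C" "0 < r"
      "\<And>p q. norm p \<le> r \<Longrightarrow> norm q \<le> r \<Longrightarrow> norm (Z p - Z q - 0) \<le> C * (norm p + norm q) * norm (p - q)"
    then show thesis by (intro that[of C r]) simp_all
  qed
  define s where "s = min (min \<delta> r) (1 / (4 * (C + 1)))"
  have s: "0 < s" "s \<le> \<delta>" "s \<le> r" "s \<le> 1 / (4 * (C + 1))" using C \<delta> by (auto simp: s_def)
  have sC: "C * (s + s) \<le> 1 / 2"
  proof -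
    have "C * (s + s) \<le> (C + 1) * (2 * (1 / (4 * (C + 1))))" using s C by (intro mult_mono) auto
    also have "\<dots> = 1 / 2" using C by simp
    finally show ?thesis .
  qed
  have lip: "norm (Z p - Z q) \<le> 1 / 2 * norm (p - q)" if "norm p \<le> s" "norm q \<le> s" for p q
  proof -
    have "norm (Z p - Z q) \<le> C * (norm p + norm q) * norm (p - q)" using e that s by auto
    also have "\<dots> \<le> C * (s + s) * norm (p - q)" using that C by (intro mult_right_mono mult_left_mono) auto
    also have "\<dots> \<le> 1 / 2 * norm (p - q)" by (intro mult_right_mono sC) auto
    finally show ?thesis .
  qed
  show ?thesis
  proof (rule that[of "s / 2"])
    fix g assume g: "g \<in> V" "norm g \<le> s / 2"
    have "\<exists>!\<rho>. \<rho> \<in> cball 0 s \<inter> V \<and> g - Z \<rho> = \<rho>"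
    proof (rule Banach_fix[where c = "1 / 2"])
      show "Topological_Spaces.complete (cball 0 s \<inter> V)" using V by (intro closed_Int closed_cball complete_eq_closed[THEN iffD2])
      have "0 \<in> cball 0 s \<inter> V" using V(2) s(1) by simp
      then show "cball 0 s \<inter> V \<noteq> {}" by blast
      show "(\<lambda>\<rho>. g - Z \<rho>) ` (cball 0 s \<inter> V) \<subseteq> cball 0 s \<inter> V"
      proof clarify
        fix \<rho> assume \<rho>: "\<rho> \<in> cball 0 s" "\<rho> \<in> V"
        have "norm (Z \<rho>) \<le> 1 / 2 * s" using lip[of \<rho> 0] \<rho> s Z(2) by auto
        then have "norm (g - Z \<rho>) \<le> s" using norm_triangle_ineq4[of g "Z \<rho>"] g by auto
        then show "g - Z \<rho> \<in> cball 0 s \<inter> V" using V(3)[OF g(1) ZV[OF \<rho>(2)]] \<rho> s by auto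
      qed
      show "dist (g - Z x) (g - Z y) \<le> 1 / 2 * dist x y" if "x \<in> cball 0 s \<inter> V" "y \<in> cball 0 s \<inter> V" for x y
        using lip[of y x] that by (simp add: dist_norm norm_minus_commute)
    qed auto
    then obtain \<rho> where \<rho>: "\<rho> \<in> cball 0 s \<inter> V" "g - Z \<rho> = \<rho>" by blast
    then have "norm \<rho> \<le> \<delta>" "\<rho> \<in> V" using s by auto
    then show "\<exists>\<rho>\<in>V. norm \<rho> \<le> \<delta> \<and> \<rho> = g - Z \<rho>" using \<rho>(2)[symmetric] by blast
  qed (use s in auto)
qed

section \<open>Evaluation on the circle\<close>

text \<open>The character that evaluates at \<open>\<zeta>\<close>, \<open>cnj \<zeta>\<close> and \<open>t\<close>. The division by \<open>R\<close> and \<open>\<tau>\<close> means that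
  absolute convergence of the coefficients gives convergence for \<open>norm \<zeta> \<le> R\<close> and \<open>\<bar>t\<bar> \<le> \<tau>\<close>.\<close>

definition chi :: "real \<Rightarrow> real \<Rightarrow> complex \<Rightarrow> real \<Rightarrow> index \<Rightarrow> complex" where
  "chi R \<tau> \<zeta> t = (\<lambda>(a, b, k). (\<zeta> / of_real R) ^ a * (cnj \<zeta> / of_real R) ^ b * of_real (t / \<tau>) ^ k)"

lemma chi_hom: "chi R \<tau> \<zeta> t 0 = 1" "chi R \<tau> \<zeta> t (i + j) = chi R \<tau> \<zeta> t i * chi R \<tau> \<zeta> t j"
  by (auto simp: chi_def zero_prod_def power_add split: prod.splits)

lemma norm_chi_le:
  assumes "norm \<zeta> = 1" "1 \<le> R" "0 < \<tau>" "\<bar>t\<bar> \<le> \<tau>"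
  shows "norm (chi R \<tau> \<zeta> t i) \<le> 1"
proof -
  obtain a b k where i: "i = (a, b, k)" by (rule prod_cases3)
  have "(1 / R) ^ n \<le> 1" "0 \<le> (1 / R) ^ n" for n using assms by (auto intro!: power_le_one)
  moreover have "\<bar>t / \<tau>\<bar> ^ k \<le> 1" using assms by (intro power_le_one) auto
  ultimately show ?thesis using assms
    unfolding i chi_def by (auto simp: norm_mult norm_power norm_divide intro!: mult_le_one)
qed

lemma chi_flip: "chi R \<tau> \<zeta> t (flip i) = cnj (chi R \<tau> \<zeta> t i)"
  by (auto simp: chi_def flip_def split: prod.splits)

lemma pairing_star: "(\<And>i. \<xi> (flip i) = cnj (\<xi> i)) \<Longrightarrow> pairing \<xi> (star f) = cnj (pairing \<xi> f)"
  unfolding pairing_def infsum_cnj[symmetric]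
  by (rule infsum_reindex_bij_witness[where i = flip and j = flip]) (auto simp: coeff_star)

text \<open>A one-variable power series in \<open>\<zeta>\<close> as an element of the algebra; the powers of \<open>R\<close> undo
  the scaling in \<open>chi\<close>.\<close>

definition pser :: "real \<Rightarrow> (nat \<Rightarrow> complex) \<Rightarrow> index ell1" where
  "pser R c = (\<Sum>n. single (n, 0, 0) (c n * of_real R ^ n))"

lemma pairing_suminf:
  assumes "\<And>i. norm (\<xi> i) \<le> 1" "summable u"
  shows "(\<lambda>n. pairing \<xi> (u n)) sums pairing \<xi> (suminf u)"
  by (rule bounded_linear.sums[OF bounded_linear_pairing[OF assms(1)] summable_sums[OF assms(2)]])

lemma pairing_pser:
  assumes \<zeta>: "norm \<zeta> = 1" "1 \<le> R" "0 < \<tau>" "\<bar>t\<bar> \<le> \<tau>" and s: "summable (\<lambda>n. norm (c n) * R ^ n)"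
    and g: "(\<lambda>n. c n * \<zeta> ^ n) sums g"
  shows "pairing (chi R \<tau> \<zeta> t) (pser R c) = g"
proof -
  have R: "R \<noteq> 0" "0 \<le> R" using \<zeta>(2) by auto
  have "norm (single (n, 0, 0) (c n * of_real R ^ n) :: index ell1) = norm (c n) * R ^ n" for n
    using R(2) by (simp add: norm_single norm_mult norm_power)
  with s have "summable (\<lambda>n. norm (single (n, 0, 0) (c n * of_real R ^ n) :: index ell1))" by simp
  then have "summable (\<lambda>n. single (n, 0, 0) (c n * of_real R ^ n) :: index ell1)"
    by (rule summable_norm_cancel)
  from pairing_suminf[OF norm_chi_le[OF \<zeta>] this]
  have 1: "(\<lambda>n. pairing (chi R \<tau> \<zeta> t) (single (n, 0, 0) (c n * of_real R ^ n))) sums pairing (chi R \<tau> \<zeta> t) (pser R c)"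
    unfolding pser_def .
  have 2: "pairing (chi R \<tau> \<zeta> t) (single (n, 0, 0) (c n * of_real R ^ n)) = c n * \<zeta> ^ n" for n
  proof -
    have "(of_real R :: complex) ^ n \<noteq> 0" using R(1) by simp
    then have "c n * of_real R ^ n * (\<zeta> / of_real R) ^ n = c n * \<zeta> ^ n"
      using R(1) by (simp add: power_divide)
    then show ?thesis by (simp add: pairing_single chi_def)
  qed
  from sums_unique2[OF 1[unfolded 2] g] show ?thesis .
qed

text \<open>The closed ideal of series that vanish at time 0. A solution inside this ideal starts from the
  prescribed initial domain.\<close>

definition vanishing :: "index ell1 set" where
  "vanishing = {p. \<forall>a b. coeff p (a, b, 0) = 0}"

lemma vanishing_0: "0 \<in> vanishing" by (simp add: vanishing_def)
lemma vanishing_diff: "p \<in> vanishing \<Longrightarrow> q \<in> vanishing \<Longrightarrow> p - q \<in> vanishing" by (simp add: vanishing_def)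
lemma vanishing_add: "p \<in> vanishing \<Longrightarrow> q \<in> vanishing \<Longrightarrow> p + q \<in> vanishing" by (simp add: vanishing_def)
lemma vanishing_uminus: "p \<in> vanishing \<Longrightarrow> - p \<in> vanishing" by (simp add: vanishing_def)
lemma vanishing_scaleR: "p \<in> vanishing \<Longrightarrow> r *\<^sub>R p \<in> vanishing" by (simp add: vanishing_def)
lemma vanishing_star: "p \<in> vanishing \<Longrightarrow> star p \<in> vanishing" by (simp add: vanishing_def coeff_star)
lemma vanishing_mask: "p \<in> vanishing \<Longrightarrow> mask w p \<in> vanishing" by (simp add: vanishing_def mask.rep_eq)

lemma vanishing_mult:
  assumes "p \<in> vanishing" shows "q * p \<in> vanishing"
  unfolding vanishing_def
proof (intro CollectI allI)
  fix a b
  have "coeff q (fst i) * coeff p (snd i) = 0" if "fst i + snd i = (a, b, 0)" for i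
  proof -
    have "snd (snd (snd i)) = 0" using arg_cong[OF that, of "\<lambda>j. snd (snd j)"] by simp
    then have "coeff p (snd i) = 0" using assms by (cases "snd i") (auto simp: vanishing_def)
    then show ?thesis by simp
  qed
  then show "coeff (q * p) (a, b, 0) = 0" unfolding coeff_times by (intro infsum_0) auto
qed

lemma closed_vanishing: "closed vanishing"
proof -
  have eq: "vanishing = (\<Inter>a. \<Inter>b. {p. coeff p (a, b, 0) = 0})" by (auto simp: vanishing_def)
  have "closed {p. coeff p i = 0}" for i :: index
    by (intro closed_Collect_eq continuous_on_const linear_continuous_on bounded_linear_coeff)
  then show ?thesis unfolding eq by (intro closed_INT ballI)
qed

lemma vanishing_sums:
  assumes "u sums p" "\<And>n. u n \<in> vanishing" shows "p \<in> vanishing"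
  unfolding vanishing_def
proof (safe)
  fix a b
  have "(\<lambda>n. coeff (u n) (a, b, 0)) sums coeff p (a, b, 0)"
    by (rule bounded_linear.sums[OF bounded_linear_coeff assms(1)])
  moreover have "coeff (u n) (a, b, 0) = 0" for n using assms(2)[of n] by (simp add: vanishing_def)
  ultimately show "coeff p (a, b, 0) = 0" by (simp add: sums_iff)
qed

lemma vanishing_exp: assumes "p \<in> vanishing" shows "exp p - 1 \<in> vanishing"
proof (rule vanishing_sums)
  show "(\<lambda>n. p ^ Suc n /\<^sub>R fact (Suc n)) sums (exp p - 1)"
    using sums_split_initial_segment[OF exp_converges[of p], of 1] by simp
  show "p ^ Suc n /\<^sub>R fact (Suc n) \<in> vanishing" for n
    unfolding power_Suc2 by (intro vanishing_scaleR vanishing_mult assms)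
qed

text \<open>A series on the circle splits into Fourier modes \<open>a - b > 0\<close>, \<open>a - b < 0\<close> and the constants
  \<open>a = b\<close>, which are shared equally. For a self-conjugate series \<open>\<rho>\<close> the part \<open>Kplus \<rho>\<close> is the holomorphic
  function in the disc, real at 0, whose real part on the circle is \<open>\<rho> / 2\<close>.\<close>

definition wplus :: "index \<Rightarrow> real" where
  "wplus = (\<lambda>(a, b, k). if b < a then 1 else if a = b then 1/2 else 0)"
definition wminus :: "index \<Rightarrow> real" where
  "wminus = (\<lambda>(a, b, k). if a < b then 1 else if a = b then 1/2 else 0)"

definition Kplus :: "index ell1 \<Rightarrow> index ell1" where "Kplus = mask wplus"
definition Kminus :: "index ell1 \<Rightarrow> index ell1" where "Kminus = mask wminus"

lemma coeff_Kplus: "coeff (Kplus p) (a, b, k) = (if b < a then coeff p (a, b, k) else if a = b then coeff p (a, b, k) / 2 else 0)"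
  unfolding Kplus_def by (subst coeff_mask) (auto simp: wplus_def scaleR_conv_of_real)

lemma coeff_Kminus: "coeff (Kminus p) (a, b, k) = (if a < b then coeff p (a, b, k) else if a = b then coeff p (a, b, k) / 2 else 0)"
  unfolding Kminus_def by (subst coeff_mask) (auto simp: wminus_def scaleR_conv_of_real)

lemma ell1_index_eqI: "(\<And>a b k. coeff f (a, b, k) = coeff g (a, b, k)) \<Longrightarrow> f = (g :: index ell1)"
  by (rule ell1_eqI) (simp only: split_paired_all)

lemma Kplus_Kminus: "Kplus p + Kminus p = p"
  by (rule ell1_index_eqI) (auto simp: coeff_Kplus coeff_Kminus)

lemma bounded_linear_K: "bounded_linear Kplus" "bounded_linear Kminus"
  by (simp_all add: Kplus_def Kminus_def bounded_linear_mask)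

text \<open>The unique correction that is self-conjugate and leaves, in \<open>p - symm p\<close>, only modes \<open>a > b\<close> and an
  imaginary constant. The remainder therefore extends holomorphically to the disc, with imaginary
  value at 0.\<close>

definition symm :: "index ell1 \<Rightarrow> index ell1" where "symm p = Kminus p + star (Kminus p)"

lemma bounded_linear_symm: "bounded_linear symm"
  unfolding symm_def
  by (intro bounded_linear_add bounded_linear_K bounded_linear_compose[OF bounded_linear_star])

lemma star_symm: "star (symm p) = symm p" by (simp add: symm_def star_add add.commute)

lemma coeff_diff_symm:
  "a < b \<Longrightarrow> coeff (p - symm p) (a, b, k) = 0"
  "Re (coeff (p - symm p) (a, a, k)) = 0"
  by (auto simp: symm_def coeff_Kminus coeff_star)

lemma Kminus_symmetric: "star p = p \<Longrightarrow> Kminus p = star (Kplus p)"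
proof (rule ell1_index_eqI)
  fix a b k assume "star p = p"
  then have "cnj (coeff p (flip (a, b, k))) = coeff p (a, b, k)"
    using coeff_star[of p "(a, b, k)"] by simp
  then show "coeff (Kminus p) (a, b, k) = coeff (star (Kplus p)) (a, b, k)"
    by (auto simp: coeff_Kminus coeff_star coeff_Kplus)
qed

lemma vanishing_K: "p \<in> vanishing \<Longrightarrow> Kplus p \<in> vanishing" "p \<in> vanishing \<Longrightarrow> Kminus p \<in> vanishing"
  "p \<in> vanishing \<Longrightarrow> symm p \<in> vanishing"
  by (simp_all add: Kplus_def Kminus_def symm_def vanishing_mask vanishing_star vanishing_add)

lemma norm_K: "norm (Kplus p) \<le> norm p" "norm (Kminus p) \<le> norm p"
  unfolding norm_ell1_eq Kplus_def Kminus_def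
  by (intro infsum_mono coeff_summable_norm; auto simp: mask.rep_eq intro!: mult_left_le_one_le)+

lemma sdiff_cong: "sdiff \<Phi> L \<Longrightarrow> (\<And>p. L p = L' p) \<Longrightarrow> sdiff \<Phi> L'"
  by (simp add: ext[of L L'])

section \<open>The integrated evolution equation\<close>

lemma taylor_coeffs:
  assumes "g holomorphic_on ball 0 R"
  obtains c :: "nat \<Rightarrow> complex" where "\<And>z. norm z < R \<Longrightarrow> (\<lambda>n. c n * z ^ n) sums g z"
    "\<And>s. 0 \<le> s \<Longrightarrow> s < R \<Longrightarrow> summable (\<lambda>n. norm (c n) * s ^ n)"
proof -
  define c where "c n = (deriv ^^ n) g 0 / fact n" for n
  have 1: "(\<lambda>n. c n * z ^ n) sums g z" if "norm z < R" for z
    using holomorphic_power_series[OF assms, of z] that by (simp add: c_def)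
  have 2: "summable (\<lambda>n. norm (c n) * s ^ n)" if s: "0 \<le> s" "s < R" for s
  proof -
    obtain s' where s': "s < s'" "s' < R" using dense[OF s(2)] by blast
    have "summable (\<lambda>n. c n * of_real s' ^ n)"
      using 1[of "of_real s'"] s s' by (auto intro: sums_summable)
    from powser_insidea[OF this, of "of_real s"] show ?thesis
      using s s' by (simp add: norm_mult norm_power)
  qed
  show ?thesis by (rule that[OF 1 2])
qed

locale univalent_disc =
  fixes f :: "complex \<Rightarrow> complex" and R0 :: real
  assumes R0: "1 < R0" and holo: "f holomorphic_on ball 0 R0" and inj: "inj_on f (ball 0 R0)" and f0: "f 0 = 0"
begin

lemma R0_pos: "0 < R0" using R0 by simp

lemma deriv_nz: "norm z < R0 \<Longrightarrow> deriv f z \<noteq> 0"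
  using holomorphic_injective_imp_regular[OF holo open_ball inj, of z] by simp

lemma f_eq_0_iff: "norm z < R0 \<Longrightarrow> f z = 0 \<longleftrightarrow> z = 0"
  using inj_onD[OF inj, of z 0] f0 R0_pos by auto

text \<open>Dividing by \<open>z\<close> keeps the logarithmic derivative \<open>J z = z * deriv f z / f z\<close> below
  holomorphic at 0.\<close>

definition m :: "complex \<Rightarrow> complex" where "m z = (if z = 0 then deriv f 0 else f z / z)"

lemma m_holo: "m holomorphic_on ball 0 R0"
proof -
  have "(\<lambda>z. if z = 0 then deriv f 0 else (f z - f 0) / (z - 0)) holomorphic_on ball 0 R0"
    using R0_pos by (intro pole_lemma[OF holo]) simp
  then show ?thesis by (simp add: m_def[abs_def] f0 cong: if_cong)
qed

lemma m_nz: "norm z < R0 \<Longrightarrow> m z \<noteq> 0"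
  using deriv_nz[of z] f_eq_0_iff[of z] by (auto simp: m_def)

lemma f_eq_m: "f z = z * m z" by (simp add: m_def f0)

definition J :: "complex \<Rightarrow> complex" where "J z = deriv f z / m z"

lemma deriv_holo: "deriv f holomorphic_on ball 0 R0"
  by (rule holomorphic_deriv[OF holo open_ball])

lemma J_holo: "J holomorphic_on ball 0 R0"
  unfolding J_def[abs_def] using m_nz by (intro holomorphic_on_divide deriv_holo m_holo) auto

lemma J_0: "J 0 = 1" using deriv_nz[of 0] R0_pos by (simp add: J_def m_def)

lemma J_nz: "norm z < R0 \<Longrightarrow> J z \<noteq> 0" using deriv_nz m_nz by (simp add: J_def)

lemma J_f: "norm z < R0 \<Longrightarrow> J z * f z = z * deriv f z" using m_nz by (simp add: J_def f_eq_m)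

text \<open>The evolution in integrated form. Write the moving map as \<open>f \<phi>\<close> with \<open>\<phi> = \<zeta> * exp \<kappa>\<close>, \<open>\<kappa>\<close> holomorphic in
  the disc. On the circle \<open>exp (- pi * norm (f \<phi>)^2)\<close> is compared with the function
  \<open>exp (- pi * (f \<phi> * cnj (f (1 / cnj \<phi>))))\<close>, which depends on \<open>\<phi>\<close> only holomorphically and equals it at time
  0. The claim is that their difference, multiplied by \<open>J \<zeta>\<close>, is \<open>- 2 * pi * t\<close> plus a boundary value of a
  holomorphic function that is imaginary at 0.

  With \<open>\<kappa> = Kplus \<rho>\<close> and \<open>\<rho>\<close> self-conjugate, the left-hand side has derivative \<open>- \<beta> * \<rho>\<close> at
  \<open>\<rho> = 0\<close>. The factor \<open>J\<close> is chosen to make \<open>\<beta> = pi * norm (deriv f \<zeta>)^2 * exp (- pi * norm (f \<zeta>)^2)\<close> real,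
  positive and free of derivatives of \<open>\<rho>\<close>: no derivatives are lost, and a contraction in the algebra
  suffices. Writing the left-hand side as \<open>- \<beta> * \<rho> - Y \<rho>\<close>, the equation
  \<open>\<beta> * \<rho> = 2 * pi * t - symm (Y \<rho>)\<close> leaves the admissible remainder \<open>symm (Y \<rho>) - Y \<rho>\<close>.\<close>

lemma fixed_point_in_algebra:
  obtains R \<tau> :: real and \<kappa> Q G :: "index ell1" where "1 < R" "0 < \<tau>"
    "\<kappa> \<in> vanishing" "\<And>a b k. a < b \<Longrightarrow> coeff \<kappa> (a, b, k) = 0"
    "Q \<in> vanishing" "\<And>a b k. a < b \<Longrightarrow> coeff Q (a, b, k) = 0" "\<And>a k. Re (coeff Q (a, a, k)) = 0"
    "\<And>\<zeta> t \<phi>. norm \<zeta> = 1 \<Longrightarrow> \<bar>t\<bar> \<le> \<tau> \<Longrightarrow> \<phi> = \<zeta> * exp (pairing (chi R \<tau> \<zeta> t) \<kappa>) \<Longrightarrow>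
       norm \<phi> < R0 \<and> 1 / R0 < norm \<phi> \<and> pairing (chi R \<tau> \<zeta> t) G = f \<phi> \<and>
       J \<zeta> * (exp (- of_real pi * (f \<phi> * cnj (f \<phi>))) - exp (- of_real pi * (f \<phi> * cnj (f (1 / cnj \<phi>)))))
         = - of_real (2 * pi * t) + pairing (chi R \<tau> \<zeta> t) Q"
proof -
  \<comment> \<open>chosen so that \<open>R * exp (3 * r) < R0\<close>, which \<open>sdiff_exp_series\<close> needs for the Taylor series of \<open>f\<close>\<close>
  define R where "R = exp (ln R0 / 4)"
  define r where "r = ln R0 / 6"
  have lnR: "0 < ln R0" using R0 by simp
  have r: "0 < r" and R: "1 < R" using lnR by (auto simp: r_def R_def)
  have Rr: "R * exp (3 * r) < R0" and er: "exp r < R0" and RR: "R < R0"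
  proof -
    have "R * exp (3 * r) = exp (ln R0 * (3 / 4))" by (simp add: R_def r_def exp_add[symmetric])
    also have "\<dots> < exp (ln R0)" using lnR by simp
    finally show "R * exp (3 * r) < R0" using R0 by simp
    have "exp r < exp (ln R0)" "R < exp (ln R0)" unfolding R_def using lnR by (auto simp: r_def)
    then show "exp r < R0" "R < R0" using R0 by simp_all
  qed
  obtain cf where cf: "\<And>z. norm z < R0 \<Longrightarrow> (\<lambda>n. cf n * z ^ n) sums f z"
    and cfs: "\<And>s. 0 \<le> s \<Longrightarrow> s < R0 \<Longrightarrow> summable (\<lambda>n. norm (cf n) * s ^ n)"
    using taylor_coeffs[OF holo] by blast
  obtain cJ where cJ: "\<And>z. norm z < R0 \<Longrightarrow> (\<lambda>n. cJ n * z ^ n) sums J z"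
    and cJs: "\<And>s. 0 \<le> s \<Longrightarrow> s < R0 \<Longrightarrow> summable (\<lambda>n. norm (cJ n) * s ^ n)"
    using taylor_coeffs[OF J_holo] by blast
  have "(\<lambda>z. 1 / deriv f z) holomorphic_on ball 0 R0"
    using deriv_nz by (intro holomorphic_intros deriv_holo) auto
  from taylor_coeffs[OF this] obtain ci where ci: "\<And>z. norm z < R0 \<Longrightarrow> (\<lambda>n. ci n * z ^ n) sums (1 / deriv f z)"
    and cis: "\<And>s. 0 \<le> s \<Longrightarrow> s < R0 \<Longrightarrow> summable (\<lambda>n. norm (ci n) * s ^ n)"
    by blast
  define u :: "nat \<Rightarrow> index ell1" where "u n = single (n, 0, 0) (cf n * of_real R ^ n)" for n
  define v :: "nat \<Rightarrow> index ell1" where "v n = single (0, n, 0) (cnj (cf n) * of_real R ^ n)" for n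
  have su: "summable (\<lambda>n. norm (u n) * exp (3 * r * real n))"
    and sv: "summable (\<lambda>n. norm (v n) * exp (3 * r * real n))"
  proof -
    have e: "exp (3 * r * real n) = exp (3 * r) ^ n" for n by (simp add: exp_of_nat2_mult)
    show "summable (\<lambda>n. norm (u n) * exp (3 * r * real n))" "summable (\<lambda>n. norm (v n) * exp (3 * r * real n))"
      using cfs[of "R * exp (3 * r)"] Rr R unfolding e
      by (simp_all add: u_def v_def norm_single norm_mult norm_power power_mult_distrib mult_ac)
  qed
  define A where "A p = (\<Sum>n. u n * exp (real n *\<^sub>R p))" for p
  define B where "B p = (\<Sum>n. v n * exp (real n *\<^sub>R p))" for p
  define A1 where "A1 = (\<Sum>n. real n *\<^sub>R u n)"
  define B1 where "B1 = (\<Sum>n. real n *\<^sub>R v n)"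
  have sA: "sdiff A (\<lambda>p. A1 * p)" unfolding A_def[abs_def] A1_def by (rule sdiff_exp_series(3)[OF r su])
  have sB: "sdiff B (\<lambda>p. B1 * p)" unfolding B_def[abs_def] B1_def by (rule sdiff_exp_series(3)[OF r sv])
  define N where "N \<rho> = exp ((- pi) *\<^sub>R (A (Kplus \<rho>) * B (Kminus \<rho>))) - exp ((- pi) *\<^sub>R (A (Kplus \<rho>) * B (- Kplus \<rho>)))" for \<rho>
  have K0: "Kplus 0 = 0" "Kminus 0 = 0" using bounded_linear_K by (simp_all add: linear_simps(3))
  have sAp: "sdiff (\<lambda>\<rho>. A (Kplus \<rho>)) (\<lambda>\<rho>. A1 * Kplus \<rho>)" by (rule sdiff_pre[OF bounded_linear_K(1) sA])
  have sBm: "sdiff (\<lambda>\<rho>. B (Kminus \<rho>)) (\<lambda>\<rho>. B1 * Kminus \<rho>)" by (rule sdiff_pre[OF bounded_linear_K(2) sB])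
  have sBp: "sdiff (\<lambda>\<rho>. B (- Kplus \<rho>)) (\<lambda>\<rho>. B1 * (- Kplus \<rho>))"
    by (rule sdiff_pre[OF bounded_linear_minus[OF bounded_linear_K(1)] sB])
  define e0 where "e0 = exp ((- pi) *\<^sub>R (A 0 * B 0))"
  have sN: "sdiff N (\<lambda>\<rho>. (- pi) *\<^sub>R (e0 * A 0 * B1 * \<rho>))"
    unfolding N_def[abs_def]
  proof (rule sdiff_cong[OF sdiff_diff[OF sdiff_exp[OF sdiff_post[OF bounded_linear_scaleR_right sdiff_mult[OF sAp sBm]]]
        sdiff_exp[OF sdiff_post[OF bounded_linear_scaleR_right sdiff_mult[OF sAp sBp]]]]])
    fix \<rho> :: "index ell1"
    have "exp ((- pi) *\<^sub>R (A (Kplus 0) * B (Kminus 0))) * ((- pi) *\<^sub>R (A (Kplus 0) * (B1 * Kminus \<rho>) + B (Kminus 0) * (A1 * Kplus \<rho>)))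
        - exp ((- pi) *\<^sub>R (A (Kplus 0) * B (- Kplus 0))) * ((- pi) *\<^sub>R (A (Kplus 0) * (B1 * - Kplus \<rho>) + B (- Kplus 0) * (A1 * Kplus \<rho>)))
       = (- pi) *\<^sub>R (e0 * A 0 * B1 * (Kplus \<rho> + Kminus \<rho>))"
      unfolding K0 minus_zero e0_def[symmetric] by (simp add: algebra_simps)
    then show "exp ((- pi) *\<^sub>R (A (Kplus 0) * B (Kminus 0))) * ((- pi) *\<^sub>R (A (Kplus 0) * (B1 * Kminus \<rho>) + B (Kminus 0) * (A1 * Kplus \<rho>)))
        - exp ((- pi) *\<^sub>R (A (Kplus 0) * B (- Kplus 0))) * ((- pi) *\<^sub>R (A (Kplus 0) * (B1 * - Kplus \<rho>) + B (- Kplus 0) * (A1 * Kplus \<rho>)))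
       = (- pi) *\<^sub>R (e0 * A 0 * B1 * \<rho>)" unfolding Kplus_Kminus .
  qed
  define Jp where "Jp = pser R cJ"
  define \<beta> where "\<beta> = pi *\<^sub>R (Jp * e0 * A 0 * B1)"
  define Y where "Y \<rho> = - (Jp * N \<rho>) - \<beta> * \<rho>" for \<rho>
  have sY: "sdiff Y (\<lambda>_. 0)"
    unfolding Y_def[abs_def]
    by (rule sdiff_cong[OF sdiff_diff[OF sdiff_post[OF bounded_linear_minus[OF bounded_linear_mult_right] sN]
          sdiff_linear[OF bounded_linear_mult_right]]])
       (simp add: \<beta>_def mult_ac)
  \<comment> \<open>an inverse of \<open>\<beta>\<close> on the circle; symmetrizing changes no value there and makes it formally self-conjugate\<close>
  define c0 where "c0 = (1 / pi) *\<^sub>R (exp (pi *\<^sub>R (A 0 * B 0)) * (pser R ci * star (pser R ci)))"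
  define c where "c = (1 / 2) *\<^sub>R (c0 + star c0)"
  have c_star: "star c = c" by (simp add: c_def star_scaleR star_add add.commute)
  define Z where "Z \<rho> = c * symm (Y \<rho>)" for \<rho>
  have sZ: "sdiff Z (\<lambda>_. 0)"
    unfolding Z_def[abs_def]
    by (rule sdiff_cong[OF sdiff_post[OF bounded_linear_mult_right sdiff_post[OF bounded_linear_symm sY]]])
       (simp add: linear_simps(3)[OF bounded_linear_symm])
  have N0: "N 0 = 0" by (simp add: N_def K0)
  have Z0: "Z 0 = 0" by (simp add: Z_def Y_def N0 linear_simps(3)[OF bounded_linear_symm])
  have B_diff: "B p - B q \<in> vanishing" if "p \<in> vanishing" "q \<in> vanishing" "norm p \<le> r" "norm q \<le> r" for p q
  proof -
    have "(\<lambda>n. v n * exp (real n *\<^sub>R p) - v n * exp (real n *\<^sub>R q)) sums (B p - B q)"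
      unfolding B_def by (intro sums_diff summable_sums sdiff_exp_series(1)[OF r sv] that)
    moreover have "v n * exp (real n *\<^sub>R p) - v n * exp (real n *\<^sub>R q) \<in> vanishing" for n
    proof -
      have "(exp (real n *\<^sub>R p) - 1) - (exp (real n *\<^sub>R q) - 1) \<in> vanishing"
        by (intro vanishing_diff vanishing_exp vanishing_scaleR that)
      from vanishing_mult[OF this, of "v n"] show ?thesis by (simp add: algebra_simps)
    qed
    ultimately show ?thesis by (rule vanishing_sums)
  qed
  have norm_Kr: "norm (Kplus p) \<le> r" "norm (Kminus p) \<le> r" "norm (- Kplus p) \<le> r" if "norm p \<le> r" for p
    using norm_K[of p] that by auto
  have N_van: "N p \<in> vanishing" if p: "p \<in> vanishing" "norm p \<le> r" for p
  proof -
    let ?D = "(- pi) *\<^sub>R (A (Kplus p) * (B (Kminus p) - B (- Kplus p)))"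
    let ?E = "(- pi) *\<^sub>R (A (Kplus p) * B (- Kplus p))"
    have "?D \<in> vanishing"
      by (intro vanishing_scaleR vanishing_mult B_diff vanishing_K vanishing_uminus norm_Kr p)
    then have "exp ?E * (exp ?D - 1) \<in> vanishing" by (intro vanishing_mult vanishing_exp)
    also have "exp ?E * (exp ?D - 1) = exp (?E + ?D) - exp ?E"
      unfolding exp_add_comm by (simp add: algebra_simps)
    also have "?E + ?D = (- pi) *\<^sub>R (A (Kplus p) * B (Kminus p))" by (simp add: algebra_simps)
    finally show ?thesis by (simp add: N_def)
  qed
  have Y_van: "Y p \<in> vanishing" if "p \<in> vanishing" "norm p \<le> r" for p
    unfolding Y_def by (intro vanishing_diff vanishing_uminus vanishing_mult N_van that)
  have Z_van: "Z p \<in> vanishing" if "p \<in> vanishing" "norm p \<le> r" for p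
    unfolding Z_def by (intro vanishing_mult vanishing_K Y_van that)
  obtain \<eta> where \<eta>: "0 < \<eta>" "\<And>g. g \<in> vanishing \<Longrightarrow> norm g \<le> \<eta> \<Longrightarrow> \<exists>\<rho>\<in>vanishing. norm \<rho> \<le> r \<and> \<rho> = g - Z \<rho>"
    using sdiff_fixed_point[OF sZ Z0 closed_vanishing vanishing_0 vanishing_diff r Z_van] by blast
  define \<tau> where "\<tau> = \<eta> / (2 * pi * (norm c + 1))"
  have \<tau>: "0 < \<tau>" using \<eta>(1) norm_ge_zero[of c] by (simp add: \<tau>_def add_nonneg_pos)
  define T where "T = (single (0, 0, 1) 1 :: index ell1)"
  have T: "T \<in> vanishing" "star T = T" "norm T = 1"
    by (auto simp: T_def vanishing_def norm_single coeff_star flip_def split: prod.splits intro!: ell1_eqI)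
  define g where "g = (2 * pi * \<tau>) *\<^sub>R (c * T)"
  have "norm g \<le> (2 * pi * \<tau>) * norm c"
    unfolding g_def using norm_mult_ineq[of c T] \<tau> T(3) by (simp add: mult_left_mono)
  also have "\<dots> \<le> \<eta>" using \<eta>(1) norm_ge_zero[of c] by (simp add: \<tau>_def divide_simps add_nonneg_pos mult_left_mono)
  finally obtain \<rho> where \<rho>: "\<rho> \<in> vanishing" "norm \<rho> \<le> r" "\<rho> = g - Z \<rho>"
    using \<eta>(2)[of g] T(1) by (auto simp: g_def intro: vanishing_scaleR vanishing_mult)
  have \<rho>_star: "star \<rho> = \<rho>"
    using arg_cong[OF \<rho>(3), of star] \<rho>(3)
    by (simp add: star_diff g_def Z_def star_scaleR star_mult c_star T star_symm)
  define \<kappa> where "\<kappa> = Kplus \<rho>"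
  define Q where "Q = - (Y \<rho> - symm (Y \<rho>))"
  have Q: "Q \<in> vanishing" unfolding Q_def by (intro vanishing_uminus vanishing_diff vanishing_K Y_van \<rho>)
  have "norm (\<zeta> * exp (pairing (chi R \<tau> \<zeta> t) \<kappa>)) < R0 \<and> 1 / R0 < norm (\<zeta> * exp (pairing (chi R \<tau> \<zeta> t) \<kappa>))
      \<and> pairing (chi R \<tau> \<zeta> t) (A \<kappa>) = f (\<zeta> * exp (pairing (chi R \<tau> \<zeta> t) \<kappa>)) \<and>
       J \<zeta> * (exp (- of_real pi * (f (\<zeta> * exp (pairing (chi R \<tau> \<zeta> t) \<kappa>)) * cnj (f (\<zeta> * exp (pairing (chi R \<tau> \<zeta> t) \<kappa>)))))
         - exp (- of_real pi * (f (\<zeta> * exp (pairing (chi R \<tau> \<zeta> t) \<kappa>)) * cnj (f (1 / cnj (\<zeta> * exp (pairing (chi R \<tau> \<zeta> t) \<kappa>)))))))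
         = - of_real (2 * pi * t) + pairing (chi R \<tau> \<zeta> t) Q"
    if \<zeta>: "norm \<zeta> = 1" and t: "\<bar>t\<bar> \<le> \<tau>" for \<zeta> t
  proof -
    define \<xi> where "\<xi> = chi R \<tau> \<zeta> t"
    have b: "norm (\<xi> i) \<le> 1" for i unfolding \<xi>_def using \<zeta> R \<tau> t by (intro norm_chi_le) auto
    have hom: "\<xi> (i + j) = \<xi> i * \<xi> j" "\<xi> 0 = 1" for i j by (simp_all add: \<xi>_def chi_hom)
    note ev = pairing_mult[OF b hom(1)] pairing_exp[OF b hom]
    note lin = linear_simps[OF bounded_linear_pairing[where \<xi> = \<xi>, OF b]]
    have ev_star: "pairing \<xi> (star p) = cnj (pairing \<xi> p)" for p
      by (rule pairing_star) (simp add: \<xi>_def chi_flip)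
    have cancel: "x * of_real R ^ n * (w / of_real R) ^ n = x * w ^ n"
      "of_real R ^ n * (w / of_real R) ^ n = w ^ n" for x w :: complex and n
      using R by (simp_all add: power_divide)
    have bound: "norm (\<zeta> * exp (pairing \<xi> p)) < R0" "1 / R0 < norm (\<zeta> * exp (pairing \<xi> p))"
      "norm (\<zeta> * exp (cnj (pairing \<xi> p))) < R0" if "norm p \<le> r" for p
    proof -
      have "\<bar>Re (pairing \<xi> p)\<bar> \<le> r"
        using abs_Re_le_cmod[of "pairing \<xi> p"] norm_pairing_le[where \<xi> = \<xi> and f = p, OF b] that by linarith
      then have "exp (Re (pairing \<xi> p)) \<le> exp r" "exp (- r) \<le> exp (Re (pairing \<xi> p))" by auto
      moreover have "1 / R0 < exp (- r)" using er R0 by (simp add: exp_minus field_simps)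
      ultimately have "exp (Re (pairing \<xi> p)) < R0" "1 / R0 < exp (Re (pairing \<xi> p))"
        using er by (meson le_less_trans, meson less_le_trans)
      then show "norm (\<zeta> * exp (pairing \<xi> p)) < R0" "1 / R0 < norm (\<zeta> * exp (pairing \<xi> p))"
        "norm (\<zeta> * exp (cnj (pairing \<xi> p))) < R0"
        using \<zeta> by (simp_all add: norm_mult norm_exp_eq_Re)
    qed
    have evA: "pairing \<xi> (A p) = f (\<zeta> * exp (pairing \<xi> p))" if p: "norm p \<le> r" for p
    proof (rule sums_unique2)
      show "(\<lambda>n. pairing \<xi> (u n * exp (real n *\<^sub>R p))) sums pairing \<xi> (A p)"
        unfolding A_def by (rule pairing_suminf[OF b sdiff_exp_series(1)[OF r su p]])
      have "pairing \<xi> (u n * exp (real n *\<^sub>R p)) = cf n * (\<zeta> * exp (pairing \<xi> p)) ^ n" for n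
        unfolding ev lin(5) u_def pairing_single
        by (simp add: \<xi>_def[symmetric] scaleR_conv_of_real exp_of_nat_mult power_mult_distrib)
           (simp add: \<xi>_def chi_def cancel)
      then show "(\<lambda>n. pairing \<xi> (u n * exp (real n *\<^sub>R p))) sums f (\<zeta> * exp (pairing \<xi> p))"
        using cf[OF bound(1)[OF p]] by simp
    qed
    have evB: "pairing \<xi> (B p) = cnj (f (\<zeta> * exp (cnj (pairing \<xi> p))))" if p: "norm p \<le> r" for p
    proof (rule sums_unique2)
      show "(\<lambda>n. pairing \<xi> (v n * exp (real n *\<^sub>R p))) sums pairing \<xi> (B p)"
        unfolding B_def by (rule pairing_suminf[OF b sdiff_exp_series(1)[OF r sv p]])
      have "pairing \<xi> (v n * exp (real n *\<^sub>R p)) = cnj (cf n * (\<zeta> * exp (cnj (pairing \<xi> p))) ^ n)" for n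
        unfolding ev lin(5) v_def pairing_single
        by (simp add: \<xi>_def[symmetric] scaleR_conv_of_real exp_of_nat_mult power_mult_distrib exp_cnj)
           (simp add: \<xi>_def chi_def cancel)
      then show "(\<lambda>n. pairing \<xi> (v n * exp (real n *\<^sub>R p))) sums cnj (f (\<zeta> * exp (cnj (pairing \<xi> p))))"
        using cf[OF bound(3)[OF p]] by (simp only: sums_cnj)
    qed
    have evpser: "pairing \<xi> (pser R d) = h" if "summable (\<lambda>n. norm (d n) * R ^ n)" "(\<lambda>n. d n * \<zeta> ^ n) sums h" for d h
      unfolding \<xi>_def using \<zeta> R \<tau> t that by (intro pairing_pser) auto
    have evJ: "pairing \<xi> Jp = J \<zeta>"
      unfolding Jp_def using cJ[of \<zeta>] cJs[of R] RR R \<zeta> by (intro evpser) auto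
    have evi: "pairing \<xi> (pser R ci) = 1 / deriv f \<zeta>"
      using ci[of \<zeta>] cis[of R] RR R \<zeta> by (intro evpser) auto
    have evA0: "pairing \<xi> (A 0) = f \<zeta>" and evB0: "pairing \<xi> (B 0) = cnj (f \<zeta>)"
      using evA[of 0] evB[of 0] r by (simp_all add: lin(3))
    have evB1: "pairing \<xi> B1 = cnj (\<zeta> * deriv f \<zeta>)"
    proof (rule sums_unique2)
      show "(\<lambda>n. pairing \<xi> (real n *\<^sub>R v n)) sums pairing \<xi> B1"
        unfolding B1_def by (rule pairing_suminf[OF b sdiff_exp_series(2)[OF r sv]])
      have "pairing \<xi> (real n *\<^sub>R v n) = cnj (of_nat n * cf n * \<zeta> ^ n)" for n
        unfolding lin(5) v_def pairing_single
        by (simp add: \<xi>_def chi_def cancel scaleR_conv_of_real)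
      moreover have "(\<lambda>n. of_nat n * cf n * \<zeta> ^ n) sums (\<zeta> * deriv f \<zeta>)"
      proof -
        have s: "summable (\<lambda>n. diffs cf n * \<zeta> ^ n)"
          by (rule termdiff_converges[of \<zeta> R0]) (use cf R0 \<zeta> in \<open>auto intro: sums_summable\<close>)
        have "((\<lambda>z. \<Sum>n. cf n * z ^ n) has_field_derivative (\<Sum>n. diffs cf n * \<zeta> ^ n)) (at \<zeta>)"
          by (rule termdiffs_strong'[of R0]) (use cf R0 \<zeta> in \<open>auto intro: sums_summable\<close>)
        then have "(f has_field_derivative (\<Sum>n. diffs cf n * \<zeta> ^ n)) (at \<zeta>)"
          by (rule has_field_derivative_transform_within_open[where S = "ball 0 R0"])
             (use cf R0 \<zeta> in \<open>auto simp: sums_iff\<close>)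
        then have "deriv f \<zeta> = (\<Sum>n. diffs cf n * \<zeta> ^ n)" by (rule DERIV_imp_deriv)
        with s have "(\<lambda>n. diffs cf n * \<zeta> ^ n) sums deriv f \<zeta>" by (simp add: sums_iff)
        from sums_mult[OF this, of \<zeta>] have "(\<lambda>n. of_nat (Suc n) * cf (Suc n) * \<zeta> ^ Suc n) sums (\<zeta> * deriv f \<zeta>)"
          by (simp add: diffs_def mult_ac)
        then show ?thesis by (subst (asm) sums_Suc_iff) simp
      qed
      ultimately show "(\<lambda>n. pairing \<xi> (real n *\<^sub>R v n)) sums cnj (\<zeta> * deriv f \<zeta>)"
        by (simp only: sums_cnj)
    qed
    define w where "w = exp (- of_real pi * (f \<zeta> * cnj (f \<zeta>)))"
    have ev\<beta>: "pairing \<xi> \<beta> = of_real pi * w * (deriv f \<zeta> * cnj (deriv f \<zeta>))"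
    proof -
      have "pairing \<xi> \<beta> = of_real pi * (J \<zeta> * w * f \<zeta> * cnj (\<zeta> * deriv f \<zeta>))"
        unfolding \<beta>_def e0_def lin(5) ev evJ evA0 evB0 evB1 by (simp add: scaleR_conv_of_real w_def)
      also have "\<dots> = of_real pi * w * ((J \<zeta> * f \<zeta>) * cnj (\<zeta> * deriv f \<zeta>))" by (simp add: mult_ac)
      also have "\<dots> = of_real pi * w * ((\<zeta> * cnj \<zeta>) * (deriv f \<zeta> * cnj (deriv f \<zeta>)))"
        using J_f[of \<zeta>] \<zeta> R0 by (simp add: mult_ac)
      also have "\<zeta> * cnj \<zeta> = 1" using \<zeta> by (simp add: complex_norm_square[symmetric])
      finally show ?thesis by simp
    qed
    have evc: "pairing \<xi> \<beta> * pairing \<xi> c = 1"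
    proof -
      have c0: "pairing \<xi> c0 = of_real (1 / pi) * (exp (of_real pi * (f \<zeta> * cnj (f \<zeta>))) * (1 / (deriv f \<zeta> * cnj (deriv f \<zeta>))))"
        unfolding c0_def lin(5) ev evA0 evB0 ev_star evi by (simp add: scaleR_conv_of_real)
      also have "\<dots> = of_real (1 / pi * (exp (pi * (cmod (f \<zeta>))\<^sup>2) * (1 / (cmod (deriv f \<zeta>))\<^sup>2)))"
        unfolding complex_norm_square[symmetric] by (simp add: exp_of_real[symmetric])
      finally have "cnj (pairing \<xi> c0) = pairing \<xi> c0" by simp
      then have "pairing \<xi> c = pairing \<xi> c0"
        unfolding c_def lin(5) lin(1) ev_star by (simp add: scaleR_conv_of_real)
      moreover have "w * exp (of_real pi * (f \<zeta> * cnj (f \<zeta>))) = 1"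
        unfolding w_def by (simp add: exp_add[symmetric])
      moreover have "deriv f \<zeta> * cnj (deriv f \<zeta>) \<noteq> 0" using deriv_nz[of \<zeta>] \<zeta> R0 by simp
      moreover have "of_real pi * w * D * (of_real (1 / pi) * (E * (1 / D))) = (w * E) * (of_real pi * of_real (1 / pi)) * (D * (1 / D))"
        for D E :: complex by (simp only: mult_ac)
      moreover have "of_real pi * of_real (1 / pi) = (1 :: complex)" by (simp flip: of_real_mult)
      ultimately show ?thesis unfolding ev\<beta> c0 by (simp only: mult_1_right mult_1_left times_divide_eq_right divide_self_if if_False)
    qed
    have ev\<rho>: "pairing \<xi> \<beta> * pairing \<xi> \<rho> = of_real (2 * pi * t) - pairing \<xi> (symm (Y \<rho>))"
    proof -
      have "pairing \<xi> T = of_real (t / \<tau>)" by (simp add: T_def pairing_single \<xi>_def chi_def)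
      moreover have "of_real (2 * pi * \<tau>) * of_real (t / \<tau>) = (of_real (2 * pi * t) :: complex)"
      proof -
        have "2 * pi * \<tau> * (t / \<tau>) = 2 * pi * t" using \<tau> by simp
        then show ?thesis by (simp only: of_real_mult[symmetric])
      qed
      moreover have "pairing \<xi> \<rho> = pairing \<xi> (g - Z \<rho>)" using \<rho>(3) by (rule arg_cong)
      moreover have "pairing \<xi> (g - Z \<rho>) = of_real (2 * pi * \<tau>) * (pairing \<xi> c * pairing \<xi> T) - pairing \<xi> c * pairing \<xi> (symm (Y \<rho>))"
        unfolding g_def Z_def lin(2) lin(5) ev by (simp only: scaleR_conv_of_real)
      ultimately have "pairing \<xi> \<rho> = of_real (2 * pi * \<tau>) * (pairing \<xi> c * of_real (t / \<tau>)) - pairing \<xi> c * pairing \<xi> (symm (Y \<rho>))"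
        and 1: "of_real (2 * pi * \<tau>) * of_real (t / \<tau>) = (of_real (2 * pi * t) :: complex)" by (simp_all only:)
      then have "pairing \<xi> \<rho> = pairing \<xi> c * (of_real (2 * pi * \<tau>) * of_real (t / \<tau>)) - pairing \<xi> c * pairing \<xi> (symm (Y \<rho>))"
        by (simp only: mult_ac)
      then have "pairing \<xi> \<rho> = pairing \<xi> c * (of_real (2 * pi * t) - pairing \<xi> (symm (Y \<rho>)))"
        unfolding 1 by (simp only: right_diff_distrib)
      then show ?thesis using evc by (simp only: mult.assoc[symmetric] mult_1_left)
    qed
    define \<phi> where "\<phi> = \<zeta> * exp (pairing \<xi> \<kappa>)"
    have \<kappa>r: "norm \<kappa> \<le> r" "norm (- \<kappa>) \<le> r" unfolding \<kappa>_def using norm_Kr[OF \<rho>(2)] by auto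
    have "1 / cnj \<phi> = \<zeta> * exp (cnj (pairing \<xi> (- \<kappa>)))"
    proof -
      define E where "E = exp (cnj (pairing \<xi> \<kappa>))"
      have 1: "cnj \<zeta> * \<zeta> = 1" using \<zeta> by (simp add: complex_norm_square[symmetric] mult.commute)
      have 2: "cnj \<phi> = cnj \<zeta> * E" unfolding \<phi>_def E_def exp_cnj complex_cnj_mult ..
      have 3: "exp (cnj (pairing \<xi> (- \<kappa>))) = inverse E" unfolding E_def lin(4) complex_cnj_minus exp_minus ..
      have "\<zeta> * inverse E = (cnj \<zeta> * \<zeta>) / (cnj \<zeta> * E)"
        using \<zeta> by (subst mult_divide_mult_cancel_left) (auto simp: divide_inverse)
      then show ?thesis unfolding 1 2 3 by (rule sym)
    qed
    then have evBp: "pairing \<xi> (B (- \<kappa>)) = cnj (f (1 / cnj \<phi>))" using evB[OF \<kappa>r(2)] by simp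
    have "pairing \<xi> (Kminus \<rho>) = cnj (pairing \<xi> \<kappa>)"
      unfolding Kminus_symmetric[OF \<rho>_star] ev_star \<kappa>_def ..
    then have evBm: "pairing \<xi> (B (Kminus \<rho>)) = cnj (f \<phi>)"
      using evB[OF norm_Kr(2)[OF \<rho>(2)]] by (simp add: \<phi>_def)
    have evAk: "pairing \<xi> (A \<kappa>) = f \<phi>" using evA[OF \<kappa>r(1)] by (simp add: \<phi>_def)
    have evN: "pairing \<xi> (N \<rho>) = exp (- of_real pi * (f \<phi> * cnj (f \<phi>))) - exp (- of_real pi * (f \<phi> * cnj (f (1 / cnj \<phi>))))"
      unfolding N_def \<kappa>_def[symmetric] lin(2) ev lin(5) evBp evBm evAk by (simp add: scaleR_conv_of_real)
    have "pairing \<xi> (Y \<rho>) = - (J \<zeta> * pairing \<xi> (N \<rho>)) - pairing \<xi> \<beta> * pairing \<xi> \<rho>"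
      unfolding Y_def lin(2,4) ev evJ ..
    then have "J \<zeta> * pairing \<xi> (N \<rho>) = - of_real (2 * pi * t) + pairing \<xi> Q"
      unfolding Q_def lin(4,2) ev\<rho> by simp
    then show ?thesis
      unfolding \<xi>_def[symmetric] \<phi>_def[symmetric] evN using bound(1,2)[OF \<kappa>r(1)] evAk by (simp add: \<phi>_def)
  qed
  note main = this
  show thesis
  proof (rule that[OF R \<tau> _ _ Q])
    show "\<kappa> \<in> vanishing" unfolding \<kappa>_def by (rule vanishing_K(1)[OF \<rho>(1)])
    show "a < b \<Longrightarrow> coeff \<kappa> (a, b, k) = 0" for a b k by (simp add: \<kappa>_def coeff_Kplus)
    show "a < b \<Longrightarrow> coeff Q (a, b, k) = 0" for a b k
      unfolding Q_def coeff_simps(4) by (simp only: coeff_diff_symm minus_zero)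
    show "Re (coeff Q (a, a, k)) = 0" for a k
      unfolding Q_def coeff_simps(4) uminus_complex.simps by (simp only: coeff_diff_symm minus_zero)
  qed (use main in blast)
qed

end

section \<open>Double power series\<close>

text \<open>Power series in one complex and one real variable; \<open>dz\<close> and \<open>dt\<close> are the coefficients of the
  two partial derivatives.\<close>

definition dps :: "(nat \<times> nat \<Rightarrow> complex) \<Rightarrow> complex \<Rightarrow> real \<Rightarrow> complex" where
  "dps c \<zeta> t = (\<Sum>\<^sub>\<infinity>(n, k)\<in>UNIV. c (n, k) * \<zeta> ^ n * of_real t ^ k)"

definition dps_summable :: "(nat \<times> nat \<Rightarrow> complex) \<Rightarrow> real \<Rightarrow> real \<Rightarrow> bool" where
  "dps_summable c R \<tau> \<longleftrightarrow> (\<lambda>(n, k). norm (c (n, k)) * R ^ n * \<tau> ^ k) summable_on UNIV"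

definition dz :: "(nat \<times> nat \<Rightarrow> complex) \<Rightarrow> nat \<times> nat \<Rightarrow> complex" where
  "dz c = (\<lambda>(n, k). of_nat (Suc n) * c (Suc n, k))"
definition dt :: "(nat \<times> nat \<Rightarrow> complex) \<Rightarrow> nat \<times> nat \<Rightarrow> complex" where
  "dt c = (\<lambda>(n, k). of_nat (Suc k) * c (n, Suc k))"

lemma of_nat_power_le:
  fixes r R :: real
  assumes "0 \<le> r" "r < R"
  shows "real n * r ^ (n - 1) \<le> R ^ n / (R - r)"
proof -
  have "real n * r ^ (n - 1) * (R - r) \<le> R ^ n - r ^ n"
  proof (induction n)
    case (Suc n)
    have "real (Suc n) * r ^ (Suc n - 1) * (R - r) = r * (real n * r ^ (n - 1) * (R - r)) + r ^ n * (R - r)"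
      by (cases n) (simp_all add: algebra_simps)
    also have "\<dots> \<le> R * (R ^ n - r ^ n) + r ^ n * (R - r)"
      using Suc.IH assms power_mono[of r R n] by (intro add_mono mult_mono) auto
    also have "\<dots> = R ^ Suc n - r ^ Suc n" by (simp add: algebra_simps)
    finally show ?case .
  qed simp
  also have "\<dots> \<le> R ^ n" using assms by simp
  finally show ?thesis using assms by (simp add: pos_le_divide_eq)
qed

lemma sums_prod_decode:
  fixes f :: "nat \<times> nat \<Rightarrow> 'a::banach"
  assumes "(\<lambda>x. norm (f x)) summable_on UNIV"
  shows "(\<lambda>m. f (prod_decode m)) sums (\<Sum>\<^sub>\<infinity>x. f x)"
  using has_sum_infsum[OF abs_summable_summable[OF assms]]
  by (intro has_sum_imp_sums) (simp add: has_sum_reindex_bij_betw[OF bij_prod_decode])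

lemma dps_summable_term:
  assumes "dps_summable c R \<tau>" "norm \<zeta> \<le> R" "\<bar>t\<bar> \<le> \<tau>"
  shows "(\<lambda>x. norm (c x * \<zeta> ^ fst x * of_real t ^ snd x)) summable_on UNIV"
proof (rule summable_on_comparison_test[OF assms(1)[unfolded dps_summable_def]])
  fix x :: "nat \<times> nat"
  show "norm (c x * \<zeta> ^ fst x * of_real t ^ snd x) \<le> (case x of (n, k) \<Rightarrow> norm (c (n, k)) * R ^ n * \<tau> ^ k)"
    using assms(2,3) order_trans[OF norm_ge_zero assms(2)]
    by (cases x) (auto simp: norm_mult norm_power intro!: mult_mono mult_left_mono power_mono)
qed auto

lemma dps_sums:
  assumes "dps_summable c R \<tau>" "norm \<zeta> \<le> R" "\<bar>t\<bar> \<le> \<tau>"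
  shows "(\<lambda>m. case prod_decode m of (n, k) \<Rightarrow> c (n, k) * \<zeta> ^ n * of_real t ^ k) sums dps c \<zeta> t"
  using sums_prod_decode[OF dps_summable_term[OF assms]] unfolding dps_def by (simp add: case_prod_unfold)

lemma summable_shift_fst:
  fixes f :: "nat \<times> nat \<Rightarrow> 'a::banach"
  assumes "\<And>k. f (0, k) = 0"
  shows "(\<lambda>(n, k). f (Suc n, k)) summable_on UNIV \<longleftrightarrow> f summable_on UNIV"
    and "(\<Sum>\<^sub>\<infinity>(n, k). f (Suc n, k)) = (\<Sum>\<^sub>\<infinity>x. f x)"
proof -
  define h :: "nat \<times> nat \<Rightarrow> nat \<times> nat" where "h x = (Suc (fst x), snd x)" for x
  have inj: "inj h" by (auto simp: inj_on_def h_def prod_eq_iff)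
  have r: "x \<in> range h" if "fst x \<noteq> 0" for x
    using that by (intro image_eqI[where x = "(fst x - 1, snd x)"]) (auto simp: h_def)
  have fr: "f x = 0" if "x \<notin> range h" for x
    using r[of x] that assms[of "snd x"] by (cases x) auto
  have 1: "f summable_on range h \<longleftrightarrow> f summable_on UNIV"
    by (rule summable_on_cong_neutral) (use fr in auto)
  have 2: "infsum f (range h) = infsum f UNIV"
    by (rule infsum_cong_neutral) (use fr in auto)
  show "(\<lambda>(n, k). f (Suc n, k)) summable_on UNIV \<longleftrightarrow> f summable_on UNIV"
    using summable_on_reindex[OF inj, of f] unfolding 1 o_def h_def case_prod_unfold by (simp only:)
  show "(\<Sum>\<^sub>\<infinity>(n, k). f (Suc n, k)) = (\<Sum>\<^sub>\<infinity>x. f x)"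
    using infsum_reindex[OF inj, of f] unfolding 2 o_def h_def case_prod_unfold by (simp only:)
qed

lemma summable_shift_snd:
  fixes f :: "nat \<times> nat \<Rightarrow> 'a::banach"
  assumes "\<And>n. f (n, 0) = 0"
  shows "(\<lambda>(n, k). f (n, Suc k)) summable_on UNIV \<longleftrightarrow> f summable_on UNIV"
    and "(\<Sum>\<^sub>\<infinity>(n, k). f (n, Suc k)) = (\<Sum>\<^sub>\<infinity>x. f x)"
proof -
  have bij: "bij (prod.swap :: nat \<times> nat \<Rightarrow> nat \<times> nat)" by (rule bij_swap)
  show "(\<lambda>(n, k). f (n, Suc k)) summable_on UNIV \<longleftrightarrow> f summable_on UNIV"
    using summable_shift_fst(1)[of "\<lambda>x. f (prod.swap x)"] assms
      summable_on_reindex_bij_betw[OF bij, of f] summable_on_reindex_bij_betw[OF bij, of "\<lambda>(n, k). f (n, Suc k)"]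
    by (simp add: case_prod_unfold)
  show "(\<Sum>\<^sub>\<infinity>(n, k). f (n, Suc k)) = (\<Sum>\<^sub>\<infinity>x. f x)"
    using summable_shift_fst(2)[of "\<lambda>x. f (prod.swap x)"] assms
      infsum_reindex_bij_betw[OF bij, of f] infsum_reindex_bij_betw[OF bij, of "\<lambda>(n, k). f (n, Suc k)"]
    by (simp add: case_prod_unfold)
qed

lemma dps_term_bounds:
  assumes c: "dps_summable c R \<tau>" and r: "0 \<le> R1" "R1 < R" "0 \<le> \<tau>1" "\<tau>1 < \<tau>"
  obtains M where "M summable_on UNIV"
    "\<And>n k z x. norm z \<le> R1 \<Longrightarrow> \<bar>x\<bar> \<le> \<tau>1 \<Longrightarrow> norm (c (n, k) * (of_nat n * z ^ (n - 1)) * of_real x ^ k) \<le> M (n, k)"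
    "\<And>n k z x. norm z \<le> R1 \<Longrightarrow> \<bar>x\<bar> \<le> \<tau>1 \<Longrightarrow> norm (c (n, k) * z ^ n * (of_nat k * of_real x ^ (k - 1))) \<le> M (n, k)"
proof -
  define C where "C = 1 / (R - R1) + 1 / (\<tau> - \<tau>1)"
  have C: "1 / (R - R1) \<le> C" "1 / (\<tau> - \<tau>1) \<le> C" using r by (auto simp: C_def)
  define M where "M = (\<lambda>(n, k). norm (c (n, k)) * R ^ n * \<tau> ^ k * C)"
  have "M summable_on UNIV"
    using summable_on_cmult_left[OF c[unfolded dps_summable_def], of C] by (simp add: M_def case_prod_unfold)
  moreover have "norm (c (n, k) * (of_nat n * z ^ (n - 1)) * of_real x ^ k) \<le> M (n, k)"
    if "norm z \<le> R1" "\<bar>x\<bar> \<le> \<tau>1" for n k z x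
  proof -
    have "real n * norm z ^ (n - 1) \<le> real n * R1 ^ (n - 1)" using that by (intro mult_left_mono power_mono) auto
    also have "\<dots> \<le> R ^ n * (1 / (R - R1))" using of_nat_power_le[OF r(1,2), of n] by simp
    also have "\<dots> \<le> R ^ n * C" using C r by (intro mult_left_mono) auto
    finally have 1: "real n * norm z ^ (n - 1) \<le> R ^ n * C" .
    have 2: "\<bar>x\<bar> ^ k \<le> \<tau> ^ k" using that r by (intro power_mono) auto
    have "norm (c (n, k)) * ((real n * norm z ^ (n - 1)) * \<bar>x\<bar> ^ k) \<le> norm (c (n, k)) * ((R ^ n * C) * \<tau> ^ k)"
      using r by (intro mult_left_mono mult_mono 1 2) (auto simp: C_def)
    then show ?thesis by (simp add: M_def norm_mult norm_power mult_ac)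
  qed
  moreover have "norm (c (n, k) * z ^ n * (of_nat k * of_real x ^ (k - 1))) \<le> M (n, k)"
    if "norm z \<le> R1" "\<bar>x\<bar> \<le> \<tau>1" for n k z x
  proof -
    have "real k * \<bar>x\<bar> ^ (k - 1) \<le> real k * \<tau>1 ^ (k - 1)" using that by (intro mult_left_mono power_mono) auto
    also have "\<dots> \<le> \<tau> ^ k * (1 / (\<tau> - \<tau>1))" using of_nat_power_le[OF r(3,4), of k] by simp
    also have "\<dots> \<le> \<tau> ^ k * C" using C r by (intro mult_left_mono) auto
    finally have 1: "real k * \<bar>x\<bar> ^ (k - 1) \<le> \<tau> ^ k * C" .
    have 2: "norm z ^ n \<le> R ^ n" using that r by (intro power_mono) auto
    have "norm (c (n, k)) * (norm z ^ n * (real k * \<bar>x\<bar> ^ (k - 1))) \<le> norm (c (n, k)) * (R ^ n * (\<tau> ^ k * C))"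
      using r by (intro mult_left_mono mult_mono 1 2) (auto simp: C_def)
    then show ?thesis by (simp add: M_def norm_mult norm_power mult_ac)
  qed
  ultimately show thesis by (rule that)
qed

lemma dps_derivs:
  assumes c: "dps_summable c R \<tau>" and r: "0 \<le> R1" "R1 < R" "0 \<le> \<tau>1" "\<tau>1 < \<tau>"
  shows "dps_summable (dz c) R1 \<tau>1" "dps_summable (dt c) R1 \<tau>1"
    and "norm z \<le> R1 \<Longrightarrow> \<bar>x\<bar> \<le> \<tau>1 \<Longrightarrow>
      (\<lambda>m. case prod_decode m of (n, k) \<Rightarrow> c (n, k) * (of_nat n * z ^ (n - 1)) * of_real x ^ k) sums dps (dz c) z x"
    and "norm z \<le> R1 \<Longrightarrow> \<bar>x\<bar> \<le> \<tau>1 \<Longrightarrow>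
      (\<lambda>m. case prod_decode m of (n, k) \<Rightarrow> c (n, k) * z ^ n * (of_nat k * of_real x ^ (k - 1))) sums dps (dt c) z x"
proof -
  obtain M where M: "M summable_on UNIV"
    and 1: "\<And>n k z x. norm z \<le> R1 \<Longrightarrow> \<bar>x\<bar> \<le> \<tau>1 \<Longrightarrow> norm (c (n, k) * (of_nat n * z ^ (n - 1)) * of_real x ^ k) \<le> M (n, k)"
    and 2: "\<And>n k z x. norm z \<le> R1 \<Longrightarrow> \<bar>x\<bar> \<le> \<tau>1 \<Longrightarrow> norm (c (n, k) * z ^ n * (of_nat k * of_real x ^ (k - 1))) \<le> M (n, k)"
    using dps_term_bounds[OF assms] by blast
  have s1: "(\<lambda>p. norm (case p of (n, k) \<Rightarrow> c (n, k) * (of_nat n * z ^ (n - 1)) * of_real x ^ k)) summable_on UNIV"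
    and s2: "(\<lambda>p. norm (case p of (n, k) \<Rightarrow> c (n, k) * z ^ n * (of_nat k * of_real x ^ (k - 1)))) summable_on UNIV"
    if "norm z \<le> R1" "\<bar>x\<bar> \<le> \<tau>1" for z x
    by (rule summable_on_comparison_test[OF M]; use 1 2 that in \<open>auto split: prod.splits\<close>)+
  have n1: "norm (of_real R1 :: complex) \<le> R1" "\<bar>\<tau>1\<bar> \<le> \<tau>1" using r by auto
  show "dps_summable (dz c) R1 \<tau>1"
    using s1[OF n1] summable_shift_fst(1)[of "\<lambda>p. norm (case p of (n, k) \<Rightarrow> c (n, k) * (of_nat n * of_real R1 ^ (n - 1)) * of_real \<tau>1 ^ k)"] r
    by (simp add: dps_summable_def dz_def norm_mult norm_power case_prod_unfold mult_ac del: of_nat_Suc)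
  show "dps_summable (dt c) R1 \<tau>1"
    using s2[OF n1] summable_shift_snd(1)[of "\<lambda>p. norm (case p of (n, k) \<Rightarrow> c (n, k) * of_real R1 ^ n * (of_nat k * of_real \<tau>1 ^ (k - 1)))"] r
    by (simp add: dps_summable_def dt_def norm_mult norm_power case_prod_unfold mult_ac del: of_nat_Suc)
  assume zx: "norm z \<le> R1" "\<bar>x\<bar> \<le> \<tau>1"
  show "(\<lambda>m. case prod_decode m of (n, k) \<Rightarrow> c (n, k) * (of_nat n * z ^ (n - 1)) * of_real x ^ k) sums dps (dz c) z x"
    using sums_prod_decode[OF s1[OF zx]] summable_shift_fst(2)[of "\<lambda>(n, k). c (n, k) * (of_nat n * z ^ (n - 1)) * of_real x ^ k"]
    by (simp add: dps_def dz_def case_prod_unfold mult_ac del: of_nat_Suc)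
  show "(\<lambda>m. case prod_decode m of (n, k) \<Rightarrow> c (n, k) * z ^ n * (of_nat k * of_real x ^ (k - 1))) sums dps (dt c) z x"
    using sums_prod_decode[OF s2[OF zx]] summable_shift_snd(2)[of "\<lambda>(n, k). c (n, k) * z ^ n * (of_nat k * of_real x ^ (k - 1))"]
    by (simp add: dps_def dt_def case_prod_unfold mult_ac del: of_nat_Suc)
qed

lemma dps_has_derivative:
  assumes c: "dps_summable c R \<tau>" and z: "norm \<zeta> < R" "\<bar>t\<bar> < \<tau>"
  shows "((\<lambda>(z, x). dps c z x) has_derivative (\<lambda>(h, l). dps (dz c) \<zeta> t * h + dps (dt c) \<zeta> t * of_real l)) (at (\<zeta>, t))"
proof -
  obtain R1 where R1: "norm \<zeta> < R1" "R1 < R" using dense[OF z(1)] by blast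
  obtain \<tau>1 where \<tau>1: "\<bar>t\<bar> < \<tau>1" "\<tau>1 < \<tau>" using dense[OF z(2)] by blast
  have r: "0 \<le> R1" "R1 < R" "0 \<le> \<tau>1" "\<tau>1 < \<tau>"
    using R1 \<tau>1 norm_ge_zero[of \<zeta>] abs_ge_zero[of t] by linarith+
  define S where "S = ball (0::complex) R1 \<times> {-\<tau>1<..<\<tau>1}"
  have S: "convex S" "open S" "(\<zeta>, t) \<in> S"
    unfolding S_def using R1 \<tau>1 by (auto intro!: convex_Times open_Times)
  obtain M where M: "M summable_on UNIV"
    and 1: "\<And>n k z x. norm z \<le> R1 \<Longrightarrow> \<bar>x\<bar> \<le> \<tau>1 \<Longrightarrow> norm (c (n, k) * (of_nat n * z ^ (n - 1)) * of_real x ^ k) \<le> M (n, k)"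
    and 2: "\<And>n k z x. norm z \<le> R1 \<Longrightarrow> \<bar>x\<bar> \<le> \<tau>1 \<Longrightarrow> norm (c (n, k) * z ^ n * (of_nat k * of_real x ^ (k - 1))) \<le> M (n, k)"
    using dps_term_bounds[OF c r] by blast
  have inS: "norm (fst p) \<le> R1" "\<bar>snd p\<bar> \<le> \<tau>1" if "p \<in> S" for p using that by (auto simp: S_def)
  have "M (n, k) \<ge> 0" for n k using order_trans[OF norm_ge_zero 1[of 0 0]] r by simp
  then have "norm (M x) = M x" for x by (cases x) auto
  then have "(\<lambda>x. norm (M x)) summable_on UNIV" using M by simp
  from sums_summable[OF sums_prod_decode[OF this]] have sM: "summable (\<lambda>m. M (prod_decode m))" by simp
  define A where "A m p = (case prod_decode m of (n, k) \<Rightarrow> c (n, k) * (of_nat n * fst p ^ (n - 1)) * of_real (snd p) ^ k)" for m and p :: "complex \<times> real"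
  define B where "B m p = (case prod_decode m of (n, k) \<Rightarrow> c (n, k) * fst p ^ n * (of_nat k * of_real (snd p) ^ (k - 1)))" for m and p :: "complex \<times> real"
  define F where "F m p = (case prod_decode m of (n, k) \<Rightarrow> c (n, k) * fst p ^ n * of_real (snd p) ^ k)" for m and p :: "complex \<times> real"
  have sA: "(\<lambda>m. A m p) sums dps (dz c) (fst p) (snd p)" and sB: "(\<lambda>m. B m p) sums dps (dt c) (fst p) (snd p)" if "p \<in> S" for p
    unfolding A_def B_def using dps_derivs(3,4)[OF c r inS[OF that]] by auto
  have uA: "uniform_limit S (\<lambda>n p. \<Sum>i<n. A i p) (\<lambda>p. suminf (\<lambda>i. A i p)) sequentially"
  proof (rule Weierstrass_m_test[OF _ sM])
    fix m p assume p: "p \<in> S"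
    show "norm (A m p) \<le> M (prod_decode m)"
      using 1[OF inS[OF p], of "fst (prod_decode m)" "snd (prod_decode m)"] by (simp add: A_def case_prod_unfold)
  qed
  have uB: "uniform_limit S (\<lambda>n p. \<Sum>i<n. B i p) (\<lambda>p. suminf (\<lambda>i. B i p)) sequentially"
  proof (rule Weierstrass_m_test[OF _ sM])
    fix m p assume p: "p \<in> S"
    show "norm (B m p) \<le> M (prod_decode m)"
      using 2[OF inS[OF p], of "fst (prod_decode m)" "snd (prod_decode m)"] by (simp add: B_def case_prod_unfold)
  qed
  have "\<exists>g. \<forall>p\<in>S. (\<lambda>m. F m p) sums (g p) \<and>
     (g has_derivative (\<lambda>(h, l). dps (dz c) (fst p) (snd p) * h + dps (dt c) (fst p) (snd p) * of_real l)) (at p within S)"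
  proof (rule has_derivative_series[OF S(1) _ _ S(3), where f' = "\<lambda>m p (h, l). A m p * h + B m p * of_real l"])
    show "(F m has_derivative (\<lambda>(h, l). A m p * h + B m p * of_real l)) (at p within S)" if "p \<in> S" for m p
    proof -
      obtain n k where m: "prod_decode m = (n, k)" by (cases "prod_decode m")
      have "((\<lambda>p. c (n, k) * fst p ^ n * of_real (snd p) ^ k) has_derivative
        (\<lambda>q. c (n, k) * (of_nat n * fst q * fst p ^ (n - 1)) * of_real (snd p) ^ k
           + c (n, k) * fst p ^ n * (of_nat k * of_real (snd q) * of_real (snd p) ^ (k - 1)))) (at p within S)"
        by (rule has_derivative_eq_rhs, (rule derivative_intros)+) (auto simp: fun_eq_iff)
      then show ?thesis
        unfolding F_def A_def B_def m by (simp add: case_prod_unfold mult_ac)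
    qed
    fix e :: real assume e: "e > 0"
    have "\<forall>\<^sub>F n in sequentially. \<forall>p\<in>S. dist (\<Sum>i<n. A i p) (suminf (\<lambda>i. A i p)) < e / 2"
      using uA e unfolding uniform_limit_iff by (simp only: half_gt_zero)
    moreover have "\<forall>\<^sub>F n in sequentially. \<forall>p\<in>S. dist (\<Sum>i<n. B i p) (suminf (\<lambda>i. B i p)) < e / 2"
      using uB e unfolding uniform_limit_iff by (simp only: half_gt_zero)
    ultimately show "\<forall>\<^sub>F n in sequentially. \<forall>p\<in>S. \<forall>h. norm ((\<Sum>i<n. case h of (h, l) \<Rightarrow> A i p * h + B i p * of_real l) -
        (case h of (h, l) \<Rightarrow> dps (dz c) (fst p) (snd p) * h + dps (dt c) (fst p) (snd p) * of_real l)) \<le> e * norm h"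
    proof eventually_elim
      case (elim n)
      show ?case
      proof (intro ballI allI)
        fix p and q :: "complex \<times> real" assume p: "p \<in> S"
        let ?a = "(\<Sum>i<n. A i p) - dps (dz c) (fst p) (snd p)" and ?b = "(\<Sum>i<n. B i p) - dps (dt c) (fst p) (snd p)"
        have ab: "norm ?a \<le> e / 2" "norm ?b \<le> e / 2"
          using elim p sums_unique[OF sA[OF p]] sums_unique[OF sB[OF p]] by (auto simp: dist_norm less_imp_le)
        have "(\<Sum>i<n. case q of (h, l) \<Rightarrow> A i p * h + B i p * of_real l) -
          (case q of (h, l) \<Rightarrow> dps (dz c) (fst p) (snd p) * h + dps (dt c) (fst p) (snd p) * of_real l)
          = ?a * fst q + ?b * of_real (snd q)"
          by (simp add: case_prod_unfold sum.distrib sum_distrib_right left_diff_distrib)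
        also have "norm \<dots> \<le> norm ?a * norm (fst q) + norm ?b * norm (snd q)"
          by (rule order_trans[OF norm_triangle_ineq]) (simp add: norm_mult)
        also have "\<dots> \<le> e / 2 * norm q + e / 2 * norm q"
          using e norm_fst_le[of "fst q" "snd q"] norm_snd_le[of "snd q" "fst q"]
          by (intro add_mono mult_mono ab) auto
        finally show "norm ((\<Sum>i<n. case q of (h, l) \<Rightarrow> A i p * h + B i p * of_real l) -
          (case q of (h, l) \<Rightarrow> dps (dz c) (fst p) (snd p) * h + dps (dt c) (fst p) (snd p) * of_real l)) \<le> e * norm q" by simp
      qed
    qed
  next
    show "(\<lambda>m. F m (\<zeta>, t)) sums dps c \<zeta> t"
      unfolding F_def using dps_sums[OF c, of \<zeta> t] z by simp
  qed
  then obtain g where g: "\<And>p. p \<in> S \<Longrightarrow> (\<lambda>m. F m p) sums (g p)"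
    "\<And>p. p \<in> S \<Longrightarrow> (g has_derivative (\<lambda>(h, l). dps (dz c) (fst p) (snd p) * h + dps (dt c) (fst p) (snd p) * of_real l)) (at p within S)"
    by blast
  have gd: "g p = (case p of (z, x) \<Rightarrow> dps c z x)" if "p \<in> S" for p
  proof -
    have "(\<lambda>m. F m p) sums dps c (fst p) (snd p)"
      unfolding F_def using inS[OF that] r by (intro dps_sums[OF c]) auto
    with g(1)[OF that] show ?thesis by (simp add: sums_iff case_prod_unfold)
  qed
  have "(g has_derivative (\<lambda>(h, l). dps (dz c) \<zeta> t * h + dps (dt c) \<zeta> t * of_real l)) (at (\<zeta>, t))"
    using g(2)[OF S(3)] at_within_open[OF S(3) S(2)] by simp
  then show ?thesis
    by (rule has_derivative_transform_within_open[OF _ S(2,3)]) (rule gd)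
qed

lemma dps_continuous:
  assumes c: "dps_summable c R \<tau>"
  shows "continuous_on (ball 0 R \<times> {-\<tau><..<\<tau>}) (\<lambda>(z, x). dps c z x)"
  by (intro continuous_at_imp_continuous_on ballI)
     (auto intro!: has_derivative_continuous dps_has_derivative[OF c] simp: abs_less_iff)

lemma dps_derivs_continuous:
  assumes c: "dps_summable c R \<tau>"
  shows "continuous_on (ball 0 R \<times> {-\<tau><..<\<tau>}) (\<lambda>(z, x). dps (dz c) z x)"
    and "continuous_on (ball 0 R \<times> {-\<tau><..<\<tau>}) (\<lambda>(z, x). dps (dt c) z x)"
proof -
  have *: "isCont (\<lambda>(z, x). dps (dz c) z x) (z, x) \<and> isCont (\<lambda>(z, x). dps (dt c) z x) (z, x)"
    if z: "norm z < R" "\<bar>x\<bar> < \<tau>" for z x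
  proof -
    obtain R1 where R1: "norm z < R1" "R1 < R" using dense[OF z(1)] by blast
    obtain \<tau>1 where \<tau>1: "\<bar>x\<bar> < \<tau>1" "\<tau>1 < \<tau>" using dense[OF z(2)] by blast
    have r: "0 \<le> R1" "0 \<le> \<tau>1" using R1 \<tau>1 norm_ge_zero[of z] abs_ge_zero[of x] by linarith+
    show ?thesis
      using dps_has_derivative[OF dps_derivs(1)[OF c r(1) R1(2) r(2) \<tau>1(2)] R1(1) \<tau>1(1)]
        dps_has_derivative[OF dps_derivs(2)[OF c r(1) R1(2) r(2) \<tau>1(2)] R1(1) \<tau>1(1)]
      by (auto intro: has_derivative_continuous)
  qed
  show "continuous_on (ball 0 R \<times> {-\<tau><..<\<tau>}) (\<lambda>(z, x). dps (dz c) z x)"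
    "continuous_on (ball 0 R \<times> {-\<tau><..<\<tau>}) (\<lambda>(z, x). dps (dt c) z x)"
    using * by (intro continuous_at_imp_continuous_on ballI; force simp: abs_less_iff)+
qed

lemma dps_field_derivative:
  assumes c: "dps_summable c R \<tau>" and z: "norm \<zeta> < R" "\<bar>t\<bar> < \<tau>"
  shows "((\<lambda>z. dps c z t) has_field_derivative dps (dz c) \<zeta> t) (at \<zeta>)"
proof -
  have "((\<lambda>z. (z, t)) has_derivative (\<lambda>h. (h, 0))) (at \<zeta>)" by (auto intro!: derivative_eq_intros)
  from has_derivative_compose[OF this dps_has_derivative[OF c z]] show ?thesis
    by (simp add: has_field_derivative_def)
qed

lemma dps_vector_derivative:
  assumes c: "dps_summable c R \<tau>" and z: "norm \<zeta> < R" "\<bar>t\<bar> < \<tau>"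
  shows "((\<lambda>x. dps c \<zeta> x) has_vector_derivative dps (dt c) \<zeta> t) (at t)"
proof -
  have "((\<lambda>x. (\<zeta>, x)) has_derivative (\<lambda>h. (0, h))) (at t)" by (auto intro!: derivative_eq_intros)
  from has_derivative_compose[OF this dps_has_derivative[OF c z]] show ?thesis
    by (simp add: has_vector_derivative_def scaleR_conv_of_real mult.commute)
qed

lemma dps_dt_holomorphic:
  assumes c: "dps_summable c R \<tau>" and t: "\<bar>t\<bar> < \<tau>"
  shows "(\<lambda>z. dps (dt c) z t) holomorphic_on ball 0 R" "(\<lambda>z. dps c z t) holomorphic_on ball 0 R"
    "(\<lambda>z. dps (dz c) z t) holomorphic_on ball 0 R"
proof -
  have *: "(\<lambda>z. dps (dt c) z t) field_differentiable at z \<and> (\<lambda>z. dps (dz c) z t) field_differentiable at z"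
    if z: "norm z < R" for z
  proof -
    obtain R1 where R1: "norm z < R1" "R1 < R" using dense[OF z(1)] by blast
    obtain \<tau>1 where \<tau>1: "\<bar>t\<bar> < \<tau>1" "\<tau>1 < \<tau>" using dense[OF t] by blast
    have r: "0 \<le> R1" "0 \<le> \<tau>1" using R1 \<tau>1 norm_ge_zero[of z] abs_ge_zero[of t] by linarith+
    show ?thesis
      using dps_field_derivative[OF dps_derivs(2)[OF c r(1) R1(2) r(2) \<tau>1(2)] R1(1) \<tau>1(1)]
        dps_field_derivative[OF dps_derivs(1)[OF c r(1) R1(2) r(2) \<tau>1(2)] R1(1) \<tau>1(1)]
      by (auto simp: field_differentiable_def)
  qed
  show "(\<lambda>z. dps (dt c) z t) holomorphic_on ball 0 R" "(\<lambda>z. dps (dz c) z t) holomorphic_on ball 0 R"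
    using * by (auto simp: holomorphic_on_def field_differentiable_at_within)
  show "(\<lambda>z. dps c z t) holomorphic_on ball 0 R"
  proof (rule holomorphic_on_open[OF open_ball, THEN iffD2], intro ballI exI)
    fix z :: complex assume "z \<in> ball 0 R"
    then show "((\<lambda>z. dps c z t) has_field_derivative dps (dz c) z t) (at z)"
      by (intro dps_field_derivative[OF c _ t]) simp
  qed
qed

section \<open>From the algebra to analytic functions\<close>

text \<open>On the circle \<open>\<zeta> ^ (n + b) * cnj \<zeta> ^ b = \<zeta> ^ n\<close>, so an element without modes \<open>a < b\<close> is an honest power
  series in \<open>\<zeta>\<close> and \<open>t\<close>: all monomials of equal mode are collected.\<close>

definition dcoef :: "real \<Rightarrow> real \<Rightarrow> index ell1 \<Rightarrow> nat \<times> nat \<Rightarrow> complex" where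
  "dcoef R \<tau> p = (\<lambda>(n, k). \<Sum>\<^sub>\<infinity>b. coeff p (n + b, b, k) / (of_real R ^ (n + 2 * b) * of_real \<tau> ^ k))"

lemma dcoef:
  assumes R: "1 \<le> R" "0 < \<tau>" and p: "\<And>a b k. a < b \<Longrightarrow> coeff p (a, b, k) = 0"
  shows "dps_summable (dcoef R \<tau> p) R \<tau>"
    and "norm \<zeta> = 1 \<Longrightarrow> \<bar>t\<bar> \<le> \<tau> \<Longrightarrow> pairing (chi R \<tau> \<zeta> t) p = dps (dcoef R \<tau> p) \<zeta> t"
proof -
  define h :: "(nat \<times> nat) \<times> nat \<Rightarrow> index" where "h x = (fst (fst x) + snd x, snd x, snd (fst x))" for x
  have inj: "inj h" by (auto simp: inj_on_def h_def prod_eq_iff)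
  have r: "(a, b, k) \<in> range h" if "b \<le> a" for a b k
    using that by (intro image_eqI[where x = "((a - b, k), b)"]) (auto simp: h_def)
  have 0: "coeff p i = 0" if "i \<notin> range h" for i
    using that r[of "fst (snd i)" "fst i" "snd (snd i)"] p[of "fst i" "fst (snd i)" "snd (snd i)"]
    by (cases "fst i < fst (snd i)") auto
  define g where "g x = coeff p (h x) / (of_real R ^ (fst (fst x) + 2 * snd x) * of_real \<tau> ^ snd (fst x))" for x
  have s0: "(\<lambda>x. norm (coeff p (h x))) summable_on UNIV"
    using summable_on_reindex[OF inj, of "\<lambda>i. norm (coeff p i)"] coeff_summable_norm[of p "range h"] by (simp add: o_def)
  have gle: "norm (g x) * R ^ fst (fst x) * \<tau> ^ snd (fst x) \<le> norm (coeff p (h x))" for x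
  proof -
    have "norm (g x) * R ^ fst (fst x) * \<tau> ^ snd (fst x) = norm (coeff p (h x)) / R ^ (2 * snd x)"
      using R by (simp add: g_def norm_divide norm_mult norm_power power_add)
    also have "\<dots> \<le> norm (coeff p (h x)) / 1" using R by (intro divide_left_mono) auto
    finally show ?thesis by simp
  qed
  have s1: "(\<lambda>((n, k), b). norm (g ((n, k), b)) * R ^ n * \<tau> ^ k) summable_on (UNIV \<times> UNIV)"
    using summable_on_comparison_test[OF s0, of "\<lambda>x. norm (g x) * R ^ fst (fst x) * \<tau> ^ snd (fst x)"] gle R
    by (simp add: case_prod_unfold)
  have s1': "(\<lambda>(y, b). norm (g (y, b)) * R ^ fst y * \<tau> ^ snd y) summable_on Sigma UNIV (\<lambda>_. UNIV)"
    using s1 by (simp add: case_prod_unfold)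
  have dc: "dcoef R \<tau> p y = (\<Sum>\<^sub>\<infinity>b. g (y, b))" for y
    by (cases y) (simp add: dcoef_def g_def h_def)
  have sb: "(\<lambda>b. norm (g (y, b))) summable_on UNIV" for y
  proof -
    have "(\<lambda>b. norm (g (y, b)) * R ^ fst y * \<tau> ^ snd y) summable_on UNIV"
      using summable_on_SigmaD1[OF s1', of y] by simp
    from summable_on_cmult_left[OF this, of "1 / (R ^ fst y * \<tau> ^ snd y)"] show ?thesis using R by simp
  qed
  show "dps_summable (dcoef R \<tau> p) R \<tau>"
    unfolding dps_summable_def
  proof (rule summable_on_comparison_test[OF summable_on_Sigma_banach[OF s1']])
    fix y :: "nat \<times> nat"
    have "norm (dcoef R \<tau> p y) \<le> (\<Sum>\<^sub>\<infinity>b. norm (g (y, b)))"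
      unfolding dc by (rule norm_infsum_bound[OF sb])
    then have "norm (dcoef R \<tau> p y) * (R ^ fst y * \<tau> ^ snd y) \<le> (\<Sum>\<^sub>\<infinity>b. norm (g (y, b))) * (R ^ fst y * \<tau> ^ snd y)"
      using R by (intro mult_right_mono) auto
    also have "\<dots> = (\<Sum>\<^sub>\<infinity>b. norm (g (y, b)) * R ^ fst y * \<tau> ^ snd y)"
      by (simp add: infsum_cmult_left'[symmetric] mult.assoc)
    finally show "(case y of (n, k) \<Rightarrow> norm (dcoef R \<tau> p (n, k)) * R ^ n * \<tau> ^ k) \<le> (\<Sum>\<^sub>\<infinity>b. norm (g (y, b)) * R ^ fst y * \<tau> ^ snd y)"
      by (cases y) (simp add: mult.assoc)
  qed (use R in auto)
  assume \<zeta>: "norm \<zeta> = 1" and t: "\<bar>t\<bar> \<le> \<tau>"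
  have b: "norm (chi R \<tau> \<zeta> t i) \<le> 1" for i using \<zeta> t R by (intro norm_chi_le) auto
  have zz: "(\<zeta> * cnj \<zeta>) ^ n = 1" for n using \<zeta> by (simp add: complex_norm_square[symmetric])
  have chi: "coeff p (h x) * chi R \<tau> \<zeta> t (h x) = g x * \<zeta> ^ fst (fst x) * of_real t ^ snd (fst x)" for x
  proof -
    have "chi R \<tau> \<zeta> t (h x) = (\<zeta> ^ fst (fst x) * (\<zeta> * cnj \<zeta>) ^ snd x * of_real t ^ snd (fst x)) / (of_real R ^ (fst (fst x) + 2 * snd x) * of_real \<tau> ^ snd (fst x))"
      using R by (simp add: chi_def h_def power_divide power_add power_mult_distrib mult_2 of_real_divide divide_simps)
    then show ?thesis unfolding zz g_def by simp
  qed
  have "pairing (chi R \<tau> \<zeta> t) p = (\<Sum>\<^sub>\<infinity>i\<in>range h. coeff p i * chi R \<tau> \<zeta> t i)"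
    unfolding pairing_def by (rule infsum_cong_neutral) (use 0 in auto)
  also have "\<dots> = (\<Sum>\<^sub>\<infinity>x. coeff p (h x) * chi R \<tau> \<zeta> t (h x))"
    by (subst infsum_reindex[OF inj]) (simp add: o_def)
  also have "\<dots> = (\<Sum>\<^sub>\<infinity>(y, b)\<in>Sigma UNIV (\<lambda>_. UNIV). g (y, b) * \<zeta> ^ fst y * of_real t ^ snd y)"
    unfolding chi by (simp add: case_prod_unfold)
  also have "\<dots> = (\<Sum>\<^sub>\<infinity>y. \<Sum>\<^sub>\<infinity>b. g (y, b) * \<zeta> ^ fst y * of_real t ^ snd y)"
  proof (rule infsum_Sigma'_banach[symmetric])
    have "(\<lambda>x. coeff p (h x) * chi R \<tau> \<zeta> t (h x)) summable_on UNIV"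
      using summable_on_reindex[OF inj, of "\<lambda>i. coeff p i * chi R \<tau> \<zeta> t i"] summable_pairing(2)[where \<xi> = "chi R \<tau> \<zeta> t" and f = p and A = "range h", OF b]
      by (simp add: o_def)
    then show "(\<lambda>(y, b). g (y, b) * \<zeta> ^ fst y * of_real t ^ snd y) summable_on Sigma UNIV (\<lambda>_. UNIV)"
      unfolding chi by (simp add: case_prod_unfold)
  qed
  also have "\<dots> = dps (dcoef R \<tau> p) \<zeta> t"
    unfolding dps_def dc by (simp add: infsum_cmult_left' mult.assoc case_prod_unfold)
  finally show "pairing (chi R \<tau> \<zeta> t) p = dps (dcoef R \<tau> p) \<zeta> t" .
qed

lemma dcoef_vanishing: "p \<in> vanishing \<Longrightarrow> dcoef R \<tau> p (n, 0) = 0"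
  by (simp add: dcoef_def vanishing_def)

lemma dcoef_imaginary:
  assumes "\<And>a k. Re (coeff p (a, a, k)) = 0" "1 \<le> R" "0 < \<tau>"
  shows "Re (dcoef R \<tau> p (0, k)) = 0"
proof (cases "(\<lambda>b. coeff p (0 + b, b, k) / (of_real R ^ (0 + 2 * b) * of_real \<tau> ^ k)) summable_on UNIV")
  case True
  have "Re (dcoef R \<tau> p (0, k)) = (\<Sum>\<^sub>\<infinity>b. Re (coeff p (0 + b, b, k) / (of_real R ^ (0 + 2 * b) * of_real \<tau> ^ k)))"
    unfolding dcoef_def by (simp add: infsum_Re[OF True, simplified])
  also have "\<dots> = 0"
  proof (rule infsum_0)
    fix b
    show "Re (coeff p (0 + b, b, k) / (of_real R ^ (0 + 2 * b) * of_real \<tau> ^ k)) = 0"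
      using assms(1)[of b k] by (simp flip: of_real_power of_real_mult)
  qed
  finally show ?thesis .
next
  case False
  then show ?thesis by (simp add: dcoef_def infsum_not_exists)
qed

lemma has_sum_Times:
  fixes f :: "'a \<Rightarrow> complex" and g :: "'b \<Rightarrow> complex"
  assumes "(\<lambda>x. norm (f x)) summable_on UNIV" "(\<lambda>x. norm (g x)) summable_on UNIV"
  shows "(\<Sum>\<^sub>\<infinity>(x, y). f x * g y) = infsum f UNIV * infsum g UNIV"
proof -
  have "(\<lambda>p. norm (case p of (x, y) \<Rightarrow> f x * g y)) summable_on UNIV"
    using abs_summable_Times[OF assms] by (simp add: case_prod_unfold)
  then have "(\<lambda>(x, y). f x * g y) summable_on (UNIV \<times> UNIV)"
    using abs_summable_summable by (simp add: case_prod_unfold)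
  from infsum_Sigma'_banach[OF this] show ?thesis
    by (simp add: infsum_cmult_right' infsum_cmult_left')
qed

lemma binomial_has_sum:
  fixes x h :: "'a::{real_normed_field,banach}"
  shows "(\<lambda>m. norm (of_nat (k choose m) * x ^ (k - m) * h ^ m)) summable_on UNIV"
    "((\<lambda>m. of_nat (k choose m) * x ^ (k - m) * h ^ m) has_sum (x + h) ^ k) UNIV"
proof -
  have e: "(x + h) ^ k = (\<Sum>m\<le>k. of_nat (k choose m) * x ^ (k - m) * h ^ m)"
    unfolding add.commute[of x h] binomial_ring by (simp add: mult_ac)
  show "((\<lambda>m. of_nat (k choose m) * x ^ (k - m) * h ^ m) has_sum (x + h) ^ k) UNIV"
    unfolding e by (rule has_sum_finite_neutralI[of "{..k}"]) (auto simp: binomial_eq_0)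
  show "(\<lambda>m. norm (of_nat (k choose m) * x ^ (k - m) * h ^ m)) summable_on UNIV"
    by (rule summable_on_cong_neutral[THEN iffD2, OF _ _ _ summable_on_finite[of "{..k}"]]) (auto simp: binomial_eq_0)
qed

lemma exp_has_sum:
  fixes z :: "'a::{real_normed_field,banach}"
  shows "(\<lambda>n. norm (z ^ n /\<^sub>R fact n)) summable_on UNIV" "((\<lambda>n. z ^ n /\<^sub>R fact n) has_sum exp z) UNIV"
proof -
  show "(\<lambda>n. norm (z ^ n /\<^sub>R fact n)) summable_on UNIV"
    using summable_norm_exp[of z] by (intro norm_summable_imp_summable_on) simp
  show "((\<lambda>n. z ^ n /\<^sub>R fact n) has_sum exp z) UNIV"
    using summable_norm_exp[of z] exp_converges[of z] by (intro norm_summable_imp_has_sum) auto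
qed

text \<open>Substituting \<open>\<zeta> = cis (2 * pi * (s + k))\<close> and \<open>t + h\<close> into a monomial gives an exponential in
  \<open>k\<close> and a binomial in \<open>h\<close>. For \<open>\<bar>k\<bar>\<close> below \<open>ln R / (2 * pi)\<close> the growth of the exponentials is absorbed by
  the powers of \<open>R\<close>, so the resulting multiple series may be rearranged into a double power series.\<close>

lemma real_analytic2_pairing:
  assumes R: "1 < R" and \<tau>: "0 < \<tau>"
  shows "real_analytic2_on ({-\<tau><..<\<tau>} \<times> UNIV) (\<lambda>t s. pairing (chi R \<tau> (cis (2 * pi * s)) t) p)"
  unfolding real_analytic2_on_def
proof clarify
  fix t s :: real assume t: "t \<in> {-\<tau><..<\<tau>}"
  define r where "r = min (\<tau> - \<bar>t\<bar>) (ln R / (2 * pi))"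
  have r: "0 < r" "\<bar>t\<bar> + r \<le> \<tau>" "2 * pi * r \<le> ln R"
    using t R by (auto simp: r_def abs_less_iff min_def field_simps)
  define Cf where "Cf = (\<lambda>(a, b, k). coeff p (a, b, k) * (cis (2 * pi * s)) ^ a * (cnj (cis (2 * pi * s))) ^ b / (of_real R ^ (a + b) * of_real \<tau> ^ k))"
  define \<omega> :: "index \<Rightarrow> complex" where "\<omega> = (\<lambda>(a, b, k). 2 * of_real pi * \<i> * (of_nat a - of_nat b))"
  define deg :: "index \<Rightarrow> nat" where "deg = (\<lambda>(a, b, k). k)"
  define E where "E i = (\<lambda>(m, n). Cf i * (of_nat (deg i choose m) * of_real t ^ (deg i - m)) * (\<omega> i ^ n /\<^sub>R fact n))" for i
  define c where "c m n = (\<Sum>\<^sub>\<infinity>i. E i (m, n))" for m n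
  show "\<exists>c. \<exists>r>0. \<forall>h v. \<bar>h\<bar> < r \<longrightarrow> \<bar>v\<bar> < r \<longrightarrow> (t + h, s + v) \<in> {-\<tau><..<\<tau>} \<times> UNIV \<longrightarrow>
        ((\<lambda>(m, n). c m n * of_real (h ^ m * v ^ n)) has_sum pairing (chi R \<tau> (cis (2 * pi * (s + v))) (t + h)) p) UNIV"
  proof (intro exI[of _ c] exI[of _ r] conjI r(1) allI impI)
    fix h v :: real assume h: "\<bar>h\<bar> < r" and v: "\<bar>v\<bar> < r"
    define G where "G i = (\<lambda>(m, n). Cf i * ((of_nat (deg i choose m) * of_real t ^ (deg i - m) * of_real h ^ m) * ((\<omega> i * of_real v) ^ n /\<^sub>R fact n)))" for i
    have GE: "G i (m, n) = E i (m, n) * of_real (h ^ m * v ^ n)" for i m n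
      by (simp add: G_def E_def power_mult_distrib scaleR_conv_of_real mult_ac)
    have tm: "coeff p i * chi R \<tau> (cis (2 * pi * (s + v))) (t + h) i = Cf i * ((of_real t + of_real h) ^ deg i * exp (\<omega> i * of_real v))" for i
    proof -
      obtain a b k where i: "i = (a, b, k)" by (rule prod_cases3)
      have "exp (\<omega> i * of_real v) = exp (of_nat a * (2 * of_real pi * \<i> * of_real v)) * exp (of_nat b * (- (2 * of_real pi * \<i> * of_real v)))"
        unfolding exp_add[symmetric] by (simp add: i \<omega>_def algebra_simps)
      also have "\<dots> = cis (2 * pi * v) ^ a * cnj (cis (2 * pi * v)) ^ b"
        unfolding exp_of_nat_mult by (simp add: cis_conv_exp exp_cnj mult_ac)
      finally have e: "exp (\<omega> i * of_real v) = cis (2 * pi * v) ^ a * cnj (cis (2 * pi * v)) ^ b" .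
      have "cis (2 * pi * (s + v)) = cis (2 * pi * s) * cis (2 * pi * v)" by (simp add: cis_mult distrib_left)
      then show ?thesis
        unfolding e using R \<tau> by (simp add: i chi_def Cf_def deg_def power_mult_distrib power_divide power_add)
    qed
    have Cf: "norm (Cf i) = norm (coeff p i) / (R ^ (fst i + fst (snd i)) * \<tau> ^ deg i)" for i
      using R \<tau> by (auto simp: Cf_def deg_def norm_mult norm_divide norm_power split: prod.splits)
    have abs_i: "(\<lambda>x. norm (G i x)) summable_on UNIV" and sum_i: "infsum (G i) UNIV = coeff p i * chi R \<tau> (cis (2 * pi * (s + v))) (t + h) i"
      and norm_i: "(\<Sum>\<^sub>\<infinity>x. norm (G i x)) \<le> norm (coeff p i)" for i
    proof -
      note bs = binomial_has_sum[of "deg i" "complex_of_real t" "complex_of_real h"] and es = exp_has_sum[of "\<omega> i * of_real v"]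
      have "(\<lambda>x. norm (case x of (m, n) \<Rightarrow> (of_nat (deg i choose m) * of_real t ^ (deg i - m) * of_real h ^ m) * ((\<omega> i * of_real v) ^ n /\<^sub>R fact n))) summable_on UNIV"
        using abs_summable_Times[OF bs(1) es(1)] by (simp add: case_prod_unfold)
      from summable_on_cmult_right[OF this, of "norm (Cf i)"]
      show ab: "(\<lambda>x. norm (G i x)) summable_on UNIV" by (simp add: G_def case_prod_unfold norm_mult mult_ac)
      have "infsum (G i) UNIV = Cf i * (\<Sum>\<^sub>\<infinity>(m, n). (of_nat (deg i choose m) * of_real t ^ (deg i - m) * of_real h ^ m) * ((\<omega> i * of_real v) ^ n /\<^sub>R fact n))"
        unfolding G_def infsum_cmult_right'[symmetric] by (intro infsum_cong) auto
      also have "\<dots> = Cf i * ((of_real t + of_real h) ^ deg i * exp (\<omega> i * of_real v))"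
        unfolding has_sum_Times[OF bs(1) es(1)] infsumI[OF bs(2)] infsumI[OF es(2)] ..
      finally show "infsum (G i) UNIV = coeff p i * chi R \<tau> (cis (2 * pi * (s + v))) (t + h) i" using tm by simp
      note bs' = binomial_has_sum[of "deg i" "complex_of_real \<bar>t\<bar>" "complex_of_real \<bar>h\<bar>"] and es' = exp_has_sum[of "complex_of_real (norm (\<omega> i * of_real v))"]
      have "complex_of_real (\<Sum>\<^sub>\<infinity>x. norm (G i x)) = (\<Sum>\<^sub>\<infinity>x. complex_of_real (norm (G i x)))"
        by (rule infsumI[OF has_sum_bounded_linear[OF bounded_linear_of_real has_sum_infsum[OF ab]], symmetric])
      also have "\<dots> = of_real (norm (Cf i)) * (\<Sum>\<^sub>\<infinity>(m, n). (of_nat (deg i choose m) * of_real \<bar>t\<bar> ^ (deg i - m) * of_real \<bar>h\<bar> ^ m) * (of_real (norm (\<omega> i * of_real v)) ^ n /\<^sub>R fact n))"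
        unfolding infsum_cmult_right'[symmetric]
        by (intro infsum_cong) (auto simp: G_def norm_mult norm_power norm_inverse scaleR_conv_of_real abs_mult power_mult_distrib power_abs)
      also have "\<dots> = of_real (norm (Cf i)) * ((of_real \<bar>t\<bar> + of_real \<bar>h\<bar>) ^ deg i * exp (of_real (norm (\<omega> i * of_real v))))"
        unfolding has_sum_Times[OF bs'(1) es'(1)] infsumI[OF bs'(2)] infsumI[OF es'(2)] ..
      also have "\<dots> = of_real (norm (Cf i) * ((\<bar>t\<bar> + \<bar>h\<bar>) ^ deg i * exp (norm (\<omega> i * of_real v))))"
        by (simp add: exp_of_real[symmetric])
      finally have "(\<Sum>\<^sub>\<infinity>x. norm (G i x)) = norm (Cf i) * ((\<bar>t\<bar> + \<bar>h\<bar>) ^ deg i * exp (norm (\<omega> i * of_real v)))"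
        unfolding of_real_eq_iff .
      also have "\<dots> \<le> norm (Cf i) * (\<tau> ^ deg i * R ^ (fst i + fst (snd i)))"
      proof (intro mult_left_mono mult_mono)
        show "(\<bar>t\<bar> + \<bar>h\<bar>) ^ deg i \<le> \<tau> ^ deg i" using h r by (intro power_mono) auto
        obtain a b k where i: "i = (a, b, k)" by (rule prod_cases3)
        have "norm (of_nat a - of_nat b :: complex) \<le> real a + real b"
          by (rule order_trans[OF norm_triangle_ineq4]) simp
        then have "norm (\<omega> i * of_real v) \<le> 2 * pi * (real a + real b) * \<bar>v\<bar>"
          unfolding i \<omega>_def by (simp add: norm_mult mult_right_mono)
        also have "\<dots> \<le> 2 * pi * (real a + real b) * r" using v by (intro mult_left_mono) auto
        also have "\<dots> \<le> (real a + real b) * ln R" using mult_left_mono[OF r(3), of "real a + real b"] by (simp add: mult_ac)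
        also have "\<dots> = ln (R ^ (a + b))" using R by (simp add: ln_realpow)
        finally have "exp (norm (\<omega> i * of_real v)) \<le> exp (ln (R ^ (a + b)))" by simp
        then show "exp (norm (\<omega> i * of_real v)) \<le> R ^ (fst i + fst (snd i))" using R by (simp add: i)
      qed (use \<tau> in auto)
      also have "\<dots> = norm (coeff p i)" unfolding Cf using R \<tau> by simp
      finally show "(\<Sum>\<^sub>\<infinity>x. norm (G i x)) \<le> norm (coeff p i)" .
    qed
    have sG: "(\<lambda>y. norm ((\<lambda>(i, x). G i x) y)) summable_on Sigma UNIV (\<lambda>_. UNIV)"
    proof (rule Infinite_Sum.abs_summable_on_Sigma_iff[THEN iffD2], intro conjI ballI)
      show "(\<lambda>y. norm (case (i, y) of (i, x) \<Rightarrow> G i x)) summable_on UNIV" for i using abs_i[of i] by simp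
      show "(\<lambda>i. norm (\<Sum>\<^sub>\<infinity>y. norm (case (i, y) of (i, x) \<Rightarrow> G i x))) summable_on UNIV"
        by (rule summable_on_comparison_test[OF coeff_summable_norm[of p]]) (use norm_i in \<open>auto simp: infsum_nonneg\<close>)
    qed
    have sG': "(\<lambda>(i, x). G i x) summable_on UNIV \<times> UNIV"
      using abs_summable_summable[OF sG] by simp
    have sG2: "(\<lambda>(x, i). G i x) summable_on UNIV \<times> UNIV"
      using sG' summable_on_reindex_bij_betw[OF bij_swap, of "\<lambda>(i, x). G i x"] by (simp add: case_prod_unfold)
    have cx: "(\<Sum>\<^sub>\<infinity>i. G i x) = (case x of (m, n) \<Rightarrow> c m n * of_real (h ^ m * v ^ n))" for x
      by (cases x) (simp add: GE c_def infsum_cmult_left' del: of_real_mult of_real_power)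
    have "(\<lambda>x. \<Sum>\<^sub>\<infinity>i. G i x) summable_on UNIV" by (rule summable_on_Sigma_banach[OF sG2])
    then have "((\<lambda>x. \<Sum>\<^sub>\<infinity>i. G i x) has_sum (\<Sum>\<^sub>\<infinity>x. \<Sum>\<^sub>\<infinity>i. G i x)) UNIV" by (rule has_sum_infsum)
    moreover have "(\<Sum>\<^sub>\<infinity>x. \<Sum>\<^sub>\<infinity>i. G i x) = (\<Sum>\<^sub>\<infinity>i. \<Sum>\<^sub>\<infinity>x. G i x)" by (rule infsum_swap_banach[OF sG2])
    ultimately show "((\<lambda>(m, n). c m n * of_real (h ^ m * v ^ n)) has_sum pairing (chi R \<tau> (cis (2 * pi * (s + v))) (t + h)) p) UNIV"
      unfolding cx sum_i pairing_def by simp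
  qed
qed

lemma real_analytic2_on_cong:
  assumes "real_analytic2_on S f" "T \<subseteq> S" "\<And>t s. (t, s) \<in> T \<Longrightarrow> f t s = g t s"
  shows "real_analytic2_on T g"
  unfolding real_analytic2_on_def
proof clarify
  fix t s assume "(t, s) \<in> T"
  then have "(t, s) \<in> S" using assms(2) by blast
  then obtain c r where "r > 0" "\<And>h k. \<bar>h\<bar> < r \<Longrightarrow> \<bar>k\<bar> < r \<Longrightarrow> (t + h, s + k) \<in> S \<Longrightarrow>
        ((\<lambda>(m, n). c m n * of_real (h ^ m * k ^ n)) has_sum f (t + h) (s + k)) UNIV"
    using assms(1) unfolding real_analytic2_on_def by fast
  then show "\<exists>c. \<exists>r>0. \<forall>h k. \<bar>h\<bar> < r \<longrightarrow> \<bar>k\<bar> < r \<longrightarrow> (t + h, s + k) \<in> T \<longrightarrow>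
        ((\<lambda>(m, n). c m n * of_real (h ^ m * k ^ n)) has_sum g (t + h) (s + k)) UNIV"
    using assms(2,3) by (intro exI[of _ c] exI[of _ r]) (auto simp flip: assms(3))
qed

context univalent_disc
begin

theorem conformal_flow:
  obtains R \<tau> :: real and \<kappa> q :: "nat \<times> nat \<Rightarrow> complex" where "1 < R" "0 < \<tau>"
    "dps_summable \<kappa> R \<tau>" "\<And>n. \<kappa> (n, 0) = 0"
    "dps_summable q R \<tau>" "\<And>n. q (n, 0) = 0" "\<And>k. Re (q (0, k)) = 0"
    "\<And>\<zeta> t. norm \<zeta> = 1 \<Longrightarrow> \<bar>t\<bar> \<le> \<tau> \<Longrightarrow> norm (\<zeta> * exp (dps \<kappa> \<zeta> t)) < R0 \<and> 1 / R0 < norm (\<zeta> * exp (dps \<kappa> \<zeta> t))"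
    "\<And>\<zeta> t \<phi>. norm \<zeta> = 1 \<Longrightarrow> \<bar>t\<bar> \<le> \<tau> \<Longrightarrow> \<phi> = \<zeta> * exp (dps \<kappa> \<zeta> t) \<Longrightarrow>
       J \<zeta> * (exp (- of_real pi * (f \<phi> * cnj (f \<phi>))) - exp (- of_real pi * (f \<phi> * cnj (f (1 / cnj \<phi>)))))
         = - of_real (2 * pi * t) + dps q \<zeta> t"
    "real_analytic2_on ({-\<tau><..<\<tau>} \<times> UNIV) (\<lambda>t s. f (cis (2 * pi * s) * exp (dps \<kappa> (cis (2 * pi * s)) t)))"
proof -
  obtain R \<tau> :: real and \<kappa> Q G where R: "1 < R" "0 < \<tau>"
    and \<kappa>: "\<kappa> \<in> vanishing" "\<And>a b k. a < b \<Longrightarrow> coeff \<kappa> (a, b, k) = 0"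
    and Q: "Q \<in> vanishing" "\<And>a b k. a < b \<Longrightarrow> coeff Q (a, b, k) = 0" "\<And>a k. Re (coeff Q (a, a, k)) = 0"
    and eq: "\<And>\<zeta> t \<phi>. norm \<zeta> = 1 \<Longrightarrow> \<bar>t\<bar> \<le> \<tau> \<Longrightarrow> \<phi> = \<zeta> * exp (pairing (chi R \<tau> \<zeta> t) \<kappa>) \<Longrightarrow>
       norm \<phi> < R0 \<and> 1 / R0 < norm \<phi> \<and> pairing (chi R \<tau> \<zeta> t) G = f \<phi> \<and>
       J \<zeta> * (exp (- of_real pi * (f \<phi> * cnj (f \<phi>))) - exp (- of_real pi * (f \<phi> * cnj (f (1 / cnj \<phi>)))))
         = - of_real (2 * pi * t) + pairing (chi R \<tau> \<zeta> t) Q"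
    using fixed_point_in_algebra by blast
  have R': "1 \<le> R" using R by simp
  have e: "norm \<zeta> = 1 \<Longrightarrow> \<bar>t\<bar> \<le> \<tau> \<Longrightarrow> pairing (chi R \<tau> \<zeta> t) \<kappa> = dps (dcoef R \<tau> \<kappa>) \<zeta> t"
    "norm \<zeta> = 1 \<Longrightarrow> \<bar>t\<bar> \<le> \<tau> \<Longrightarrow> pairing (chi R \<tau> \<zeta> t) Q = dps (dcoef R \<tau> Q) \<zeta> t" for \<zeta> t
    using dcoef(2)[OF R' R(2), of \<kappa>] dcoef(2)[OF R' R(2), of Q] \<kappa>(2) Q(2) by blast+
  show thesis
  proof (rule that[OF R dcoef(1)[OF R' R(2) \<kappa>(2)] _ dcoef(1)[OF R' R(2) Q(2)]])
    show "dcoef R \<tau> \<kappa> (n, 0) = 0" "dcoef R \<tau> Q (n, 0) = 0" for n using \<kappa>(1) Q(1) by (simp_all add: dcoef_vanishing)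
    show "Re (dcoef R \<tau> Q (0, k)) = 0" for k by (rule dcoef_imaginary[OF Q(3) R' R(2)])
    fix \<zeta> :: complex and t :: real assume \<zeta>: "norm \<zeta> = 1" "\<bar>t\<bar> \<le> \<tau>"
    show "norm (\<zeta> * exp (dps (dcoef R \<tau> \<kappa>) \<zeta> t)) < R0 \<and> 1 / R0 < norm (\<zeta> * exp (dps (dcoef R \<tau> \<kappa>) \<zeta> t))"
      using eq[OF \<zeta> refl] unfolding e[OF \<zeta>] by blast
    fix \<phi> assume "\<phi> = \<zeta> * exp (dps (dcoef R \<tau> \<kappa>) \<zeta> t)"
    then show "J \<zeta> * (exp (- of_real pi * (f \<phi> * cnj (f \<phi>))) - exp (- of_real pi * (f \<phi> * cnj (f (1 / cnj \<phi>)))))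
         = - of_real (2 * pi * t) + dps (dcoef R \<tau> Q) \<zeta> t"
      using eq[OF \<zeta>, of \<phi>] unfolding e[OF \<zeta>] by blast
  next
    show "real_analytic2_on ({-\<tau><..<\<tau>} \<times> UNIV) (\<lambda>t s. f (cis (2 * pi * s) * exp (dps (dcoef R \<tau> \<kappa>) (cis (2 * pi * s)) t)))"
    proof (rule real_analytic2_on_cong[OF real_analytic2_pairing[OF R, of G] order_refl])
      fix t s :: real assume "(t, s) \<in> {-\<tau><..<\<tau>} \<times> UNIV"
      then have t: "\<bar>t\<bar> \<le> \<tau>" by auto
      show "pairing (chi R \<tau> (cis (2 * pi * s)) t) G = f (cis (2 * pi * s) * exp (dps (dcoef R \<tau> \<kappa>) (cis (2 * pi * s)) t))"
        using eq[of "cis (2 * pi * s)" t, OF _ t refl] e(1)[of "cis (2 * pi * s)" t, OF _ t] by simp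
    qed
  qed
qed

end

section \<open>The Polubarinova-Galin equation\<close>

text \<open>Exponentials of \<open>\<i> * h\<close> and \<open>- \<i> * h\<close> have modulus 1 on the circle, hence modulus at most 1 inside; so
  \<open>Im h = 0\<close> in the disc, and the open mapping theorem makes \<open>h\<close> constant.\<close>

lemma holomorphic_real_on_circle:
  assumes R: "1 < R" and h: "h holomorphic_on ball 0 R" and re: "\<And>z. norm z = 1 \<Longrightarrow> Im (h z) = 0" and z: "norm z \<le> 1"
  shows "h z = h 0"
proof -
  have sub: "cball 0 1 \<subseteq> ball (0::complex) R" using R by auto
  have hb: "h holomorphic_on ball 0 1" by (rule holomorphic_on_subset[OF h]) (use R in auto)
  have hc: "continuous_on (cball 0 1) h"
    by (rule continuous_on_subset[OF holomorphic_on_imp_continuous_on[OF h] sub])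
  have bound: "norm (exp (c * h x)) \<le> 1" if "norm x < 1" "c = \<i> \<or> c = - \<i>" for x c
  proof (rule maximum_modulus_frontier[where S = "ball 0 1" and f = "\<lambda>x. exp (c * h x)"])
    show "(\<lambda>x. exp (c * h x)) holomorphic_on interior (ball 0 1)" using hb by (auto intro!: holomorphic_intros)
    show "continuous_on (closure (ball 0 1)) (\<lambda>x. exp (c * h x))" using hc by (auto intro!: continuous_intros)
    show "norm (exp (c * h z)) \<le> 1" if "z \<in> frontier (ball 0 1)" for z
      using that re[of z] \<open>c = \<i> \<or> c = - \<i>\<close> by (auto simp: norm_exp_eq_Re)
  qed (use that in auto)
  have im: "Im (h x) = 0" if "norm x < 1" for x
    using bound[OF that, of \<i>] bound[OF that, of "- \<i>"] by (simp add: norm_exp_eq_Re)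
  have "h constant_on ball 0 1"
  proof (rule ccontr)
    assume "\<not> h constant_on ball 0 1"
    then have "open (h ` ball 0 1)"
      by (intro open_mapping_thm[OF hb open_ball connected_ball open_ball order_refl])
    moreover have "h 0 \<in> h ` ball 0 1" by (rule imageI) simp
    ultimately obtain e where e: "e > 0" "ball (h 0) e \<subseteq> h ` ball 0 1"
      by (rule openE) blast
    have "norm (of_real (e / 2) * \<i>) < e" unfolding norm_mult norm_of_real using e(1) by simp
    then have "h 0 + of_real (e / 2) * \<i> \<in> ball (h 0) e" by (simp add: dist_norm norm_minus_cancel)
    then have "h 0 + of_real (e / 2) * \<i> \<in> h ` ball 0 1" using e(2) by blast
    then obtain x where x: "h 0 + of_real (e / 2) * \<i> = h x" "x \<in> ball 0 1" by (rule imageE)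
    have "Im (h 0 + of_real (e / 2) * \<i>) = 0" unfolding x(1) using x(2) by (intro im) simp
    then show False using im[of 0] e by simp
  qed
  then obtain c where c: "\<forall>x\<in>ball 0 1. h x = c" unfolding constant_on_def by (rule exE)
  then have "h x = c" if "x \<in> ball 0 1" for x using that by (rule bspec)
  note c = this
  have "h 0 = c" by (rule c) simp
  moreover have "h z = c"
  proof (rule continuous_constant_on_closure[where f = h and S = "ball 0 1" and a = c])
    show "continuous_on (closure (ball 0 1)) h" using hc by simp
    show "h x = c" if "x \<in> ball 0 1" for x using that by (rule c)
    show "z \<in> closure (ball 0 1)" using z by simp
  qed
  ultimately show ?thesis by simp
qed

lemma dps_at_0:
  assumes "\<And>n. c (n, 0) = 0" shows "dps c \<zeta> 0 = 0"
  unfolding dps_def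
proof (rule infsum_0)
  fix x :: "nat \<times> nat"
  obtain n k where x: "x = (n, k)" by (cases x)
  show "(case x of (n, k) \<Rightarrow> c (n, k) * \<zeta> ^ n * of_real 0 ^ k) = 0"
    using assms[of n] unfolding x by (cases k) simp_all
qed

lemma Re_dps_0:
  assumes "\<And>k. Re (c (0, k)) = 0" and s: "dps_summable c R \<tau>" "0 < R" "\<bar>t\<bar> < \<tau>"
  shows "Re (dps c 0 t) = 0"
proof -
  have "(\<lambda>x. c x * 0 ^ fst x * of_real t ^ snd x) summable_on UNIV"
    by (rule abs_summable_summable, rule dps_summable_term[OF s(1)]) (use s in auto)
  from infsum_Re[OF this] have "Re (dps c 0 t) = (\<Sum>\<^sub>\<infinity>x. Re (c x * 0 ^ fst x * of_real t ^ snd x))"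
    by (simp add: dps_def case_prod_unfold)
  also have "\<dots> = 0"
  proof (rule infsum_0)
    fix x :: "nat \<times> nat"
    obtain n k where x: "x = (n, k)" by (cases x)
    have "Re (c (0, k) * of_real (t ^ k)) = 0" using assms(1)[of k] by simp
    then show "Re (c x * 0 ^ fst x * of_real t ^ snd x) = 0"
      unfolding x by (cases n) (simp_all only: fst_conv snd_conv power_0 power_Suc mult_zero_left mult_zero_right mult_1_right of_real_power zero_complex.sel)
  qed
  finally show ?thesis .
qed

locale flow = univalent_disc +
  fixes R \<tau> :: real and \<kappa> q :: "nat \<times> nat \<Rightarrow> complex"
  assumes R: "1 < R" and \<tau>: "0 < \<tau>"
    and \<kappa>: "dps_summable \<kappa> R \<tau>" "\<And>n. \<kappa> (n, 0) = 0"
    and q: "dps_summable q R \<tau>" "\<And>n. q (n, 0) = 0" "\<And>k. Re (q (0, k)) = 0"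
    and annulus: "\<And>\<zeta> t. norm \<zeta> = 1 \<Longrightarrow> \<bar>t\<bar> \<le> \<tau> \<Longrightarrow> norm (\<zeta> * exp (dps \<kappa> \<zeta> t)) < R0 \<and> 1 / R0 < norm (\<zeta> * exp (dps \<kappa> \<zeta> t))"
    and equation: "\<And>\<zeta> t \<phi>. norm \<zeta> = 1 \<Longrightarrow> \<bar>t\<bar> \<le> \<tau> \<Longrightarrow> \<phi> = \<zeta> * exp (dps \<kappa> \<zeta> t) \<Longrightarrow>
       J \<zeta> * (exp (- of_real pi * (f \<phi> * cnj (f \<phi>))) - exp (- of_real pi * (f \<phi> * cnj (f (1 / cnj \<phi>)))))
         = - of_real (2 * pi * t) + dps q \<zeta> t"
begin

definition phi :: "complex \<Rightarrow> real \<Rightarrow> complex" where "phi \<zeta> t = \<zeta> * exp (dps \<kappa> \<zeta> t)"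
definition phiz :: "complex \<Rightarrow> real \<Rightarrow> complex" where "phiz \<zeta> t = exp (dps \<kappa> \<zeta> t) * (1 + \<zeta> * dps (dz \<kappa>) \<zeta> t)"
definition phit :: "complex \<Rightarrow> real \<Rightarrow> complex" where "phit \<zeta> t = \<zeta> * exp (dps \<kappa> \<zeta> t) * dps (dt \<kappa>) \<zeta> t"
definition F :: "complex \<Rightarrow> real \<Rightarrow> complex" where "F \<zeta> t = f (phi \<zeta> t)"
definition Fz :: "complex \<Rightarrow> real \<Rightarrow> complex" where "Fz \<zeta> t = deriv f (phi \<zeta> t) * phiz \<zeta> t"
definition Ft :: "complex \<Rightarrow> real \<Rightarrow> complex" where "Ft \<zeta> t = deriv f (phi \<zeta> t) * phit \<zeta> t"

abbreviation cyl :: "(complex \<times> real) set" where "cyl \<equiv> ball 0 R \<times> {-\<tau><..<\<tau>}"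

lemma open_cyl: "open cyl" by (intro open_Times open_ball open_greaterThanLessThan)

lemma dps_continuous':
  "continuous_on cyl (\<lambda>p. dps \<kappa> (fst p) (snd p))" "continuous_on cyl (\<lambda>p. dps (dz \<kappa>) (fst p) (snd p))"
  "continuous_on cyl (\<lambda>p. dps (dt \<kappa>) (fst p) (snd p))"
  using dps_continuous[OF \<kappa>(1)] dps_derivs_continuous[OF \<kappa>(1)] by (simp_all add: case_prod_unfold)

lemma phi_continuous:
  "continuous_on cyl (\<lambda>p. phi (fst p) (snd p))" "continuous_on cyl (\<lambda>p. phiz (fst p) (snd p))"
  "continuous_on cyl (\<lambda>p. phit (fst p) (snd p))"
  unfolding phi_def phiz_def phit_def by (intro continuous_intros dps_continuous')+

lemma phi_0: "phi \<zeta> 0 = \<zeta>" "phiz \<zeta> 0 = 1"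
  using dps_at_0[of \<kappa>, OF \<kappa>(2)] dps_at_0[of "dz \<kappa>"] \<kappa>(2) by (auto simp: phi_def phiz_def dz_def)

lemma phi_centre: "phi 0 t = 0" "phit 0 t = 0" by (simp_all add: phi_def phit_def)

lemma phi_has_derivative:
  assumes "norm \<zeta> < R" "\<bar>t\<bar> < \<tau>"
  shows "((\<lambda>(z, x). phi z x) has_derivative (\<lambda>(h, l). phiz \<zeta> t * h + phit \<zeta> t * of_real l)) (at (\<zeta>, t))"
proof -
  note d = dps_has_derivative[OF \<kappa>(1) assms, unfolded case_prod_unfold]
  have e: "((\<lambda>p. exp (dps \<kappa> (fst p) (snd p))) has_derivative
      (\<lambda>p. exp (dps \<kappa> \<zeta> t) * (dps (dz \<kappa>) \<zeta> t * fst p + dps (dt \<kappa>) \<zeta> t * of_real (snd p)))) (at (\<zeta>, t))"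
    using has_derivative_compose[OF d DERIV_exp[unfolded has_field_derivative_def]] by simp
  have "((\<lambda>p. fst p * exp (dps \<kappa> (fst p) (snd p))) has_derivative
      (\<lambda>p. \<zeta> * (exp (dps \<kappa> \<zeta> t) * (dps (dz \<kappa>) \<zeta> t * fst p + dps (dt \<kappa>) \<zeta> t * of_real (snd p))) + fst p * exp (dps \<kappa> \<zeta> t))) (at (\<zeta>, t))"
    using has_derivative_mult[OF has_derivative_fst[OF has_derivative_ident] e] by simp
  moreover have "(\<lambda>p. \<zeta> * (exp (dps \<kappa> \<zeta> t) * (dps (dz \<kappa>) \<zeta> t * fst p + dps (dt \<kappa>) \<zeta> t * of_real (snd p))) + fst p * exp (dps \<kappa> \<zeta> t))
      = (\<lambda>(h, l). phiz \<zeta> t * h + phit \<zeta> t * of_real l)"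
    by (auto simp: phiz_def phit_def algebra_simps)
  ultimately show ?thesis by (simp add: phi_def case_prod_unfold)
qed

lemma F_has_derivative:
  assumes "norm \<zeta> < R" "\<bar>t\<bar> < \<tau>" "norm (phi \<zeta> t) < R0"
  shows "((\<lambda>(z, x). F z x) has_derivative (\<lambda>(h, l). Fz \<zeta> t * h + Ft \<zeta> t * of_real l)) (at (\<zeta>, t))"
proof -
  have "(f has_field_derivative deriv f (phi \<zeta> t)) (at (phi \<zeta> t))"
    using assms(3) by (intro holomorphic_derivI[OF holo open_ball]) auto
  from has_derivative_compose[OF phi_has_derivative[OF assms(1,2)] , of f "\<lambda>h. deriv f (phi \<zeta> t) * h"] this
  have "((\<lambda>p. f (case p of (z, x) \<Rightarrow> phi z x)) has_derivative
      (\<lambda>p. deriv f (phi \<zeta> t) * (case p of (h, l) \<Rightarrow> phiz \<zeta> t * h + phit \<zeta> t * of_real l))) (at (\<zeta>, t))"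
    by (simp add: has_field_derivative_def)
  then show ?thesis by (simp add: F_def Fz_def Ft_def case_prod_unfold algebra_simps)
qed

lemma phi_field_derivative:
  assumes "norm \<zeta> < R" "\<bar>t\<bar> < \<tau>"
  shows "((\<lambda>z. phi z t) has_field_derivative phiz \<zeta> t) (at \<zeta>)"
proof -
  have "((\<lambda>z. (z, t)) has_derivative (\<lambda>h. (h, 0))) (at \<zeta>)" by (auto intro!: derivative_eq_intros)
  from has_derivative_compose[OF this phi_has_derivative[OF assms]] show ?thesis
    by (simp add: has_field_derivative_def)
qed

lemma F_field_derivative:
  assumes "norm \<zeta> < R" "\<bar>t\<bar> < \<tau>" "norm (phi \<zeta> t) < R0"
  shows "((\<lambda>z. F z t) has_field_derivative Fz \<zeta> t) (at \<zeta>)"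
proof -
  have "((\<lambda>z. (z, t)) has_derivative (\<lambda>h. (h, 0))) (at \<zeta>)" by (auto intro!: derivative_eq_intros)
  from has_derivative_compose[OF this F_has_derivative[OF assms]] show ?thesis
    by (simp add: has_field_derivative_def)
qed

text \<open>In these terms the boundary equation reads \<open>W - Ext \<circ> phi = H\<close> on the circle: the Gaussian weight on the
  moving curve is a fixed holomorphic function of \<open>phi\<close>, plus a term that is holomorphic in the whole disc.\<close>

definition W :: "complex \<Rightarrow> real \<Rightarrow> complex" where "W \<zeta> t = exp (- of_real pi * (F \<zeta> t * cnj (F \<zeta> t)))"
definition Ext :: "complex \<Rightarrow> complex" where "Ext \<xi> = exp (- of_real pi * (f \<xi> * cnj (f (1 / cnj \<xi>))))"
definition H :: "complex \<Rightarrow> real \<Rightarrow> complex" where "H \<zeta> t = (- of_real (2 * pi * t) + dps q \<zeta> t) / J \<zeta>"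
definition Ht :: "complex \<Rightarrow> real \<Rightarrow> complex" where "Ht \<zeta> t = (- of_real (2 * pi) + dps (dt q) \<zeta> t) / J \<zeta>"

lemma Ext_holo: "Ext holomorphic_on {\<xi>. norm \<xi> < R0 \<and> 1 / R0 < norm \<xi>}"
proof -
  let ?A = "{\<xi>::complex. norm \<xi> < R0 \<and> 1 / R0 < norm \<xi>}"
  have nz: "\<xi> \<noteq> 0" if "\<xi> \<in> ?A" for \<xi> using that R0 by auto
  have "x \<in> cnj ` ball 0 R0" if "x \<in> ball 0 R0" for x
    by (rule image_eqI[of _ _ "cnj x"]) (use that in auto)
  moreover have "cnj ` ball 0 R0 \<subseteq> ball 0 R0" by (rule image_subsetI) simp
  ultimately have "cnj ` ball 0 R0 = ball 0 R0" by blast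
  then have 1: "(cnj \<circ> f \<circ> cnj) holomorphic_on ball 0 R0"
    using holo by (intro holomorphic_on_compose_cnj_cnj) auto
  have 2: "(\<lambda>\<xi>. 1 / \<xi>) holomorphic_on ?A" using nz by (auto intro!: holomorphic_intros)
  have "(\<lambda>\<xi>. 1 / \<xi>) ` ?A \<subseteq> ball 0 R0"
  proof (rule image_subsetI)
    fix x assume x: "x \<in> ?A"
    have "0 < 1 / R0" "1 / R0 < norm x" using x R0 by simp_all
    then have "0 < norm x" by (rule less_trans)
    then show "1 / x \<in> ball 0 R0" using x R0 by (simp add: norm_divide divide_less_eq mult.commute)
  qed
  from holomorphic_on_compose_gen[OF 2 1 this]
  have "(\<lambda>\<xi>. cnj (f (1 / cnj \<xi>))) holomorphic_on ?A" by (simp add: o_def)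
  moreover have "f holomorphic_on ?A" by (rule holomorphic_on_subset[OF holo]) auto
  ultimately show ?thesis unfolding Ext_def[abs_def] by (intro holomorphic_intros)
qed

lemma boundary_equation:
  assumes "norm \<zeta> = 1" "\<bar>t\<bar> \<le> \<tau>" shows "W \<zeta> t - Ext (phi \<zeta> t) = H \<zeta> t"
  using equation[OF assms, of "phi \<zeta> t"] J_nz[of \<zeta>] R0 assms(1)
  by (simp add: W_def Ext_def H_def F_def phi_def[symmetric] field_simps)

text \<open>The boundary equation holds only for \<open>norm \<zeta> = 1\<close>, so it may be differentiated only along curves that
  stay on the circle.\<close>

lemma boundary_equation_along:
  assumes c: "(z has_vector_derivative z') (at 0)" "(x has_vector_derivative x') (at 0)"
    and circ: "\<And>r. norm (z r) = 1" "\<And>r. \<bar>x r\<bar> \<le> \<tau>" and p: "z 0 = \<zeta>" "x 0 = t" and t: "\<bar>t\<bar> < \<tau>"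
    and H: "((\<lambda>r. H (z r) (x r)) has_vector_derivative h) (at 0)"
  defines "G' \<equiv> Fz \<zeta> t * z' + Ft \<zeta> t * of_real x'"
  shows "W \<zeta> t * (- of_real pi * (G' * cnj (F \<zeta> t) + F \<zeta> t * cnj G')) - deriv Ext (phi \<zeta> t) * (phiz \<zeta> t * z' + phit \<zeta> t * of_real x') = h"
proof -
  have \<zeta>: "norm \<zeta> = 1" "norm \<zeta> < R" using circ(1)[of 0] p R by auto
  have ph: "norm (phi \<zeta> t) < R0" "1 / R0 < norm (phi \<zeta> t)"
    using annulus[OF \<zeta>(1), of t] t by (auto simp: phi_def)
  have zx: "((\<lambda>r. (z r, x r)) has_derivative (\<lambda>h. (h *\<^sub>R z', h *\<^sub>R x'))) (at 0)"
    using c unfolding has_vector_derivative_def by (intro has_derivative_Pair)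
  have at0: "(z 0, x 0) = (\<zeta>, t)" using p by simp
  have G: "((\<lambda>r. F (z r) (x r)) has_vector_derivative G') (at 0)"
    using has_derivative_compose[OF zx, unfolded at0, OF F_has_derivative[OF \<zeta>(2) t ph(1)]]
    by (simp add: has_vector_derivative_def G'_def scaleR_conv_of_real algebra_simps)
  have P: "((\<lambda>r. phi (z r) (x r)) has_vector_derivative (phiz \<zeta> t * z' + phit \<zeta> t * of_real x')) (at 0)"
    using has_derivative_compose[OF zx, unfolded at0, OF phi_has_derivative[OF \<zeta>(2) t]]
    by (simp add: has_vector_derivative_def scaleR_conv_of_real algebra_simps)
  have "open {\<xi>::complex. norm \<xi> < R0 \<and> 1 / R0 < norm \<xi>}"
    by (intro open_Collect_conj open_Collect_less continuous_intros)
  from holomorphic_derivI[OF Ext_holo this, of "phi \<zeta> t"] ph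
  have "(Ext has_field_derivative deriv Ext (phi \<zeta> t)) (at (phi (z 0) (x 0)))" using p by auto
  from field_vector_diff_chain_at[OF P this]
  have E: "((\<lambda>r. Ext (phi (z r) (x r))) has_vector_derivative deriv Ext (phi \<zeta> t) * (phiz \<zeta> t * z' + phit \<zeta> t * of_real x')) (at 0)"
    by (simp add: o_def mult.commute)
  have "((\<lambda>r. F (z r) (x r) * cnj (F (z r) (x r))) has_vector_derivative F (z 0) (x 0) * cnj G' + G' * cnj (F (z 0) (x 0))) (at 0)"
    by (intro has_vector_derivative_mult G has_vector_derivative_cnj)
  then have "((\<lambda>r. - of_real pi * (F (z r) (x r) * cnj (F (z r) (x r)))) has_vector_derivative - of_real pi * (F \<zeta> t * cnj G' + G' * cnj (F \<zeta> t))) (at 0)"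
    unfolding p by (rule has_vector_derivative_mult_right)
  from field_vector_diff_chain_at[OF this DERIV_exp]
  have Wd: "((\<lambda>r. W (z r) (x r)) has_vector_derivative W \<zeta> t * (- of_real pi * (G' * cnj (F \<zeta> t) + F \<zeta> t * cnj G'))) (at 0)"
    by (simp add: o_def W_def p algebra_simps)
  have "((\<lambda>r. W (z r) (x r) - Ext (phi (z r) (x r))) has_vector_derivative
     W \<zeta> t * (- of_real pi * (G' * cnj (F \<zeta> t) + F \<zeta> t * cnj G')) - deriv Ext (phi \<zeta> t) * (phiz \<zeta> t * z' + phit \<zeta> t * of_real x')) (at 0)"
    by (intro has_vector_derivative_diff Wd E)
  moreover have "(\<lambda>r. W (z r) (x r) - Ext (phi (z r) (x r))) = (\<lambda>r. H (z r) (x r))"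
    using boundary_equation circ by auto
  ultimately show ?thesis using vector_derivative_unique_at[OF _ H] by simp
qed

lemma H_derivs:
  assumes "norm \<zeta> < R" "norm \<zeta> < R0" "\<bar>t\<bar> < \<tau>"
  shows "((\<lambda>x. H \<zeta> x) has_vector_derivative Ht \<zeta> t) (at t)"
    and "(\<lambda>z. H z t) field_differentiable at \<zeta>"
proof -
  have "((\<lambda>x. - of_real (2 * pi * x) + dps q \<zeta> x) has_vector_derivative (- of_real (2 * pi) + dps (dt q) \<zeta> t)) (at t)"
  proof -
    have "((\<lambda>x. - complex_of_real (2 * pi * x)) has_vector_derivative - of_real (2 * pi)) (at t)"
      by (auto intro!: derivative_eq_intros has_vector_derivative_of_real simp: has_real_derivative_iff_has_vector_derivative[symmetric])
    then show ?thesis by (intro has_vector_derivative_add dps_vector_derivative[OF q(1) assms(1,3)])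
  qed
  then show "((\<lambda>x. H \<zeta> x) has_vector_derivative Ht \<zeta> t) (at t)"
    unfolding H_def Ht_def by (rule has_vector_derivative_divide)
  have "(\<lambda>z. dps q z t) field_differentiable at \<zeta>"
    using dps_field_derivative[OF q(1) assms(1,3)] field_differentiable_def by blast
  moreover have "J field_differentiable at \<zeta>"
    using J_holo assms(2) by (intro holomorphic_on_imp_differentiable_at[OF _ open_ball]) auto
  ultimately show "(\<lambda>z. H z t) field_differentiable at \<zeta>"
    unfolding H_def using J_nz[OF assms(2)] by (intro derivative_intros) auto
qed

definition L :: "complex \<Rightarrow> real \<Rightarrow> complex" where
  "L \<zeta> t = - (Fz \<zeta> t * Ht \<zeta> t - Ft \<zeta> t * deriv (\<lambda>z. H z t) \<zeta>) / (of_real (2 * pi) * (exp (dps \<kappa> \<zeta> t) * m (phi \<zeta> t)))"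

lemma W_real: "W \<zeta> t = of_real (exp (- pi * (norm (F \<zeta> t))\<^sup>2))"
  unfolding W_def complex_norm_square[symmetric] by (simp add: exp_of_real[symmetric])

text \<open>The derivatives of the boundary equation in time and in angle both contain the factor \<open>deriv Ext\<close>.
  Eliminating it leaves an expression in \<open>W\<close> times the Jacobian of \<open>F\<close> on one side and a function holomorphic in the
  disc on the other.\<close>

lemma WD_eq_L:
  assumes \<zeta>: "norm \<zeta> = 1" and t: "\<bar>t\<bar> < \<tau>"
  shows "W \<zeta> t * of_real (Re (Ft \<zeta> t * cnj (\<zeta> * Fz \<zeta> t))) = L \<zeta> t"
proof -
  have \<zeta>R: "norm \<zeta> < R" "norm \<zeta> < R0" using \<zeta> R R0 by auto
  have ph: "norm (phi \<zeta> t) < R0" "1 / R0 < norm (phi \<zeta> t)"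
    using annulus[OF \<zeta>, of t] t by (auto simp: phi_def)
  have phnz: "phi \<zeta> t \<noteq> 0" using ph R0 by auto
  have Fnz: "F \<zeta> t \<noteq> 0" unfolding F_def using f_eq_0_iff[OF ph(1)] phnz by simp
  define Hz where "Hz = deriv (\<lambda>z. H z t) \<zeta>"
  define w where "w = W \<zeta> t" define G where "G = F \<zeta> t" define a where "a = Ft \<zeta> t" define b where "b = \<i> * \<zeta> * Fz \<zeta> t"
  define e where "e = deriv Ext (phi \<zeta> t)"
  \<comment> \<open>the time direction; the equation is known only for \<open>\<bar>t\<bar> \<le> \<tau>\<close>, so the path is cut off\<close>
  define x where "x r = (if \<bar>t + r\<bar> \<le> \<tau> then t + r else t)" for r
  have xd: "(x has_vector_derivative 1) (at 0)"
  proof (rule has_vector_derivative_transform_within_open)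
    show "((\<lambda>r. t + r) has_vector_derivative 1) (at 0)" by (auto intro!: derivative_eq_intros)
    show "open {- \<tau> - t<..<\<tau> - t}" "0 \<in> {- \<tau> - t<..<\<tau> - t}" using t by auto
    show "\<And>r. r \<in> {- \<tau> - t<..<\<tau> - t} \<Longrightarrow> t + r = x r" by (auto simp: x_def)
  qed
  have 1: "w * (- of_real pi * (a * cnj G + G * cnj a)) - e * phit \<zeta> t = Ht \<zeta> t"
  proof -
    have "((\<lambda>r. H \<zeta> (x r)) has_vector_derivative 1 *\<^sub>R Ht \<zeta> t) (at 0)"
      using vector_diff_chain_at[OF xd, of "\<lambda>x. H \<zeta> x"] H_derivs(1)[OF \<zeta>R t] by (simp add: x_def o_def)
    from boundary_equation_along[of "\<lambda>_. \<zeta>" 0 x 1 \<zeta> t, OF _ xd _ _ _ _ t this] \<zeta> t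
    show ?thesis by (simp add: x_def w_def a_def G_def e_def)
  qed
  \<comment> \<open>the angular direction\<close>
  define z where "z r = \<zeta> * exp (\<i> * of_real r)" for r
  have zd: "(z has_vector_derivative \<i> * \<zeta>) (at 0)"
    unfolding z_def by (auto intro!: derivative_eq_intros has_vector_derivative_real_field)
  have 2: "w * (- of_real pi * (b * cnj G + G * cnj b)) - e * (phiz \<zeta> t * (\<i> * \<zeta>)) = Hz * (\<i> * \<zeta>)"
  proof -
    have Hd: "((\<lambda>z. H z t) has_field_derivative Hz) (at (z 0))"
      using H_derivs(2)[OF \<zeta>R t] unfolding Hz_def z_def by (simp add: DERIV_deriv_iff_field_differentiable)
    have "((\<lambda>r. H (z r) t) has_vector_derivative \<i> * \<zeta> * Hz) (at 0)"
      using field_vector_diff_chain_at[OF zd Hd] by (simp add: o_def)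
    from boundary_equation_along[of z "\<i> * \<zeta>" "\<lambda>_. t" 0 \<zeta> t, OF zd _ _ _ _ _ t this] \<zeta> t
    show ?thesis by (simp add: z_def w_def b_def G_def e_def norm_mult mult_ac)
  qed
  have ab: "b * phit \<zeta> t = a * (phiz \<zeta> t * (\<i> * \<zeta>))" by (simp add: a_def b_def Ft_def Fz_def mult_ac)
  have "b * (w * (- p * (a * g + G * a')) - e * u) - a * (w * (- p * (b * g + G * b')) - e * v)
     = - p * w * G * (a' * b - a * b') - e * (b * u - a * v)" for p g a' b' u v
    by (simp add: algebra_simps)
  from this[of "of_real pi" "cnj G" "cnj a" "phit \<zeta> t" "cnj b" "phiz \<zeta> t * (\<i> * \<zeta>)"] have key: "b * Ht \<zeta> t - a * (Hz * (\<i> * \<zeta>)) = - of_real pi * w * G * (cnj a * b - a * cnj b)"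
    unfolding 1 2 ab by (simp only: diff_self mult_zero_right diff_zero)
  have D: "cnj a * b - a * cnj b = 2 * \<i> * of_real (Re (a * cnj (\<zeta> * Fz \<zeta> t)))"
  proof -
    have "cnj a * (\<i> * c) - a * cnj (\<i> * c) = 2 * \<i> * of_real (Re (a * cnj c))" for c
      by (simp add: complex_eq_iff)
    then show ?thesis unfolding b_def mult.assoc .
  qed
  have "\<i> * \<zeta> * (Fz \<zeta> t * Ht \<zeta> t - a * Hz) = - of_real pi * w * G * (2 * \<i> * of_real (Re (a * cnj (\<zeta> * Fz \<zeta> t))))"
    using key[unfolded D] unfolding b_def by (simp only: right_diff_distrib mult_ac)
  then have "\<i> * (\<zeta> * (Fz \<zeta> t * Ht \<zeta> t - a * Hz)) = \<i> * (- of_real (2 * pi) * G * (w * of_real (Re (a * cnj (\<zeta> * Fz \<zeta> t)))))"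
    unfolding of_real_mult of_real_numeral by (simp only: mult_ac mult_minus_left mult_minus_right)
  then have key2: "\<zeta> * (Fz \<zeta> t * Ht \<zeta> t - a * Hz) = - of_real (2 * pi) * G * (w * of_real (Re (a * cnj (\<zeta> * Fz \<zeta> t))))"
    unfolding mult_cancel_left by (simp only: complex_i_not_zero simp_thms)
  have Gm: "G = \<zeta> * (exp (dps \<kappa> \<zeta> t) * m (phi \<zeta> t))" 
    using f_eq_m[of "phi \<zeta> t"] unfolding G_def F_def by (simp only: phi_def mult.assoc)
  have \<zeta>0: "\<zeta> \<noteq> 0" using \<zeta> by auto
  have nz: "exp (dps \<kappa> \<zeta> t) * m (phi \<zeta> t) \<noteq> 0" using Fnz Gm by (auto simp: G_def)
  define k where "k = exp (dps \<kappa> \<zeta> t) * m (phi \<zeta> t)"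
  define y where "y = w * of_real (Re (a * cnj (\<zeta> * Fz \<zeta> t)))"
  define v where "v = Fz \<zeta> t * Ht \<zeta> t - a * Hz"
  have "\<zeta> * v = \<zeta> * (- of_real (2 * pi) * k * y)" using key2 unfolding Gm k_def[symmetric] y_def[symmetric] v_def[symmetric] by (simp only: mult_ac)
  then have "v = - of_real (2 * pi) * k * y" unfolding mult_left_cancel[OF \<zeta>0] .
  then have "y = - v / (of_real (2 * pi) * k)" 
    using nz unfolding k_def[symmetric] by (simp add: divide_simps)
  then show ?thesis unfolding L_def y_def v_def k_def a_def w_def Hz_def .
qed

lemma L_holo:
  assumes r: "r \<le> R" "r \<le> R0" and ph: "\<And>z. norm z < r \<Longrightarrow> norm (phi z t) < R0" and t: "\<bar>t\<bar> < \<tau>"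
  shows "(\<lambda>z. L z t) holomorphic_on ball 0 r"
proof -
  have ph_holo: "(\<lambda>z. phi z t) holomorphic_on ball 0 r"
  proof -
    have "(\<lambda>z. dps \<kappa> z t) holomorphic_on ball 0 r"
      by (rule holomorphic_on_subset[OF dps_dt_holomorphic(2)[OF \<kappa>(1) t]]) (use r in auto)
    then show ?thesis unfolding phi_def by (intro holomorphic_intros)
  qed
  have sub: "(\<lambda>z. g (phi z t)) holomorphic_on ball 0 r" if "g holomorphic_on ball 0 R0" for g
  proof -
    have "(\<lambda>z. phi z t) ` ball 0 r \<subseteq> ball 0 R0" using ph by (intro image_subsetI) simp
    from holomorphic_on_compose_gen[OF ph_holo that this] show ?thesis by (simp add: o_def)
  qed
  have h: "(\<lambda>z. g z) holomorphic_on ball 0 r" if "g holomorphic_on ball 0 R" for g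
    using r by (intro holomorphic_on_subset[OF that]) auto
  have J: "J holomorphic_on ball 0 r" using r by (intro holomorphic_on_subset[OF J_holo]) auto
  have Jnz: "J z \<noteq> 0" if "z \<in> ball 0 r" for z using that r J_nz[of z] by auto
  have H: "(\<lambda>z. H z t) holomorphic_on ball 0 r"
    unfolding H_def using h[OF dps_dt_holomorphic(2)[OF q(1) t]] Jnz by (intro holomorphic_intros J) auto
  have nz: "of_real (2 * pi) * (exp (dps \<kappa> z t) * m (phi z t)) \<noteq> 0" if "z \<in> ball 0 r" for z
    using m_nz[OF ph[of z]] that by simp
  show ?thesis
    unfolding L_def Fz_def Ft_def Ht_def phiz_def phit_def
    using h[OF dps_dt_holomorphic(1)[OF q(1) t]] h[OF dps_dt_holomorphic(1)[OF \<kappa>(1) t]]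
      h[OF dps_dt_holomorphic(2)[OF \<kappa>(1) t]] h[OF dps_dt_holomorphic(3)[OF \<kappa>(1) t]] Jnz nz
    by (intro holomorphic_intros sub deriv_holo m_holo J holomorphic_deriv[OF H open_ball]) auto
qed

lemma Re_L_0: assumes t: "\<bar>t\<bar> < \<tau>" shows "Re (L 0 t) = 1"
proof -
  obtain R1 where R1: "1 < R1" "R1 < R" using dense[OF R] by blast
  obtain \<tau>1 where \<tau>1: "\<bar>t\<bar> < \<tau>1" "\<tau>1 < \<tau>" using dense[OF t] by blast
  have "Re (dps (dt q) 0 t) = 0"
  proof (rule Re_dps_0)
    show "dps_summable (dt q) R1 \<tau>1" using R1 \<tau>1 by (intro dps_derivs(2)[OF q(1)]) auto
    show "Re (dt q (0, k)) = 0" for k using q(3)[of "Suc k"] by (simp add: dt_def del: of_nat_Suc)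
  qed (use R1 \<tau>1 in auto)
  moreover have "L 0 t = - Ht 0 t / of_real (2 * pi)"
  proof -
    have "deriv f 0 \<noteq> 0" using deriv_nz[of 0] R0 by simp
    then show ?thesis by (simp add: L_def Fz_def Ft_def phi_centre phiz_def m_def)
  qed
  ultimately show ?thesis by (simp add: Ht_def J_0 Re_divide_of_real del: of_real_mult)
qed

text \<open>Both factors on the left of \<open>WD_eq_L\<close> are real, so the holomorphic function \<open>L\<close> is constant; its value at 0
  is \<open>1\<close> because the remainder \<open>q\<close> is imaginary there.\<close>

lemma polubarinova_galin:
  assumes r: "1 < r" "r \<le> R" "r \<le> R0" and ph: "\<And>z. norm z < r \<Longrightarrow> norm (phi z t) < R0" and t: "\<bar>t\<bar> < \<tau>"
    and z: "norm z = 1"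
  shows "Re (Ft z t * cnj (z * Fz z t)) = exp (pi * (norm (F z t))\<^sup>2)"
proof -
  let ?D = "\<lambda>z. Re (Ft z t * cnj (z * Fz z t))"
  have WD: "L z t = of_real (exp (- pi * (norm (F z t))\<^sup>2) * ?D z)" if "norm z = 1" for z
    using WD_eq_L[OF that t] unfolding W_real by simp
  have "L z t = L 0 t"
    by (rule holomorphic_real_on_circle[OF r(1) L_holo[OF r(2,3) ph t]]) (use WD z in auto)
  then have "Re (L z t) = 1" using Re_L_0[OF t] by simp
  then have "exp (- pi * (norm (F z t))\<^sup>2) * ?D z = 1" unfolding WD[OF z] by simp
  then show ?thesis by (simp add: exp_minus field_simps)
qed

text \<open>An open condition that holds on a compact disc at time 0 persists on that disc for a short time.\<close>

lemma tube:
  assumes "r < R"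
    and "open X" "continuous_on cyl g" "\<And>z. norm z \<le> r \<Longrightarrow> g (z, 0) \<in> X"
  shows "\<exists>e. 0 < e \<and> e \<le> \<tau> \<and> (\<forall>z t. norm z \<le> r \<longrightarrow> \<bar>t\<bar> < e \<longrightarrow> g (z, t) \<in> X)"
proof -
  define U where "U = cyl \<inter> g -` X"
  have U: "open U" unfolding U_def by (rule continuous_open_preimage[OF assms(3) open_cyl assms(2)])
  have K: "compact (cball (0::complex) r \<times> {0::real})" by (intro compact_Times) auto
  have "cball 0 r \<times> {0} \<subseteq> U" using assms \<tau> by (auto simp: U_def)
  from compact_subset_open_imp_ball_epsilon_subset[OF K U this]
  obtain e where e: "e > 0" "(\<Union>x\<in>cball 0 r \<times> {0}. ball x e) \<subseteq> U" by blast
  have "g (z, t) \<in> X" if "norm z \<le> r" "\<bar>t\<bar> < min e \<tau>" for z t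
  proof -
    have "(z, t) \<in> ball (z, 0) e" using that by (simp add: dist_Pair_Pair dist_norm)
    moreover have "ball (z, 0) e \<subseteq> U" by (rule order_trans[OF UN_upper e(2)]) (use that(1) in simp)
    ultimately have "(z, t) \<in> U" by blast
    then show ?thesis by (simp add: U_def)
  qed
  with e(1) \<tau> show ?thesis by (intro exI[of _ "min e \<tau>"]) simp
qed

text \<open>At time 0 the map \<open>phi\<close> is the identity, so for short times it is a small perturbation of it: its derivative is
  close to 1, which gives injectivity on a disc of radius larger than 1, and a quantitative open mapping argument
  shows that this larger disc still covers all the closed unit discs moved by other times.\<close>

theorem flow_properties:
  obtains R1 t1 where "1 < R1" "R1 < R" "0 < t1" "t1 \<le> \<tau>"
    "\<And>z t. norm z < R1 \<Longrightarrow> \<bar>t\<bar> < t1 \<Longrightarrow> ((\<lambda>(z, x). F z x) has_derivative (\<lambda>(h, l). Fz z t * h + Ft z t * of_real l)) (at (z, t))"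
    "\<And>t. \<bar>t\<bar> < t1 \<Longrightarrow> (\<lambda>z. F z t) holomorphic_on ball 0 R1"
    "\<And>t. \<bar>t\<bar> < t1 \<Longrightarrow> inj_on (\<lambda>z. F z t) (ball 0 R1)"
    "\<And>z t. norm z < R1 \<Longrightarrow> \<bar>t\<bar> < t1 \<Longrightarrow> Fz z t \<noteq> 0"
    "\<And>z t. norm z = 1 \<Longrightarrow> \<bar>t\<bar> < t1 \<Longrightarrow> Re (Ft z t * cnj (z * Fz z t)) = exp (pi * (norm (F z t))\<^sup>2)"
    "\<And>z s t. norm z \<le> 1 \<Longrightarrow> \<bar>s\<bar> < t1 \<Longrightarrow> \<bar>t\<bar> < t1 \<Longrightarrow> F z s \<in> (\<lambda>z. F z t) ` ball 0 R1"
proof -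
  have "1 < min R R0" using R R0 by simp
  then obtain R1 where R1: "1 < R1" "R1 < min R R0" using dense by blast
  have R1R: "R1 < R" "R1 < R0" using R1 by auto
  define \<epsilon> where "\<epsilon> = (R1 - 1) / 16"
  have \<epsilon>: "0 < \<epsilon>" using R1 by (simp add: \<epsilon>_def)
  have "\<exists>e. 0 < e \<and> e \<le> \<tau> \<and> (\<forall>z t. norm z \<le> R1 \<longrightarrow> \<bar>t\<bar> < e \<longrightarrow> phi (fst (z, t)) (snd (z, t)) \<in> ball 0 R0)"
    by (rule tube[OF R1R(1) open_ball phi_continuous(1)]) (use phi_0 R1R in simp)
  then obtain e1 where e1: "0 < e1" "e1 \<le> \<tau>" "\<And>z t. norm z \<le> R1 \<Longrightarrow> \<bar>t\<bar> < e1 \<Longrightarrow> phi z t \<in> ball 0 R0"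
    unfolding fst_conv snd_conv by blast
  have "\<exists>e. 0 < e \<and> e \<le> \<tau> \<and> (\<forall>z t. norm z \<le> R1 \<longrightarrow> \<bar>t\<bar> < e \<longrightarrow> phiz (fst (z, t)) (snd (z, t)) - 1 \<in> ball 0 (1/2))"
    by (rule tube[OF R1R(1) open_ball continuous_on_diff[OF phi_continuous(2) continuous_on_const]]) (use phi_0 in simp)
  then obtain e2 where e2: "0 < e2" "\<And>z t. norm z \<le> R1 \<Longrightarrow> \<bar>t\<bar> < e2 \<Longrightarrow> phiz z t - 1 \<in> ball 0 (1/2)"
    unfolding fst_conv snd_conv by blast
  have "\<exists>e. 0 < e \<and> e \<le> \<tau> \<and> (\<forall>z t. norm z \<le> R1 \<longrightarrow> \<bar>t\<bar> < e \<longrightarrow> phi (fst (z, t)) (snd (z, t)) - fst (z, t) \<in> ball 0 \<epsilon>)"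
    by (rule tube[OF R1R(1) open_ball continuous_on_diff[OF phi_continuous(1) continuous_on_fst[OF continuous_on_id]]]) (use phi_0 \<epsilon> in simp)
  then obtain e3 where e3: "0 < e3" "\<And>z t. norm z \<le> R1 \<Longrightarrow> \<bar>t\<bar> < e3 \<Longrightarrow> phi z t - z \<in> ball 0 \<epsilon>"
    unfolding fst_conv snd_conv by blast
  define t1 where "t1 = min e1 (min e2 e3)"
  have t1: "0 < t1" "t1 \<le> \<tau>" using e1 e2 e3 by (auto simp: t1_def)
  have ph: "norm (phi z t) < R0" "norm (phiz z t - 1) \<le> 1 / 2" "norm (phi z t - z) < \<epsilon>"
    if "norm z \<le> R1" "\<bar>t\<bar> < t1" for z t
    using e1(3)[OF that(1), of t] e2(2)[OF that(1), of t] e3(2)[OF that(1), of t] that(2) by (simp_all add: t1_def)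
  have lip: "norm (a - b) \<le> 2 * norm (phi a t - phi b t)" if "norm a < R1" "norm b < R1" "\<bar>t\<bar> < t1" for a b t
  proof -
    have "norm ((phi a t - a) - (phi b t - b)) \<le> 1 / 2 * norm (a - b)"
    proof (rule field_differentiable_bound[of "ball 0 R1" "\<lambda>z. phi z t - z" "\<lambda>z. phiz z t - 1"])
      fix z :: complex assume z: "z \<in> ball 0 R1"
      show "((\<lambda>z. phi z t - z) has_field_derivative phiz z t - 1) (at z within ball 0 R1)"
        using z R1R that t1 by (intro DERIV_diff has_field_derivative_at_within[OF phi_field_derivative] DERIV_ident) auto
      show "norm (phiz z t - 1) \<le> 1 / 2" using ph(2)[of z t] z that by simp
    qed (use that in auto)
    moreover have "norm (a - b) \<le> norm ((phi a t - a) - (phi b t - b)) + norm (phi a t - phi b t)"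
      using norm_triangle_ineq4[of "phi a t - phi b t" "(phi a t - a) - (phi b t - b)"] by (simp add: algebra_simps)
    ultimately show ?thesis by simp
  qed
  show thesis
  proof (rule that[OF R1(1) R1R(1) t1])
    fix z :: complex and t :: real assume z: "norm z < R1" and t: "\<bar>t\<bar> < t1"
    show "((\<lambda>(z, x). F z x) has_derivative (\<lambda>(h, l). Fz z t * h + Ft z t * of_real l)) (at (z, t))"
      using z t R1R t1 ph(1)[of z t] by (intro F_has_derivative) auto
    have "phiz z t \<noteq> 0" using ph(2)[of z t] z t by auto
    then show "Fz z t \<noteq> 0" unfolding Fz_def using deriv_nz ph(1)[of z t] z t by simp
  next
    fix t :: real assume t: "\<bar>t\<bar> < t1"
    have "((\<lambda>z. F z t) has_field_derivative Fz z t) (at z)" if "z \<in> ball 0 R1" for z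
      using that t R1R t1 ph(1)[of z t] by (intro F_field_derivative) auto
    then show "(\<lambda>z. F z t) holomorphic_on ball 0 R1" unfolding holomorphic_on_open[OF open_ball] by blast
    show "inj_on (\<lambda>z. F z t) (ball 0 R1)"
    proof (rule inj_onI)
      fix a b assume a: "a \<in> ball 0 R1" and b: "b \<in> ball 0 R1" and eq: "F a t = F b t"
      have "phi a t = phi b t"
        using eq inj_onD[OF inj, of "phi a t" "phi b t"] ph(1)[of a t] ph(1)[of b t] a b t by (simp add: F_def)
      then show "a = b" using lip[of a b t] a b t by simp
    qed
  next
    fix z :: complex and t :: real assume z: "norm z = 1" and t: "\<bar>t\<bar> < t1"
    show "Re (Ft z t * cnj (z * Fz z t)) = exp (pi * (norm (F z t))\<^sup>2)"
      using R1 R1R t t1 by (intro polubarinova_galin[OF R1(1) _ _ ph(1) _ z]) auto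
  next
    fix z :: complex and s t :: real assume z: "norm z \<le> 1" and s: "\<bar>s\<bar> < t1" and t: "\<bar>t\<bar> < t1"
    define r where "r = (R1 - 1) / 2"
    have r: "0 < r" using R1 by (simp add: r_def)
    have sub: "cball z r \<subseteq> ball 0 R1"
    proof
      fix x assume "x \<in> cball z r"
      then show "x \<in> ball 0 R1" using z R1 norm_triangle_sub[of x z] by (auto simp: dist_norm norm_minus_commute r_def field_simps)
    qed
    have "ball (phi z t) (r / 2) \<subseteq> (\<lambda>z. phi z t) ` ball z r"
    proof (rule ball_subset_open_map_image)
      have holo1: "(\<lambda>z. phi z t) holomorphic_on ball 0 R1"
        unfolding holomorphic_on_open[OF open_ball]
      proof
        fix x :: complex assume "x \<in> ball 0 R1"
        then have "((\<lambda>z. phi z t) has_field_derivative phiz x t) (at x)"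
          using t t1 R1R by (intro phi_field_derivative) auto
        then show "\<exists>f'. ((\<lambda>z. phi z t) has_field_derivative f') (at x)" by blast
      qed
      show "continuous_on (closure (ball z r)) (\<lambda>z. phi z t)"
        by (rule continuous_on_subset[OF holomorphic_on_imp_continuous_on[OF holo1]]) (use sub r in simp)
      have "inj_on (\<lambda>z. phi z t) (ball z r)"
      proof (rule inj_onI)
        fix a b assume ab: "a \<in> ball z r" "b \<in> ball z r" "phi a t = phi b t"
        have "a \<in> ball 0 R1" "b \<in> ball 0 R1" using ab sub ball_subset_cball[of z r] by blast+
        then show "a = b" using lip[of a b t] t ab(3) by simp
      qed
      moreover have "(\<lambda>z. phi z t) holomorphic_on ball z r"
        by (rule holomorphic_on_subset[OF holo1 order_trans[OF ball_subset_cball sub]])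
      ultimately show "open ((\<lambda>z. phi z t) ` interior (ball z r))"
        unfolding interior_open[OF open_ball] by (intro open_mapping_thm3 open_ball)
      show "r / 2 \<le> norm (phi x t - phi z t)" if "x \<in> frontier (ball z r)" for x
      proof -
        have x: "norm (x - z) = r" using that r by (simp add: dist_norm norm_minus_commute)
        then have "x \<in> cball z r" by (simp add: dist_norm norm_minus_commute)
        then have "x \<in> ball 0 R1" by (rule subsetD[OF sub])
        then show ?thesis using lip[of x z t] x t z R1 by simp
      qed
    qed (use r in auto)
    moreover have "phi z s \<in> ball (phi z t) (r / 2)"
    proof -
      have "norm (phi z t - phi z s) \<le> norm (phi z t - z) + norm (phi z s - z)"
        using norm_triangle_ineq4[of "phi z t - z" "phi z s - z"] by simp
      then show ?thesis using ph(3)[of z s] ph(3)[of z t] z s t R1 by (simp add: dist_norm r_def \<epsilon>_def field_simps)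
    qed
    ultimately obtain x where x: "x \<in> ball z r" "phi z s = phi x t" by blast
    then have "F z s = F x t" "x \<in> ball 0 R1" using sub ball_subset_cball[of z r] by (simp add: F_def, blast)
    then show "F z s \<in> (\<lambda>z. F z t) ` ball 0 R1" by (rule image_eqI)
  qed
qed

lemma F_at_0: "F z 0 = f z" by (simp add: F_def phi_0)
lemma F_centre: "F 0 t = 0" by (simp add: F_def phi_centre f0)

end

section \<open>Riemann maps onto domains with analytic boundary\<close>

lemma holomorphic_eq_on_reals:
  assumes S: "open S" "connected S" and f: "f holomorphic_on S" "g holomorphic_on S"
    and x0: "complex_of_real x0 \<in> S" and eq: "\<And>x. complex_of_real x \<in> S \<Longrightarrow> f (of_real x) = g (of_real x)" and w: "w \<in> S"
  shows "f w = g w"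
proof -
  define U where "U = {z \<in> S. Im z = 0}"
  have lim: "complex_of_real x0 islimpt U"
    unfolding islimpt_approachable
  proof (intro allI impI)
    fix e :: real assume e: "0 < e"
    obtain d where d: "0 < d" "ball (complex_of_real x0) d \<subseteq> S" using S(1) x0 by (rule openE) blast
    define h where "h = min d e / 2"
    have h: "0 < h" "h < d" "h < e" using d(1) e by (auto simp: h_def min_def)
    have dd: "dist (complex_of_real (x0 + h)) (of_real x0) = h" using h(1) by (simp add: dist_norm)
    then have "complex_of_real (x0 + h) \<in> S" using d(2) h(2) by (auto simp: dist_commute)
    then show "\<exists>x'\<in>U. x' \<noteq> complex_of_real x0 \<and> dist x' (complex_of_real x0) < e"
      using h dd by (intro bexI[of _ "complex_of_real (x0 + h)"]) (auto simp: U_def)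
  qed
  have "f w - g w = 0"
  proof (rule analytic_continuation[of "\<lambda>z. f z - g z" S U "complex_of_real x0" w])
    fix z assume z: "z \<in> U"
    then have "z = of_real (Re z)" "z \<in> S" by (auto simp: U_def complex_eq_iff)
    then show "f z - g z = 0" using eq[of "Re z"] by simp
  qed (use S f x0 w lim in \<open>auto simp: U_def intro!: holomorphic_on_diff\<close>)
  then show ?thesis by simp
qed

lemma real_analytic_local_extension:
  assumes "real_analytic \<gamma>"
  shows "\<exists>r>0. \<exists>P. P holomorphic_on ball (complex_of_real s) r \<and> (\<forall>x. \<bar>x - s\<bar> < r \<longrightarrow> P (of_real x) = \<gamma> x)"
proof -
  obtain a r where r: "r > 0" and a: "\<And>h. \<bar>h\<bar> < r \<Longrightarrow> (\<lambda>n. a n * of_real (h ^ n)) sums \<gamma> (s + h)"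
    using assms unfolding real_analytic_def by meson
  define P where "P z = (\<Sum>n. a n * (z - of_real s) ^ n)" for z
  have "P holomorphic_on ball (complex_of_real s) r"
  proof (rule power_series_holomorphic)
    fix w assume "w \<in> ball (complex_of_real s) r"
    then have "norm (w - of_real s) < r" by (simp add: dist_norm norm_minus_commute)
    then obtain h where h: "norm (w - of_real s) < h" "h < r" using dense by blast
    have "0 \<le> h" using h(1) norm_ge_zero[of "w - of_real s"] by linarith
    then have "summable (\<lambda>n. a n * complex_of_real h ^ n)"
      using a[of h] h by (auto intro: sums_summable)
    then have "summable (\<lambda>n. a n * (w - of_real s) ^ n)"
      by (rule powser_inside) (use h \<open>0 \<le> h\<close> in simp)
    then show "(\<lambda>n. a n * (w - of_real s) ^ n) sums P w" unfolding P_def by (rule summable_sums)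
  qed
  moreover have "P (of_real x) = \<gamma> x" if "\<bar>x - s\<bar> < r" for x
    using sums_unique[OF a[OF that]] by (simp add: P_def flip: of_real_diff)
  ultimately show ?thesis using r by blast
qed

text \<open>The local power series have radii bounded below on one period by the Lebesgue covering lemma, and on the
  whole line by periodicity.\<close>

lemma real_analytic_uniform_extension:
  assumes \<gamma>: "real_analytic \<gamma>" "\<And>s. \<gamma> (s + 1) = \<gamma> s"
  obtains \<delta> P where "0 < \<delta>" "\<And>x. P x holomorphic_on ball (complex_of_real x) \<delta>"
    "\<And>x y. \<bar>y - x\<bar> < \<delta> \<Longrightarrow> P x (of_real y) = \<gamma> y"
proof -
  define good where "good s r \<longleftrightarrow> (\<exists>P. P holomorphic_on ball (complex_of_real s) r \<and> (\<forall>x. \<bar>x - s\<bar> < r \<longrightarrow> P (of_real x) = \<gamma> x))" for s r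
  define GG where "GG = {ball (complex_of_real s) r | s r. good s r}"
  have c1: "compact (complex_of_real ` {0..1})" by (intro compact_continuous_image continuous_intros) auto
  have c2: "complex_of_real ` {0..1} \<subseteq> \<Union>GG"
  proof (rule image_subsetI)
    fix s :: real
    obtain r where "r > 0" "good s r" using real_analytic_local_extension[OF \<gamma>(1), of s] unfolding good_def by blast
    then have "ball (of_real s) r \<in> GG" "complex_of_real s \<in> ball (of_real s) r" by (auto simp: GG_def)
    then show "complex_of_real s \<in> \<Union>GG" by (rule UnionI)
  qed
  have c3: "open G" if "G \<in> GG" for G using that by (auto simp: GG_def)
  obtain \<delta> where \<delta>: "0 < \<delta>" "\<And>x. x \<in> complex_of_real ` {0..1} \<Longrightarrow> \<exists>G\<in>GG. ball x \<delta> \<subseteq> G"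
    using Heine_Borel_lemma[OF c1 c2 c3] by blast
  have per: "\<gamma> (s + real n) = \<gamma> s" for s n
  proof (induction n)
    case (Suc n)
    have "\<gamma> (s + real (Suc n)) = \<gamma> ((s + real n) + 1)" by (rule arg_cong[of _ _ \<gamma>]) simp
    then show ?case using \<gamma>(2) Suc.IH by simp
  qed simp
  have peri: "\<gamma> (s + of_int n) = \<gamma> s" for s n
  proof (cases "n \<ge> 0")
    case True then show ?thesis using per[of s "nat n"] by simp
  next
    case False then show ?thesis using per[of "s + of_int n" "nat (- n)"] by simp
  qed
  have gd: "good y \<delta>" if y: "y \<in> {0..1}" for y
  proof -
    obtain s r where s: "good s r" "ball (complex_of_real y) \<delta> \<subseteq> ball (of_real s) r"
      using \<delta>(2)[OF imageI[OF y]] by (auto simp: GG_def)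
    then obtain P where P: "P holomorphic_on ball (complex_of_real s) r" "\<And>x. \<bar>x - s\<bar> < r \<Longrightarrow> P (of_real x) = \<gamma> x"
      unfolding good_def by blast
    have "\<bar>x - s\<bar> < r" if "\<bar>x - y\<bar> < \<delta>" for x
    proof -
      have "complex_of_real x \<in> ball (of_real y) \<delta>" using that by (simp add: dist_of_real dist_real_def abs_minus_commute)
      then have "complex_of_real x \<in> ball (of_real s) r" using s(2) by blast
      then show ?thesis by (simp add: dist_of_real dist_real_def abs_minus_commute)
    qed
    then show ?thesis unfolding good_def using P holomorphic_on_subset[OF P(1) s(2)] by blast
  qed
  have "good x \<delta>" for x
  proof -
    define n where "n = \<lfloor>x\<rfloor>"
    have "x - of_int n \<in> {0..1}" unfolding n_def by (auto intro: less_imp_le) linarith+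
    then obtain P where P: "P holomorphic_on ball (complex_of_real (x - of_int n)) \<delta>"
      "\<And>y. \<bar>y - (x - of_int n)\<bar> < \<delta> \<Longrightarrow> P (of_real y) = \<gamma> y" using gd unfolding good_def by blast
    have "(P \<circ> (\<lambda>z. z - of_int n)) holomorphic_on ball (of_real x) \<delta>"
    proof (rule holomorphic_on_compose_gen[OF _ P(1)])
      show "(\<lambda>z. z - of_int n) ` ball (of_real x) \<delta> \<subseteq> ball (complex_of_real (x - of_int n)) \<delta>"
        by (rule image_subsetI) (simp add: dist_norm)
    qed (intro holomorphic_intros)
    moreover have "(P \<circ> (\<lambda>z. z - of_int n)) (of_real y) = \<gamma> y" if "\<bar>y - x\<bar> < \<delta>" for y
      using P(2)[of "y - of_int n"] peri[of "y - of_int n" n] that by simp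
    ultimately show ?thesis unfolding good_def by blast
  qed
  then obtain P where "\<And>x. P x holomorphic_on ball (complex_of_real x) \<delta> \<and> (\<forall>y. \<bar>y - x\<bar> < \<delta> \<longrightarrow> P x (of_real y) = \<gamma> y)"
    unfolding good_def by metis
  then show thesis using \<delta>(1) by (intro that[of \<delta> P]) auto
qed

lemma real_analytic_strip_extension:
  assumes \<gamma>: "real_analytic \<gamma>" "\<And>s. \<gamma> (s + 1) = \<gamma> s"
  obtains \<delta> \<Gamma> where "0 < \<delta>" "\<Gamma> holomorphic_on {z. \<bar>Im z\<bar> < \<delta>}" "\<And>s. \<Gamma> (complex_of_real s) = \<gamma> s"
    "\<And>z n. \<bar>Im z\<bar> < \<delta> \<Longrightarrow> \<Gamma> (z + of_int n) = \<Gamma> z"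
proof -
  obtain \<delta> P where \<delta>: "0 < \<delta>" and P: "\<And>x. P x holomorphic_on ball (complex_of_real x) \<delta>"
    "\<And>x y. \<bar>y - x\<bar> < \<delta> \<Longrightarrow> P x (of_real y) = \<gamma> y"
    using real_analytic_uniform_extension[OF \<gamma>] by metis
  define \<Gamma> where "\<Gamma> z = P (Re z) z" for z
  let ?S = "{z. \<bar>Im z\<bar> < \<delta>}"
  have S: "open ?S" by (intro open_Collect_less continuous_intros)
  have conv: "convex ?S"
  proof -
    have "?S = {z. Im z < \<delta>} \<inter> {z. Im z > - \<delta>}" by auto
    then show ?thesis by (simp only:) (intro convex_Int convex_halfspace_Im_lt convex_halfspace_Im_gt)
  qed
  have agree: "P x z = P y z" if "\<bar>x - y\<bar> < \<delta>" "z \<in> ball (of_real x) \<delta>" "z \<in> ball (of_real y) \<delta>" for x y z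
  proof (rule holomorphic_eq_on_reals[of "ball (of_real x) \<delta> \<inter> ball (of_real y) \<delta>" "P x" "P y" x z])
    show "connected (ball (complex_of_real x) \<delta> \<inter> ball (complex_of_real y) \<delta>)"
      by (intro convex_connected convex_Int convex_ball)
    show "P x (of_real u) = P y (of_real u)" if "complex_of_real u \<in> ball (of_real x) \<delta> \<inter> ball (of_real y) \<delta>" for u
      using that by (simp add: P(2) dist_of_real dist_real_def abs_minus_commute)
    show "P x holomorphic_on ball (complex_of_real x) \<delta> \<inter> ball (complex_of_real y) \<delta>"
      "P y holomorphic_on ball (complex_of_real x) \<delta> \<inter> ball (complex_of_real y) \<delta>"
      by (rule holomorphic_on_subset[OF P(1)], simp)+
    show "complex_of_real x \<in> ball (of_real x) \<delta> \<inter> ball (of_real y) \<delta>"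
      using that(1) \<delta> by (simp add: dist_of_real dist_real_def abs_minus_commute)
  qed (use that in auto)
  have holo: "\<Gamma> holomorphic_on ?S"
    unfolding holomorphic_on_open[OF S]
  proof
    fix z0 assume z0: "z0 \<in> ?S"
    let ?x = "Re z0"
    have dz: "dist (complex_of_real (Re z)) z = \<bar>Im z\<bar>" for z by (simp add: dist_norm cmod_def)
    define T where "T = ball (complex_of_real ?x) \<delta> \<inter> ?S"
    have T: "open T" "z0 \<in> T" using S z0 dz[of z0] by (auto simp: T_def)
    have "(P ?x has_field_derivative deriv (P ?x) z0) (at z0)"
      by (rule holomorphic_derivI[OF P(1) open_ball]) (use T in \<open>simp add: T_def\<close>)
    then have "(\<Gamma> has_field_derivative deriv (P ?x) z0) (at z0)"
    proof (rule has_field_derivative_transform_within_open[OF _ T])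
      fix z assume z: "z \<in> T"
      have "\<bar>Re z0 - Re z\<bar> \<le> dist (of_real ?x) z" using abs_Re_le_cmod[of "of_real ?x - z"] by (simp add: dist_norm)
      then show "P ?x z = \<Gamma> z" unfolding \<Gamma>_def using z dz[of z] by (intro agree) (auto simp: T_def)
    qed
    then show "\<exists>f'. (\<Gamma> has_field_derivative f') (at z0)" by blast
  qed
  have real: "\<Gamma> (complex_of_real s) = \<gamma> s" for s using P(2)[of s s] \<delta> by (simp add: \<Gamma>_def)
  have one: "\<Gamma> (z + 1) = \<Gamma> z" if "\<bar>Im z\<bar> < \<delta>" for z
  proof (rule holomorphic_eq_on_reals[of ?S "\<lambda>z. \<Gamma> (z + 1)" \<Gamma> 0])
    have "(\<Gamma> \<circ> (\<lambda>z. z + 1)) holomorphic_on ?S"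
      by (rule holomorphic_on_compose_gen[OF _ holo]) (auto intro!: holomorphic_intros)
    then show "(\<lambda>z. \<Gamma> (z + 1)) holomorphic_on ?S" by (simp add: o_def)
    show "\<Gamma> (of_real x + 1) = \<Gamma> (of_real x)" for x
      using real[of "x + 1"] real[of x] \<gamma>(2) by simp
  qed (use S conv holo \<delta> that in \<open>auto intro: convex_connected\<close>)
  have nat: "\<Gamma> (z + of_nat n) = \<Gamma> z" if "\<bar>Im z\<bar> < \<delta>" for z n
  proof (induction n)
    case (Suc n)
    have "\<Gamma> (z + of_nat (Suc n)) = \<Gamma> ((z + of_nat n) + 1)" by (simp add: add_ac)
    also have "\<dots> = \<Gamma> (z + of_nat n)" using that by (intro one) simp
    finally show ?case using Suc.IH by simp
  qed simp
  have int: "\<Gamma> (z + of_int n) = \<Gamma> z" if "\<bar>Im z\<bar> < \<delta>" for z n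
  proof (cases "n \<ge> 0")
    case True then show ?thesis using nat[OF that, of "nat n"] by simp
  next
    case False then show ?thesis using nat[of "z + of_int n" "nat (- n)"] that by simp
  qed
  show thesis by (rule that[OF \<delta> holo real int])
qed

text \<open>Otherwise pairs of distinct points with equal images would accumulate at two points of \<open>K\<close> with equal
  images. These coincide, and there the map is locally injective.\<close>

lemma inj_on_near_compact:
  fixes G :: "complex \<Rightarrow> complex"
  assumes K: "compact K" and U: "open U" "K \<subseteq> U" and G: "G holomorphic_on U" and inj: "inj_on G K" and nz: "\<And>x. x \<in> K \<Longrightarrow> deriv G x \<noteq> 0"
  obtains e where "0 < e" "(\<Union>x\<in>K. ball x e) \<subseteq> U" "inj_on G (\<Union>x\<in>K. ball x e)"
proof -
  obtain e0 where e0: "0 < e0" "(\<Union>x\<in>K. ball x e0) \<subseteq> U" using compact_subset_open_imp_ball_epsilon_subset[OF K U] by blast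
  have "\<exists>e>0. e \<le> e0 \<and> inj_on G (\<Union>x\<in>K. ball x e)"
  proof (rule ccontr)
    assume neg: "\<not> (\<exists>e>0. e \<le> e0 \<and> inj_on G (\<Union>x\<in>K. ball x e))"
    have ex: "\<exists>a b x y. x \<in> K \<and> y \<in> K \<and> dist x a < e0 / real (Suc n) \<and> dist y b < e0 / real (Suc n) \<and> a \<noteq> b \<and> G a = G b" for n
    proof -
      have "\<not> inj_on G (\<Union>x\<in>K. ball x (e0 / real (Suc n)))"
        using neg e0(1) by (auto simp: divide_le_eq mult_le_cancel_left1)
      then obtain a b where ab: "a \<in> (\<Union>x\<in>K. ball x (e0 / real (Suc n)))" "b \<in> (\<Union>x\<in>K. ball x (e0 / real (Suc n)))"
        "G a = G b" "a \<noteq> b" unfolding inj_on_def by blast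
      obtain x y where "x \<in> K" "a \<in> ball x (e0 / real (Suc n))" "y \<in> K" "b \<in> ball y (e0 / real (Suc n))"
        using ab(1,2) by blast
      then show ?thesis using ab(3,4) unfolding mem_ball by blast
    qed
    have "\<forall>n. \<exists>p. fst (snd (snd p)) \<in> K \<and> snd (snd (snd p)) \<in> K \<and> dist (fst (snd (snd p))) (fst p) < e0 / real (Suc n) \<and>
        dist (snd (snd (snd p))) (fst (snd p)) < e0 / real (Suc n) \<and> fst p \<noteq> fst (snd p) \<and> G (fst p) = G (fst (snd p))"
    proof
      fix n :: nat
      obtain a b x y where "x \<in> K \<and> y \<in> K \<and> dist x a < e0 / real (Suc n) \<and> dist y b < e0 / real (Suc n) \<and> a \<noteq> b \<and> G a = G b"
        using ex[of n] by blast
      then show "\<exists>p. fst (snd (snd p)) \<in> K \<and> snd (snd (snd p)) \<in> K \<and> dist (fst (snd (snd p))) (fst p) < e0 / real (Suc n) \<and>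
        dist (snd (snd (snd p))) (fst (snd p)) < e0 / real (Suc n) \<and> fst p \<noteq> fst (snd p) \<and> G (fst p) = G (fst (snd p))"
        by (intro exI[of _ "(a, b, x, y)"]) simp
    qed
    from choice[OF this] obtain p where p: "\<forall>n. fst (snd (snd (p n))) \<in> K \<and> snd (snd (snd (p n))) \<in> K \<and> dist (fst (snd (snd (p n)))) (fst (p n)) < e0 / real (Suc n) \<and>
        dist (snd (snd (snd (p n)))) (fst (snd (p n))) < e0 / real (Suc n) \<and> fst (p n) \<noteq> fst (snd (p n)) \<and> G (fst (p n)) = G (fst (snd (p n)))" ..
    define a where "a n = fst (p n)" for n
    define b where "b n = fst (snd (p n))" for n
    define x where "x n = fst (snd (snd (p n)))" for n
    define y where "y n = snd (snd (snd (p n)))" for n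
    have xy: "x n \<in> K" "y n \<in> K" and d: "dist (x n) (a n) < e0 / real (Suc n)" "dist (y n) (b n) < e0 / real (Suc n)"
      and ab: "a n \<noteq> b n" "G (a n) = G (b n)" for n
      using p[rule_format, of n] unfolding a_def b_def x_def y_def by (simp_all only: simp_thms)
    have cK: "compact (K \<times> K)" by (intro compact_Times K)
    have fK: "\<forall>n. (x n, y n) \<in> K \<times> K" using xy by simp
    obtain l r where l: "l \<in> K \<times> K" and r: "strict_mono (r :: nat \<Rightarrow> nat)" and lim: "((\<lambda>n. (x n, y n)) \<circ> r) \<longlonglongrightarrow> l"
      by (rule seq_compactE[OF compact_imp_seq_compact[OF cK] fK]) (rule that)
    have lx: "(\<lambda>n. x (r n)) \<longlonglongrightarrow> fst l" and ly: "(\<lambda>n. y (r n)) \<longlonglongrightarrow> snd l"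
      using tendsto_fst[OF lim] tendsto_snd[OF lim] by (simp_all add: o_def)
    have e: "(\<lambda>n. e0 / real (Suc (r n))) \<longlonglongrightarrow> 0"
      using LIMSEQ_subseq_LIMSEQ[OF LIMSEQ_Suc[OF lim_const_over_n[of e0]] r] by (simp add: o_def)
    have "(\<lambda>n. dist (x (r n)) (a (r n))) \<longlonglongrightarrow> 0" "(\<lambda>n. dist (y (r n)) (b (r n))) \<longlonglongrightarrow> 0"
      by (rule tendsto_sandwich[OF _ _ tendsto_const e]; use d in \<open>auto intro!: always_eventually less_imp_le\<close>)+
    then have ax: "(\<lambda>n. a (r n) - x (r n)) \<longlonglongrightarrow> 0" and by0: "(\<lambda>n. b (r n) - y (r n)) \<longlonglongrightarrow> 0"
      by (simp_all only: dist_norm norm_minus_commute[of "x _"] norm_minus_commute[of "y _"] tendsto_norm_zero_iff)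
    have la: "(\<lambda>n. a (r n)) \<longlonglongrightarrow> fst l" by (rule Lim_transform[OF lx ax])
    have lb: "(\<lambda>n. b (r n)) \<longlonglongrightarrow> snd l" by (rule Lim_transform[OF ly by0])
    have lU: "fst l \<in> U" "snd l \<in> U" using l U(2) by auto
    have cont: "isCont G z" if "z \<in> U" for z
      using continuous_on_eq_continuous_at[OF U(1), of G] holomorphic_on_imp_continuous_on[OF G] that by blast
    have Ga: "(\<lambda>n. G (a (r n))) \<longlonglongrightarrow> G (fst l)" by (rule isCont_tendsto_compose[OF cont[OF lU(1)] la])
    have "(\<lambda>n. G (b (r n))) \<longlonglongrightarrow> G (snd l)" by (rule isCont_tendsto_compose[OF cont[OF lU(2)] lb])
    from LIMSEQ_unique[OF Ga[unfolded ab(2)] this] have "G (fst l) = G (snd l)" .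
    moreover have "fst l \<in> K" "snd l \<in> K" using l by (simp_all add: mem_Times_iff)
    ultimately have ll: "fst l = snd l" by (rule inj_onD[OF inj])
    obtain \<rho> where \<rho>: "\<rho> > 0" "inj_on G (ball (fst l) \<rho>)"
    proof -
      have "fst l \<in> K" using l by (simp add: mem_Times_iff)
      then show thesis using has_complex_derivative_locally_injective[OF G lU(1) U(1) nz] that by blast
    qed
    have "\<forall>\<^sub>F n in sequentially. dist (a (r n)) (fst l) < \<rho> \<and> dist (b (r n)) (fst l) < \<rho>"
      using tendstoD[OF la \<rho>(1)] tendstoD[OF lb \<rho>(1)] ll by (auto elim: eventually_elim2)
    then obtain n where "dist (a (r n)) (fst l) < \<rho> \<and> dist (b (r n)) (fst l) < \<rho>"
      unfolding eventually_sequentially by blast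
    then have "a (r n) \<in> ball (fst l) \<rho>" "b (r n) \<in> ball (fst l) \<rho>"
      by (simp_all add: dist_commute)
    then show False using inj_onD[OF \<rho>(2) ab(2)] ab(1) by blast
  qed
  then obtain e where e: "e > 0" "e \<le> e0" "inj_on G (\<Union>x\<in>K. ball x e)" by blast
  have "(\<Union>x\<in>K. ball x e) \<subseteq> U" using e(2) e0(2) by (intro order_trans[OF _ e0(2)] UN_mono subset_ball) auto
  then show thesis using e by (intro that)
qed

text \<open>The parametrization extends holomorphically and periodically to a strip around the real line; through
  \<open>\<xi> = exp (2 * pi * \<i> * z)\<close> it becomes a function on an annulus around the circle.\<close>

lemma analytic_Jordan_annulus:
  assumes "analytic_Jordan_curve C"
  obtains G \<rho> where "1 < \<rho>" "G holomorphic_on {z. 1 / \<rho> < norm z \<and> norm z < \<rho>}" "inj_on G {z. 1 / \<rho> < norm z \<and> norm z < \<rho>}"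
    "G ` sphere 0 1 = C"
proof -
  obtain \<gamma> where \<gamma>: "real_analytic \<gamma>" "\<And>s. \<gamma> (s + 1) = \<gamma> s" and inj: "inj_on \<gamma> {0..<1}"
    and nz: "\<And>s. vector_derivative \<gamma> (at s) \<noteq> 0" and C: "range \<gamma> = C"
    using assms unfolding analytic_Jordan_curve_def analytic_Jordan_parametrization_def by blast
  obtain \<delta> \<Gamma> where \<delta>: "0 < \<delta>" and holo: "\<Gamma> holomorphic_on {z. \<bar>Im z\<bar> < \<delta>}" and real: "\<And>s. \<Gamma> (complex_of_real s) = \<gamma> s"
    and per: "\<And>z n. \<bar>Im z\<bar> < \<delta> \<Longrightarrow> \<Gamma> (z + of_int n) = \<Gamma> z"
    using real_analytic_strip_extension[OF \<gamma>] by blast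
  have S: "open {z. \<bar>Im z\<bar> < \<delta>}" by (intro open_Collect_less continuous_intros)
  let ?c = "2 * of_real pi * \<i>"
  define G where "G \<xi> = \<Gamma> (Ln \<xi> / ?c)" for \<xi>
  define \<rho>0 where "\<rho>0 = exp (2 * pi * \<delta>)"
  define A where "A = {z::complex. 1 / \<rho>0 < norm z \<and> norm z < \<rho>0}"
  have \<rho>0: "1 < \<rho>0" using \<delta> by (simp add: \<rho>0_def)
  have A: "open A" unfolding A_def by (intro open_Collect_conj open_Collect_less continuous_intros)
  have Anz: "z \<noteq> 0" if "z \<in> A" for z using that \<rho>0 by (auto simp: A_def)
  have Im: "Im (z / ?c) = - (Re z / (2 * pi))" for z by (simp add: Im_divide power2_eq_square divide_simps)
  have strip: "\<bar>Im (z / ?c)\<bar> < \<delta>" if "exp z \<in> A" for z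
  proof -
    have "exp (- (2 * pi * \<delta>)) < exp (Re z)" "exp (Re z) < exp (2 * pi * \<delta>)"
      using that by (auto simp: A_def \<rho>0_def norm_exp_eq_Re exp_minus inverse_eq_divide)
    then have "\<bar>Re z\<bar> < 2 * pi * \<delta>" by auto
    then show ?thesis unfolding Im by (simp add: abs_divide divide_less_eq mult_ac)
  qed
  have Geq: "G (exp z) = \<Gamma> (z / ?c)" if "exp z \<in> A" for z
  proof -
    have "exp (Ln (exp z)) = exp z" by simp
    then obtain n :: int where "Ln (exp z) = z + (of_int (2 * n) * pi) * \<i>" unfolding exp_eq by blast
    then have "Ln (exp z) / ?c = z / ?c + of_int n" by (simp add: divide_simps)
    then show ?thesis unfolding G_def using per[OF strip[OF that]] by simp
  qed
  have Gholo: "G holomorphic_on A" and Gder: "\<And>z. exp z \<in> A \<Longrightarrow> deriv \<Gamma> (z / ?c) = deriv G (exp z) * exp z * ?c"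
  proof -
    show "G holomorphic_on A"
      unfolding holomorphic_on_open[OF A]
    proof
      fix \<xi>0 assume \<xi>0: "\<xi>0 \<in> A"
      define T where "T = A \<inter> ball \<xi>0 (norm \<xi>0)"
      have T: "open T" "\<xi>0 \<in> T" using A \<xi>0 Anz[OF \<xi>0] by (auto simp: T_def)
      define l where "l \<xi> = Ln (\<xi> / \<xi>0) + Ln \<xi>0" for \<xi>
      have nn: "\<xi> / \<xi>0 \<notin> \<real>\<^sub>\<le>\<^sub>0" if "\<xi> \<in> T" for \<xi>
      proof -
        have "norm (\<xi> / \<xi>0 - 1) < 1"
        proof -
          have "\<xi> / \<xi>0 - 1 = (\<xi> - \<xi>0) / \<xi>0" using Anz[OF \<xi>0] by (simp add: diff_divide_distrib)
          then show ?thesis using that Anz[OF \<xi>0] by (simp add: T_def norm_divide dist_norm norm_minus_commute)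
        qed
        then have "0 < Re (\<xi> / \<xi>0)" using abs_Re_le_cmod[of "\<xi> / \<xi>0 - 1"] by simp
        then show ?thesis by (auto simp: complex_nonpos_Reals_iff)
      qed
      have el: "exp (l \<xi>) = \<xi>" if "\<xi> \<in> T" for \<xi>
        using Anz[OF \<xi>0] Anz[of \<xi>] that by (simp add: l_def exp_add T_def)
      have "(\<Gamma> \<circ> (\<lambda>\<xi>. l \<xi> / ?c)) holomorphic_on T"
      proof (rule holomorphic_on_compose_gen[OF _ holo])
        show "(\<lambda>\<xi>. l \<xi> / ?c) holomorphic_on T"
          unfolding l_def using nn Anz[OF \<xi>0] by (intro holomorphic_intros) auto
        show "(\<lambda>\<xi>. l \<xi> / ?c) ` T \<subseteq> {z. \<bar>Im z\<bar> < \<delta>}"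
        proof (rule image_subsetI, rule CollectI)
          fix \<xi> assume "\<xi> \<in> T"
          then show "\<bar>Im (l \<xi> / ?c)\<bar> < \<delta>" using strip[of "l \<xi>"] el[of \<xi>] by (simp only: T_def Int_iff)
        qed
      qed
      then have "((\<Gamma> \<circ> (\<lambda>\<xi>. l \<xi> / ?c)) has_field_derivative deriv (\<Gamma> \<circ> (\<lambda>\<xi>. l \<xi> / ?c)) \<xi>0) (at \<xi>0)"
        by (rule holomorphic_derivI[OF _ T])
      then have "(G has_field_derivative deriv (\<Gamma> \<circ> (\<lambda>\<xi>. l \<xi> / ?c)) \<xi>0) (at \<xi>0)"
      proof (rule has_field_derivative_transform_within_open[OF _ T])
        fix \<xi> assume "\<xi> \<in> T"
        then show "(\<Gamma> \<circ> (\<lambda>\<xi>. l \<xi> / ?c)) \<xi> = G \<xi>" using Geq[of "l \<xi>"] el[of \<xi>] by (simp add: T_def)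
      qed
      then show "\<exists>f'. (G has_field_derivative f') (at \<xi>0)" by blast
    qed
    fix z assume z: "exp z \<in> A"
    have e: "exp (?c * (z / ?c)) = exp z" by simp
    have "(G has_field_derivative deriv G (exp z)) (at (exp (?c * (z / ?c))))"
      unfolding e by (rule holomorphic_derivI[OF \<open>G holomorphic_on A\<close> A z])
    moreover have "((\<lambda>w. exp (?c * w)) has_field_derivative exp z * ?c) (at (z / ?c))"
      by (auto intro!: derivative_eq_intros)
    ultimately have "((\<lambda>w. G (exp (?c * w))) has_field_derivative deriv G (exp z) * (exp z * ?c)) (at (z / ?c))"
      by (rule DERIV_chain2)
    moreover have "open ((\<lambda>w. exp (?c * w)) -` A)" by (intro open_vimage A continuous_intros)
    moreover have "z / ?c \<in> (\<lambda>w. exp (?c * w)) -` A" using z by simp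
    ultimately have "(\<Gamma> has_field_derivative deriv G (exp z) * (exp z * ?c)) (at (z / ?c))"
      by (rule has_field_derivative_transform_within_open) (use Geq[of "?c * _"] in auto)
    then show "deriv \<Gamma> (z / ?c) = deriv G (exp z) * exp z * ?c" by (simp add: DERIV_imp_deriv mult.assoc)
  qed
  have circ: "exp (?c * of_real s) = cis (2 * pi * s)" for s by (simp add: cis_conv_exp mult_ac)
  have inA: "z \<in> A" if "norm z = 1" for z using that \<rho>0 by (simp add: A_def)
  have Gc: "G (cis (2 * pi * s)) = \<gamma> s" for s
    using Geq[of "?c * of_real s"] inA[of "cis (2 * pi * s)"] by (simp add: circ real)
  have sph: "\<exists>s\<in>{0..<1}. z = cis (2 * pi * s)" if "norm z = 1" for z
  proof -
    have "z = cis (Arg2pi z)" using Arg2pi_eq[of z] that by (simp add: cis_conv_exp)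
    then show ?thesis using Arg2pi_ge_0[of z] Arg2pi_lt_2pi[of z]
      by (intro bexI[of _ "Arg2pi z / (2 * pi)"]) auto
  qed
  have im: "G ` sphere 0 1 = C"
  proof (intro subset_antisym subsetI)
    fix w assume "w \<in> G ` sphere 0 1"
    then obtain z where "norm z = 1" "w = G z" by auto
    then show "w \<in> C" using sph[of z] Gc C by auto
  next
    fix w assume "w \<in> C"
    then obtain s where "w = \<gamma> s" using C by auto
    then show "w \<in> G ` sphere 0 1" using Gc[of s] by (intro image_eqI[of _ _ "cis (2 * pi * s)"]) auto
  qed
  have injc: "inj_on G (sphere 0 1)"
  proof (rule inj_onI)
    fix a b :: complex assume "a \<in> sphere 0 1" "b \<in> sphere 0 1" and eq: "G a = G b"
    then obtain s u where s: "s \<in> {0..<1}" "a = cis (2 * pi * s)" and u: "u \<in> {0..<1}" "b = cis (2 * pi * u)"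
      using sph[of a] sph[of b] by auto
    then have "\<gamma> s = \<gamma> u" using eq Gc by simp
    then have "s = u" using inj_onD[OF inj _ s(1) u(1)] by blast
    then show "a = b" using s u by simp
  qed
  have dG: "deriv G z \<noteq> 0" if z: "z \<in> sphere 0 1" for z
  proof
    assume 0: "deriv G z = 0"
    obtain s where s: "z = cis (2 * pi * s)" using sph[of z] z by auto
    have "deriv \<Gamma> (of_real s) = 0"
      using Gder[of "?c * of_real s"] 0 inA[of z] z by (simp add: circ s)
    moreover have "(\<Gamma> has_field_derivative deriv \<Gamma> (of_real s)) (at (complex_of_real s))"
      by (rule holomorphic_derivI[OF holo S]) (use \<delta> in simp)
    moreover have "((\<lambda>x. complex_of_real x) has_vector_derivative complex_of_real 1) (at s)"
      by (rule bounded_linear.has_vector_derivative[OF bounded_linear_of_real has_vector_derivative_id])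
    ultimately have "((\<lambda>x. \<Gamma> (complex_of_real x)) has_vector_derivative 1 * 0) (at s)"
      using field_vector_diff_chain_at[of complex_of_real 1 s \<Gamma> 0] by (simp add: o_def)
    then have "vector_derivative \<gamma> (at s) = 0" unfolding real by (simp add: vector_derivative_at)
    then show False using nz by blast
  qed
  obtain e where e: "0 < e" "(\<Union>x\<in>sphere 0 1. ball x e) \<subseteq> A" "inj_on G (\<Union>x\<in>sphere 0 1. ball x e)"
    by (rule inj_on_near_compact[OF compact_sphere A _ Gholo injc dG]) (use inA in auto)
  have near: "z \<in> (\<Union>x\<in>sphere 0 1. ball x e)" if "\<bar>norm z - 1\<bar> < e" "z \<noteq> 0" for z :: complex
  proof -
    have "dist (z / of_real (norm z)) z = \<bar>norm z - 1\<bar>"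
    proof -
      have "z / of_real (norm z) - z = (z / of_real (norm z)) * of_real (1 - norm z)" using that(2) by (simp add: field_simps)
      also have "norm \<dots> = \<bar>1 - norm z\<bar>" using that(2) by (simp only: norm_mult norm_divide norm_of_real abs_norm_cancel) simp
      finally show ?thesis by (simp add: dist_norm)
    qed
    then show ?thesis using that by (intro UN_I[of "z / of_real (norm z)"]) (auto simp: norm_divide)
  qed
  define \<rho> where "\<rho> = 1 + e / 2"
  have \<rho>: "1 < \<rho>" using e by (simp add: \<rho>_def)
  have sub: "{z::complex. 1 / \<rho> < norm z \<and> norm z < \<rho>} \<subseteq> (\<Union>x\<in>sphere 0 1. ball x e)"
  proof
    fix z :: complex assume z: "z \<in> {z. 1 / \<rho> < norm z \<and> norm z < \<rho>}"
    have "1 - e / 2 \<le> 1 / \<rho>"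
      using e(1) by (simp add: \<rho>_def field_simps)
    then have "\<bar>norm z - 1\<bar> < e" using z e(1) by (auto simp: \<rho>_def abs_less_iff)
    moreover have "z \<noteq> 0" using z \<rho> by auto
    ultimately show "z \<in> (\<Union>x\<in>sphere 0 1. ball x e)" by (rule near)
  qed
  show thesis
    by (rule that[OF \<rho> holomorphic_on_subset[OF Gholo order_trans[OF sub e(2)]] inj_on_subset[OF e(3) sub] im])
qed

lemma contour_integral_circle_radius:
  assumes h: "h holomorphic_on {z. a < norm z \<and> norm z < b}" and r: "0 \<le> a" "a < r" "r < b" "a < s" "s < b"
  shows "contour_integral (circlepath 0 r) h = contour_integral (circlepath 0 s) h"
proof (rule Cauchy_theorem_homotopic_loops[OF _ _ h])
  let ?A = "{z::complex. a < norm z \<and> norm z < b}"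
  show "open ?A" by (intro open_Collect_conj open_Collect_less continuous_intros)
  show "homotopic_loops ?A (circlepath 0 r) (circlepath 0 s)"
  proof (rule homotopic_loops_linear)
    fix t x :: real assume "t \<in> {0..1}"
    show "closed_segment (circlepath 0 r t) (circlepath 0 s t) \<subseteq> ?A"
    proof
      fix w assume "w \<in> closed_segment (circlepath 0 r t) (circlepath 0 s t)"
      then obtain u where u: "0 \<le> u" "u \<le> 1" "w = (1 - u) *\<^sub>R circlepath 0 r t + u *\<^sub>R circlepath 0 s t"
        by (auto simp: closed_segment_def)
      have "w = of_real ((1 - u) * r + u * s) * exp (2 * of_real pi * \<i> * of_real t)"
        unfolding u(3) by (simp add: circlepath_def part_circlepath_def linepath_def scaleR_conv_of_real algebra_simps)
      then have nw: "norm w = \<bar>(1 - u) * r + u * s\<bar>" by (simp only: norm_mult norm_of_real) (simp add: norm_exp_eq_Re)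
      have "(1 - u) * r + u * s \<in> {a<..<b}"
        using convexD_alt[of "{a<..<b}" r s u] r u by (simp add: algebra_simps)
      then show "w \<in> ?A" using nw r by auto
    qed
  qed auto
qed auto

text \<open>The two integrands are weighted by the position on the circle, which is how \<open>dz\<close> scales with the radius.\<close>

lemma contour_integral_circle_compare:
  assumes g: "continuous_on (sphere 0 r) g" and h: "continuous_on (sphere 0 s) h" and r: "0 < r" "0 < s"
    and le: "\<And>\<omega>. norm \<omega> = 1 \<Longrightarrow> norm (h (of_real s * \<omega>) * (of_real s * \<omega>) - g (of_real r * \<omega>) * (of_real r * \<omega>)) \<le> e"
  shows "norm (contour_integral (circlepath 0 s) h - contour_integral (circlepath 0 r) g) \<le> 2 * pi * e"
proof -
  let ?w = "\<lambda>t. exp (2 * of_real pi * \<i> * of_real t)"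
  have n1: "norm (?w t) = 1" for t by (simp add: norm_exp_eq_Re)
  have I: "((\<lambda>t. 2 * of_real pi * \<i> * (k (of_real u * ?w t) * (of_real u * ?w t))) has_integral contour_integral (circlepath 0 u) k) {0..1}"
    if "continuous_on (sphere 0 u) k" "0 < u" for k u
  proof -
    have "(k has_contour_integral contour_integral (circlepath 0 u) k) (circlepath 0 u)"
      using that by (intro has_contour_integral_integral contour_integrable_continuous_circlepath) (simp add: path_image_circlepath)
    then have "((\<lambda>t. k (circlepath 0 u t) * vector_derivative (circlepath 0 u) (at t)) has_integral contour_integral (circlepath 0 u) k) {0..1}"
      unfolding has_contour_integral by simp
    then show ?thesis
      by (rule has_integral_eq[rotated])
         (simp add: vector_derivative_circlepath, simp add: circlepath_def part_circlepath_def linepath_def mult_ac)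
  qed
  have d: "((\<lambda>t. 2 * of_real pi * \<i> * (h (of_real s * ?w t) * (of_real s * ?w t) - g (of_real r * ?w t) * (of_real r * ?w t)))
      has_integral contour_integral (circlepath 0 s) h - contour_integral (circlepath 0 r) g) {0..1}"
    using has_integral_diff[OF I[OF h r(2)] I[OF g r(1)]] by (simp add: right_diff_distrib)
  have "norm (contour_integral (circlepath 0 s) h - contour_integral (circlepath 0 r) g) \<le> (2 * pi * e) * measure lborel (cbox 0 (1::real))"
  proof (rule has_integral_bound)
    have "0 \<le> e" using order_trans[OF norm_ge_zero le[of 1]] by simp
    then show "0 \<le> 2 * pi * e" by simp
    show "((\<lambda>t. 2 * of_real pi * \<i> * (h (of_real s * ?w t) * (of_real s * ?w t) - g (of_real r * ?w t) * (of_real r * ?w t)))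
      has_integral contour_integral (circlepath 0 s) h - contour_integral (circlepath 0 r) g) (cbox 0 1)" using d by simp
    fix t :: real
    show "norm (2 * of_real pi * \<i> * (h (of_real s * ?w t) * (of_real s * ?w t) - g (of_real r * ?w t) * (of_real r * ?w t))) \<le> 2 * pi * e"
      using mult_left_mono[OF le[OF n1[of t]], of "2 * pi"] by (simp add: norm_mult)
  qed
  then show ?thesis by simp
qed

text \<open>No boundary values are available on either side; only the values at points symmetric about the circle are close
  to each other. The Cauchy integral of \<open>gout\<close> over a circle of radius greater than 1 can be moved inwards to a
  circle slightly outside the unit circle and compared with the Cauchy integral of \<open>g\<close> over the reflected one. In the
  limit it represents \<open>g\<close> inside; subtracting the pole shows that it represents \<open>gout\<close> outside.\<close>

lemma paste_across_circle:
  fixes g gout :: "complex \<Rightarrow> complex"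
  assumes g: "g holomorphic_on ball 0 1" and M: "\<And>z. norm z < 1 \<Longrightarrow> norm (g z) \<le> M"
    and gout: "gout holomorphic_on {z. 1 < norm z \<and> norm z < b}"
    and close: "\<And>e. 0 < e \<Longrightarrow> \<exists>s<1. \<forall>z. s < norm z \<and> norm z < 1 \<longrightarrow> norm (gout (1 / cnj z) - g z) < e"
    and R1: "1 < R1" "R1 < b"
  obtains K where "K holomorphic_on ball 0 R1" "\<And>z. norm z < 1 \<Longrightarrow> K z = g z" "\<And>z. 1 < norm z \<Longrightarrow> norm z < R1 \<Longrightarrow> K z = gout z"
proof -
  let ?A = "{z::complex. 1 < norm z \<and> norm z < b}"
  have A: "open ?A" by (intro open_Collect_conj open_Collect_less continuous_intros)
  have M0: "0 \<le> M" using order_trans[OF norm_ge_zero M[of 0]] by simp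
  have gc: "continuous_on ?A gout" by (rule holomorphic_on_imp_continuous_on[OF gout])
  have lim: "\<exists>s<1. \<forall>r. s < r \<and> r < 1 \<longrightarrow> norm (contour_integral (circlepath 0 (1 / r)) (\<lambda>z. gout z / (z - w)) - contour_integral (circlepath 0 r) (\<lambda>z. g z / (z - w))) \<le> 2 * pi * e"
    if w: "norm w \<noteq> 1" and e: "0 < e" for w e
  proof -
    obtain s0 where s0: "1 / 2 < s0" "1 / b < s0" "s0 < 1" "norm w < s0 \<or> 1 / s0 < norm w"
    proof (cases "norm w < 1")
      case True
      obtain s0 where "max (1 / 2) (max (1 / b) (norm w)) < s0" "s0 < 1"
        using dense[of "max (1 / 2) (max (1 / b) (norm w))" 1] True R1 by auto
      then show thesis by (intro that[of s0]) auto
    next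
      case False
      then have w1: "1 < norm w" using w by simp
      have "1 / norm w < 1" "1 / b < 1" using w1 R1 by (simp_all add: divide_less_eq)
      then obtain s0 where s0: "max (1 / 2) (max (1 / b) (1 / norm w)) < s0" "s0 < 1"
        using dense[of "max (1 / 2) (max (1 / b) (1 / norm w))" 1] by auto
      then have "1 / norm w < s0" "0 < s0" by auto
      have "w \<noteq> 0" by (cases "w = 0") (use w1 in simp_all)
      then have "1 < s0 * norm w" using \<open>1 / norm w < s0\<close> by (simp add: divide_less_eq)
      then have "1 / s0 < norm w" using \<open>0 < s0\<close> by (simp add: divide_less_eq mult.commute)
      then show thesis using s0 by (intro that[of s0]) auto
    qed
    define Kc where "Kc = {z::complex. s0 \<le> norm z \<and> norm z \<le> 1 / s0}"
    have Kc: "compact Kc"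
    proof -
      have "Kc = cball 0 (1 / s0) \<inter> {z. s0 \<le> norm z}" by (auto simp: Kc_def)
      moreover have "closed {z::complex. s0 \<le> norm z}" by (intro closed_Collect_le continuous_intros)
      ultimately show ?thesis by (simp add: compact_Int_closed)
    qed
    define u where "u z = z / (z - w)" for z
    have uc: "continuous_on Kc u" unfolding u_def using s0(4) by (intro continuous_intros) (auto simp: Kc_def)
    obtain B where B: "\<And>z. z \<in> Kc \<Longrightarrow> norm (u z) \<le> B" "0 < B"
      using compact_imp_bounded[OF compact_continuous_image[OF uc Kc]] by (auto simp: bounded_pos)
    have "uniformly_continuous_on Kc u" by (rule compact_uniformly_continuous[OF uc Kc])
    moreover have "0 < e / (2 * (M + 1))" using e M0 by simp
    ultimately obtain d where d: "0 < d" "\<And>z z'. z \<in> Kc \<Longrightarrow> z' \<in> Kc \<Longrightarrow> dist z' z < d \<Longrightarrow> dist (u z') (u z) < e / (2 * (M + 1))"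
      by (rule uniformly_continuous_onE) (rule that)
    obtain s1 where s1: "s1 < 1" "\<And>z. s1 < norm z \<Longrightarrow> norm z < 1 \<Longrightarrow> norm (gout (1 / cnj z) - g z) < e / (2 * B)"
      using close[of "e / (2 * B)"] e B(2) by auto
    define s where "s = max s0 (max s1 (1 - d / 4))"
    have "norm (contour_integral (circlepath 0 (1 / r)) (\<lambda>z. gout z / (z - w)) - contour_integral (circlepath 0 r) (\<lambda>z. g z / (z - w))) \<le> 2 * pi * e"
      if r: "s < r" "r < 1" for r
    proof (rule contour_integral_circle_compare)
      have r0: "1 / 2 < r" "s0 < r" "s1 < r" "1 - d / 4 < r" using r s0 by (auto simp: s_def)
      then show rp: "0 < r" "0 < 1 / r" by auto
      have rb: "1 < 1 / r" "1 / r < b" "1 / r < 1 / s0"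
      proof -
        show "1 < 1 / r" using r rp by simp
        show "1 / r < 1 / s0" using r0 s0 by (simp add: frac_less2)
        have "1 / b < r" using r0 s0 by simp
        then show "1 / r < b" using rp R1 by (simp add: field_simps)
      qed
      have wn: "w \<notin> sphere 0 r" "w \<notin> sphere 0 (1 / r)" 
      proof -
        have "s0 \<le> r" "r \<le> 1 / s0" "s0 \<le> 1 / r" "1 / r \<le> 1 / s0" using r r0 rb by linarith+
        then show "w \<notin> sphere 0 r" "w \<notin> sphere 0 (1 / r)" using s0(4) by (auto simp del: divide_le_eq_1)
      qed
      have "continuous_on (sphere 0 r) g"
        by (rule continuous_on_subset[OF holomorphic_on_imp_continuous_on[OF g]]) (use r in auto)
      then show "continuous_on (sphere 0 r) (\<lambda>z. g z / (z - w))" using wn by (intro continuous_on_divide continuous_on_diff continuous_on_id continuous_on_const) auto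
      have "continuous_on (sphere 0 (1 / r)) gout" by (rule continuous_on_subset[OF gc]) (use rb in auto)
      then show "continuous_on (sphere 0 (1 / r)) (\<lambda>z. gout z / (z - w))" using wn by (intro continuous_on_divide continuous_on_diff continuous_on_id continuous_on_const) auto
      fix \<omega> :: complex assume \<omega>: "norm \<omega> = 1"
      define z where "z = of_real r * \<omega>" define z' where "z' = of_real (1 / r) * \<omega>"
      have nz: "norm z = r" "norm z' = 1 / r" using \<omega> rp by (auto simp: z_def z'_def norm_mult norm_divide)
      have "cnj \<omega> * \<omega> = 1" using \<omega> by (simp add: complex_norm_square[symmetric] mult.commute)
      then have "\<omega> = 1 / cnj \<omega>" using \<omega> by (metis eq_divide_eq mult.commute complex_cnj_zero_iff norm_zero zero_neq_one)
      then have z': "z' = 1 / cnj z" unfolding z_def z'_def by (simp add: divide_inverse mult.commute)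
      have inK: "z \<in> Kc" "z' \<in> Kc"
      proof -
        have "s0 \<le> r" "r \<le> 1 / s0" "s0 \<le> 1 / r" "1 / r \<le> 1 / s0" using r r0 rb by linarith+
        then show "z \<in> Kc" "z' \<in> Kc" by (simp_all only: Kc_def mem_Collect_eq nz simp_thms)
      qed
      have "dist z' z = 1 / r - r"
      proof -
        have "z' - z = of_real (1 / r - r) * \<omega>" by (simp add: z_def z'_def left_diff_distrib)
        then have "dist z' z = \<bar>1 / r - r\<bar>" unfolding dist_norm by (simp only: norm_mult norm_of_real \<omega> mult_1_right)
        then show ?thesis using rb r by simp
      qed
      also have "\<dots> < d"
      proof -
        have "1 / r - r = (1 - r) * ((1 + r) / r)" using rp by (simp add: field_simps)
        also have "\<dots> \<le> (1 - r) * 4" using r r0 rp by (intro mult_left_mono) (auto simp: divide_le_eq)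
        also have "\<dots> < d" using r0 by simp
        finally show ?thesis .
      qed
      finally have du: "norm (u z' - u z) < e / (2 * (M + 1))" using d(2)[OF inK(1) inK(2)] by (simp add: dist_norm)
      have "gout z' / (z' - w) * z' - g z / (z - w) * z = (gout z' - g z) * u z' + g z * (u z' - u z)"
        by (simp add: u_def algebra_simps diff_divide_distrib)
      also have "norm \<dots> \<le> norm (gout z' - g z) * norm (u z') + norm (g z) * norm (u z' - u z)"
        by (rule order_trans[OF norm_triangle_ineq]) (simp add: norm_mult)
      also have "\<dots> \<le> e / (2 * B) * B + M * (e / (2 * (M + 1)))"
      proof (intro add_mono mult_mono)
        show "norm (gout z' - g z) \<le> e / (2 * B)" using s1(2)[of z] nz r0 r by (simp add: z')
        show "norm (u z') \<le> B" by (rule B(1)[OF inK(2)])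
        show "norm (g z) \<le> M" using M[of z] nz r by simp
        show "norm (u z' - u z) \<le> e / (2 * (M + 1))" using du by simp
      qed (use e B M0 in auto)
      also have "\<dots> \<le> e / 2 + e / 2"
        using e B(2) M0 by (intro add_mono) (auto simp: field_simps)
      finally show "norm (gout (of_real (1 / r) * \<omega>) / (of_real (1 / r) * \<omega> - w) * (of_real (1 / r) * \<omega>) - g (of_real r * \<omega>) / (of_real r * \<omega> - w) * (of_real r * \<omega>)) \<le> e"
        unfolding z_def[symmetric] z'_def[symmetric] by simp
    qed
    moreover have "s < 1" using s0 s1 d by (simp add: s_def)
    ultimately show ?thesis by blast
  qed
  define I where "I w = contour_integral (circlepath 0 R1) (\<lambda>z. gout z / (z - w))" for w
  have small: "x = 0" if "\<And>e. 0 < e \<Longrightarrow> norm x \<le> 2 * pi * e" for x :: complex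
  proof (rule ccontr)
    assume "x \<noteq> 0"
    then show False using that[of "norm x / (4 * pi)"] by simp
  qed
  have inside: "I w = 2 * of_real pi * \<i> * g w" if w: "norm w < 1" for w
  proof -
    have "I w - 2 * of_real pi * \<i> * g w = 0"
    proof (rule small)
      fix e :: real assume e: "0 < e"
      obtain s where s: "s < 1" "\<And>r. s < r \<Longrightarrow> r < 1 \<Longrightarrow> norm (contour_integral (circlepath 0 (1 / r)) (\<lambda>z. gout z / (z - w)) - contour_integral (circlepath 0 r) (\<lambda>z. g z / (z - w))) \<le> 2 * pi * e"
        using lim[of w e] w e by auto
      obtain r where r: "max s (max (norm w) (1 / b)) < r" "r < 1" using dense[of "max s (max (norm w) (1 / b))" 1] s w R1 by auto
      have rp: "0 < r" using r norm_ge_zero[of w] by linarith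
      have rb: "1 / r < b" "1 < 1 / r" using r rp R1 by (auto simp: field_simps)
      have "(\<lambda>z. gout z / (z - w)) holomorphic_on ?A" using w by (intro holomorphic_intros gout) auto
      from contour_integral_circle_radius[OF this, of R1 "1 / r"] have "I w = contour_integral (circlepath 0 (1 / r)) (\<lambda>z. gout z / (z - w))"
        using R1 rb by (simp add: I_def)
      moreover have "contour_integral (circlepath 0 r) (\<lambda>z. g z / (z - w)) = 2 * of_real pi * \<i> * g w"
      proof (rule contour_integral_unique, rule Cauchy_integral_circlepath_simple)
        show "g holomorphic_on cball 0 r" by (rule holomorphic_on_subset[OF g]) (use r in auto)
        show "norm (w - 0) < r" using r by simp
      qed
      ultimately show "norm (I w - 2 * of_real pi * \<i> * g w) \<le> 2 * pi * e" using s(2)[of r] r by simp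
    qed
    then show ?thesis by simp
  qed
  have outside: "I w = 2 * of_real pi * \<i> * gout w" if w: "1 < norm w" "norm w < R1" for w
  proof -
    have wA: "w \<in> ?A" using w R1 by simp
    have "I w - 2 * of_real pi * \<i> * gout w = 0"
    proof (rule small)
      fix e :: real assume e: "0 < e"
      obtain s where s: "s < 1" "\<And>r. s < r \<Longrightarrow> r < 1 \<Longrightarrow> norm (contour_integral (circlepath 0 (1 / r)) (\<lambda>z. gout z / (z - w)) - contour_integral (circlepath 0 r) (\<lambda>z. g z / (z - w))) \<le> 2 * pi * e"
        using lim[of w e] w e by auto
      have "0 < norm w" using w(1) by linarith
      then have "1 / norm w < 1" using w(1) by (simp only: pos_divide_less_eq mult_1_left)
      then obtain r where r: "max s (1 / norm w) < r" "r < 1" using dense[of "max s (1 / norm w)" 1] s by auto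
      have "0 < 1 / norm w" using \<open>0 < norm w\<close> by (rule divide_pos_pos[OF zero_less_one])
      then have rp: "0 < r" using r by linarith
      have "0 < norm w" using w(1) by linarith
      then have "w \<noteq> 0" by (rule zero_less_norm_iff[THEN iffD1])
      then have rb: "1 / r < norm w" "1 < 1 / r" using r rp by (simp_all add: divide_less_eq mult.commute)
      define q where "q z = (if z = w then deriv gout w else (gout z - gout w) / (z - w))" for z
      have qh: "q holomorphic_on ?A" unfolding q_def by (rule pole_lemma[OF gout]) (use wA A in \<open>simp add: interior_open\<close>)
      have int: "(\<lambda>z. gout z / (z - w)) contour_integrable_on circlepath 0 \<rho>" "(\<lambda>z. gout w / (z - w)) contour_integrable_on circlepath 0 \<rho>"
        "contour_integral (circlepath 0 \<rho>) q = contour_integral (circlepath 0 \<rho>) (\<lambda>z. gout z / (z - w)) - gout w * contour_integral (circlepath 0 \<rho>) (\<lambda>z. 1 / (z - w))"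
        if \<rho>: "1 < \<rho>" "\<rho> < b" "\<rho> \<noteq> norm w" for \<rho>
      proof -
        have wn: "z - w \<noteq> 0" if "z \<in> sphere 0 \<rho>" for z using that \<rho> by auto
        have gs: "continuous_on (sphere 0 \<rho>) gout" by (rule continuous_on_subset[OF gc]) (use \<rho> in auto)
        have pi: "path_image (circlepath 0 \<rho>) = sphere 0 \<rho>" using \<rho> by (simp add: path_image_circlepath)
        show 1: "(\<lambda>z. gout z / (z - w)) contour_integrable_on circlepath 0 \<rho>" "(\<lambda>z. gout w / (z - w)) contour_integrable_on circlepath 0 \<rho>"
          using wn by (intro contour_integrable_continuous_circlepath; unfold pi; intro continuous_on_divide continuous_on_diff continuous_on_id continuous_on_const gs; simp)+
        have "contour_integral (circlepath 0 \<rho>) q = contour_integral (circlepath 0 \<rho>) (\<lambda>z. gout z / (z - w) - gout w / (z - w))"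
        proof (rule contour_integral_cong[OF refl])
          fix z assume "z \<in> path_image (circlepath 0 \<rho>)"
          then have "z \<noteq> w" using wn[of z] unfolding pi by auto
          then show "q z = gout z / (z - w) - gout w / (z - w)" by (simp add: q_def diff_divide_distrib)
        qed
        also have "\<dots> = contour_integral (circlepath 0 \<rho>) (\<lambda>z. gout z / (z - w)) - contour_integral (circlepath 0 \<rho>) (\<lambda>z. gout w / (z - w))"
          by (rule contour_integral_diff[OF 1])
        also have "contour_integral (circlepath 0 \<rho>) (\<lambda>z. gout w / (z - w)) = gout w * contour_integral (circlepath 0 \<rho>) (\<lambda>z. 1 / (z - w))"
        proof -
          have "(\<lambda>z. 1 / (z - w)) contour_integrable_on circlepath 0 \<rho>"
            using wn by (intro contour_integrable_continuous_circlepath; unfold pi; intro continuous_on_divide continuous_on_diff continuous_on_id continuous_on_const; simp)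
          from contour_integral_lmul[OF this, of "gout w"] show ?thesis by simp
        qed
        finally show "contour_integral (circlepath 0 \<rho>) q = contour_integral (circlepath 0 \<rho>) (\<lambda>z. gout z / (z - w)) - gout w * contour_integral (circlepath 0 \<rho>) (\<lambda>z. 1 / (z - w))" .
      qed
      have "contour_integral (circlepath 0 R1) q = contour_integral (circlepath 0 (1 / r)) q"
        using R1 rb w by (intro contour_integral_circle_radius[OF qh]) auto
      moreover have "contour_integral (circlepath 0 R1) (\<lambda>z. 1 / (z - w)) = 2 * of_real pi * \<i>"
        using contour_integral_unique[OF Cauchy_integral_circlepath_simple[of "\<lambda>_. 1" 0 R1 w]] w by simp
      moreover have "contour_integral (circlepath 0 (1 / r)) (\<lambda>z. 1 / (z - w)) = 0"
        by (rule contour_integral_unique, rule Cauchy_theorem_convex_simple[of _ "cball 0 (1 / r)"])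
           (use rb rp in \<open>auto intro!: holomorphic_intros simp: path_image_circlepath\<close>)
      ultimately have "I w - 2 * of_real pi * \<i> * gout w = contour_integral (circlepath 0 (1 / r)) (\<lambda>z. gout z / (z - w))"
        using int(3)[of R1] int(3)[of "1 / r"] R1 rb w by (simp add: I_def mult.commute)
      moreover have "contour_integral (circlepath 0 r) (\<lambda>z. g z / (z - w)) = 0"
      proof (rule contour_integral_unique, rule Cauchy_theorem_convex_simple[of _ "cball 0 r"])
        have "g holomorphic_on cball 0 r" by (rule holomorphic_on_subset[OF g]) (use r in auto)
        then show "(\<lambda>z. g z / (z - w)) holomorphic_on cball 0 r" using w r by (intro holomorphic_intros) auto
      qed (use rp in \<open>auto simp: path_image_circlepath\<close>)
      ultimately show "norm (I w - 2 * of_real pi * \<i> * gout w) \<le> 2 * pi * e" using s(2)[of r] r by simp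
    qed
    then show ?thesis by simp
  qed
  have Iholo: "I holomorphic_on ball 0 R1"
    unfolding holomorphic_on_open[OF open_ball]
  proof
    fix w :: complex assume w: "w \<in> ball 0 R1"
    have gs: "continuous_on (path_image (circlepath 0 R1)) gout"
      by (rule continuous_on_subset[OF gc]) (use R1 in \<open>auto simp: path_image_circlepath\<close>)
    have "((\<lambda>u. gout u / (u - v) ^ 1) has_contour_integral I v) (circlepath 0 R1)" if "v \<in> ball 0 R1" for v
    proof -
      have "(\<lambda>z. gout z / (z - v)) contour_integrable_on circlepath 0 R1"
        using that R1 by (intro contour_integrable_continuous_circlepath continuous_on_divide continuous_on_diff continuous_on_id continuous_on_const gs)
          (auto simp: path_image_circlepath)
      then show ?thesis unfolding I_def by (simp add: has_contour_integral_integral)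
    qed
    from Cauchy_next_derivative_circlepath(2)[OF gs this _ w] show "\<exists>f'. (I has_field_derivative f') (at w)" by auto
  qed
  show thesis
  proof (rule that[of "\<lambda>w. I w / (2 * of_real pi * \<i>)"])
    show "(\<lambda>w. I w / (2 * of_real pi * \<i>)) holomorphic_on ball 0 R1" by (intro holomorphic_intros Iholo) auto
    show "I z / (2 * of_real pi * \<i>) = g z" if "norm z < 1" for z using inside[OF that] by simp
    show "I z / (2 * of_real pi * \<i>) = gout z" if "1 < norm z" "norm z < R1" for z using outside[OF that] by simp
  qed
qed

lemma simply_connected_Riemann_map_origin:
  assumes D: "open D" "simply_connected D" "0 \<in> D" "bounded D"
  obtains f g where "f holomorphic_on D" "g holomorphic_on ball 0 1" "\<And>z. z \<in> D \<Longrightarrow> norm (f z) < 1 \<and> g (f z) = z"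
    "\<And>z. norm z < 1 \<Longrightarrow> g z \<in> D \<and> f (g z) = z" "g 0 = (0 :: complex)"
proof -
  have "D \<noteq> {}" "D \<noteq> UNIV" using D by (auto simp: not_bounded_UNIV)
  then obtain f0 g0 where f0: "f0 holomorphic_on D" and g0: "g0 holomorphic_on ball 0 1"
    and fg: "\<forall>z\<in>D. f0 z \<in> ball 0 1 \<and> g0 (f0 z) = z" and gf: "\<forall>z\<in>ball 0 1. g0 z \<in> D \<and> f0 (g0 z) = z"
    using Riemann_mapping_theorem[of D] D by auto
  define a where "a = f0 0"
  have a: "norm a < 1" using fg D(3) by (auto simp: a_def)
  define M1 where "M1 = Moebius_function 0 a" define M2 where "M2 = Moebius_function 0 (- a)"
  have M: "norm (M1 z) < 1" "norm (M2 z) < 1" "M1 (M2 z) = z" "M2 (M1 z) = z" if "norm z < 1" for z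
    using that a Moebius_function_compose[of a "- a" z] Moebius_function_compose[of "- a" a z]
    by (auto simp: M1_def M2_def Moebius_function_norm_lt_1)
  have Mh: "M1 holomorphic_on ball 0 1" "M2 holomorphic_on ball 0 1"
    unfolding M1_def M2_def using a by (intro Moebius_function_holomorphic; simp)+
  have M20: "M2 0 = a" unfolding M2_def Moebius_function_of_zero by simp
  show thesis
  proof (rule that[of "M1 \<circ> f0" "g0 \<circ> M2"])
    show "(M1 \<circ> f0) holomorphic_on D" by (rule holomorphic_on_compose_gen[OF f0 Mh(1)]) (use fg in auto)
    show "(g0 \<circ> M2) holomorphic_on ball 0 1" by (rule holomorphic_on_compose_gen[OF Mh(2) g0]) (use M in auto)
    show "norm ((M1 \<circ> f0) z) < 1 \<and> (g0 \<circ> M2) ((M1 \<circ> f0) z) = z" if "z \<in> D" for z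
      using fg that M[of "f0 z"] by auto
    show "(g0 \<circ> M2) z \<in> D \<and> (M1 \<circ> f0) ((g0 \<circ> M2) z) = z" if "norm z < 1" for z
      using gf M[of z] that by auto
    show "(g0 \<circ> M2) 0 = 0" using fg D(3) by (simp add: M20 a_def)
  qed
qed

text \<open>Each half of a thin annular neighbourhood of the boundary is connected and avoids the boundary, so it lies inside or
  outside; both sides occur, since every boundary point is a limit of points of \<open>D\<close> and, by the Jordan curve theorem,
  of points outside. The inversion \<open>1 / z\<close> exchanges the two halves if necessary.\<close>

lemma annulus_sides:
  assumes D: "open D" "connected D" "bounded D" "D \<noteq> {}" and J: "analytic_Jordan_curve (frontier D)"
  obtains G \<rho> where "1 < \<rho>" "G holomorphic_on {z. 1 / \<rho> < norm z \<and> norm z < \<rho>}" "inj_on G {z. 1 / \<rho> < norm z \<and> norm z < \<rho>}"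
    "G ` sphere 0 1 = frontier D" "\<And>z. 1 / \<rho> < norm z \<Longrightarrow> norm z < 1 \<Longrightarrow> G z \<in> D"
    "\<And>z. 1 < norm z \<Longrightarrow> norm z < \<rho> \<Longrightarrow> G z \<notin> D \<union> frontier D"
proof -
  obtain G \<rho> where \<rho>: "1 < \<rho>" and G: "G holomorphic_on {z. 1 / \<rho> < norm z \<and> norm z < \<rho>}"
    and inj: "inj_on G {z. 1 / \<rho> < norm z \<and> norm z < \<rho>}" and C: "G ` sphere 0 1 = frontier D"
    by (rule analytic_Jordan_annulus[OF J], rule that)
  define A where "A = {z::complex. 1 / \<rho> < norm z \<and> norm z < \<rho>}"
  note G = G[folded A_def] and inj = inj[folded A_def]
  have A: "open A" unfolding A_def by (intro open_Collect_conj open_Collect_less continuous_intros)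
  have r1: "1 / \<rho> < 1" using \<rho> by simp
  have SA: "sphere 0 1 \<subseteq> A" using \<rho> r1 by (auto simp: A_def)
  have Gc: "continuous_on A G" by (rule holomorphic_on_imp_continuous_on[OF G])
  define c where "c = G \<circ> circlepath 0 1"
  have "simple_path c"
    unfolding c_def
  proof (rule simple_path_continuous_image)
    show "continuous_on (path_image (circlepath 0 1)) G" "inj_on G (path_image (circlepath 0 1))"
      using continuous_on_subset[OF Gc SA] inj_on_subset[OF inj SA] by (simp_all add: path_image_circlepath)
  qed (simp add: simple_path_circlepath)
  moreover have "pathfinish c = pathstart c" unfolding c_def pathfinish_compose pathstart_compose by simp
  moreover have pc: "path_image c = frontier D" unfolding c_def path_image_compose using C by (simp add: path_image_circlepath)
  ultimately have out: "outside (frontier D) \<noteq> {}" "connected (outside (frontier D))" "\<not> bounded (outside (frontier D))"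
    "frontier (outside (frontier D)) = frontier D" "frontier D \<inter> outside (frontier D) = {}"
    using Jordan_inside_outside[of c] outside_no_overlap[of "frontier D"] by (auto simp: Int_commute)
  have outD: "D \<inter> outside (frontier D) = {}"
  proof (rule ccontr)
    assume "D \<inter> outside (frontier D) \<noteq> {}"
    then have "outside (frontier D) - D = {}"
      using connected_Int_frontier[OF out(2), of D] out(5) by blast
    then show False using bounded_subset[OF D(3), of "outside (frontier D)"] out(3) by blast
  qed
  have DC: "D \<inter> frontier D = {}" using D(1) by (auto simp: frontier_def interior_open)
  have "1 \<in> sphere (0::complex) 1" by simp
  then have "G 1 \<in> frontier D" unfolding C[symmetric] by (rule imageI)
  then obtain p where p: "p \<in> frontier D" by (rule that)
  have U: "open (G ` A)" by (rule open_mapping_thm3[OF G A inj])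
  have pU: "p \<in> G ` A" using p C SA by blast
  have fc: "frontier S \<subseteq> closure S" for S :: "complex set" by (auto simp: frontier_def)
  have meetD: "G ` A \<inter> D \<noteq> {}"
    using open_Int_closure_eq_empty[OF U, of D] subsetD[OF fc p] pU by blast
  have meetO: "G ` A \<inter> outside (frontier D) \<noteq> {}"
  proof -
    have "p \<in> frontier (outside (frontier D))" unfolding out(4) by (rule p)
    then have "p \<in> closure (outside (frontier D))" by (rule subsetD[OF fc])
    then show ?thesis using open_Int_closure_eq_empty[OF U, of "outside (frontier D)"] pU by blast
  qed
  define Ap where "Ap = {z::complex. 1 / \<rho> < norm z \<and> norm z < 1}"
  define Am where "Am = {z::complex. 1 < norm z \<and> norm z < \<rho>}"
  have sub: "Ap \<subseteq> A" "Am \<subseteq> A"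
    unfolding Ap_def Am_def A_def using less_trans[OF r1] less_trans[OF _ \<rho>] by blast+
  have cover: "A = Ap \<union> Am \<union> sphere 0 1"
  proof (intro subset_antisym)
    show "A \<subseteq> Ap \<union> Am \<union> sphere 0 1" by (auto simp: Ap_def Am_def A_def)
    show "Ap \<union> Am \<union> sphere 0 1 \<subseteq> A" using sub SA by blast
  qed
  have con: "connected Ap" "connected Am"
    unfolding Ap_def Am_def using connected_annulus[of "1 / \<rho>" "0::complex" 1] connected_annulus[of 1 "0::complex" \<rho>] by auto
  have notC: "G z \<notin> frontier D" if "z \<in> A" "norm z \<noteq> 1" for z
  proof
    assume "G z \<in> frontier D"
    then obtain y where "y \<in> sphere 0 1" "G z = G y" using C by (metis imageE)
    then have "z = y" using inj_onD[OF inj] that(1) SA by blast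
    then show False using \<open>y \<in> sphere 0 1\<close> that(2) by simp
  qed
  have half: "G ` B \<subseteq> D \<or> G ` B \<inter> D = {}" if "connected B" "B \<subseteq> A" "\<And>z. z \<in> B \<Longrightarrow> norm z \<noteq> 1" for B
  proof -
    have "connected (G ` B)" by (rule connected_continuous_image[OF continuous_on_subset[OF Gc that(2)] that(1)])
    moreover have "G ` B \<inter> frontier D = {}" using notC that by blast
    ultimately show ?thesis using connected_Int_frontier[of "G ` B" D] by blast
  qed
  have hp: "G ` Ap \<subseteq> D \<or> G ` Ap \<inter> D = {}" by (rule half[OF con(1) sub(1)]) (auto simp: Ap_def)
  have hm: "G ` Am \<subseteq> D \<or> G ` Am \<inter> D = {}" by (rule half[OF con(2) sub(2)]) (auto simp: Am_def)
  have GA: "G ` A = G ` Ap \<union> G ` Am \<union> frontier D" unfolding cover image_Un C ..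
  have both: "(G ` Ap \<subseteq> D \<and> G ` Am \<inter> D = {}) \<or> (G ` Am \<subseteq> D \<and> G ` Ap \<inter> D = {})"
    using hp hm meetD meetO outD DC out(5) unfolding GA by blast
  then show thesis
  proof
    assume *: "G ` Ap \<subseteq> D \<and> G ` Am \<inter> D = {}"
    show thesis
    proof (rule that[OF \<rho> G[unfolded A_def] inj[unfolded A_def] C])
      show "G z \<in> D" if "1 / \<rho> < norm z" "norm z < 1" for z
        using * that by (auto simp: Ap_def)
      show "G z \<notin> D \<union> frontier D" if "1 < norm z" "norm z < \<rho>" for z
        using * that notC[of z] sub(2) by (auto simp: Am_def)
    qed
  next
    assume *: "G ` Am \<subseteq> D \<and> G ` Ap \<inter> D = {}"
    have inv: "1 / z \<in> A" if "z \<in> A" for z :: complex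
    proof -
      have "0 < norm z" using that \<rho> by (auto simp: A_def intro: less_trans[of 0 "1 / \<rho>"])
      then show ?thesis using that \<rho> by (auto simp: A_def norm_divide divide_simps mult.commute)
    qed
    have nz: "z \<noteq> 0" if "z \<in> A" for z using that \<rho> by (auto simp: A_def)
    show thesis
    proof (rule that[OF \<rho>, of "\<lambda>z. G (1 / z)"]; (fold A_def)?)
      have "(G \<circ> (\<lambda>z. 1 / z)) holomorphic_on A"
        by (rule holomorphic_on_compose_gen[OF _ G]) (use inv nz in \<open>auto intro!: holomorphic_intros\<close>)
      then show "(\<lambda>z. G (1 / z)) holomorphic_on A" by (simp add: o_def)
      show "inj_on (\<lambda>z. G (1 / z)) A"
        by (rule inj_onI) (use inj_onD[OF inj _ inv inv] in fastforce)
      show "(\<lambda>z. G (1 / z)) ` sphere 0 1 = frontier D"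
      proof -
        have "(\<lambda>z. 1 / z) ` sphere 0 1 = sphere (0::complex) 1"
        proof (intro subset_antisym subsetI)
          fix z :: complex assume "z \<in> sphere 0 1"
          then show "z \<in> (\<lambda>z. 1 / z) ` sphere 0 1" by (intro image_eqI[of _ _ "1 / z"]) (auto simp: norm_divide)
        qed (auto simp: norm_divide)
        then show ?thesis unfolding C[symmetric] by (metis image_image)
      qed
      show "G (1 / z) \<in> D" if "1 / \<rho> < norm z" "norm z < 1" for z
      proof -
        have "0 < norm z" using that(1) \<rho> by (auto intro: less_trans[of 0 "1 / \<rho>"])
        then have "1 / z \<in> Am" using that \<rho> by (simp add: Am_def norm_divide divide_simps mult.commute)
        then show ?thesis using * by blast
      qed
      show "G (1 / z) \<notin> D \<union> frontier D" if "1 < norm z" "norm z < \<rho>" for z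
      proof -
        have "0 < norm z" using that(1) by linarith
        then have "1 / norm z < 1" using that by (simp only: pos_divide_less_eq mult_1_left)
        moreover have "1 / \<rho> < 1 / norm z" by (rule frac_less2) (use \<open>0 < norm z\<close> that in simp_all)
        ultimately have "1 / z \<in> Ap" by (simp add: Ap_def norm_divide)
        then show ?thesis using * notC[of "1 / z"] sub(1) by (auto simp: Ap_def)
      qed
    qed
  qed
qed

text \<open>Schwarz reflection. In the annular coordinate \<open>G\<close> the boundary curve is the unit circle, so reflection of the
  Riemann map \<open>g\<close> is \<open>G (1 / cnj (G^-1 (g (1 / cnj z))))\<close>. Since \<open>g\<close> is proper, its values near the circle
  are close to the boundary curve, hence close to their reflections, and the two functions are pasted together.
  Points inside, on and outside the circle go to \<open>D\<close>, to its frontier and to the exterior; injectivity on the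
  circle follows from injectivity inside, because neighbourhoods of two points of the circle with the same image would have
  images that overlap inside \<open>D\<close>.\<close>

theorem Riemann_map_extension:
  assumes D: "bounded_simply_connected_domain D" "0 \<in> D" and J: "analytic_Jordan_curve (frontier D)"
  obtains K R1 where "1 < R1" "K holomorphic_on ball 0 R1" "inj_on K (ball 0 R1)" "K 0 = 0" "K ` ball 0 1 = D" "K ` sphere 0 1 = frontier D"
proof -
  have D': "open D" "connected D" "bounded D" "D \<noteq> {}" "simply_connected D" using D by (auto simp: bounded_simply_connected_domain_def)
  obtain G \<rho> where \<rho>: "1 < \<rho>" and G: "G holomorphic_on {z. 1 / \<rho> < norm z \<and> norm z < \<rho>}"
    and inj: "inj_on G {z. 1 / \<rho> < norm z \<and> norm z < \<rho>}" and C: "G ` sphere 0 1 = frontier D"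
    and Gin: "\<And>z. 1 / \<rho> < norm z \<Longrightarrow> norm z < 1 \<Longrightarrow> G z \<in> D" and Gout: "\<And>z. 1 < norm z \<Longrightarrow> norm z < \<rho> \<Longrightarrow> G z \<notin> D \<union> frontier D"
    by (rule annulus_sides[OF D'(1-4) J], rule that)
  define A where "A = {z::complex. 1 / \<rho> < norm z \<and> norm z < \<rho>}"
  note G = G[folded A_def] and inj = inj[folded A_def]
  have A: "open A" unfolding A_def by (intro open_Collect_conj open_Collect_less continuous_intros)
  have r1: "1 / \<rho> < 1" using \<rho> by simp
  have Gc: "continuous_on A G" by (rule holomorphic_on_imp_continuous_on[OF G])
  obtain f g where f: "f holomorphic_on D" and g: "g holomorphic_on ball 0 1" and fg: "\<And>z. z \<in> D \<Longrightarrow> norm (f z) < 1 \<and> g (f z) = z"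
    and gf: "\<And>z. norm z < 1 \<Longrightarrow> g z \<in> D \<and> f (g z) = z" and g0: "g 0 = 0"
    by (rule simply_connected_Riemann_map_origin[OF D'(1,5) D(2) D'(3)], rule that)
  obtain \<Theta> where \<Theta>: "\<Theta> holomorphic_on G ` A" "\<And>z. z \<in> A \<Longrightarrow> \<Theta> (G z) = z"
    by (rule holomorphic_has_inverse[OF G A inj], rule that)
  have proper: "\<exists>r<1. \<forall>\<zeta>. r < norm \<zeta> \<and> norm \<zeta> < 1 \<longrightarrow> g \<zeta> \<notin> S" if S: "compact S" "S \<subseteq> D" for S
  proof (cases "S = {}")
    case False
    have "continuous_on S (\<lambda>z. norm (f z))"
      by (intro continuous_on_norm continuous_on_subset[OF holomorphic_on_imp_continuous_on[OF f] S(2)])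
    from continuous_attains_sup[OF S(1) False this] obtain x where x: "x \<in> S" "\<And>y. y \<in> S \<Longrightarrow> norm (f y) \<le> norm (f x)" by blast
    have "g \<zeta> \<notin> S" if "norm (f x) < norm \<zeta>" "norm \<zeta> < 1" for \<zeta>
      using x(2)[of "g \<zeta>"] gf[of \<zeta>] that by auto
    then show ?thesis using fg[of x] x(1) S(2) by (intro exI[of _ "norm (f x)"]) auto
  qed (auto intro: exI[of _ 0])
  have approach: "\<exists>r<1. \<forall>\<zeta>. r < norm \<zeta> \<and> norm \<zeta> < 1 \<longrightarrow> g \<zeta> \<in> G ` {z. \<sigma> < norm z \<and> norm z < 1}"
    if \<sigma>: "1 / \<rho> \<le> \<sigma>" "\<sigma> < 1" for \<sigma>
  proof -
    define B where "B = {z::complex. \<sigma> < norm z \<and> norm z < \<rho>}"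
    have B: "open B" "B \<subseteq> A" unfolding B_def A_def using \<sigma> by (auto intro!: open_Collect_conj open_Collect_less continuous_intros)
    have oB: "open (G ` B)"
      by (rule open_mapping_thm3[OF holomorphic_on_subset[OF G B(2)] B(1) inj_on_subset[OF inj B(2)]])
    have sB: "sphere 0 1 \<subseteq> B" using \<sigma> \<rho> by (auto simp: B_def)
    have fr: "frontier D \<subseteq> G ` B" unfolding C[symmetric] by (rule image_mono[OF sB])
    have "compact (closure D - G ` B)" using D'(3) oB by (intro compact_diff) auto
    moreover have "closure D - G ` B \<subseteq> D" using fr D'(1) by (auto simp: frontier_def interior_open)
    ultimately obtain r where r: "r < 1" "\<forall>\<zeta>. r < norm \<zeta> \<and> norm \<zeta> < 1 \<longrightarrow> g \<zeta> \<notin> closure D - G ` B"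
      using proper by blast
    have "g \<zeta> \<in> G ` {z. \<sigma> < norm z \<and> norm z < 1}" if \<zeta>: "r < norm \<zeta>" "norm \<zeta> < 1" for \<zeta>
    proof -
      have gD: "g \<zeta> \<in> D" using gf \<zeta>(2) by blast
      then have "g \<zeta> \<in> G ` B" using r(2) \<zeta> closure_subset by blast
      then obtain z where z: "z \<in> B" "g \<zeta> = G z" by blast
      have "norm z < 1"
      proof (rule ccontr)
        assume "\<not> norm z < 1"
        then consider "norm z = 1" | "1 < norm z" by linarith
        then have "G z \<in> frontier D \<or> G z \<notin> D \<union> frontier D"
        proof cases
          case 1 then show ?thesis using C by auto
        next
          case 2 then show ?thesis using Gout[of z] z(1) by (auto simp: B_def)
        qed
        then show False using gD z(2) D'(1) by (auto simp: frontier_def interior_open)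
      qed
      then show ?thesis using z by (auto simp: B_def)
    qed
    then show ?thesis using r(1) by blast
  qed
  obtain r' where r': "r' < 1" "\<And>\<zeta>. r' < norm \<zeta> \<Longrightarrow> norm \<zeta> < 1 \<Longrightarrow> g \<zeta> \<in> G ` {z. 1 / \<rho> < norm z \<and> norm z < 1}"
    using approach[OF order_refl r1] by blast
  define r0 where "r0 = max r' (1 / 2)"
  have r0: "0 < r0" "r0 < 1" "r' \<le> r0" using r' by (auto simp: r0_def)
  define g1 where "g1 \<zeta> = \<Theta> (g \<zeta>)" for \<zeta>
  define B where "B = {\<zeta>::complex. r0 < norm \<zeta> \<and> norm \<zeta> < 1}"
  define B' where "B' = {\<zeta>::complex. 1 < norm \<zeta> \<and> norm \<zeta> < 1 / r0}"
  have oB: "open B" unfolding B_def by (intro open_Collect_conj open_Collect_less continuous_intros)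
  have g1: "1 / \<rho> < norm (g1 \<zeta>)" "norm (g1 \<zeta>) < 1" "G (g1 \<zeta>) = g \<zeta>" "g1 \<zeta> \<in> A" if "\<zeta> \<in> B" for \<zeta>
  proof -
    have "r' < norm \<zeta>" "norm \<zeta> < 1" using that r0(3) by (simp_all add: B_def)
    from r'(2)[OF this] obtain z where z: "1 / \<rho> < norm z" "norm z < 1" "g \<zeta> = G z" by auto
    then have "z \<in> A" using \<rho> by (auto simp: A_def)
    then have "g1 \<zeta> = z" using \<Theta>(2) z by (simp add: g1_def)
    then show "1 / \<rho> < norm (g1 \<zeta>)" "norm (g1 \<zeta>) < 1" "G (g1 \<zeta>) = g \<zeta>" "g1 \<zeta> \<in> A" using z \<open>z \<in> A\<close> by auto
  qed
  have g1nz: "g1 \<zeta> \<noteq> 0" if "\<zeta> \<in> B" for \<zeta> using g1(1)[OF that] \<rho> by auto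
  have g1h: "g1 holomorphic_on B"
  proof -
    have "(\<Theta> \<circ> g) holomorphic_on B"
    proof (rule holomorphic_on_compose_gen[OF _ \<Theta>(1)])
      show "g holomorphic_on B" by (rule holomorphic_on_subset[OF g]) (auto simp: B_def)
      show "g ` B \<subseteq> G ` A" by (rule image_subsetI) (use g1(3,4) in \<open>metis imageI\<close>)
    qed
    then show ?thesis by (simp add: g1_def[abs_def] o_def)
  qed
  have BB: "1 / cnj \<zeta> \<in> B" if "\<zeta> \<in> B'" for \<zeta>
  proof -
    have n: "1 < norm \<zeta>" "norm \<zeta> * r0 < 1" using that r0 by (auto simp: B'_def field_simps)
    have "0 < norm \<zeta>" using n by linarith
    then have "r0 < 1 / norm \<zeta>" "1 / norm \<zeta> < 1" using n by (simp_all only: pos_less_divide_eq pos_divide_less_eq mult.commute mult_1_left)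
    then show ?thesis by (simp add: B_def norm_divide)
  qed
  define gout where "gout \<zeta> = G (1 / cnj (g1 (1 / cnj \<zeta>)))" for \<zeta>
  have inA: "1 / cnj (g1 \<zeta>) \<in> A" "1 < norm (1 / cnj (g1 \<zeta>))" "norm (1 / cnj (g1 \<zeta>)) < \<rho>" if "\<zeta> \<in> B" for \<zeta>
  proof -
    have p: "0 < norm (g1 \<zeta>)" using g1nz[OF that] by simp
    show 1: "1 < norm (1 / cnj (g1 \<zeta>))" "norm (1 / cnj (g1 \<zeta>)) < \<rho>"
      using g1(1,2)[OF that] p \<rho> by (simp_all add: norm_divide field_simps)
    from less_trans[OF r1 this(1)] this(2) show "1 / cnj (g1 \<zeta>) \<in> A" unfolding A_def by blast
  qed
  have gouth: "gout holomorphic_on B'"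
  proof -
    have cB: "cnj ` B = B" 
    proof (intro subset_antisym subsetI)
      fix z assume "z \<in> B" then show "z \<in> cnj ` B" by (intro image_eqI[of _ _ "cnj z"]) (auto simp: B_def)
    qed (auto simp: B_def)
    have h1: "(cnj \<circ> g1 \<circ> cnj) holomorphic_on B"
      using g1h oB cB by (intro holomorphic_on_compose_cnj_cnj) auto
    have nzB': "z \<noteq> 0" if "z \<in> B'" for z using that by (auto simp: B'_def)
    have iB: "(\<lambda>z. 1 / z) ` B' \<subseteq> B"
    proof (rule image_subsetI)
      fix z assume "z \<in> B'"
      then show "1 / z \<in> B" using BB[of z] by (simp add: B_def norm_divide)
    qed
    have "(\<lambda>z. 1 / z) holomorphic_on B'" using nzB' by (intro holomorphic_intros)
    from holomorphic_on_compose_gen[OF this h1 iB]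
    have h2: "((cnj \<circ> g1 \<circ> cnj) \<circ> (\<lambda>z. 1 / z)) holomorphic_on B'" .
    have e: "((cnj \<circ> g1 \<circ> cnj) \<circ> (\<lambda>z. 1 / z)) z = cnj (g1 (1 / cnj z))" for z by simp
    have "(\<lambda>z. 1 / ((cnj \<circ> g1 \<circ> cnj) \<circ> (\<lambda>z. 1 / z)) z) holomorphic_on B'"
      using g1nz BB by (intro holomorphic_on_divide h2 holomorphic_on_const) auto
    then have "(G \<circ> (\<lambda>z. 1 / ((cnj \<circ> g1 \<circ> cnj) \<circ> (\<lambda>z. 1 / z)) z)) holomorphic_on B'"
      by (rule holomorphic_on_compose_gen[OF _ G]) (use inA BB in auto)
    then show ?thesis unfolding gout_def[abs_def] by (simp add: o_def)
  qed
  obtain M where M: "\<And>x. x \<in> D \<Longrightarrow> norm x \<le> M" using D'(3) unfolding bounded_iff by blast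
  have close: "\<exists>s<1. \<forall>z. s < norm z \<and> norm z < 1 \<longrightarrow> norm (gout (1 / cnj z) - g z) < e" if e: "0 < e" for e
  proof -
    obtain \<rho>1 where \<rho>1: "1 < \<rho>1" "\<rho>1 < \<rho>" using dense[OF \<rho>] by blast
    define Ac where "Ac = {z::complex. 1 / \<rho>1 \<le> norm z \<and> norm z \<le> \<rho>1}"
    have "Ac = cball 0 \<rho>1 \<inter> {z. 1 / \<rho>1 \<le> norm z}" by (auto simp: Ac_def)
    moreover have "closed {z::complex. 1 / \<rho>1 \<le> norm z}" by (intro closed_Collect_le continuous_intros)
    ultimately have cAc: "compact Ac" by (simp add: compact_Int_closed)
    have i1: "1 / \<rho> < 1 / \<rho>1" "1 / \<rho>1 < 1" using \<rho>1 by (simp_all add: frac_less2)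
    have "Ac \<subseteq> A" using \<rho>1 i1 by (auto simp: Ac_def A_def)
    then have "uniformly_continuous_on Ac G" by (intro compact_uniformly_continuous continuous_on_subset[OF Gc] cAc)
    then obtain d where d: "0 < d" "\<And>x y. x \<in> Ac \<Longrightarrow> y \<in> Ac \<Longrightarrow> dist y x < d \<Longrightarrow> dist (G y) (G x) < e"
      by (rule uniformly_continuous_onE[OF _ e]) (rule that)
    define \<sigma> where "\<sigma> = max (1 / \<rho>1) (max (1 / 2) (1 - d / 4))"
    have \<sigma>: "1 / \<rho> \<le> \<sigma>" "\<sigma> < 1" "1 / \<rho>1 \<le> \<sigma>" "1 / 2 \<le> \<sigma>" "1 - d / 4 \<le> \<sigma>"
      using i1 d(1) unfolding \<sigma>_def by linarith+
    obtain r where r: "r < 1" "\<And>\<zeta>. r < norm \<zeta> \<Longrightarrow> norm \<zeta> < 1 \<Longrightarrow> g \<zeta> \<in> G ` {z. \<sigma> < norm z \<and> norm z < 1}"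
      using approach[OF \<sigma>(1,2)] by blast
    have "norm (gout (1 / cnj z) - g z) < e" if z: "max r r0 < norm z" "norm z < 1" for z
    proof -
      have zB: "z \<in> B" using z by (simp add: B_def)
      have "r < norm z" using z by simp
      from r(2)[OF this z(2)] obtain x where x: "\<sigma> < norm x" "norm x < 1" "g z = G x" by auto
      have xA: "x \<in> A" using x \<sigma>(1) \<rho> by (auto simp: A_def)
      have gx: "g1 z = x" using \<Theta>(2)[OF xA] x(3) by (simp add: g1_def)
      have xp: "0 < norm x" using x(1) \<sigma>(4) by linarith
      have "gout (1 / cnj z) = G (1 / cnj x)" by (simp add: gout_def gx)
      moreover have "dist (G (1 / cnj x)) (G x) < e"
      proof (rule d(2))
        have xl: "1 / \<rho>1 \<le> norm x" "norm x \<le> \<rho>1" using x \<sigma>(3) \<rho>1 by linarith+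
        then show "x \<in> Ac" by (simp only: Ac_def mem_Collect_eq simp_thms)
        have "1 \<le> norm x * \<rho>1" using xl(1) \<rho>1 by (simp add: divide_le_eq)
        then have "1 / norm x \<le> \<rho>1" "1 < 1 / norm x" using x xp by (simp_all only: pos_divide_le_eq pos_less_divide_eq mult.commute mult_1_left)
        moreover from this have "1 / \<rho>1 \<le> 1 / norm x" using i1(2) by linarith
        ultimately show "1 / cnj x \<in> Ac" unfolding Ac_def by (simp only: mem_Collect_eq norm_divide complex_mod_cnj norm_one simp_thms)
        have "x * cnj x = of_real ((norm x)\<^sup>2)" by (rule complex_norm_square[symmetric])
        then have "1 / cnj x - x = (1 - of_real ((norm x)\<^sup>2)) / cnj x" using xp by (simp add: divide_simps)
        also have "norm \<dots> = \<bar>1 - (norm x)\<^sup>2\<bar> / norm x"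
        proof -
          have "1 - complex_of_real ((norm x)\<^sup>2) = of_real (1 - (norm x)\<^sup>2)" by simp
          then show ?thesis by (simp only: norm_divide norm_of_real complex_mod_cnj)
        qed
        also have "\<dots> = (1 - norm x) * ((1 + norm x) / norm x)" 
        proof -
          have "(norm x)\<^sup>2 \<le> 1" by (rule power_le_one) (use x(2) in simp_all)
          then have "\<bar>1 - (norm x)\<^sup>2\<bar> = (1 - norm x) * (1 + norm x)" by (simp add: power2_eq_square algebra_simps)
          then show ?thesis by simp
        qed
        also have "\<dots> \<le> (1 - norm x) * 4" using x \<sigma>(4) xp by (intro mult_left_mono) (auto simp: divide_le_eq)
        also have "\<dots> < d" using x(1) \<sigma>(5) by simp
        finally show "dist (1 / cnj x) x < d" by (simp add: dist_norm)
      qed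
      ultimately show ?thesis using x(3) by (simp add: dist_norm)
    qed
    then show ?thesis using r(1) r0(2) by (intro exI[of _ "max r r0"]) auto
  qed
  have "1 < 1 / r0" using r0 by simp
  then obtain R1 where R1: "1 < R1" "R1 < 1 / r0" using dense by blast
  obtain K where K: "K holomorphic_on ball 0 R1" and Kin: "\<And>z. norm z < 1 \<Longrightarrow> K z = g z" and Kout: "\<And>z. 1 < norm z \<Longrightarrow> norm z < R1 \<Longrightarrow> K z = gout z"
    by (rule paste_across_circle[OF g _ gouth[unfolded B'_def] close R1, of M]) (use gf M in auto)
  have Kc: "continuous_on (ball 0 R1) K" by (rule holomorphic_on_imp_continuous_on[OF K])
  have goutD: "gout z \<notin> D \<union> frontier D" if "z \<in> B'" for z
    unfolding gout_def using inA(2,3)[OF BB[OF that]] by (intro Gout) auto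
  have DC: "D \<inter> frontier D = {}" using D'(1) by (auto simp: frontier_def interior_open)
  have inD: "K z \<in> D" if "norm z < 1" for z using Kin[OF that] gf[OF that] by simp
  have clo: "K z \<in> closure D" if "norm z \<le> 1" for z
  proof -
    have "K ` closure (ball 0 1) \<subseteq> closure (K ` ball 0 1)"
      by (rule image_closure_subset[OF continuous_on_subset[OF Kc] closed_closure closure_subset]) (use R1 in auto)
    moreover have "closure (K ` ball 0 1) \<subseteq> closure D" using inD by (intro closure_mono) auto
    moreover have "K z \<in> K ` closure (ball 0 1)" using that by simp
    ultimately show ?thesis by blast
  qed
  have circ: "K z \<in> frontier D" if z: "norm z = 1" for z
  proof (rule ccontr)
    assume "K z \<notin> frontier D"
    then have KD: "K z \<in> D" using clo[of z] z D'(1) by (auto simp: frontier_def interior_open)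
    define w where "w = f (K z)"
    have w: "norm w < 1" "g w = K z" using fg[OF KD] by (auto simp: w_def)
    have "open (D \<inter> f -` ball 0 ((1 + norm w) / 2))"
      by (rule continuous_open_preimage[OF holomorphic_on_imp_continuous_on[OF f] D'(1) open_ball])
    moreover have "K z \<in> D \<inter> f -` ball 0 ((1 + norm w) / 2)" using KD w by (simp add: w_def)
    ultimately have "open (ball 0 R1 \<inter> K -` (D \<inter> f -` ball 0 ((1 + norm w) / 2)))" "z \<in> ball 0 R1 \<inter> K -` (D \<inter> f -` ball 0 ((1 + norm w) / 2))"
      using z R1 by (simp_all only: continuous_open_preimage[OF Kc open_ball] Int_iff vimage_eq mem_ball_0 conj_ac simp_thms)
    then obtain d where d: "0 < d" "ball z d \<subseteq> ball 0 R1 \<inter> K -` (D \<inter> f -` ball 0 ((1 + norm w) / 2))"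
      by (rule openE) (rule that)
    have d2: "K y \<in> D \<inter> f -` ball 0 ((1 + norm w) / 2)" if "dist y z < d" for y
    proof -
      have "y \<in> ball z d" using that by (simp add: dist_commute)
      from subsetD[OF d(2) this] show ?thesis by (rule IntD2[THEN vimageD])
    qed
    define s where "s = max (1 - d / 2) ((1 + norm w) / 2)"
    have s1: "s < 1" using d(1) w(1) by (simp add: s_def)
    have s2: "1 - d < s" using d(1) by (simp add: s_def less_max_iff_disj)
    have s3: "(1 + norm w) / 2 \<le> s" unfolding s_def by (rule max.cobounded2)
    have "0 \<le> (1 + norm w) / 2" by (intro divide_nonneg_nonneg add_nonneg_nonneg) auto
    from order_trans[OF this s3] have "0 \<le> s" .
    note s = s1 s2 s3 this
    have "dist (of_real s * z) z = 1 - s"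
    proof -
      have "of_real s * z - z = of_real (s - 1) * z" by (simp add: algebra_simps)
      then show ?thesis using s z by (simp only: dist_norm norm_mult norm_of_real) simp
    qed
    then have "K (of_real s * z) \<in> D \<inter> f -` ball 0 ((1 + norm w) / 2)" using d2[of "of_real s * z"] s by simp
    moreover have n: "norm (of_real s * z) = s" using s z by (simp add: norm_mult)
    ultimately have "norm (f (g (of_real s * z))) < (1 + norm w) / 2" using Kin[of "of_real s * z"] s by simp
    then show False using gf[of "of_real s * z"] n s by simp
  qed
  have outer: "K z \<notin> D \<union> frontier D" if "1 < norm z" "norm z < R1" for z
    using Kout[OF that] goutD[of z] that R1 by (simp add: B'_def)
  have inj_in: "a = b" if "norm a < 1" "norm b < 1" "K a = K b" for a b
    using that Kin gf[of a] gf[of b] by metis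
  have inj_out: "a = b" if "1 < norm a" "norm a < R1" "1 < norm b" "norm b < R1" "K a = K b" for a b
  proof -
    have ab: "a \<in> B'" "b \<in> B'" using that R1 by (auto simp: B'_def)
    have "gout a = gout b" using Kout[of a] Kout[of b] that by simp
    then have "1 / cnj (g1 (1 / cnj a)) = 1 / cnj (g1 (1 / cnj b))"
      unfolding gout_def by (rule inj_onD[OF inj]) (rule inA(1)[OF BB[OF ab(1)]], rule inA(1)[OF BB[OF ab(2)]])
    then have "g1 (1 / cnj a) = g1 (1 / cnj b)" by (simp add: divide_inverse)
    then have "g (1 / cnj a) = g (1 / cnj b)" using g1(3)[OF BB[OF ab(1)]] g1(3)[OF BB[OF ab(2)]] by simp
    then have "f (g (1 / cnj a)) = f (g (1 / cnj b))" by (rule arg_cong)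
    moreover have "norm (1 / cnj a) < 1" "norm (1 / cnj b) < 1" using BB[OF ab(1)] BB[OF ab(2)] unfolding B_def by blast+
    ultimately have "1 / cnj a = 1 / cnj b"
      using gf[of "1 / cnj a"] gf[of "1 / cnj b"] by argo
    then show ?thesis by (simp add: divide_inverse)
  qed
  have char: "norm z < 1 \<longleftrightarrow> K z \<in> D" "norm z = 1 \<longleftrightarrow> K z \<in> frontier D" if z: "norm z < R1" for z
  proof -
    consider "norm z < 1" | "norm z = 1" | "1 < norm z" by linarith
    then have "(norm z < 1 \<longleftrightarrow> K z \<in> D) \<and> (norm z = 1 \<longleftrightarrow> K z \<in> frontier D)"
    proof cases
      case 1 then show ?thesis using inD[OF 1] DC by auto
    next
      case 2 then show ?thesis using circ[OF 2] DC by auto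
    next
      case 3 then show ?thesis using outer[OF 3 z] by auto
    qed
    then show "norm z < 1 \<longleftrightarrow> K z \<in> D" "norm z = 1 \<longleftrightarrow> K z \<in> frontier D" by blast+
  qed
  have nconst: "\<not> K constant_on S" if S: "open S" "S \<noteq> {}" "S \<subseteq> ball 0 R1" for S
  proof
    assume "K constant_on S"
    then obtain c where c: "\<And>x. x \<in> S \<Longrightarrow> K x = c" unfolding constant_on_def by blast
    obtain x where x: "x \<in> S" using S(2) by blast
    have "x islimpt S" using S(1) x by (simp add: interior_limit_point interior_open)
    have "K y - c = 0" if "y \<in> ball 0 R1" for y
      by (rule analytic_continuation[of "\<lambda>y. K y - c" "ball 0 R1" S x])
        (use \<open>x islimpt S\<close> x c \<open>S \<subseteq> ball 0 R1\<close> that K in \<open>auto intro!: holomorphic_on_diff\<close>)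
    then have "K 0 = c" "K (1 / 2) = c" using R1 by (auto simp: norm_divide)
    then show False using inj_in[of 0 "1 / 2"] by (simp add: norm_divide)
  qed
  have inj_circ: "a = b" if ab: "norm a = 1" "norm b = 1" "K a = K b" for a b
  proof (rule ccontr)
    assume "a \<noteq> b"
    define e where "e = min (dist a b / 2) (R1 - 1)"
    have e: "0 < e" using \<open>a \<noteq> b\<close> R1 by (simp add: e_def)
    have sub: "ball x e \<subseteq> ball 0 R1" if "norm x = 1" for x
    proof
      fix y assume "y \<in> ball x e"
      then show "y \<in> ball 0 R1" using norm_triangle_sub[of y x] that by (simp add: e_def dist_norm norm_minus_commute)
    qed
    have op: "open (K ` ball x e)" if "norm x = 1" for x
      by (rule open_mapping_thm[OF holomorphic_on_subset[OF K sub[OF that]] open_ball connected_ball open_ball order_refl nconst[OF open_ball _ sub[OF that]]]) (use e in simp)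
    have "K a \<in> K ` ball a e" "K b \<in> K ` ball b e" using e by (simp_all only: imageI centre_in_ball)
    then have mem: "K a \<in> K ` ball a e \<inter> K ` ball b e" unfolding ab(3) by (rule IntI)
    have op2: "open (K ` ball a e \<inter> K ` ball b e)" using op ab by (intro open_Int) auto
    have "(K ` ball a e \<inter> K ` ball b e) \<inter> D \<noteq> {}"
    proof -
      have "K a \<in> closure D" using circ[OF ab(1)] by (simp add: frontier_def)
      then show ?thesis using mem open_Int_closure_eq_empty[OF op2, of D] by blast
    qed
    then obtain v where v: "v \<in> K ` ball a e" "v \<in> K ` ball b e" "v \<in> D" by blast
    obtain x where x: "x \<in> ball a e" "v = K x" using v(1) by (rule imageE)
    obtain y where y: "y \<in> ball b e" "v = K y" using v(2) by (rule imageE)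
    have xy: "K x = K y" "K x \<in> D" using x y v by simp_all
    note x = x(1) and y = y(1)
    have bn: "norm x < R1" "norm y < R1" using subsetD[OF sub[OF ab(1)] x] subsetD[OF sub[OF ab(2)] y] by simp_all
    have "K y \<in> D" using xy(2) unfolding xy(1) .
    then have n: "norm x < 1" "norm y < 1" using char(1)[OF bn(1)] char(1)[OF bn(2)] xy(2) by blast+
    have "x = y" by (rule inj_in[OF n xy(1)])
    then have "dist b x < e" using y by simp
    moreover have "dist a x < e" using x by simp
    moreover have "e \<le> dist a b / 2" unfolding e_def by (rule min.cobounded1)
    ultimately have "dist a x < dist a b / 2" "dist b x < dist a b / 2" by linarith+
    then show False using dist_triangle2[of a b x] by linarith
  qed
  have injK: "inj_on K (ball 0 R1)"
  proof (rule inj_onI)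
    fix a b assume "a \<in> ball 0 R1" "b \<in> ball 0 R1" and eq: "K a = K b"
    then have n: "norm a < R1" "norm b < R1" by auto
    have key: "(norm a < 1 \<longleftrightarrow> norm b < 1) \<and> (norm a = 1 \<longleftrightarrow> norm b = 1)"
      unfolding char(1)[OF n(1)] char(1)[OF n(2)] char(2)[OF n(1)] char(2)[OF n(2)] eq by blast
    consider "norm a < 1" "norm b < 1" | "norm a = 1" "norm b = 1" | "1 < norm a" "1 < norm b" using key by linarith
    then show "a = b"
    proof cases
      case 1 show ?thesis by (rule inj_in[OF 1 eq])
    next
      case 2 show ?thesis by (rule inj_circ[OF 2 eq])
    next
      case 3 show ?thesis by (rule inj_out[OF 3(1) n(1) 3(2) n(2) eq])
    qed
  qed
  have imb: "K ` ball 0 1 = D"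
  proof (intro subset_antisym subsetI)
    fix z assume "z \<in> D"
    then show "z \<in> K ` ball 0 1" using fg[of z] Kin[of "f z"] by (intro image_eqI[of _ _ "f z"]) auto
  qed (use inD in auto)
  have ims: "K ` sphere 0 1 = frontier D"
  proof (intro subset_antisym subsetI)
    fix w assume w: "w \<in> frontier D"
    have "compact (K ` cball 0 1)" using R1 by (intro compact_continuous_image continuous_on_subset[OF Kc]) auto
    moreover have "D \<subseteq> K ` cball 0 1" unfolding imb[symmetric] by (intro image_mono) auto
    ultimately have "closure D \<subseteq> K ` cball 0 1" by (intro closure_minimal compact_imp_closed)
    then obtain z where z: "norm z \<le> 1" "w = K z" using w by (auto simp: frontier_def)
    then have "norm z = 1" using inD[of z] w DC by (cases "norm z < 1") auto
    then show "w \<in> K ` sphere 0 1" using z by auto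
  qed (use circ in auto)
  show thesis using R1(1) K injK _ imb ims by (rule that) (simp add: Kin g0)
qed

section \<open>Growing images of the disc\<close>

lemma cis_turns_inj:
  assumes "cis (2 * pi * a) = cis (2 * pi * b)" "\<bar>a - b\<bar> < 1"
  shows "a = b"
proof -
  have "cis (2 * pi * (a - b)) = 1"
    using assms(1) cis_divide[of "2 * pi * a" "2 * pi * b"] by (simp add: right_diff_distrib)
  then have "exp (\<i> * complex_of_real (2 * pi * (a - b))) = 1" by (simp only: cis_conv_exp)
  then obtain n :: int where "Im (\<i> * complex_of_real (2 * pi * (a - b))) = of_int (2 * n) * pi"
    unfolding exp_eq_1 by blast
  then have "(a - b) * (2 * pi) = of_int n * (2 * pi)" by simp
  then have n: "a - b = of_int n" by (simp only: mult_cancel_right) simp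
  then have "\<bar>of_int n :: real\<bar> < 1" using assms(2) by simp
  then have "n = 0" by linarith
  then show ?thesis using n by simp
qed

lemma circle_eq_cis_turns: "sphere (0::complex) 1 = (\<lambda>s. cis (2 * pi * s)) ` {0..<1}" "range (\<lambda>s. cis (2 * pi * s)) = sphere (0::complex) 1"
proof -
  have sub: "sphere (0::complex) 1 \<subseteq> (\<lambda>s. cis (2 * pi * s)) ` {0..<1}"
  proof
    fix z :: complex assume z: "z \<in> sphere 0 1"
    define x where "x = Arg z / (2 * pi)"
    have "0 < norm z" using z by simp
    then have "z \<noteq> 0" by (rule zero_less_norm_iff[THEN iffD1])
    then have "cis (2 * pi * x) = z" using z cis_Arg[of z] by (simp add: x_def sgn_eq)
    moreover have "cis (2 * pi * frac x) = cis (2 * pi * x)"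
    proof -
      have "2 * pi * frac x = 2 * pi * x - 2 * pi * of_int \<lfloor>x\<rfloor>" by (simp add: frac_def right_diff_distrib)
      moreover have "cis (2 * pi * of_int \<lfloor>x\<rfloor>) = 1" by (rule cis_multiple_2pi) simp
      ultimately show ?thesis by (simp flip: cis_divide)
    qed
    ultimately show "z \<in> (\<lambda>s. cis (2 * pi * s)) ` {0..<1}"
      by (intro image_eqI[of _ _ "frac x"]) (simp_all add: frac_lt_1)
  qed
  then show "sphere (0::complex) 1 = (\<lambda>s. cis (2 * pi * s)) ` {0..<1}" by auto
  show "range (\<lambda>s. cis (2 * pi * s)) = sphere (0::complex) 1"
    using sub by (intro subset_antisym) auto
qed

lemma real_analytic2_on_slice:
  assumes "real_analytic2_on S \<Gamma>" "\<And>s. (t, s) \<in> S"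
  shows "real_analytic (\<Gamma> t)"
  unfolding real_analytic_def
proof
  fix s
  obtain c r where r: "0 < r" and c: "\<And>h k. \<bar>h\<bar> < r \<Longrightarrow> \<bar>k\<bar> < r \<Longrightarrow> (t + h, s + k) \<in> S \<Longrightarrow>
      ((\<lambda>(m, n). c m n * of_real (h ^ m * k ^ n)) has_sum \<Gamma> (t + h) (s + k)) UNIV"
    using assms(1) assms(2)[of s] unfolding real_analytic2_on_def by blast
  have "(\<lambda>n. c 0 n * of_real (k ^ n)) sums \<Gamma> t (s + k)" if "\<bar>k\<bar> < r" for k
  proof -
    have "((\<lambda>(m, n). c m n * of_real (0 ^ m * k ^ n)) has_sum \<Gamma> t (s + k)) UNIV"
      using c[of 0 k] r that assms(2)[of "s + k"] by simp
    also have "?this \<longleftrightarrow> ((\<lambda>(m, n). c m n * of_real (0 ^ m * k ^ n)) has_sum \<Gamma> t (s + k)) (range (Pair (0::nat)))"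
    proof (rule has_sum_cong_neutral)
      fix x :: "nat \<times> nat" assume "x \<in> UNIV - range (Pair 0)"
      then show "(case x of (m, n) \<Rightarrow> c m n * of_real (0 ^ m * k ^ n)) = 0" by (cases x) (auto simp: power_0_left)
    qed simp_all
    also have "\<dots> \<longleftrightarrow> (((\<lambda>(m, n). c m n * of_real (0 ^ m * k ^ n)) \<circ> Pair (0::nat)) has_sum \<Gamma> t (s + k)) UNIV"
      by (rule has_sum_reindex) (simp add: inj_on_def)
    also have "((\<lambda>(m, n). c m n * of_real (0 ^ m * k ^ n)) \<circ> Pair (0::nat)) = (\<lambda>n. c 0 n * of_real (k ^ n))"
      by (simp add: fun_eq_iff)
    finally show ?thesis by (rule has_sum_imp_sums)
  qed
  then show "\<exists>a. \<exists>r>0. \<forall>h. \<bar>h\<bar> < r \<longrightarrow> (\<lambda>n. a n * of_real (h ^ n)) sums \<Gamma> t (s + h)" using r by blast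
qed

text \<open>At the last time the level is not exceeded, the function would have to increase through it.\<close>

lemma stays_below_level:
  fixes G :: "real \<Rightarrow> real"
  assumes d: "\<And>x. a \<le> x \<Longrightarrow> x \<le> b \<Longrightarrow> DERIV G x :> G' x" and neg: "\<And>x. a \<le> x \<Longrightarrow> x \<le> b \<Longrightarrow> G x = 1 \<Longrightarrow> G' x < 0"
    and "G a \<le> 1" "a < b"
  shows "G b < 1"
proof -
  have above: False if c: "a < c" "c \<le> b" "1 < G c" for c
  proof -
    have cont: "continuous_on {a..c} G"
      using c by (intro continuous_at_imp_continuous_on ballI) (auto intro!: DERIV_isCont[OF d])
    define X where "X = {x \<in> {a..c}. G x \<le> 1}"
    have "closed X" unfolding X_def
      by (rule continuous_on_closed_Collect_le[OF cont continuous_on_const]) simp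
    moreover have "bounded X" by (rule bounded_subset[of "{a..c}"]) (auto simp: X_def)
    ultimately have cX: "compact X" by (simp add: compact_eq_bounded_closed)
    have "a \<in> X" using assms(3) c by (simp add: X_def)
    then have "X \<noteq> {}" by blast
    from compact_attains_sup[OF cX this] obtain m where m': "m \<in> X" "\<forall>y\<in>X. y \<le> m" by (rule bexE)
    have m: "m \<in> {x \<in> {a..c}. G x \<le> 1}" using m'(1) unfolding X_def .
    have mX: "y \<le> m" if "a \<le> y" "y \<le> c" "G y \<le> 1" for y by (rule bspec[OF m'(2)]) (use that in \<open>simp add: X_def\<close>)
    have mc: "m < c" using m c(3) by (cases "m = c") auto
    have m1: "G m = 1"
    proof (rule ccontr)
      assume "G m \<noteq> 1"
      then have "G m \<le> 1" "1 \<le> G c" "m \<le> c" using m c mc by auto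
      moreover have "continuous_on {m..c} G" by (rule continuous_on_subset[OF cont]) (use m in auto)
      ultimately obtain y where y: "m \<le> y" "y \<le> c" "G y = 1" using IVT'[of G m 1 c] by blast
      then have "y \<le> m" using m by (intro mX) auto
      then show False using y \<open>G m \<noteq> 1\<close> by auto
    qed
    have mab: "a \<le> m" "m \<le> b" using m c by auto
    obtain e where e: "e > 0" "\<And>h. h > 0 \<Longrightarrow> h < e \<Longrightarrow> G (m + h) < G m"
      using DERIV_neg_dec_right[OF d[OF mab] neg[OF mab m1]] by blast
    define h where "h = min (e / 2) (c - m)"
    have h: "0 < h" "h < e" "m + h \<le> c" using e(1) mc by (auto simp: h_def)
    then have "m + h \<le> m" using e(2)[of h] m1 mab by (intro mX) auto
    then show False using h by simp
  qed
  show ?thesis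
  proof (rule ccontr)
    assume "\<not> G b < 1"
    then have "G b = 1" using above[of b] \<open>a < b\<close> by force
    then obtain e where e: "e > 0" "\<And>h. h > 0 \<Longrightarrow> h < e \<Longrightarrow> G b < G (b - h)"
      using DERIV_neg_dec_left[OF d[of b] neg[of b]] \<open>a < b\<close> by auto
    define h where "h = min (e / 2) ((b - a) / 2)"
    have "0 < h" "h < e" "a < b - h" using e(1) \<open>a < b\<close> by (auto simp: h_def min_def field_simps)
    then show False using above[of "b - h"] e(2)[of h] \<open>G b = 1\<close> by auto
  qed
qed

text \<open>What the geometric part uses about the flow. The condition on the radial derivative says that \<open>F\<close> pushes the unit
  circle outwards, at a speed inverse to the Gaussian weight and proportional to the density of harmonic measure
  seen from 0.\<close>

locale growing_discs =
  fixes F Fz Ft :: "complex \<Rightarrow> real \<Rightarrow> complex" and R1 t1 :: real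
  assumes R1: "1 < R1" and t1: "0 < t1"
    and der: "\<And>z t. norm z < R1 \<Longrightarrow> \<bar>t\<bar> < t1 \<Longrightarrow> ((\<lambda>(z, x). F z x) has_derivative (\<lambda>(h, l). Fz z t * h + Ft z t * of_real l)) (at (z, t))"
    and holo: "\<And>t. \<bar>t\<bar> < t1 \<Longrightarrow> (\<lambda>z. F z t) holomorphic_on ball 0 R1"
    and inj: "\<And>t. \<bar>t\<bar> < t1 \<Longrightarrow> inj_on (\<lambda>z. F z t) (ball 0 R1)"
    and nz: "\<And>z t. norm z < R1 \<Longrightarrow> \<bar>t\<bar> < t1 \<Longrightarrow> Fz z t \<noteq> 0"
    and PG: "\<And>z t. norm z = 1 \<Longrightarrow> \<bar>t\<bar> < t1 \<Longrightarrow> Re (Ft z t * cnj (z * Fz z t)) = exp (pi * (norm (F z t))\<^sup>2)"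
    and cover: "\<And>z s t. norm z \<le> 1 \<Longrightarrow> \<bar>s\<bar> < t1 \<Longrightarrow> \<bar>t\<bar> < t1 \<Longrightarrow> F z s \<in> (\<lambda>z. F z t) ` ball 0 R1"
    and centre: "\<And>t. F 0 t = 0"
begin

definition D :: "real \<Rightarrow> complex set" where "D t = (\<lambda>z. F z t) ` ball 0 1"

lemma disc_sub: "ball (0::complex) 1 \<subseteq> ball 0 R1" "cball (0::complex) 1 \<subseteq> ball 0 R1" "sphere (0::complex) 1 \<subseteq> ball 0 R1"
  using R1 by auto

lemma image_inj: "F x t = F y t \<Longrightarrow> norm x \<le> 1 \<Longrightarrow> norm y \<le> 1 \<Longrightarrow> \<bar>t\<bar> < t1 \<Longrightarrow> x = y"
  using inj_onD[OF inj[of t], of x y] R1 by simp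

lemma cont: assumes "\<bar>t\<bar> < t1" "S \<subseteq> ball 0 R1" shows "continuous_on S (\<lambda>z. F z t)"
  by (rule continuous_on_subset[OF holomorphic_on_imp_continuous_on[OF holo[OF assms(1)]] assms(2)])

lemma open_D: "\<bar>t\<bar> < t1 \<Longrightarrow> open (D t)"
  unfolding D_def
  by (rule open_mapping_thm3[OF holomorphic_on_subset[OF holo disc_sub(1)] open_ball inj_on_subset[OF inj disc_sub(1)]])

lemma closure_D: assumes t: "\<bar>t\<bar> < t1" shows "closure (D t) = (\<lambda>z. F z t) ` cball 0 1"
proof
  have "compact ((\<lambda>z. F z t) ` cball 0 1)" by (intro compact_continuous_image cont[OF t disc_sub(2)] compact_cball)
  then show "closure (D t) \<subseteq> (\<lambda>z. F z t) ` cball 0 1"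
    unfolding D_def by (intro closure_minimal compact_imp_closed image_mono ball_subset_cball)
  have "(\<lambda>z. F z t) ` closure (ball 0 1) \<subseteq> closure (D t)"
    unfolding D_def by (rule image_closure_subset[OF _ closed_closure closure_subset]) (use cont[OF t disc_sub(2)] in simp)
  then show "(\<lambda>z. F z t) ` cball 0 1 \<subseteq> closure (D t)" by simp
qed

lemma frontier_D: assumes t: "\<bar>t\<bar> < t1" shows "frontier (D t) = (\<lambda>z. F z t) ` sphere 0 1"
proof -
  have "frontier (D t) = (\<lambda>z. F z t) ` cball 0 1 - (\<lambda>z. F z t) ` ball 0 1"
    unfolding frontier_def closure_D[OF t] interior_open[OF open_D[OF t]] by (simp add: D_def)
  also have "\<dots> = (\<lambda>z. F z t) ` (cball 0 1 - ball 0 1)"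
    by (rule inj_on_image_set_diff[OF inj[OF t], symmetric]) (use R1 in auto)
  also have "cball 0 1 - ball 0 1 = sphere (0::complex) 1" by auto
  finally show ?thesis .
qed

lemma domain_D: assumes t: "\<bar>t\<bar> < t1" shows "bounded_simply_connected_domain (D t)"
  unfolding bounded_simply_connected_domain_def
proof (intro conjI)
  show "D t \<noteq> {}" by (simp add: D_def)
  show "open (D t)" by (rule open_D[OF t])
  show "connected (D t)" unfolding D_def by (rule connected_continuous_image[OF cont[OF t disc_sub(1)] connected_ball])
  have "compact ((\<lambda>z. F z t) ` cball 0 1)" by (intro compact_continuous_image cont[OF t disc_sub(2)] compact_cball)
  then show "bounded (D t)" unfolding closure_D[OF t, symmetric] using bounded_subset[OF compact_imp_bounded closure_subset] by blast
  obtain g where "homeomorphism (ball 0 1) (D t) (\<lambda>z. F z t) g"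
    unfolding D_def
    by (rule invariance_of_domain_homeomorphism[OF open_ball cont[OF t disc_sub(1)] _ inj_on_subset[OF inj[OF t] disc_sub(1)]], simp)
  then have "ball (0::complex) 1 homeomorphic D t" unfolding homeomorphic_def by blast
  then show "simply_connected (D t)"
    using homeomorphic_simply_connected_eq convex_imp_simply_connected[OF convex_ball, of "0::complex" 1] by blast
qed

definition curve :: "real \<Rightarrow> real \<Rightarrow> complex" where "curve t s = F (cis (2 * pi * s)) t"

lemma F_field_derivative:
  assumes "norm z < R1" "\<bar>t\<bar> < t1" shows "((\<lambda>z. F z t) has_field_derivative Fz z t) (at z)"
proof -
  have "((\<lambda>z. (z, t)) has_derivative (\<lambda>h. (h, 0))) (at z)" by (intro derivative_eq_intros) auto
  from has_derivative_compose[OF this der[OF assms]]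
  show ?thesis by (simp add: has_field_derivative_def case_prod_unfold)
qed

lemma curve_vector_derivative:
  assumes "\<bar>t\<bar> < t1"
  shows "(curve t has_vector_derivative Fz (cis (2 * pi * s)) t * (2 * of_real pi * \<i> * cis (2 * pi * s))) (at s)"
proof -
  have "((\<lambda>s. cis (2 * pi * s)) has_vector_derivative (2 * of_real pi * \<i> * cis (2 * pi * s))) (at s)"
    using has_vector_derivative_circlepath[of 0 1 s UNIV] by (simp add: circlepath cis_conv_exp mult_ac)
  from field_vector_diff_chain_at[OF this F_field_derivative[OF _ assms]]
  show ?thesis using R1 by (simp add: curve_def[abs_def] o_def mult.commute)
qed

lemma curve_parametrization:
  assumes t: "\<bar>t\<bar> < t1" and an: "real_analytic (curve t)"
  shows "analytic_Jordan_parametrization (curve t) (frontier (D t))"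
  unfolding analytic_Jordan_parametrization_def
proof (intro conjI allI)
  show "real_analytic (curve t)" by (rule an)
  show "curve t (s + 1) = curve t s" for s
    by (simp add: curve_def distrib_left flip: cis_mult)
  show "inj_on (curve t) {0..<1}"
  proof (rule inj_onI)
    fix a b :: real assume ab: "a \<in> {0..<1}" "b \<in> {0..<1}" "curve t a = curve t b"
    then have "F (cis (2 * pi * a)) t = F (cis (2 * pi * b)) t" by (simp only: curve_def)
    then have "cis (2 * pi * a) = cis (2 * pi * b)" by (rule image_inj) (simp_all add: t)
    moreover have "\<bar>a - b\<bar> < 1" using ab(1,2) by (simp add: abs_less_iff)
    ultimately show "a = b" by (rule cis_turns_inj)
  qed
  show "vector_derivative (curve t) (at s) \<noteq> 0" for s
    unfolding vector_derivative_at[OF curve_vector_derivative[OF t]] 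
  proof (rule no_zero_divisors)
    show "Fz (cis (2 * pi * s)) t \<noteq> 0" by (rule nz) (use R1 t in simp_all)
  qed simp
  have "range (curve t) = (\<lambda>z. F z t) ` range (\<lambda>s. cis (2 * pi * s))" unfolding curve_def[abs_def] by (simp add: image_image)
  then show "range (curve t) = frontier (D t)" unfolding frontier_D[OF t] circle_eq_cis_turns(2) .
qed

text \<open>A fixed point \<open>p\<close> is seen from the moving coordinate: its preimage \<open>\<omega> t\<close> satisfies
  \<open>F (\<omega> t) t = p\<close>, so its velocity is \<open>- Ft / Fz\<close>. By the evolution equation the radial component of this velocity is
  negative whenever \<open>\<omega> t\<close> is on the circle. Differentiability comes from inverting \<open>(z, t) \<mapsto> (F z t, t)\<close>, whose
  inverse is continuous by invariance of domain.\<close>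

lemma pullback:
  assumes p: "\<And>t. \<bar>t\<bar> < t1 \<Longrightarrow> p \<in> (\<lambda>z. F z t) ` ball 0 R1"
  obtains \<omega> G' where "\<And>t. \<bar>t\<bar> < t1 \<Longrightarrow> norm (\<omega> t) < R1 \<and> F (\<omega> t) t = p"
    "\<And>t. \<bar>t\<bar> < t1 \<Longrightarrow> DERIV (\<lambda>t. (norm (\<omega> t))\<^sup>2) t :> G' t"
    "\<And>t. \<bar>t\<bar> < t1 \<Longrightarrow> (norm (\<omega> t))\<^sup>2 = 1 \<Longrightarrow> G' t < 0"
proof -
  define U where "U = ball (0::complex) R1 \<times> {-t1<..<t1}"
  define \<Psi> where "\<Psi> = (\<lambda>(z, t). (F z t, t))"
  have U: "open U" unfolding U_def by (intro open_Times) auto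
  have d\<Psi>: "(\<Psi> has_derivative (\<lambda>(h, l). (Fz z t * h + Ft z t * of_real l, l))) (at (z, t))" if "norm z < R1" "\<bar>t\<bar> < t1" for z t
  proof -
    have "((\<lambda>q. ((\<lambda>(z, x). F z x) q, snd q)) has_derivative (\<lambda>q. ((\<lambda>(h, l). Fz z t * h + Ft z t * of_real l) q, snd q))) (at (z, t))"
      by (intro has_derivative_Pair der[OF that] has_derivative_snd has_derivative_ident)
    then show ?thesis by (simp add: \<Psi>_def case_prod_unfold)
  qed
  have c\<Psi>: "continuous_on U \<Psi>"
  proof (intro continuous_at_imp_continuous_on ballI)
    fix q assume "q \<in> U"
    then obtain z t where q: "q = (z, t)" "norm z < R1" "\<bar>t\<bar> < t1" by (auto simp: U_def)
    show "isCont \<Psi> q" unfolding q(1) by (rule has_derivative_continuous[OF d\<Psi>[OF q(2,3)]])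
  qed
  have i\<Psi>: "inj_on \<Psi> U"
  proof (rule inj_onI)
    fix q q' assume "q \<in> U" "q' \<in> U" and eq: "\<Psi> q = \<Psi> q'"
    then obtain z t z' t' where q: "q = (z, t)" "q' = (z', t')" "norm z < R1" "\<bar>t\<bar> < t1" "norm z' < R1" by (auto simp: U_def)
    then have "t = t'" "F z t = F z' t" using eq by (auto simp: \<Psi>_def)
    then show "q = q'" using inj_onD[OF inj[OF q(4)], of z z'] q by simp
  qed
  obtain g where g: "homeomorphism U (\<Psi> ` U) \<Psi> g"
    by (rule invariance_of_domain_homeomorphism[OF U c\<Psi> _ i\<Psi>], simp)
  have oV: "open (\<Psi> ` U)" by (rule invariance_of_domain[OF c\<Psi> U i\<Psi>])
  have gi: "\<Psi> (g y) = y" "g y \<in> U" if "y \<in> \<Psi> ` U" for y using g that by (auto simp: homeomorphism_def)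
  define \<omega> where "\<omega> t = fst (g (p, t))" for t
  have pV: "(p, t) \<in> \<Psi> ` U" if t: "\<bar>t\<bar> < t1" for t
  proof -
    obtain z where "z \<in> ball 0 R1" "p = F z t" using p[OF t] by (rule imageE) blast
    then show ?thesis using t by (intro image_eqI[of _ _ "(z, t)"]) (auto simp: \<Psi>_def U_def)
  qed
  have gp: "g (p, t) = (\<omega> t, t)" and w: "norm (\<omega> t) < R1" "F (\<omega> t) t = p" if "\<bar>t\<bar> < t1" for t
    using gi[OF pV[OF that]] by (auto simp: \<omega>_def \<Psi>_def U_def case_prod_unfold prod_eq_iff)
  define w' where "w' t = - Ft (\<omega> t) t / Fz (\<omega> t) t" for t
  have dw: "(\<omega> has_vector_derivative w' t) (at t)" if t: "\<bar>t\<bar> < t1" for t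
  proof -
    have Fnz: "Fz (\<omega> t) t \<noteq> 0" by (rule nz[OF w(1)[OF t] t])
    have D1: "(g has_derivative (\<lambda>(a, l). ((a - Ft (\<omega> t) t * of_real l) / Fz (\<omega> t) t, l))) (at (p, t))"
    proof (rule has_derivative_inverse_basic[where f = \<Psi> and g = g and y = "(p, t)", OF _ _ _ _ oV pV[OF t] gi(1)])
      show "(\<Psi> has_derivative (\<lambda>(h, l). (Fz (\<omega> t) t * h + Ft (\<omega> t) t * of_real l, l))) (at (g (p, t)))"
        unfolding gp[OF t] by (rule d\<Psi>[OF w(1)[OF t] t])
      show "(\<lambda>(a, l). ((a - Ft (\<omega> t) t * of_real l) / Fz (\<omega> t) t, l)) \<circ> (\<lambda>(h, l). (Fz (\<omega> t) t * h + Ft (\<omega> t) t * of_real l, l)) = id"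
        using Fnz by (simp add: fun_eq_iff)
      show "continuous (at (p, t)) g"
        using g pV[OF t] continuous_on_eq_continuous_at[OF oV, of g] unfolding homeomorphism_def by blast
      have "bounded_linear (\<lambda>q. ((fst q - Ft (\<omega> t) t * of_real (snd q)) / Fz (\<omega> t) t, snd q :: real))"
        by (intro bounded_linear_Pair bounded_linear_compose[OF bounded_linear_divide] bounded_linear_sub bounded_linear_fst bounded_linear_snd
          bounded_linear_compose[OF bounded_linear_mult_right] bounded_linear_compose[OF bounded_linear_of_real])
      then show "bounded_linear (\<lambda>(a, l). ((a - Ft (\<omega> t) t * of_real l) / Fz (\<omega> t) t, l :: real))" by (simp add: case_prod_unfold)
    qed
    have "((\<lambda>t. (p, t)) has_derivative (\<lambda>l. (0, l))) (at t)"
      by (rule has_derivative_Pair[OF has_derivative_const has_derivative_ident])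
    from has_derivative_compose[OF this D1] have "((\<lambda>t. g (p, t)) has_derivative (\<lambda>l. ((0 - Ft (\<omega> t) t * of_real l) / Fz (\<omega> t) t, l))) (at t)"
      by simp
    from has_derivative_fst[OF this]
    show ?thesis by (simp add: has_vector_derivative_def \<omega>_def[abs_def] w'_def[unfolded \<omega>_def] scaleR_conv_of_real mult.commute)
  qed
  show thesis
  proof (rule that[of \<omega> "\<lambda>t. 2 * (\<omega> t \<bullet> w' t)"])
    fix t assume t: "\<bar>t\<bar> < t1"
    show "norm (\<omega> t) < R1 \<and> F (\<omega> t) t = p" using w[OF t] by simp
    have "((\<lambda>t. \<omega> t \<bullet> \<omega> t) has_derivative (\<lambda>l. \<omega> t \<bullet> (l *\<^sub>R w' t) + (l *\<^sub>R w' t) \<bullet> \<omega> t)) (at t)"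
      by (rule has_derivative_inner; rule dw[OF t, unfolded has_vector_derivative_def])
    moreover have "(\<lambda>l. \<omega> t \<bullet> (l *\<^sub>R w' t) + (l *\<^sub>R w' t) \<bullet> \<omega> t) = (*) (2 * (\<omega> t \<bullet> w' t))"
      by (auto simp: inner_commute)
    ultimately show "DERIV (\<lambda>t. (norm (\<omega> t))\<^sup>2) t :> 2 * (\<omega> t \<bullet> w' t)"
      by (simp add: has_field_derivative_def power2_norm_eq_inner)
    assume "(norm (\<omega> t))\<^sup>2 = 1"
    then have n: "norm (\<omega> t) = 1" using norm_ge_zero[of "\<omega> t"] by (auto simp only: power2_eq_1_iff)
    have Fnz: "Fz (\<omega> t) t \<noteq> 0" by (rule nz[OF w(1)[OF t] t])
    have wc: "\<omega> t * cnj (\<omega> t) = 1" unfolding complex_norm_square[symmetric] n by simp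
    have "\<omega> t \<bullet> w' t = Re (cnj (\<omega> t) * w' t)" by (simp add: inner_complex_def)
    also have "cnj (\<omega> t) * w' t = - (Ft (\<omega> t) t * cnj (\<omega> t * Fz (\<omega> t) t)) / (Fz (\<omega> t) t * cnj (Fz (\<omega> t) t))"
      using Fnz by (simp add: w'_def)
    also have "\<dots> = - (Ft (\<omega> t) t * cnj (\<omega> t * Fz (\<omega> t) t)) / of_real ((norm (Fz (\<omega> t) t))\<^sup>2)"
      by (simp only: complex_norm_square)
    also have "Re \<dots> = - Re (Ft (\<omega> t) t * cnj (\<omega> t * Fz (\<omega> t) t)) / (norm (Fz (\<omega> t) t))\<^sup>2"
      by (simp only: Re_divide_of_real uminus_complex.sel)
    also have "\<dots> < 0" unfolding PG[OF n t] using Fnz by simp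
    finally show "2 * (\<omega> t \<bullet> w' t) < 0" by simp
  qed
qed

lemma closure_D_subset:
  assumes "\<bar>s\<bar> < t1" "\<bar>t\<bar> < t1" "s < t"
  shows "closure (D s) \<subseteq> D t"
proof
  fix p assume "p \<in> closure (D s)"
  then obtain z where z: "norm z \<le> 1" "p = F z s" unfolding closure_D[OF assms(1)] by auto
  obtain \<omega> G' where w: "\<And>t. \<bar>t\<bar> < t1 \<Longrightarrow> norm (\<omega> t) < R1 \<and> F (\<omega> t) t = p"
    and d: "\<And>t. \<bar>t\<bar> < t1 \<Longrightarrow> DERIV (\<lambda>t. (norm (\<omega> t))\<^sup>2) t :> G' t"
    and n: "\<And>t. \<bar>t\<bar> < t1 \<Longrightarrow> (norm (\<omega> t))\<^sup>2 = 1 \<Longrightarrow> G' t < 0"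
    by (rule pullback[of p]) (use cover[OF z(1) assms(1)] z(2) in blast)+
  have "\<omega> s = z" using w[OF assms(1)] z R1 inj_onD[OF inj[OF assms(1)], of "\<omega> s" z] by simp
  then have "(norm (\<omega> s))\<^sup>2 \<le> 1" using z(1) by (simp add: power_le_one)
  then have "(norm (\<omega> t))\<^sup>2 < 1"
    by (intro stays_below_level[where G = "\<lambda>t. (norm (\<omega> t))\<^sup>2" and a = s and b = t and G' = G'] d n) (use assms in auto)
  then have "norm (\<omega> t) < 1" by (simp add: power_less_one_iff abs_square_less_1)
  then show "p \<in> D t" using w[OF assms(2)] unfolding D_def by (intro image_eqI[of _ _ "\<omega> t"]) auto
qed

text \<open>A point between the two domains has its preimage outside the circle at time 0 and inside at time \<open>t\<close>, so it is
  passed by the boundary curve at some time in between.\<close>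

lemma shell_swept:
  assumes t: "0 < t" "t < t1"
  shows "D t - closure (D 0) = (\<lambda>(\<sigma>, s). curve \<sigma> s) ` ({0<..<t} \<times> {0..<1})"
proof (intro subset_antisym subsetI)
  have t': "\<bar>t\<bar> < t1" "\<bar>0\<bar> < t1" using t by auto
  {
    fix p assume p: "p \<in> D t - closure (D 0)"
    then obtain z where z: "norm z < 1" "p = F z t" by (auto simp: D_def)
    then have z1: "norm z \<le> 1" by simp
    obtain \<omega> G' where w: "\<And>t. \<bar>t\<bar> < t1 \<Longrightarrow> norm (\<omega> t) < R1 \<and> F (\<omega> t) t = p"
      and d: "\<And>t. \<bar>t\<bar> < t1 \<Longrightarrow> DERIV (\<lambda>t. (norm (\<omega> t))\<^sup>2) t :> G' t"
      by (rule pullback[of p]) (use cover[OF z1 t'(1)] z(2) in blast)+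
    have wt: "\<omega> t = z" using w[OF t'(1)] z R1 inj_onD[OF inj[OF t'(1)], of "\<omega> t" z] by simp
    have w0: "1 < norm (\<omega> 0)"
    proof (rule ccontr)
      assume "\<not> 1 < norm (\<omega> 0)"
      then have "p \<in> closure (D 0)" using w[OF t'(2)] unfolding closure_D[OF t'(2)] by (intro image_eqI[of _ _ "\<omega> 0"]) auto
      then show False using p by simp
    qed
    have "continuous_on {0..t} (\<lambda>t. (norm (\<omega> t))\<^sup>2)"
      using t by (intro continuous_at_imp_continuous_on ballI) (auto intro!: DERIV_isCont[OF d])
    then obtain \<sigma> where \<sigma>: "0 \<le> \<sigma>" "\<sigma> \<le> t" "(norm (\<omega> \<sigma>))\<^sup>2 = 1"
      using IVT2'[of "\<lambda>t. (norm (\<omega> t))\<^sup>2" t 1 0] wt z w0 t by (auto simp: power_le_one one_le_power)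
    then have "norm (\<omega> \<sigma>) = 1" using norm_ge_zero[of "\<omega> \<sigma>"] by (auto simp only: power2_eq_1_iff)
    then have "\<omega> \<sigma> \<in> sphere 0 1" "\<sigma> \<noteq> 0" "\<sigma> \<noteq> t" using w0 wt z by auto
    then obtain s where s: "s \<in> {0..<1}" "\<omega> \<sigma> = cis (2 * pi * s)" unfolding circle_eq_cis_turns(1) by blast
    have "p = curve \<sigma> s" using w[of \<sigma>] \<sigma> t s by (simp add: curve_def)
    then show "p \<in> (\<lambda>(\<sigma>, s). curve \<sigma> s) ` ({0<..<t} \<times> {0..<1})"
      using \<sigma> \<open>\<sigma> \<noteq> 0\<close> \<open>\<sigma> \<noteq> t\<close> s by (intro image_eqI[of _ _ "(\<sigma>, s)"]) auto
  }
  fix p assume "p \<in> (\<lambda>(\<sigma>, s). curve \<sigma> s) ` ({0<..<t} \<times> {0..<1})"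
  then obtain \<sigma> s where p: "0 < \<sigma>" "\<sigma> < t" "p = curve \<sigma> s" by auto
  then have \<sigma>: "\<bar>\<sigma>\<bar> < t1" using t by auto
  have fr: "p \<in> frontier (D \<sigma>)" unfolding frontier_D[OF \<sigma>] p(3) curve_def by (intro imageI) simp
  then have "p \<in> closure (D \<sigma>)" by (simp add: frontier_def)
  moreover have "p \<notin> D \<sigma>" using fr open_D[OF \<sigma>] by (simp add: frontier_def interior_open)
  ultimately show "p \<in> D t - closure (D 0)"
    using closure_D_subset[OF \<sigma> t'(1) p(2)] closure_D_subset[OF t'(2) \<sigma> p(1)] by blast
qed

lemma curve_inj:
  assumes "t < t1"
  shows "inj_on (\<lambda>(\<sigma>, s). curve \<sigma> s) ({0<..<t} \<times> {0..<1})"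
proof (rule inj_onI)
  have lt: False if "0 < \<sigma>" "\<sigma> < \<sigma>'" "\<sigma>' < t" "curve \<sigma> s = curve \<sigma>' s'" for \<sigma> \<sigma>' s s'
  proof -
    have a: "\<bar>\<sigma>\<bar> < t1" "\<bar>\<sigma>'\<bar> < t1" using that assms by auto
    have "curve \<sigma> s \<in> closure (D \<sigma>)" unfolding closure_D[OF a(1)] curve_def by (intro imageI) simp
    then have "curve \<sigma>' s' \<in> D \<sigma>'" using closure_D_subset[OF a that(2)] that(4) by auto
    moreover have "curve \<sigma>' s' \<in> frontier (D \<sigma>')" unfolding frontier_D[OF a(2)] curve_def by (intro imageI) simp
    ultimately show False using open_D[OF a(2)] by (simp add: frontier_def interior_open)
  qed
  fix x y assume "x \<in> {0<..<t} \<times> {0..<1::real}" "y \<in> {0<..<t} \<times> {0..<1::real}" and eq: "(\<lambda>(\<sigma>, s). curve \<sigma> s) x = (\<lambda>(\<sigma>, s). curve \<sigma> s) y"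
  then obtain \<sigma> s \<sigma>' s' where x: "x = (\<sigma>, s)" "y = (\<sigma>', s')" and b: "0 < \<sigma>" "\<sigma> < t" "0 < \<sigma>'" "\<sigma>' < t" "0 \<le> s" "s < 1" "0 \<le> s'" "s' < 1" by auto
  have e: "curve \<sigma> s = curve \<sigma>' s'" using eq x by simp
  have "\<sigma> = \<sigma>'" using lt[of \<sigma> \<sigma>' s s'] lt[of \<sigma>' \<sigma> s' s] e b by (cases \<sigma> \<sigma>' rule: linorder_cases) auto
  moreover have "cis (2 * pi * s) = cis (2 * pi * s')"
    by (rule image_inj[of _ \<sigma>]) (use e b assms \<open>\<sigma> = \<sigma>'\<close> in \<open>auto simp: curve_def\<close>)
  moreover have "\<bar>s - s'\<bar> < 1" using b(5-8) by (simp add: abs_less_iff)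
  ultimately show "x = y" using x cis_turns_inj[of s s'] by simp
qed

end

section \<open>Area integrals over the swept shell\<close>

text \<open>An identification of two Euclidean spaces that matches the standard bases preserves boxes, hence Lebesgue measure.
  It is used to pass between \<open>complex\<close>, \<open>real^2\<close> and \<open>real \<times> real\<close>: integrands live on the first, the
  change of variables formula on the second, and Fubini on the third.\<close>

lemma lborel_distr_basis:
  fixes L :: "'a::euclidean_space \<Rightarrow> 'b::euclidean_space"
  assumes B: "bij_betw L Basis Basis" and L: "\<And>x b. b \<in> Basis \<Longrightarrow> L x \<bullet> L b = x \<bullet> b" and m: "L \<in> borel_measurable borel"
  shows "distr lborel lborel L = lborel"
proof (rule lborel_eqI[symmetric])
  fix l u :: 'b assume lu: "\<And>b. b \<in> Basis \<Longrightarrow> l \<bullet> b \<le> u \<bullet> b"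
  define p where "p v = (\<Sum>b\<in>Basis. (v \<bullet> L b) *\<^sub>R b)" for v
  have p: "p v \<bullet> b = v \<bullet> L b" if "b \<in> Basis" for v b using that by (simp add: p_def)
  have im: "L ` Basis = Basis" using B by (simp add: bij_betw_def)
  have "L x \<in> box l u \<longleftrightarrow> x \<in> box (p l) (p u)" for x
  proof -
    have "L x \<in> box l u \<longleftrightarrow> (\<forall>c\<in>L ` Basis. l \<bullet> c < L x \<bullet> c \<and> L x \<bullet> c < u \<bullet> c)" by (simp only: im mem_box)
    also have "\<dots> \<longleftrightarrow> (\<forall>b\<in>Basis. p l \<bullet> b < x \<bullet> b \<and> x \<bullet> b < p u \<bullet> b)" using p L by simp
    finally show ?thesis by (simp only: mem_box)
  qed
  then have "L -` box l u = box (p l) (p u)" by auto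
  then have "emeasure (distr lborel lborel L) (box l u) = emeasure lborel (box (p l) (p u))"
    using m by (simp add: emeasure_distr)
  also have "\<dots> = ennreal (\<Prod>b\<in>Basis. (p u - p l) \<bullet> b)"
  proof (rule emeasure_lborel_box)
    fix b :: 'a assume b: "b \<in> Basis"
    then have "L b \<in> Basis" using im by blast
    then show "p l \<bullet> b \<le> p u \<bullet> b" using p[OF b] lu by simp
  qed
  also have "(\<Prod>b\<in>Basis. (p u - p l) \<bullet> b) = (\<Prod>b\<in>Basis. (u - l) \<bullet> L b)"
    by (rule prod.cong) (simp_all add: inner_diff_left p)
  also have "\<dots> = (\<Prod>c\<in>Basis. (u - l) \<bullet> c)"
    by (rule prod.reindex_bij_betw[OF B, of "\<lambda>c. (u - l) \<bullet> c"])
  finally show "emeasure (distr lborel lborel L) (box l u) = (\<Prod>b\<in>Basis. (u - l) \<bullet> b)" .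
qed simp

definition plane_vec :: "complex \<Rightarrow> real^2" where "plane_vec z = vector [Re z, Im z]"
definition plane_complex :: "real^2 \<Rightarrow> complex" where "plane_complex v = Complex (v $ 1) (v $ 2)"
definition plane_pair :: "real^2 \<Rightarrow> real \<times> real" where "plane_pair v = (v $ 1, v $ 2)"

lemma plane_inverse [simp]: "plane_complex (plane_vec z) = z" "plane_vec (plane_complex v) = v"
  by (simp_all add: plane_vec_def plane_complex_def vec_eq_iff forall_2)

lemma plane_linear: "bounded_linear plane_vec" "bounded_linear plane_complex" "bounded_linear plane_pair"
proof -
  have "linear plane_vec" "linear plane_complex" "linear plane_pair"
    by (simp_all add: linear_iff plane_vec_def plane_complex_def plane_pair_def vec_eq_iff forall_2 complex_eq_iff)
  then show "bounded_linear plane_vec" "bounded_linear plane_complex" "bounded_linear plane_pair"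
    by (simp_all add: linear_conv_bounded_linear)
qed

lemma plane_measurable [measurable]: "plane_complex \<in> borel_measurable borel" "plane_pair \<in> borel_measurable borel"
  by (intro borel_measurable_continuous_onI linear_continuous_on plane_linear)+

lemma plane_preserves_measure: "distr lborel lborel plane_complex = lborel" "distr lborel lborel plane_pair = lborel"
proof -
  have Bs: "(Basis :: (real^2) set) = {axis 1 1, axis 2 1}" by (auto simp: Basis_vec_def UNIV_2)
  have v: "plane_complex (axis 1 1) = 1" "plane_complex (axis 2 1) = \<i>" "plane_pair (axis 1 1) = (1, 0)" "plane_pair (axis 2 1) = (0, 1)"
    by (simp_all add: plane_complex_def plane_pair_def axis_def complex_eq_iff)
  show "distr lborel lborel plane_complex = lborel"
  proof (rule lborel_distr_basis)
    show "bij_betw plane_complex Basis Basis" unfolding Bs Basis_complex_def bij_betw_def by (auto simp: v complex_eq_iff)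
    show "plane_complex x \<bullet> plane_complex b = x \<bullet> b" if "b \<in> Basis" for x b
      using that unfolding Bs by (auto simp: v inner_axis) (simp_all add: plane_complex_def inner_complex_def)
  qed simp
  show "distr lborel lborel plane_pair = lborel"
  proof (rule lborel_distr_basis)
    have ne: "axis 1 1 \<noteq> (axis 2 1 :: real^2)" by (simp add: axis_eq_axis)
    have Bp: "(Basis :: (real \<times> real) set) = {(1, 0), (0, 1)}" by (auto simp: Basis_prod_def)
    show "bij_betw plane_pair Basis Basis"
      unfolding Bs Bp bij_betw_def by (simp add: v ne ne[symmetric] insert_Diff_if)
    show "plane_pair x \<bullet> plane_pair b = x \<bullet> b" if "b \<in> Basis" for x b
      using that unfolding Bs by (auto simp: v inner_axis) (simp_all add: plane_pair_def)
  qed simp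
qed

lemma circle_mean_value:
  assumes h: "h holomorphic_on cball 0 1"
  shows "((\<lambda>s. h (cis (2 * pi * s))) has_integral h 0) {0..1}"
proof -
  have "((\<lambda>u. h u / (u - 0)) has_contour_integral (2 * of_real pi * \<i> * h 0)) (circlepath 0 1)"
    by (rule Cauchy_integral_circlepath_simple[OF h]) simp
  then have "((\<lambda>x. h (circlepath 0 1 x) / (circlepath 0 1 x - 0) * vector_derivative (circlepath 0 1) (at x within {0..1})) has_integral (2 * of_real pi * \<i> * h 0)) {0..1}"
    by (simp only: has_contour_integral_def)
  then have "((\<lambda>s. 2 * of_real pi * \<i> * h (cis (2 * pi * s))) has_integral (2 * of_real pi * \<i> * h 0)) {0..1}"
  proof (rule has_integral_eq[rotated])
    fix x :: real assume x: "x \<in> {0..1}"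
    have c: "circlepath 0 1 x = cis (2 * pi * x)" by (simp add: circlepath cis_conv_exp mult_ac)
    have "vector_derivative (circlepath 0 1) (at x within {0..1}) = 2 * of_real pi * \<i> * cis (2 * pi * x)"
      using x by (subst vector_derivative_circlepath01) (simp_all add: cis_conv_exp mult_ac)
    then show "h (circlepath 0 1 x) / (circlepath 0 1 x - 0) * vector_derivative (circlepath 0 1) (at x within {0..1}) = 2 * of_real pi * \<i> * h (cis (2 * pi * x))"
      unfolding c by simp
  qed
  from has_integral_mult_right[OF this, of "1 / (2 * of_real pi * \<i>)"] show ?thesis by simp
qed

context growing_discs
begin

lemma curve_derivative:
  assumes "\<bar>\<sigma>\<bar> < t1"
  shows "((\<lambda>q. curve (fst q) (snd q)) has_derivative
    (\<lambda>k. Fz (cis (2 * pi * s)) \<sigma> * (of_real (snd k) * (2 * of_real pi * \<i> * cis (2 * pi * s))) + Ft (cis (2 * pi * s)) \<sigma> * of_real (fst k))) (at (\<sigma>, s))"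
proof -
  have c: "((\<lambda>s. cis (2 * pi * s)) has_derivative (\<lambda>l. of_real l * (2 * of_real pi * \<i> * cis (2 * pi * s)))) (at s)"
    using has_vector_derivative_circlepath[of 0 1 s UNIV]
    by (simp add: circlepath cis_conv_exp mult_ac has_vector_derivative_def scaleR_conv_of_real)
  have "((\<lambda>q::real \<times> real. snd q) has_derivative snd) (at (\<sigma>, s))" by (intro derivative_eq_intros) auto
  from has_derivative_compose[OF this, of "\<lambda>s. cis (2 * pi * s)"] c
  have "((\<lambda>q. cis (2 * pi * snd q)) has_derivative (\<lambda>k. of_real (snd k) * (2 * of_real pi * \<i> * cis (2 * pi * s)))) (at (\<sigma>, s))" by simp
  from has_derivative_Pair[OF this has_derivative_fst[OF has_derivative_ident]]
  have p: "((\<lambda>q. (cis (2 * pi * snd q), fst q)) has_derivative (\<lambda>k. (of_real (snd k) * (2 * of_real pi * \<i> * cis (2 * pi * s)), fst k))) (at (\<sigma>, s))" .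
  have "((\<lambda>(z, x). F z x) has_derivative (\<lambda>(h, l). Fz (cis (2 * pi * s)) \<sigma> * h + Ft (cis (2 * pi * s)) \<sigma> * of_real l)) (at (cis (2 * pi * s), \<sigma>))"
    by (rule der) (use assms R1 in simp_all)
  then have "((\<lambda>(z, x). F z x) has_derivative (\<lambda>(h, l). Fz (cis (2 * pi * s)) \<sigma> * h + Ft (cis (2 * pi * s)) \<sigma> * of_real l)) (at ((\<lambda>q. (cis (2 * pi * snd q), fst q)) (\<sigma>, s)))"
    by simp
  from has_derivative_compose[OF p this] show ?thesis by (simp add: curve_def)
qed

lemma curve_continuous: "continuous_on ({-t1<..<t1} \<times> UNIV) (\<lambda>q. curve (fst q) (snd q))"
proof (intro continuous_at_imp_continuous_on ballI)
  fix q :: "real \<times> real" assume "q \<in> {-t1<..<t1} \<times> UNIV"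
  then have "\<bar>fst q\<bar> < t1" by auto
  from has_derivative_continuous[OF curve_derivative[OF this, of "snd q"]]
  show "isCont (\<lambda>q. curve (fst q) (snd q)) q" by simp
qed

text \<open>In the coordinates time and angle, the area element is \<open>\<bar>Im (cnj (Ft) * 2 * pi * \<i> * z * Fz)\<bar>\<close>, that is
  \<open>2 * pi * exp (pi * norm F^2)\<close> by the evolution equation. It cancels the Gaussian weight, and for each time the angular
  mean of the holomorphic function \<open>B (F z \<sigma>)\<close> is its value \<open>B 0\<close> at the centre.\<close>

lemma quadrature:
  assumes t: "0 < t" "t < t1" and B: "B holomorphic_on UNIV"
  shows "(LINT z:(D t - closure (D 0))|lebesgue. B z * of_real (exp (- pi * (norm z)\<^sup>2))) = of_real (2 * pi * t) * B 0"
proof -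
  define \<Omega> where "\<Omega> = D t - closure (D 0)"
  define H where "H z = B z * of_real (exp (- pi * (norm z)\<^sup>2))" for z
  define S where "S = {v::real^2. 0 < v $ 1 \<and> v $ 1 < t \<and> 0 \<le> v $ 2 \<and> v $ 2 < 1}"
  define T where "T = {0<..<t} \<times> {0..<1::real}"
  define q where "q v = curve (v $ 1) (v $ 2)" for v :: "real^2"
  define f where "f v = plane_vec (H (plane_complex v))" for v
  define k where "k v = (2 * pi) *\<^sub>R plane_vec (B (q v))" for v
  define A where "A v = 2 * of_real pi * \<i> * cis (2 * pi * v $ 2)" for v :: "real^2"
  define q' where "q' v w = Fz (cis (2 * pi * v $ 2)) (v $ 1) * (of_real (w $ 2) * A v) + Ft (cis (2 * pi * v $ 2)) (v $ 1) * of_real (w $ 1)" for v w :: "real^2"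
  have Bc: "continuous_on UNIV B" by (rule holomorphic_on_imp_continuous_on[OF B])
  have Hc: "continuous_on UNIV H" unfolding H_def by (intro continuous_intros Bc)
  have op: "open \<Omega>" unfolding \<Omega>_def using open_D[of t] t by (intro open_Diff) auto
  have PS: "plane_pair ` S = T"
  proof (intro subset_antisym subsetI)
    fix x assume "x \<in> T"
    then show "x \<in> plane_pair ` S"
      by (intro image_eqI[of _ _ "vector [fst x, snd x]"]) (auto simp: T_def S_def plane_pair_def)
  qed (auto simp: S_def T_def plane_pair_def)
  have qS: "q ` S = \<Omega>"
  proof -
    have "q = (\<lambda>(\<sigma>, s). curve \<sigma> s) \<circ> plane_pair" by (simp add: q_def plane_pair_def fun_eq_iff)
    then have "q ` S = (\<lambda>(\<sigma>, s). curve \<sigma> s) ` T" unfolding PS[symmetric] by (simp add: image_comp)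
    then show ?thesis unfolding \<Omega>_def shell_swept[OF t] T_def .
  qed
  have dq: "(q has_derivative q' v) (at v)" if "\<bar>v $ 1\<bar> < t1" for v :: "real^2"
  proof -
    have "(plane_pair has_derivative plane_pair) (at v)" by (rule bounded_linear_imp_has_derivative[OF plane_linear(3)])
    moreover have "((\<lambda>q. curve (fst q) (snd q)) has_derivative
      (\<lambda>k. Fz (cis (2 * pi * v $ 2)) (v $ 1) * (of_real (snd k) * A v) + Ft (cis (2 * pi * v $ 2)) (v $ 1) * of_real (fst k))) (at (plane_pair v))"
      using curve_derivative[OF that, of "v $ 2"] by (simp add: plane_pair_def A_def)
    ultimately have "((\<lambda>v. curve (fst (plane_pair v)) (snd (plane_pair v))) has_derivative
      (\<lambda>w. Fz (cis (2 * pi * v $ 2)) (v $ 1) * (of_real (snd (plane_pair w)) * A v) + Ft (cis (2 * pi * v $ 2)) (v $ 1) * of_real (fst (plane_pair w)))) (at v)"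
      by (rule has_derivative_compose)
    then show ?thesis by (simp add: q_def[abs_def] q'_def[abs_def] A_def plane_pair_def)
  qed
  have dg: "((\<lambda>v. plane_vec (q v)) has_derivative (\<lambda>w. plane_vec (q' v w))) (at v within S)" if "v \<in> S" for v
    by (rule bounded_linear.has_derivative[OF plane_linear(1)], rule has_derivative_at_withinI, rule dq) (use that t in \<open>auto simp: S_def\<close>)
  have injS: "inj_on (\<lambda>v. plane_vec (q v)) S"
  proof (rule inj_onI)
    fix x y assume xy: "x \<in> S" "y \<in> S" "plane_vec (q x) = plane_vec (q y)"
    then have "q x = q y" by (metis plane_inverse(1))
    then have "plane_pair x = plane_pair y"
      using inj_onD[OF curve_inj[OF t(2)], of "plane_pair x" "plane_pair y"] xy by (simp add: q_def plane_pair_def S_def)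
    then show "x = y" by (simp add: plane_pair_def vec_eq_iff forall_2)
  qed
  have J: "\<bar>det (matrix (\<lambda>w. plane_vec (q' v w)))\<bar> *\<^sub>R f (plane_vec (q v)) = k v" if "v \<in> S" for v
  proof -
    define z where "z = cis (2 * pi * v $ 2)"
    define a where "a = Fz z (v $ 1) * A v"
    define b where "b = Ft z (v $ 1)"
    have "det (matrix (\<lambda>w. plane_vec (q' v w))) = Re b * Im a - Re a * Im b"
      by (simp add: det_2 matrix_def plane_vec_def q'_def axis_def a_def b_def z_def)
    also have "\<dots> = 2 * pi * Re (b * cnj (z * Fz z (v $ 1)))"
      by (simp add: a_def A_def z_def algebra_simps)
    also have "Re (b * cnj (z * Fz z (v $ 1))) = exp (pi * (norm (q v))\<^sup>2)"
      unfolding b_def q_def curve_def z_def by (rule PG) (use that t in \<open>auto simp: S_def\<close>)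
    finally have "\<bar>det (matrix (\<lambda>w. plane_vec (q' v w)))\<bar> = 2 * pi * exp (pi * (norm (q v))\<^sup>2)" by simp
    moreover have "f (plane_vec (q v)) = exp (- (pi * (norm (q v))\<^sup>2)) *\<^sub>R plane_vec (B (q v))"
      using linear_scale[OF bounded_linear.linear[OF plane_linear(1)], of "exp (- (pi * (norm (q v))\<^sup>2))" "B (q v)"]
      by (simp add: f_def H_def scaleR_conv_of_real mult.commute)
    ultimately show ?thesis by (simp add: k_def exp_minus)
  qed
  have Sb: "S \<in> sets borel" unfolding S_def by measurable
  have kS: "k absolutely_integrable_on S"
  proof (rule set_integrable_subset)
    show "k absolutely_integrable_on cbox (vector [0, 0]) (vector [t, 1])"
    proof (rule absolutely_integrable_continuous)
      have "continuous_on (cbox (vector [0, 0]) (vector [t, 1])) q"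
      proof (intro continuous_at_imp_continuous_on ballI)
        fix v :: "real^2" assume "v \<in> cbox (vector [0, 0]) (vector [t, 1])"
        then have "\<bar>v $ 1\<bar> < t1" using t by (simp add: mem_box_cart forall_2)
        then show "isCont q v" by (rule has_derivative_continuous[OF dq])
      qed
      then show "continuous_on (cbox (vector [0, 0]) (vector [t, 1])) k" unfolding k_def
        by (intro continuous_on_scaleR continuous_on_const bounded_linear.continuous_on[OF plane_linear(1)] continuous_on_compose2[OF Bc]) auto
    qed
    show "S \<in> sets lebesgue" using Sb by simp
    show "S \<subseteq> cbox (vector [0, 0]) (vector [t, 1])" by (auto simp: S_def mem_box_cart forall_2)
  qed
  have "(\<lambda>v. \<bar>det (matrix (\<lambda>w. plane_vec (q' v w)))\<bar> *\<^sub>R f (plane_vec (q v))) absolutely_integrable_on S"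
    using kS by (subst set_integrable_cong[OF refl refl J]) auto
  moreover have "integral S (\<lambda>v. \<bar>det (matrix (\<lambda>w. plane_vec (q' v w)))\<bar> *\<^sub>R f (plane_vec (q v))) = integral S k"
    using J by (rule Henstock_Kurzweil_Integration.integral_cong)
  moreover have "S \<in> sets lebesgue" using Sb by simp
  ultimately have f: "f absolutely_integrable_on (\<lambda>v. plane_vec (q v)) ` S" "integral ((\<lambda>v. plane_vec (q v)) ` S) f = integral S k"
    using has_absolute_integral_change_of_variables[of S "\<lambda>v. plane_vec (q v)" "\<lambda>v w. plane_vec (q' v w)" f "integral S k"] dg injS by blast+
  define E where "E = plane_complex -` \<Omega>"
  have E: "(\<lambda>v. plane_vec (q v)) ` S = E"
  proof -
    have "plane_vec ` \<Omega> = E" unfolding E_def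
    proof (intro subset_antisym subsetI)
      fix v assume "v \<in> plane_complex -` \<Omega>"
      then show "v \<in> plane_vec ` \<Omega>" by (intro image_eqI[of _ _ "plane_complex v"]) auto
    qed auto
    then show ?thesis unfolding qS[symmetric] by (simp add: image_image)
  qed
  note f = f[unfolded E]
  have fm: "(\<lambda>v. indicator E v *\<^sub>R f v) \<in> borel_measurable borel"
  proof (rule borel_measurable_continuous_on_indicator)
    show "E \<in> sets borel" unfolding E_def using open_vimage[OF op, of plane_complex] linear_continuous_on[OF plane_linear(2)] by (intro borel_open) auto
    show "continuous_on E f" unfolding f_def
      by (intro bounded_linear.continuous_on[OF plane_linear(1)] continuous_on_compose2[OF Hc] linear_continuous_on plane_linear) auto
  qed
  have Hm: "(\<lambda>z. indicator \<Omega> z *\<^sub>R H z) \<in> borel_measurable borel"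
    by (rule borel_measurable_continuous_on_indicator) (use op continuous_on_subset[OF Hc] in auto)
  have fi: "integrable lborel (\<lambda>v. indicator E v *\<^sub>R f v)"
    using f(1) fm unfolding set_integrable_def by (subst (asm) integrable_completion) auto
  have "(LINT z:\<Omega>|lebesgue. H z) = (LINT z|lborel. indicator \<Omega> z *\<^sub>R H z)"
    unfolding set_lebesgue_integral_def using Hm by (intro integral_completion) simp
  also have "\<dots> = (LINT z|distr lborel lborel plane_complex. indicator \<Omega> z *\<^sub>R H z)" by (simp only: plane_preserves_measure)
  also have "\<dots> = (LINT v|lborel. indicator \<Omega> (plane_complex v) *\<^sub>R H (plane_complex v))" by (rule integral_distr) (use Hm in simp_all)
  also have "\<dots> = (LINT v|lborel. plane_complex (indicator E v *\<^sub>R f v))"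
    by (rule Bochner_Integration.integral_cong[OF refl])
      (simp add: E_def f_def linear_scale[OF bounded_linear.linear[OF plane_linear(2)]] indicator_def linear_0[OF bounded_linear.linear[OF plane_linear(2)]])
  also have "\<dots> = plane_complex (LINT v|lborel. indicator E v *\<^sub>R f v)" by (rule integral_bounded_linear[OF plane_linear(2) fi])
  also have "(LINT v|lborel. indicator E v *\<^sub>R f v) = (LINT v:E|lebesgue. f v)"
    unfolding set_lebesgue_integral_def using fm by (intro integral_completion[symmetric]) simp
  also have "\<dots> = integral S k" using set_lebesgue_integral_eq_integral(2)[OF f(1)] f(2) by simp
  finally have main: "(LINT z:\<Omega>|lebesgue. H z) = plane_complex (integral S k)" .

  define h where "h x = indicator T x *\<^sub>R ((2 * of_real pi) * B (curve (fst x) (snd x)))" for x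
  have Tb: "T \<in> sets borel" unfolding T_def borel_prod[symmetric] by (intro pair_measureI) auto
  have hm: "h \<in> borel_measurable borel" unfolding h_def
  proof (rule borel_measurable_continuous_on_indicator[OF Tb])
    have "continuous_on T (\<lambda>q. curve (fst q) (snd q))" by (rule continuous_on_subset[OF curve_continuous]) (use t in \<open>auto simp: T_def\<close>)
    then show "continuous_on T (\<lambda>x. 2 * of_real pi * B (curve (fst x) (snd x)))" by (intro continuous_intros continuous_on_compose2[OF Bc]) auto
  qed
  have hk: "h (plane_pair v) = plane_complex (indicator S v *\<^sub>R k v)" for v
  proof -
    have "plane_pair v \<in> T \<longleftrightarrow> v \<in> S" by (auto simp: T_def S_def plane_pair_def)
    moreover have "plane_complex (k v) = (2 * pi) *\<^sub>R B (curve (v $ 1) (v $ 2))"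
      by (simp only: k_def q_def linear_scale[OF bounded_linear.linear[OF plane_linear(2)]] plane_inverse)
    then have "plane_complex (k v) = 2 * of_real pi * B (curve (v $ 1) (v $ 2))" by (simp add: scaleR_conv_of_real)
    ultimately show ?thesis
      by (simp add: h_def indicator_def plane_pair_def linear_0[OF bounded_linear.linear[OF plane_linear(2)]])
  qed
  have km: "(\<lambda>v. indicator S v *\<^sub>R k v) \<in> borel_measurable borel"
  proof (rule borel_measurable_continuous_on_indicator[OF Sb])
    have "continuous_on S q"
      by (intro continuous_at_imp_continuous_on ballI has_derivative_continuous[OF dq]) (use t in \<open>auto simp: S_def\<close>)
    then show "continuous_on S k" unfolding k_def
      by (intro continuous_on_scaleR continuous_on_const bounded_linear.continuous_on[OF plane_linear(1)] continuous_on_compose2[OF Bc]) auto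
  qed
  have ki: "integrable lborel (\<lambda>v. indicator S v *\<^sub>R k v)"
    using kS km unfolding set_integrable_def by (subst (asm) integrable_completion) auto
  have "plane_complex (integral S k) = plane_complex (LINT v:S|lebesgue. k v)" using set_lebesgue_integral_eq_integral(2)[OF kS] by simp
  also have "(LINT v:S|lebesgue. k v) = (LINT v|lborel. indicator S v *\<^sub>R k v)"
    unfolding set_lebesgue_integral_def using km by (intro integral_completion) simp
  also have "plane_complex \<dots> = (LINT v|lborel. h (plane_pair v))"
    unfolding hk by (rule integral_bounded_linear[OF plane_linear(2) ki, symmetric])
  also have "\<dots> = (LINT x|distr lborel lborel plane_pair. h x)" by (rule integral_distr[symmetric]) (use hm in simp_all)
  also have "\<dots> = (LINT x|(lborel \<Otimes>\<^sub>M lborel). h x)" by (simp only: plane_preserves_measure lborel_prod)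
  also have "\<dots> = (LINT \<sigma>|lborel. LINT s|lborel. h (\<sigma>, s))"
  proof (rule lborel_pair.integral_fst'[symmetric])
    have "integrable lborel (\<lambda>v. h (plane_pair v))" unfolding hk by (rule integrable_bounded_linear[OF plane_linear(2) ki])
    then have "integrable (distr lborel lborel plane_pair) h" by (subst integrable_distr_eq) (use hm in simp_all)
    then show "integrable (lborel \<Otimes>\<^sub>M lborel) h" by (simp only: plane_preserves_measure lborel_prod)
  qed
  also have "\<dots> = (LINT \<sigma>|lborel. indicator {0<..<t} \<sigma> *\<^sub>R (2 * of_real pi * B 0))"
  proof (rule Bochner_Integration.integral_cong[OF refl])
    fix \<sigma> :: real
    show "(LINT s|lborel. h (\<sigma>, s)) = indicator {0<..<t} \<sigma> *\<^sub>R (2 * of_real pi * B 0)"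
    proof (cases "\<sigma> \<in> {0<..<t}")
      case True
      then have \<sigma>: "\<bar>\<sigma>\<bar> < t1" using t by auto
      define c where "c s = B (curve \<sigma> s)" for s
      have "((\<lambda>s. B (F (cis (2 * pi * s)) \<sigma>)) has_integral B (F 0 \<sigma>)) {0..1}"
      proof (rule circle_mean_value[where h = "\<lambda>z. B (F z \<sigma>)"])
        have "(B \<circ> (\<lambda>z. F z \<sigma>)) holomorphic_on cball 0 1"
          by (rule holomorphic_on_compose_gen[OF holomorphic_on_subset[OF holo[OF \<sigma>] disc_sub(2)] B]) simp
        then show "(\<lambda>z. B (F z \<sigma>)) holomorphic_on cball 0 1" by (simp add: o_def)
      qed
      then have ci: "(c has_integral B 0) {0..1}" by (simp add: c_def[abs_def] curve_def centre)
      have "continuous_on UNIV (curve \<sigma>)"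
        by (intro continuous_at_imp_continuous_on ballI has_vector_derivative_continuous[OF curve_vector_derivative[OF \<sigma>]])
      then have cc: "continuous_on UNIV c" unfolding c_def by (intro continuous_on_compose2[OF Bc]) auto
      have cm: "(\<lambda>s. indicator X s *\<^sub>R c s) \<in> borel_measurable borel" if "X \<in> sets borel" for X
        by (rule borel_measurable_continuous_on_indicator[OF that continuous_on_subset[OF cc]]) simp
      have "(LINT s|lborel. h (\<sigma>, s)) = (LINT s|lborel. 2 * of_real pi * (indicator {0..<1} s *\<^sub>R c s))"
        using True by (intro Bochner_Integration.integral_cong) (auto simp: h_def T_def c_def indicator_def)
      also have "\<dots> = 2 * of_real pi * (LINT s|lborel. indicator {0..<1} s *\<^sub>R c s)" by (rule integral_mult_right_zero)
      also have "(LINT s|lborel. indicator {0..<1} s *\<^sub>R c s) = (LINT s|lborel. indicator {0..1} s *\<^sub>R c s)"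
      proof (rule integral_cong_AE)
        show "AE s in lborel. indicator {0..<1} s *\<^sub>R c s = indicator {0..1} s *\<^sub>R c s"
          using AE_lborel_singleton[of 1] by eventually_elim (auto simp: indicator_def)
      qed (use cm in simp_all)
      also have "\<dots> = integral {0..1} c"
      proof -
        have "integrable lborel (\<lambda>s. indicator {0..1} s *\<^sub>R c s)"
          by (rule borel_integrable_compact) (use continuous_on_subset[OF cc] in auto)
        then show ?thesis using set_borel_integral_eq_integral(2)[of "{0..1}" c] by (simp add: set_integrable_def set_lebesgue_integral_def)
      qed
      also have "\<dots> = B 0" using ci by (rule integral_unique)
      finally show ?thesis using True by simp
    next
      case False
      then have "(\<sigma>, s) \<notin> T" for s by (auto simp: T_def)
      then have "h (\<sigma>, s) = 0" for s by (simp add: h_def)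
      then show ?thesis using False by simp
    qed
  qed
  also have "\<dots> = of_real (2 * pi * t) * B 0" using t by (simp add: scaleR_conv_of_real)
  finally show ?thesis using main unfolding \<Omega>_def[symmetric] H_def by simp
qed

end

section \<open>From quadrature identities to localization operators\<close>

text \<open>Completing the square gives a Gaussian centred at \<open>x / 2\<close>; after rescaling, what remains is the
  characteristic function of the standard normal distribution.\<close>

lemma stft_h0:
  "stft h0 h0 x w = exp (- \<i> * of_real (pi * x * w)) * of_real (exp (- pi * (x\<^sup>2 + w\<^sup>2) / 2))"
proof -
  define c where "c = 1 / (2 * sqrt pi)"
  have c: "c > 0" "c\<^sup>2 * pi = 1 / 4" by (simp_all add: c_def power_divide)
  define E where "E = exp (- \<i> * of_real (pi * x * w)) * of_real (exp (- pi * x\<^sup>2 / 2))"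
  have root: "(2 powr (1/4)) * (2 powr (1/4)) = sqrt 2" by (simp add: powr_half_sqrt flip: powr_add)
  have "stft h0 h0 x w = c *\<^sub>R (LINT u|lborel. h0 (x / 2 + c * u) * cnj (h0 (x / 2 + c * u - x)) * exp (- 2 * of_real pi * \<i> * of_real (x / 2 + c * u) * of_real w))"
    unfolding stft_def using lborel_integral_real_affine[of c "\<lambda>t. h0 t * cnj (h0 (t - x)) * exp (- 2 * of_real pi * \<i> * of_real t * of_real w)" "x / 2"] c by simp
  also have "\<dots> = (LINT u|lborel. c *\<^sub>R (h0 (x / 2 + c * u) * cnj (h0 (x / 2 + c * u - x)) * exp (- 2 * of_real pi * \<i> * of_real (x / 2 + c * u) * of_real w)))"
    by simp
  also have "\<dots> = (LINT u|lborel. E * (std_normal_density u *\<^sub>R iexp (- (sqrt pi * w) * u)))"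
  proof (rule Bochner_Integration.integral_cong[OF refl])
    fix u
    have sq: "- pi * (x / 2 + c * u)\<^sup>2 + - pi * (x / 2 + c * u - x)\<^sup>2 = - pi * x\<^sup>2 / 2 + - u\<^sup>2 / 2"
    proof -
      have "- pi * (x / 2 + c * u)\<^sup>2 + - pi * (x / 2 + c * u - x)\<^sup>2 = - pi * x\<^sup>2 / 2 - 2 * (c\<^sup>2 * pi) * u\<^sup>2"
        by (simp add: power2_eq_square field_simps)
      then show ?thesis unfolding c by simp
    qed
    have e: "h0 (x / 2 + c * u) * cnj (h0 (x / 2 + c * u - x)) = of_real (sqrt 2 * (exp (- pi * x\<^sup>2 / 2) * exp (- u\<^sup>2 / 2)))"
    proof -
      have "h0 (x / 2 + c * u) * cnj (h0 (x / 2 + c * u - x)) = of_real (((2 powr (1/4)) * (2 powr (1/4))) * (exp (- pi * (x / 2 + c * u)\<^sup>2) * exp (- pi * (x / 2 + c * u - x)\<^sup>2)))"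
        by (simp add: h0_def)
      then show ?thesis unfolding root exp_add[symmetric] sq .
    qed
    have cs: "2 * (c * pi) = sqrt pi" by (simp add: c_def real_div_sqrt)
    have ex: "- 2 * complex_of_real pi * \<i> * of_real (x / 2 + c * u) * of_real w = - \<i> * of_real (pi * x * w) + \<i> * of_real (- (sqrt pi * w) * u)"
      unfolding cs[symmetric] by (simp add: algebra_simps)
    have p: "exp (- 2 * complex_of_real pi * \<i> * of_real (x / 2 + c * u) * of_real w) = exp (- \<i> * of_real (pi * x * w)) * iexp (- (sqrt pi * w) * u)"
      unfolding ex exp_add ..
    have d: "c * sqrt 2 = 1 / sqrt (2 * pi)"
      by (simp add: c_def real_sqrt_mult field_simps)
    show "c *\<^sub>R (h0 (x / 2 + c * u) * cnj (h0 (x / 2 + c * u - x)) * exp (- 2 * of_real pi * \<i> * of_real (x / 2 + c * u) * of_real w))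
      = E * (std_normal_density u *\<^sub>R iexp (- (sqrt pi * w) * u))"
      unfolding e p std_normal_density_def d[symmetric] E_def scaleR_conv_of_real of_real_mult by (simp only: mult_ac)
  qed
  also have "\<dots> = E * (LINT u|lborel. std_normal_density u *\<^sub>R iexp (- (sqrt pi * w) * u))"
    by (rule integral_mult_right_zero)
  also have "(LINT u|lborel. std_normal_density u *\<^sub>R iexp (- (sqrt pi * w) * u)) = char std_normal_distribution (- (sqrt pi * w))"
    unfolding char_def by (rule integral_density[symmetric]) (auto intro!: borel_measurable_continuous_onI continuous_intros)
  also have "\<dots> = of_real (exp (- (pi * w\<^sup>2) / 2))"
    unfolding char_std_normal_distribution by (simp add: power_mult_distrib)
  finally have "stft h0 h0 x w = exp (- \<i> * of_real (pi * x * w)) * of_real (exp (- pi * x\<^sup>2 / 2) * exp (- (pi * w\<^sup>2) / 2))"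
    by (simp add: E_def)
  also have "exp (- pi * x\<^sup>2 / 2) * exp (- (pi * w\<^sup>2) / 2) = exp (- pi * (x\<^sup>2 + w\<^sup>2) / 2)"
    unfolding exp_add[symmetric] by (simp add: algebra_simps add_divide_distrib diff_divide_distrib)
  finally show ?thesis .
qed

text \<open>The Bargmann transform in disguise: the kernel of the time-frequency shift, multiplied by the transform of the window,
  is \<open>h0 t\<close> times the Gaussian weight times an entire function of \<open>z\<close> whose value at 0 is 1.\<close>

lemma gaussian_shift:
  "stft h0 h0 (Re z) (Im z) * (h0 (t - Re z) * exp (2 * of_real pi * \<i> * of_real t * of_real (Im z)))
    = h0 t * (exp (2 * of_real pi * of_real t * z - of_real pi * z\<^sup>2 / 2) * of_real (exp (- pi * (norm z)\<^sup>2)))"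
proof -
  define x w where "x = Re z" and "w = Im z"
  have z: "z = of_real x + \<i> * of_real w" by (simp add: x_def w_def complex_eq_iff)
  have n: "(norm z)\<^sup>2 = x\<^sup>2 + w\<^sup>2" by (simp add: cmod_power2 x_def w_def)
  have "- \<i> * of_real (pi * x * w) + of_real (- pi * (x\<^sup>2 + w\<^sup>2) / 2) + of_real (- pi * (t - x)\<^sup>2) + 2 * of_real pi * \<i> * of_real t * of_real w
     = of_real (- pi * t\<^sup>2) + (2 * of_real pi * of_real t * z - of_real pi * z\<^sup>2 / 2) + of_real (- pi * (x\<^sup>2 + w\<^sup>2))"
    unfolding z by (simp add: complex_eq_iff power2_eq_square field_simps)
  then have "exp (- \<i> * of_real (pi * x * w)) * exp (of_real (- pi * (x\<^sup>2 + w\<^sup>2) / 2)) * exp (of_real (- pi * (t - x)\<^sup>2)) * exp (2 * of_real pi * \<i> * of_real t * of_real w)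
     = exp (of_real (- pi * t\<^sup>2)) * exp (2 * of_real pi * of_real t * z - of_real pi * z\<^sup>2 / 2) * exp (complex_of_real (- pi * (x\<^sup>2 + w\<^sup>2)))"
    by (simp only: exp_add[symmetric])
  then show ?thesis
    unfolding stft_h0 h0_def n x_def[symmetric] w_def[symmetric] of_real_mult exp_of_real[symmetric]
    by (simp only: mult_ac)
qed

text \<open>By Fubini, the weak form against \<open>g\<close> is the integral over \<open>t\<close> of \<open>h0 t * cnj (g t)\<close> times the integral over
  \<open>\<Omega>\<close> of an entire function with the Gaussian weight, and the quadrature identity evaluates the latter.\<close>

theorem localization_of_quadrature:
  assumes \<Omega>: "open \<Omega>" "bounded \<Omega>"
    and quad: "\<And>B. B holomorphic_on UNIV \<Longrightarrow> (LINT z:\<Omega>|lebesgue. B z * of_real (exp (- pi * (norm z)\<^sup>2))) = of_real c * B 0"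
  shows "AE x in lborel. localization_operator \<Omega> h0 x = of_real c * h0 x"
proof (rule localization_operator_unique)
  show "\<Omega> \<in> lmeasurable" using \<Omega> by (rule lmeasurable_open[rotated])
  show "square_integrable h0" by (rule square_integrable_h0)
  have hm: "integrable lborel (\<lambda>t. (cmod (h0 t))\<^sup>2)" using square_integrable_h0 by (simp add: square_integrable_def)
  then show "square_integrable (\<lambda>x. of_real c * h0 x)"
    by (simp add: square_integrable_def norm_mult power_mult_distrib)
  fix g assume g: "square_integrable g"
  have [measurable]: "g \<in> borel_measurable borel" using g by (simp add: square_integrable_def)
  have [measurable]: "\<Omega> \<in> sets borel" using \<Omega>(1) by simp
  define V where "V z = stft h0 h0 (Re z) (Im z)" for z
  have [measurable]: "V \<in> borel_measurable borel" unfolding V_def by measurable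
  obtain M where M: "0 \<le> M" "\<And>x w. cmod (stft h0 h0 x w) \<le> M" using stft_bounded[OF square_integrable_h0] by blast
  define K where "K = (LINT t|lborel. (cmod (g t))\<^sup>2) + (LINT t|lborel. (cmod (h0 t))\<^sup>2)"
  define I where "I z t = indicator \<Omega> z *\<^sub>R (V z * (cnj (g t) * (h0 (t - Re z) * exp (2 * of_real pi * \<i> * of_real t * of_real (Im z)))))" for z t
  have Im: "case_prod I \<in> borel_measurable (borel \<Otimes>\<^sub>M borel)" unfolding I_def by measurable
  have In: "cmod (I z t) = indicator \<Omega> z * cmod (V z) * (cmod (g t) * cmod (h0 (t - Re z)))" for z t
    unfolding I_def norm_scaleR norm_mult cmod_character by (simp add: indicator_def)
  have gi: "integrable lborel (\<lambda>t. cmod (g t) * cmod (h0 (t - x)))" "(LINT t|lborel. cmod (g t) * cmod (h0 (t - x))) \<le> K" for x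
    using L2_product[OF g square_integrable_translate[OF square_integrable_h0, of x]]
      lborel_integral_real_affine[of 1 "\<lambda>t. (cmod (h0 t))\<^sup>2" "-x"] by (simp_all add: K_def)
  have Ii: "integrable lborel (\<lambda>t. I z t)" for z
  proof (rule Bochner_Integration.integrable_bound[OF integrable_mult_right[OF gi(1)[of "Re z"], of "indicator \<Omega> z * cmod (V z)"]])
    show "I z \<in> borel_measurable lborel" unfolding I_def by measurable
  qed (simp add: In)
  have int: "integrable (lborel \<Otimes>\<^sub>M lborel) (case_prod I)"
  proof (rule lborel_pair.Fubini_integrable)
    show "case_prod I \<in> borel_measurable (lborel \<Otimes>\<^sub>M lborel)" using Im by simp
    show "AE z in lborel. integrable lborel (\<lambda>t. case (z, t) of (z, t) \<Rightarrow> I z t)" using Ii by simp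
    have fin: "integrable lborel (\<lambda>z. indicator \<Omega> z * (M * K) :: real)"
      using emeasure_bounded_finite[OF \<Omega>(2)] by (intro integrable_mult_left integrable_real_indicator) auto
    show "integrable lborel (\<lambda>z. LINT t|lborel. norm (case (z, t) of (z, t) \<Rightarrow> I z t))"
    proof (rule Bochner_Integration.integrable_bound[OF fin])
      show "(\<lambda>z. LINT t|lborel. norm (case (z, t) of (z, t) \<Rightarrow> I z t)) \<in> borel_measurable lborel" unfolding I_def by measurable
      show "AE z in lborel. norm (LINT t|lborel. norm (case (z, t) of (z, t) \<Rightarrow> I z t)) \<le> norm (indicator \<Omega> z * (M * K))"
      proof (rule AE_I2)
        fix z
        have "0 \<le> (LINT t|lborel. cmod (g t) * cmod (h0 (t - Re z)))" by (rule Bochner_Integration.integral_nonneg) simp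
        then have K: "0 \<le> K" using gi(2)[of "Re z"] by linarith
        have "(LINT t|lborel. cmod (I z t)) = indicator \<Omega> z * cmod (V z) * (LINT t|lborel. cmod (g t) * cmod (h0 (t - Re z)))"
          unfolding In by simp
        also have "\<dots> \<le> indicator \<Omega> z * M * K"
          using M gi(2) K by (intro mult_mono) (auto simp: V_def indicator_def)
        finally show "norm (LINT t|lborel. norm (case (z, t) of (z, t) \<Rightarrow> I z t)) \<le> norm (indicator \<Omega> z * (M * K))"
          using M(1) K by (simp add: mult.assoc)
      qed
    qed
  qed
  have cg: "cnj (stft h0 g (Re z) (Im z)) = (LINT t|lborel. cnj (g t) * (h0 (t - Re z) * exp (2 * of_real pi * \<i> * of_real t * of_real (Im z))))" for z
  proof -
    have "cnj (stft h0 g (Re z) (Im z)) = (LINT t|lborel. cnj (g t * cnj (h0 (t - Re z)) * exp (- 2 * of_real pi * \<i> * of_real t * of_real (Im z))))"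
      unfolding stft_def by (rule integral_bounded_linear'[OF bounded_linear_cnj bounded_linear_cnj, symmetric]) simp
    also have "\<dots> = (LINT t|lborel. cnj (g t) * (h0 (t - Re z) * exp (2 * of_real pi * \<i> * of_real t * of_real (Im z))))"
      by (rule Bochner_Integration.integral_cong[OF refl]) (simp add: h0_def exp_cnj)
    finally show ?thesis .
  qed
  have "localization_form \<Omega> h0 g = (LINT z|lborel. indicator \<Omega> z *\<^sub>R (V z * cnj (stft h0 g (Re z) (Im z))))"
    unfolding localization_form_def set_lebesgue_integral_def V_def by (rule integral_completion) measurable
  also have "\<dots> = (LINT z|lborel. LINT t|lborel. I z t)"
    unfolding cg I_def by simp
  also have "\<dots> = (LINT t|lborel. LINT z|lborel. I z t)" by (rule lborel_pair.Fubini_integral[OF int, symmetric])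
  also have "\<dots> = (LINT t|lborel. of_real c * h0 t * cnj (g t))"
  proof (rule Bochner_Integration.integral_cong[OF refl])
    fix t :: real
    define B where "B z = exp (2 * of_real pi * of_real t * z - of_real pi * z\<^sup>2 / 2)" for z :: complex
    have B: "B holomorphic_on UNIV" unfolding B_def by (intro holomorphic_intros) auto
    have [measurable]: "B \<in> borel_measurable borel"
      by (intro borel_measurable_continuous_onI holomorphic_on_imp_continuous_on[OF B])
    have "I z t = cnj (g t) * h0 t * (indicator \<Omega> z *\<^sub>R (B z * of_real (exp (- pi * (norm z)\<^sup>2))))" for z
    proof -
      have "I z t = indicator \<Omega> z *\<^sub>R (cnj (g t) * (V z * (h0 (t - Re z) * exp (2 * of_real pi * \<i> * of_real t * of_real (Im z)))))"
        unfolding I_def by (simp only: mult_ac)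
      also have "\<dots> = indicator \<Omega> z *\<^sub>R (cnj (g t) * (h0 t * (B z * of_real (exp (- pi * (norm z)\<^sup>2)))))"
        unfolding V_def gaussian_shift B_def ..
      finally show ?thesis by (simp add: mult_ac)
    qed
    then have "(LINT z|lborel. I z t) = cnj (g t) * h0 t * (LINT z|lborel. indicator \<Omega> z *\<^sub>R (B z * of_real (exp (- pi * (norm z)\<^sup>2))))"
      by (simp only: integral_mult_right_zero)
    also have "(LINT z|lborel. indicator \<Omega> z *\<^sub>R (B z * of_real (exp (- pi * (norm z)\<^sup>2)))) = (LINT z:\<Omega>|lebesgue. B z * of_real (exp (- pi * (norm z)\<^sup>2)))"
      unfolding set_lebesgue_integral_def by (rule integral_completion[symmetric]) measurable
    also have "\<dots> = of_real c * B 0" by (rule quad[OF B])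
    finally show "(LINT z|lborel. I z t) = of_real c * h0 t * cnj (g t)" by (simp add: B_def mult_ac)
  qed
  finally show "L2_inner (\<lambda>x. of_real c * h0 x) g = localization_form \<Omega> h0 g" by (simp add: L2_inner_def)
qed

section \<open>Topology of the shell\<close>

lemma components_two_closed:
  fixes K L :: "complex set"
  assumes "closed K" "closed L" "connected K" "connected L" "K \<noteq> {}" "L \<noteq> {}" "K \<inter> L = {}"
  shows "components (K \<union> L) = {K, L}"
proof -
  have *: "connected_component_set (K \<union> L) x = K" if "closed K" "closed L" "connected K" "K \<inter> L = {}" "x \<in> K" for K L :: "complex set" and x
  proof
    show "K \<subseteq> connected_component_set (K \<union> L) x" by (rule connected_component_maximal) (use that in auto)
    have "x \<in> connected_component_set (K \<union> L) x" using that(5) by simp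
    then show "connected_component_set (K \<union> L) x \<subseteq> K"
      using connected_closedD[OF connected_connected_component[of "K \<union> L" x], of K L] connected_component_subset[of "K \<union> L" x] that by blast
  qed
  have "connected_component_set (K \<union> L) x = K" if "x \<in> K" for x using *[of K L x] assms that by blast
  moreover have "connected_component_set (K \<union> L) x = L" if "x \<in> L" for x using *[of L K x] assms that by (simp add: Un_commute Int_commute)
  ultimately have "connected_component_set (K \<union> L) ` K = {K}" "connected_component_set (K \<union> L) ` L = {L}"
    using assms(5,6) by (auto simp: image_constant_conv)
  then show ?thesis unfolding components_def image_Un by auto
qed

lemma components_two_clopen:
  assumes "closedin Y K" "closedin Y L" "connectedin Y K" "connectedin Y L" "K \<noteq> {}" "L \<noteq> {}" "K \<inter> L = {}" "topspace Y = K \<union> L"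
  shows "connected_components_of Y = {K, L}"
proof -
  have *: "connected_component_of_set Y x = K" if "closedin Y K" "openin Y K" "connectedin Y K" "x \<in> K" for K x
  proof
    show "K \<subseteq> connected_component_of_set Y x" by (rule connected_component_of_maximal[OF that(3,4)])
    have "x \<in> topspace Y" using that(1,4) closedin_subset by blast
    then have "x \<in> connected_component_of_set Y x" by (simp add: connected_component_of_refl)
    then show "connected_component_of_set Y x \<subseteq> K"
      using connectedin_clopen_cases[OF connectedin_connected_component_of that(1,2), of x] that(4) by (auto simp: disjnt_def)
  qed
  have "topspace Y - L = K" "topspace Y - K = L" using assms(7,8) by auto
  then have op: "openin Y K" "openin Y L" using assms(1,2) by (metis openin_diff openin_topspace)+
  have "connected_component_of_set Y x = K" if "x \<in> K" for x by (rule *[OF assms(1) op(1) assms(3) that])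
  moreover have "connected_component_of_set Y x = L" if "x \<in> L" for x by (rule *[OF assms(2) op(2) assms(4) that])
  ultimately have "connected_component_of_set Y ` K = {K}" "connected_component_of_set Y ` L = {L}"
    using assms(5,6) by (auto simp: image_constant_conv)
  then show ?thesis unfolding connected_components_of_def assms(8) image_Un by auto
qed

text \<open>On the sphere the complement consists of the inner compact set and of the exterior together with the point at infinity.
  The exterior is connected because \<open>B\<close> is simply connected and stays connected when infinity is added, as infinity is a
  limit of it.\<close>

lemma doubly_connected_difference:
  fixes A B :: "complex set"
  assumes A: "bounded A" "connected A" "A \<noteq> {}" and B: "open B" "bounded B" "simply_connected B" and AB: "closure A \<subseteq> B"
    and conn: "connected (B - closure A)" and ne: "B - closure A \<noteq> {}"
  shows "doubly_connected_domain (B - closure A)"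
proof -
  let ?X = "Alexandroff_compactification (euclidean :: complex topology)"
  define Z where "Z = - Some ` (B - closure A)"
  define K where "K = Some ` closure A" define L where "L = insert None (Some ` (- B))"
  have ZKL: "Z = K \<union> L"
  proof (rule set_eqI)
    fix x show "x \<in> Z \<longleftrightarrow> x \<in> K \<union> L" using AB by (cases x) (auto simp: Z_def K_def L_def)
  qed
  have Zt: "topspace (subtopology ?X Z) = K \<union> L" unfolding ZKL by (auto simp: K_def L_def)
  have "compact (closure A)" using A(1) by simp
  then have cK: "closedin ?X K" unfolding K_def by simp
  have "L = topspace ?X - Some ` B" unfolding L_def by auto
  moreover have "openin euclidean B" using B(1) by simp
  ultimately have cL: "closedin ?X L" unfolding closedin_Alexandroff_compactification by blast
  have conK: "connectedin ?X K" unfolding K_def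
    by (rule connectedin_continuous_map_image[OF continuous_map_Some]) (simp add: connected_imp_connected_closure A(2))
  have conL: "connectedin ?X L"
  proof (rule connectedin_intermediate_closure_of)
    have "connected (- B)" using simply_connected_iff_simple[OF B(1,2)] B(3) by blast
    then show "connectedin ?X (Some ` (- B))" by (intro connectedin_continuous_map_image[OF continuous_map_Some]) simp
    show "Some ` (- B) \<subseteq> L" by (auto simp: L_def)
    have "None \<in> ?X closure_of (Some ` (- B))"
      unfolding in_closure_of
    proof (intro conjI allI impI)
      fix T assume T: "None \<in> T \<and> openin ?X T"
      then obtain C where C: "compact C" "T = insert None (Some ` (UNIV - C))"
        unfolding openin_Alexandroff_compactification by auto
      have "\<not> - B \<subseteq> C"
      proof
        assume "- B \<subseteq> C"
        then have "bounded (- B)" using C(1) compact_imp_bounded bounded_subset by blast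
        then show False using B(2) not_bounded_UNIV[where 'a = complex] bounded_Un[of B "- B"] by simp
      qed
      then obtain y where "y \<in> - B" "y \<notin> C" by blast
      then show "\<exists>y. y \<in> Some ` (- B) \<and> y \<in> T" using C(2) by blast
    qed simp
    then show "L \<subseteq> ?X closure_of (Some ` (- B))" unfolding L_def using closure_of_subset[of "Some ` (- B)" ?X] by auto
  qed
  have "connected_components_of (subtopology ?X Z) = {K, L}"
  proof (rule components_two_clopen)
    show "closedin (subtopology ?X Z) K" "closedin (subtopology ?X Z) L"
      using cK cL ZKL by (auto intro!: closedin_subset_topspace simp: closedin_subtopology)
    show "connectedin (subtopology ?X Z) K" "connectedin (subtopology ?X Z) L"
      using conK conL ZKL by (auto simp: connectedin_subtopology)
    show "K \<noteq> {}" using A(3) by (auto simp: K_def)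
    show "L \<noteq> {}" by (simp add: L_def)
    show "K \<inter> L = {}" using AB by (auto simp: K_def L_def)
  qed (rule Zt)
  moreover have "K \<noteq> L" unfolding K_def L_def by auto
  ultimately show ?thesis unfolding doubly_connected_domain_def Z_def[symmetric] using conn ne B(1) by auto
qed

lemma radial_domain_is_disc:
  assumes D: "open D" "connected D" "bounded D" "(0::complex) \<in> D"
    and rad: "\<And>z w. z \<in> D \<Longrightarrow> norm w = norm z \<Longrightarrow> w \<in> D"
  obtains r where "r > 0" "D = ball 0 r"
proof -
  define r where "r = Sup (norm ` D)"
  have bdd: "bdd_above (norm ` D)" using D(3) by (auto simp: bounded_iff bdd_above_def)
  obtain e where e: "e > 0" "ball 0 e \<subseteq> D" using D(1,4) by (rule openE)
  have "of_real (e / 2) \<in> D" by (rule subsetD[OF e(2)]) (use e(1) in \<open>simp add: norm_of_real\<close>)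
  then have "norm (complex_of_real (e / 2)) \<le> r" unfolding r_def by (intro cSup_upper bdd imageI)
  then have r: "r > 0" using e(1) by simp
  have "ball 0 r \<subseteq> D"
  proof
    fix z :: complex assume "z \<in> ball 0 r"
    then have "norm z < Sup (norm ` D)" by (simp add: r_def)
    then obtain y where y: "y \<in> D" "norm z < norm y" using less_cSup_iff[OF _ bdd] D(4) by blast
    have "connected (norm ` D)" by (intro connected_continuous_image continuous_intros D(2))
    then have "norm z \<in> norm ` D" using connectedD_interval[of "norm ` D" 0 "norm y" "norm z"] y D(4) by (force intro: image_eqI[of _ norm 0])
    then obtain x where "x \<in> D" "norm z = norm x" by blast
    then show "z \<in> D" by (rule rad)
  qed
  moreover have "D \<subseteq> interior (cball 0 r)"
  proof (rule interior_maximal[OF _ D(1)])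
    show "D \<subseteq> cball 0 r"
    proof
      fix x assume "x \<in> D"
      then have "norm x \<le> r" unfolding r_def by (intro cSup_upper bdd imageI)
      then show "x \<in> cball 0 r" by simp
    qed
  qed
  ultimately show thesis using r by (intro that[of r]) auto
qed

text \<open>A circle about 0 through a point of \<open>closure A\<close> misses the radial set \<open>B - closure A\<close>, so it lies in the disjoint
  union of the closed sets \<open>closure A\<close> and \<open>- B\<close>; being connected it stays in the first. Thus \<open>closure A\<close>, and
  with it its interior \<open>A\<close>, is invariant under rotations.\<close>

lemma radial_shell_imp_disc:
  assumes A: "open A" "connected A" "bounded A" "(0::complex) \<in> A" "interior (closure A) = A"
    and B: "open B" "closure A \<subseteq> B" and rad: "radial (B - closure A)"
  shows "\<exists>r>0. A = ball 0 r"
proof -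
  have rot: "cis \<theta> * z \<in> B - closure A" if "z \<in> B - closure A" for \<theta> z
    using rad that unfolding radial_def by blast
  have circ: "\<exists>\<theta>. w = cis \<theta> * z" if "norm w = norm z" for w z :: complex
  proof (cases "z = 0")
    case False
    have "w = cis (Arg (w / z)) * z"
    proof -
      have "norm (w / z) = 1" using that False by (simp add: norm_divide)
      moreover from this have "w / z \<noteq> 0" by (metis norm_zero zero_neq_one)
      ultimately have "cis (Arg (w / z)) = w / z" by (simp add: cis_Arg sgn_eq)
      then show ?thesis using False by simp
    qed
    then show ?thesis by blast
  qed (use that in simp)
  have cl: "w \<in> closure A" if z: "z \<in> closure A" "norm w = norm z" for z w
  proof -
    have no: "y \<notin> B - closure A" if ny: "norm y = norm z" for y
    proof
      assume y: "y \<in> B - closure A"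
      obtain \<theta> where "z = cis \<theta> * y" using circ[OF ny[symmetric]] by blast
      then show False using rot[OF y, of \<theta>] z(1) by simp
    qed
    have "connected (sphere (0::complex) (norm z))" by (rule connected_sphere) simp
    moreover have "sphere 0 (norm z) \<subseteq> closure A \<union> - B" using no by auto
    moreover have "closure A \<inter> - B \<inter> sphere 0 (norm z) = {}" using B(2) by blast
    moreover have "closure A \<inter> sphere 0 (norm z) \<noteq> {}" using z(1) by auto
    ultimately have "- B \<inter> sphere 0 (norm z) = {}"
      using connected_closedD[of "sphere 0 (norm z)" "closure A" "- B"] B(1) by (auto simp: closed_def)
    then have "w \<in> B" using z(2) by auto
    then show ?thesis using no[OF z(2)] by blast
  qed
  have "w \<in> A" if zw: "z \<in> A" "norm w = norm z" for z w
  proof -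
    obtain \<theta> where \<theta>: "w = cis \<theta> * z" using circ[OF zw(2)] by blast
    have "open ((\<lambda>y. cis (- \<theta>) * y) -` A)" by (intro open_vimage A(1) continuous_intros)
    moreover have "(\<lambda>y. cis (- \<theta>) * y) -` A \<subseteq> closure A"
    proof
      fix y assume "y \<in> (\<lambda>y. cis (- \<theta>) * y) -` A"
      then have "cis (- \<theta>) * y \<in> closure A" using closure_subset by blast
      then show "y \<in> closure A" by (rule cl) (simp add: norm_mult)
    qed
    ultimately have "(\<lambda>y. cis (- \<theta>) * y) -` A \<subseteq> interior (closure A)" by (intro interior_maximal)
    moreover have "cis (- \<theta>) * w = z" unfolding \<theta> by (simp add: mult.assoc[symmetric] cis_mult)
    ultimately show ?thesis using A(5) zw(1) by auto
  qed
  then show ?thesis using radial_domain_is_disc[OF A(1-4)] by metis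
qed

context growing_discs
begin

text \<open>The moving map is injective beyond the closed unit disc, so near a boundary point there are points outside.\<close>

lemma interior_closure_D:
  assumes t: "\<bar>t\<bar> < t1"
  shows "interior (closure (D t)) = D t"
proof
  show "D t \<subseteq> interior (closure (D t))" by (rule interior_maximal[OF closure_subset open_D[OF t]])
  define V where "V = ball 0 R1 \<inter> (\<lambda>z. F z t) -` interior (closure (D t))"
  have "open V" unfolding V_def by (rule continuous_open_preimage[OF cont[OF t order_refl] open_ball open_interior])
  moreover have "V \<subseteq> cball 0 1"
  proof
    fix z assume z: "z \<in> V"
    then have "F z t \<in> closure (D t)" using interior_subset by (auto simp: V_def)
    then obtain y where y: "norm y \<le> 1" "F z t = F y t" unfolding closure_D[OF t] by auto
    have "z = y" by (rule inj_onD[OF inj[OF t] y(2)]) (use z y R1 in \<open>auto simp: V_def\<close>)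
    then show "z \<in> cball 0 1" using y by simp
  qed
  ultimately have V: "V \<subseteq> ball 0 1" using interior_maximal[of V "cball 0 1"] by simp
  show "interior (closure (D t)) \<subseteq> D t"
  proof
    fix p assume p: "p \<in> interior (closure (D t))"
    then have "p \<in> closure (D t)" using interior_subset by blast
    then obtain z where z: "norm z \<le> 1" "p = F z t" unfolding closure_D[OF t] by auto
    then have "z \<in> V" using p R1 by (auto simp: V_def)
    then show "p \<in> D t" using V z by (auto simp: D_def)
  qed
qed

lemma frontier_shell:
  assumes t: "0 < t" "t < t1"
  shows "frontier (D t - closure (D 0)) = frontier (D 0) \<union> frontier (D t)"
proof -
  have t': "\<bar>t\<bar> < t1" "\<bar>0::real\<bar> < t1" using t by auto
  have sub: "closure (D 0) \<subseteq> D t" by (rule closure_D_subset[OF t'(2,1) t(1)])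
  have o: "open (D t)" "open (D 0)" "open (D t - closure (D 0))" using open_D t' by auto
  have f0: "frontier (D 0) = closure (D 0) - D 0" "frontier (D t) = closure (D t) - D t"
    "frontier (D t - closure (D 0)) = closure (D t - closure (D 0)) - (D t - closure (D 0))"
    using o by (simp_all add: frontier_def interior_open)
  have a: "D 0 \<inter> closure (D t - closure (D 0)) = {}"
    using open_Int_closure_eq_empty[OF o(2), of "D t - closure (D 0)"] closure_subset[of "D 0"] by blast
  have b: "closure (D t - closure (D 0)) \<subseteq> closure (D t)" by (rule closure_mono) blast
  have c: "frontier (D t) \<subseteq> closure (D t - closure (D 0))"
  proof -
    have "D t = (D t - closure (D 0)) \<union> closure (D 0)" using sub by blast
    from arg_cong[OF this, of closure]
    have "closure (D t) = closure (D t - closure (D 0)) \<union> closure (D 0)" by (simp only: closure_Un closure_closure)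
    then show ?thesis using sub f0 by auto
  qed
  have d: "frontier (D 0) \<subseteq> closure (D t - closure (D 0))"
  proof
    fix p assume p: "p \<in> frontier (D 0)"
    show "p \<in> closure (D t - closure (D 0))"
    proof (rule ccontr)
      assume "p \<notin> closure (D t - closure (D 0))"
      then have "p \<in> D t - closure (D t - closure (D 0))" using p sub f0 by auto
      moreover have "open (D t - closure (D t - closure (D 0)))" using o by auto
      moreover have "D t - closure (D t - closure (D 0)) \<subseteq> closure (D 0)" using closure_subset[of "D t - closure (D 0)"] by blast
      ultimately have "p \<in> interior (closure (D 0))" using interior_maximal by blast
      then show False using p f0 unfolding interior_closure_D[OF t'(2)] by blast
    qed
  qed
  show ?thesis using a b c d f0 sub by blast
qed

theorem shell_properties:
  assumes t: "0 < t" "t < t1" and c: "0 \<in> D 0" "\<not> (\<exists>r>0. D 0 = ball 0 r)"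
    and an: "analytic_Jordan_curve (frontier (D 0))" "analytic_Jordan_curve (frontier (D t))"
  defines "\<Omega> \<equiv> D t - closure (D 0)"
  shows "doubly_connected_domain \<Omega>" "card (components (frontier \<Omega>)) = 2" "\<forall>C\<in>components (frontier \<Omega>). analytic_Jordan_curve C"
    "\<not> radial \<Omega>" "AE x in lborel. localization_operator \<Omega> h0 x = of_real (2 * pi * t) * h0 x"
proof -
  have t': "\<bar>t\<bar> < t1" "\<bar>0::real\<bar> < t1" using t by auto
  have sub: "closure (D 0) \<subseteq> D t" by (rule closure_D_subset[OF t'(2,1) t(1)])
  have d0: "bounded (D 0)" "connected (D 0)" "D 0 \<noteq> {}" "open (D 0)"
    and dt: "bounded (D t)" "open (D t)" "simply_connected (D t)"
    using domain_D[OF t'(1)] domain_D[OF t'(2)] by (auto simp: bounded_simply_connected_domain_def)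
  have "connected ((\<lambda>q. curve (fst q) (snd q)) ` ({0<..<t} \<times> {0..<1}))"
    by (intro connected_continuous_image continuous_on_subset[OF curve_continuous] convex_connected convex_Times)
      (use t in auto)
  then have con: "connected \<Omega>" unfolding \<Omega>_def shell_swept[OF t] by (simp add: case_prod_unfold)
  have "(t / 2, 0) \<in> {0<..<t} \<times> {0..<1::real}" using t by simp
  then have ne: "\<Omega> \<noteq> {}" unfolding \<Omega>_def shell_swept[OF t] by blast
  show "doubly_connected_domain \<Omega>" unfolding \<Omega>_def
    by (rule doubly_connected_difference[OF d0(1-3) dt(2,1,3) sub con[unfolded \<Omega>_def] ne[unfolded \<Omega>_def]])
  have cs: "connected (frontier (D s))" "frontier (D s) \<noteq> {}" if "\<bar>s\<bar> < t1" for s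
    unfolding frontier_D[OF that] by (intro connected_continuous_image cont[OF that disc_sub(3)] connected_sphere) simp_all
  have disj: "frontier (D 0) \<inter> frontier (D t) = {}" using sub dt(2) by (auto simp: frontier_def interior_open)
  have comp: "components (frontier \<Omega>) = {frontier (D 0), frontier (D t)}"
    unfolding \<Omega>_def frontier_shell[OF t]
    by (rule components_two_closed[OF frontier_closed frontier_closed cs(1)[OF t'(2)] cs(1)[OF t'(1)] cs(2)[OF t'(2)] cs(2)[OF t'(1)] disj])
  have "frontier (D 0) \<noteq> frontier (D t)" using disj cs(2)[OF t'(2)] by auto
  then show "card (components (frontier \<Omega>)) = 2" unfolding comp by simp
  show "\<forall>C\<in>components (frontier \<Omega>). analytic_Jordan_curve C" unfolding comp using an by simp
  show "\<not> radial \<Omega>"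
    using radial_shell_imp_disc[OF d0(4,2,1) c(1) interior_closure_D[OF t'(2)] dt(2) sub] c(2) unfolding \<Omega>_def by blast
  show "AE x in lborel. localization_operator \<Omega> h0 x = of_real (2 * pi * t) * h0 x"
  proof (rule localization_of_quadrature)
    show "open \<Omega>" unfolding \<Omega>_def using dt(2) by auto
    show "bounded \<Omega>" unfolding \<Omega>_def by (rule bounded_subset[OF dt(1)]) auto
  qed (unfold \<Omega>_def, rule quadrature[OF t])
qed

end

section \<open>The growing family of domains\<close>

theorem theorem3:
  fixes D\<^sub>0 :: "complex set"
  assumes "bounded_simply_connected_domain D\<^sub>0"
    and "0 \<in> D\<^sub>0"
    and "analytic_Jordan_curve (frontier D\<^sub>0)"
    and "\<not> (\<exists>r>0. D\<^sub>0 = ball 0 r)"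
  shows "\<exists>t\<^sub>0>0. \<exists>D :: real \<Rightarrow> complex set.
    D 0 = D\<^sub>0 \<and>
    (\<forall>t\<in>{0..<t\<^sub>0}. bounded_simply_connected_domain (D t)) \<and>
    analytic_family t\<^sub>0 D \<and>
    (\<forall>s t. 0 \<le> s \<longrightarrow> s < t \<longrightarrow> t < t\<^sub>0 \<longrightarrow> closure (D s) \<subseteq> D t) \<and>
    (\<forall>t. 0 < t \<longrightarrow> t < t\<^sub>0 \<longrightarrow>
      (let \<Omega> = D t - closure D\<^sub>0 in
        doubly_connected_domain \<Omega> \<and>
        card (components (frontier \<Omega>)) = 2 \<and>
        (\<forall>C\<in>components (frontier \<Omega>). analytic_Jordan_curve C) \<and>
        \<not> radial \<Omega> \<and>
        \<not> (\<exists>\<A>. (\<forall>A\<in>\<A>. centred_annulus A) \<and> \<Omega> = \<Union>\<A>) \<and>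
        (AE x in lborel. localization_operator \<Omega> h0 x = of_real (2 * pi * t) * h0 x) \<and>
        2 * pi * t \<in> {0<..<1}))"
proof -
  obtain f R0 where f: "1 < R0" "f holomorphic_on ball 0 R0" "inj_on f (ball 0 R0)" "f 0 = 0"
    and fD: "f ` ball 0 1 = D\<^sub>0" "f ` sphere 0 1 = frontier D\<^sub>0"
    by (rule Riemann_map_extension[OF assms(1-3)], rule that)
  interpret univalent_disc f R0 using f by unfold_locales
  obtain R \<tau> \<kappa> q where fl: "1 < R" "0 < \<tau>" "dps_summable \<kappa> R \<tau>" "\<And>n. \<kappa> (n, 0) = 0"
    "dps_summable q R \<tau>" "\<And>n. q (n, 0) = 0" "\<And>k. Re (q (0, k)) = 0"
    "\<And>\<zeta> t. norm \<zeta> = 1 \<Longrightarrow> \<bar>t\<bar> \<le> \<tau> \<Longrightarrow> norm (\<zeta> * exp (dps \<kappa> \<zeta> t)) < R0 \<and> 1 / R0 < norm (\<zeta> * exp (dps \<kappa> \<zeta> t))"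
    "\<And>\<zeta> t \<phi>. norm \<zeta> = 1 \<Longrightarrow> \<bar>t\<bar> \<le> \<tau> \<Longrightarrow> \<phi> = \<zeta> * exp (dps \<kappa> \<zeta> t) \<Longrightarrow>
       J \<zeta> * (exp (- of_real pi * (f \<phi> * cnj (f \<phi>))) - exp (- of_real pi * (f \<phi> * cnj (f (1 / cnj \<phi>)))))
         = - of_real (2 * pi * t) + dps q \<zeta> t"
    and ra: "real_analytic2_on ({-\<tau><..<\<tau>} \<times> UNIV) (\<lambda>t s. f (cis (2 * pi * s) * exp (dps \<kappa> (cis (2 * pi * s)) t)))"
    by (rule conformal_flow, rule that)
  interpret flow f R0 R \<tau> \<kappa> q
    by (intro flow.intro flow_axioms.intro univalent_disc_axioms) (rule fl; assumption)+
  obtain R1 t1 where g: "1 < R1" "R1 < R" "0 < t1" "t1 \<le> \<tau>"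
    "\<And>z t. norm z < R1 \<Longrightarrow> \<bar>t\<bar> < t1 \<Longrightarrow> ((\<lambda>(z, x). F z x) has_derivative (\<lambda>(h, l). Fz z t * h + Ft z t * of_real l)) (at (z, t))"
    "\<And>t. \<bar>t\<bar> < t1 \<Longrightarrow> (\<lambda>z. F z t) holomorphic_on ball 0 R1"
    "\<And>t. \<bar>t\<bar> < t1 \<Longrightarrow> inj_on (\<lambda>z. F z t) (ball 0 R1)"
    "\<And>z t. norm z < R1 \<Longrightarrow> \<bar>t\<bar> < t1 \<Longrightarrow> Fz z t \<noteq> 0"
    "\<And>z t. norm z = 1 \<Longrightarrow> \<bar>t\<bar> < t1 \<Longrightarrow> Re (Ft z t * cnj (z * Fz z t)) = exp (pi * (norm (F z t))\<^sup>2)"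
    "\<And>z s t. norm z \<le> 1 \<Longrightarrow> \<bar>s\<bar> < t1 \<Longrightarrow> \<bar>t\<bar> < t1 \<Longrightarrow> F z s \<in> (\<lambda>z. F z t) ` ball 0 R1"
    by (rule flow_properties, rule that)
  interpret growing: growing_discs F Fz Ft R1 t1
  proof
    show "F 0 t = 0" for t by (rule F_centre)
  qed (rule g; assumption)+
  \<comment> \<open>the second bound keeps the eigenvalue \<open>2 * pi * t\<close> below 1\<close>
  define t\<^sub>0 where "t\<^sub>0 = min t1 (1 / (2 * pi))"
  have t0: "0 < t\<^sub>0" "t\<^sub>0 \<le> t1" "2 * pi * t\<^sub>0 \<le> 1"
  proof -
    show "0 < t\<^sub>0" "t\<^sub>0 \<le> t1" using g(3) by (simp_all add: t\<^sub>0_def)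
    have "t\<^sub>0 \<le> 1 / (2 * pi)" by (simp add: t\<^sub>0_def)
    then show "2 * pi * t\<^sub>0 \<le> 1" by (simp add: pos_le_divide_eq mult.commute)
  qed
  have D0: "growing.D 0 = D\<^sub>0" by (simp add: growing.D_def F_at_0 fD(1))
  have ra0: "real_analytic2_on ({0..<t\<^sub>0} \<times> UNIV) growing.curve"
  proof (rule real_analytic2_on_cong[OF ra])
    show "{0..<t\<^sub>0} \<times> UNIV \<subseteq> {-\<tau><..<\<tau>} \<times> UNIV" using t0 g(4) fl(2) by auto
    show "f (cis (2 * pi * s) * exp (dps \<kappa> (cis (2 * pi * s)) t)) = growing.curve t s" for t s
      by (simp add: growing.curve_def F_def phi_def)
  qed
  have small: "\<bar>t\<bar> < t1" if "0 \<le> t" "t < t\<^sub>0" for t using that t0 by simp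
  have par: "analytic_Jordan_parametrization (growing.curve t) (frontier (growing.D t))" if t: "0 \<le> t" "t < t\<^sub>0" for t
  proof (rule growing.curve_parametrization[OF small[OF t]])
    show "real_analytic (growing.curve t)" by (rule real_analytic2_on_slice[OF ra0]) (use t in simp)
  qed
  show ?thesis
  proof (rule exI[of _ t\<^sub>0], rule conjI[OF t0(1)], rule exI[of _ growing.D], intro conjI ballI allI impI)
    show "growing.D 0 = D\<^sub>0" by (rule D0)
    show "bounded_simply_connected_domain (growing.D t)" if "t \<in> {0..<t\<^sub>0}" for t
      using that by (intro growing.domain_D small) auto
    show "analytic_family t\<^sub>0 growing.D" unfolding analytic_family_def
      using ra0 par by (intro exI[of _ growing.curve]) auto
    show "closure (growing.D s) \<subseteq> growing.D t" if "0 \<le> s" "s < t" "t < t\<^sub>0" for s t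
      using that by (intro growing.closure_D_subset small) auto
    fix t assume t: "0 < t" "t < t\<^sub>0"
    have t': "t < t1" "0 \<in> growing.D 0" "\<not> (\<exists>r>0. growing.D 0 = ball 0 r)" using t t0 assms unfolding D0 by auto
    have J: "analytic_Jordan_curve (frontier (growing.D 0))" "analytic_Jordan_curve (frontier (growing.D t))"
      using par[of 0] par[of t] t unfolding analytic_Jordan_curve_def by auto
    note P = growing.shell_properties[OF t(1) t' J, unfolded D0]
    have "2 * pi * t < 2 * pi * t\<^sub>0" using t by simp
    then have "2 * pi * t < 1" by (rule less_le_trans[OF _ t0(3)])
    then have "2 * pi * t \<in> {0<..<1}" using t(1) by simp
    moreover have "\<not> (\<exists>\<A>. (\<forall>A\<in>\<A>. centred_annulus A) \<and> growing.D t - closure D\<^sub>0 = \<Union>\<A>)"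
      using P(4) radial_Union_annuli by metis
    ultimately show "let \<Omega> = growing.D t - closure D\<^sub>0 in
        doubly_connected_domain \<Omega> \<and>
        card (components (frontier \<Omega>)) = 2 \<and>
        (\<forall>C\<in>components (frontier \<Omega>). analytic_Jordan_curve C) \<and>
        \<not> radial \<Omega> \<and>
        \<not> (\<exists>\<A>. (\<forall>A\<in>\<A>. centred_annulus A) \<and> \<Omega> = \<Union>\<A>) \<and>
        (AE x in lborel. localization_operator \<Omega> h0 x = of_real (2 * pi * t) * h0 x) \<and>
        2 * pi * t \<in> {0<..<1}"
      unfolding Let_def using P by blast
  qed
qed

end
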